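(* Let $d\ge 2$ be an integer and let $b(n)=\sum_{i=1}^{\ell}B_i(n)\beta_i^n$ be an exponential polynomial over $K$, i.e. $B_i\in K[T]$ and $\beta_i\in K^*$. Let $\Gamma$ be the multiplicative subgroup of $K^*$ generated by $\beta_1,\dots,\beta_\ell$, and assume that $\Gamma\cap\mathbf{k}^*=\{1\}$. If $b(n)$ is a $d$-th power in $K$ for infinitely many $n\in\mathbb{N}$, then there exist an exponential polynomial $a(m)=\sum_{i=1}^{r}A_i(m)\alpha_i^m$ with $A_i\in\overline{K}[T]$, $\alpha_i\in\overline{K}^*$, and a polynomial $R\in\mathbf{k}[T]$ such that $b(m)=R(m)\,a(m)^d$ for all $m\in\mathbb{N}$.
   Context: $\mathbf{k}$ is an algebraically closed field of characteristic zero, $C$ is a smooth projective curve over $\mathbf{k}$ of genus $\mathfrak g$, and $K=\mathbf{k}(C)$ is its function field; $\overline K$ denotes an algebraic closure of $K$. An exponential polynomial over a field $k$ is a sequence $\mathbb{N}\to k$ of the form $n\mapsto\sum_{i\in I}B_i(n)\beta_i^n$ with $I$ finite, $\beta_i\in k^*$ and $B_i\in k[T]$. *)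

theory Defs
  imports "HOL-Computational_Algebra.Polynomial"
begin

text \<open>All fields are subfields (given as sets) of an ambient algebraically closed
  field of characteristic zero.\<close>

definition is_subfield :: "'a::field set \<Rightarrow> bool" where
  "is_subfield F \<longleftrightarrow> 0 \<in> F \<and> 1 \<in> F \<and>
     (\<forall>x\<in>F. \<forall>y\<in>F. x + y \<in> F \<and> x - y \<in> F \<and> x * y \<in> F) \<and>
     (\<forall>x\<in>F. inverse x \<in> F)"

definition field_gen :: "'a::field set \<Rightarrow> 'a set" where
  "field_gen S = \<Inter>{F. is_subfield F \<and> S \<subseteq> F}"

definition poly_over :: "'a::zero set \<Rightarrow> 'a poly \<Rightarrow> bool" where
  "poly_over F p \<longleftrightarrow> (\<forall>i. coeff p i \<in> F)"

definition algebraic_over :: "'a::field set \<Rightarrow> 'a \<Rightarrow> bool" where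
  "algebraic_over F x \<longleftrightarrow> (\<exists>p. p \<noteq> 0 \<and> poly_over F p \<and> poly p x = 0)"

definition alg_closed_subfield :: "'a::field set \<Rightarrow> bool" where
  "alg_closed_subfield k \<longleftrightarrow> is_subfield k \<and>
     (\<forall>p. poly_over k p \<and> degree p > 0 \<longrightarrow> (\<exists>x\<in>k. poly p x = 0))"

definition alg_closure_in :: "'a::field set \<Rightarrow> 'a set" where
  "alg_closure_in F = {x. algebraic_over F x}"

text \<open>K is the function field of a (smooth projective) curve over k:
  a finitely generated extension of transcendence degree 1 of k. In characteristic 0
  (primitive element theorem) this means K = k(t,u) with t transcendental over k and
  u algebraic over k(t).\<close>
definition curve_function_field :: "'a::field set \<Rightarrow> 'a set \<Rightarrow> bool" where
  "curve_function_field k K \<longleftrightarrow> is_subfield K \<and> k \<subseteq> K \<and>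
     (\<exists>t u. t \<in> K \<and> u \<in> K \<and> \<not> algebraic_over k t \<and>
        algebraic_over (field_gen (k \<union> {t})) u \<and> K = field_gen (k \<union> {t, u}))"

definition exp_poly_over :: "'a::field set \<Rightarrow> (nat \<Rightarrow> 'a) \<Rightarrow> bool" where
  "exp_poly_over F f \<longleftrightarrow> (\<exists>(r::nat) A \<alpha>.
     (\<forall>i<r. poly_over F (A i) \<and> \<alpha> i \<in> F \<and> \<alpha> i \<noteq> 0) \<and>
     (\<forall>n. f n = (\<Sum>i<r. poly (A i) (of_nat n) * \<alpha> i ^ n)))"

definition gen_mult_subgroup :: "nat \<Rightarrow> (nat \<Rightarrow> 'a::field) \<Rightarrow> 'a set" where
  "gen_mult_subgroup l \<beta> = {(\<Prod>i\<in>{1..l}. \<beta> i powi e i) | e. True}"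

end

theory Submission
  imports Defs "HOL-Computational_Algebra.Computational_Algebra" "Jordan_Normal_Form.Char_Poly" "HOL-Library.Infinite_Set"
begin

text \<open>Work in an ultrapower of \<open>K\<close> along the infinitely many \<open>n\<close> for which \<open>b(n)\<close> is a \<open>d\<close>-th power. Sequences
  whose height is \<open>o(n)\<close> form a subfield \<open>F\<close> that is stable under a derivation of \<open>K\<close> over \<open>k\<close>, and since \<open>\<Gamma>\<close>
  meets \<open>k\<close> trivially, Artin's argument shows that the exponentials \<open>\<gamma>\<^sup>n\<close> are linearly independent over \<open>F\<close>.
  After Nagata's change of variables \<open>b\<close> is, up to a unit, a monic polynomial \<open>P\<close> in one exponential \<open>X\<close> over the
  field generated by the others. If \<open>P\<close> is not a \<open>d\<close>-th power, it has a factor \<open>P1\<close> whose multiplicity is not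
  divisible by \<open>d\<close>; at a zero of \<open>P1(n)\<close> both \<open>P\<close> and a combination \<open>R\<close> of \<open>P1\<close> with its derivative vanish.
  There are too many such zeros: an auxiliary exponential polynomial of small height, built by linear algebra so
  that its derivatives lie in the ideal of \<open>P\<close> and \<open>R\<close>, would vanish there to high order. Hence \<open>P = G\<^sup>d\<close>, and
  clearing contents gives \<open>b(m) = c(m) \<kappa> u\<^sup>m g(m)\<^sup>d\<close> with a polynomial \<open>c\<close>. The same ramification argument applied
  to \<open>c\<close> shows that \<open>c\<close> is a \<open>d\<close>-th power times a polynomial over \<open>k\<close>.\<close>

section \<open>Polynomials over a subfield\<close>

hide_const (open) module.smult

text \<open>Elements of height o(n) behave like constants: their zeros, their poles and their
  derivatives are negligible against n. The ultrapower turns this asymptotic notion into an honest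
  field, over which values of exponential polynomials become polynomials in independent unknowns, so
  that factorisation, Gauss's lemma and Bezout relations apply to them. The price is that
  polynomials in n become units: the first ramification argument cannot see the factor c, and c
  needs a second one, with Bezout relations over K[T]. The counting works because one relation
  modulo P and R costs at most about N^(s-1) conditions in a space of dimension at least about
  N^(s+1), where s + 1 is the rank of \<Gamma>. Any prescribed multiple of N is therefore affordable
  as order of vanishing, while the height is at most N n times a constant fixed beforehand. The way
  back from the ultrapower to all m is algebraic: independence of the exponentials makes every
  specialisation of T and \<Gamma> a well-defined ring homomorphism on the values.\<close>

lemma subfieldD:
  assumes "is_subfield F"
  shows "0 \<in> F" "1 \<in> F" "x \<in> F \<Longrightarrow> y \<in> F \<Longrightarrow> x + y \<in> F" "x \<in> F \<Longrightarrow> y \<in> F \<Longrightarrow> x - y \<in> F"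
    "x \<in> F \<Longrightarrow> y \<in> F \<Longrightarrow> x * y \<in> F" "x \<in> F \<Longrightarrow> inverse x \<in> F" "x \<in> F \<Longrightarrow> - x \<in> F"
    "x \<in> F \<Longrightarrow> y \<in> F \<Longrightarrow> x / y \<in> F"
  by (insert assms, simp_all add: is_subfield_def divide_inverse, metis diff_0)

lemma subfield_sum: "is_subfield F \<Longrightarrow> (\<And>i. i \<in> A \<Longrightarrow> f i \<in> F) \<Longrightarrow> sum f A \<in> F"
  by (induction A rule: infinite_finite_induct) (auto intro: subfieldD)

lemma subfield_prod: "is_subfield F \<Longrightarrow> (\<And>i. i \<in> A \<Longrightarrow> f i \<in> F) \<Longrightarrow> prod f A \<in> F"
  by (induction A rule: infinite_finite_induct) (auto intro: subfieldD)

lemma subfield_power: "is_subfield F \<Longrightarrow> x \<in> F \<Longrightarrow> x ^ n \<in> F"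
  by (induction n) (auto intro: subfieldD)

lemma subfield_power_int: "is_subfield F \<Longrightarrow> x \<in> F \<Longrightarrow> x powi n \<in> F"
  by (auto simp: power_int_def intro: subfieldD subfield_power)

lemma subfield_of_nat: "is_subfield F \<Longrightarrow> of_nat n \<in> F"
  by (induction n) (auto intro: subfieldD)

lemma subfield_UNIV: "is_subfield (UNIV :: 'a::field set)" unfolding is_subfield_def by auto

lemma poly_overD: "poly_over F p \<Longrightarrow> coeff p i \<in> F" unfolding poly_over_def by auto

context
  fixes F :: "'a::field set"
  assumes F: "is_subfield F"
begin

lemma poly_over_0: "poly_over F 0" using subfieldD(1)[OF F] unfolding poly_over_def by auto
lemma poly_over_1: "poly_over F 1" using subfieldD(1,2)[OF F] unfolding poly_over_def by (auto simp: coeff_1)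
lemma poly_over_add: "poly_over F p \<Longrightarrow> poly_over F q \<Longrightarrow> poly_over F (p + q)"
  unfolding poly_over_def by (auto intro: subfieldD[OF F])
lemma poly_over_diff: "poly_over F p \<Longrightarrow> poly_over F q \<Longrightarrow> poly_over F (p - q)"
  unfolding poly_over_def by (auto intro: subfieldD[OF F])
lemma poly_over_uminus: "poly_over F p \<Longrightarrow> poly_over F (- p)"
  unfolding poly_over_def by (auto intro: subfieldD[OF F])
lemma poly_over_mult: "poly_over F p \<Longrightarrow> poly_over F q \<Longrightarrow> poly_over F (p * q)"
  unfolding poly_over_def coeff_mult by (auto intro: subfieldD[OF F] subfield_sum[OF F])
lemma poly_over_smult: "c \<in> F \<Longrightarrow> poly_over F q \<Longrightarrow> poly_over F (Polynomial.smult c q)"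
  unfolding poly_over_def by (auto intro: subfieldD[OF F])
lemma poly_over_power: "poly_over F p \<Longrightarrow> poly_over F (p ^ n)"
  by (induction n) (auto intro: poly_over_1 poly_over_mult)
lemma poly_over_sum: "(\<And>i. i \<in> A \<Longrightarrow> poly_over F (f i)) \<Longrightarrow> poly_over F (sum f A)"
  by (induction A rule: infinite_finite_induct) (auto intro: poly_over_0 poly_over_add)
lemma poly_over_prod: "(\<And>i. i \<in> A \<Longrightarrow> poly_over F (f i)) \<Longrightarrow> poly_over F (prod f A)"
  by (induction A rule: infinite_finite_induct) (auto intro: poly_over_1 poly_over_mult)
lemma poly_over_monom: "c \<in> F \<Longrightarrow> poly_over F (monom c n)"
  unfolding poly_over_def by (auto intro: subfieldD[OF F])
lemma poly_over_pCons_iff: "poly_over F (pCons a p) \<longleftrightarrow> a \<in> F \<and> poly_over F p"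
  unfolding poly_over_def by (auto simp: coeff_pCons split: nat.splits)
lemma poly_over_poly: "poly_over F p \<Longrightarrow> x \<in> F \<Longrightarrow> poly p x \<in> F"
  unfolding poly_altdef by (intro subfield_sum[OF F]) (auto intro: subfieldD[OF F] subfield_power[OF F] poly_overD)
lemma poly_over_pderiv: "poly_over F p \<Longrightarrow> poly_over F (pderiv p)"
  unfolding poly_over_def coeff_pderiv by (auto intro: subfieldD[OF F] subfield_of_nat[OF F] simp del: of_nat_Suc)

text \<open>Polynomials of the type have coefficients in the ambient field, so the usual division
  gives no control over the field of definition; long division is repeated to keep quotient and
  remainder over \<open>F\<close>.\<close>

lemma poly_over_division:
  assumes g: "poly_over F g" "g \<noteq> 0" and f: "poly_over F f"
  shows "\<exists>q r. poly_over F q \<and> poly_over F r \<and> f = g * q + r \<and> (r = 0 \<or> degree r < degree g)"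
  using f
proof (induction "degree f" arbitrary: f rule: less_induct)
  case less
  show ?case
  proof (cases "f = 0 \<or> degree f < degree g")
    case True
    then show ?thesis using less.prems poly_over_0 by (intro exI[of _ 0] exI[of _ f]) auto
  next
    case False
    define t where "t = monom (lead_coeff f / lead_coeff g) (degree f - degree g)"
    define f' where "f' = f - g * t"
    have t: "poly_over F t" unfolding t_def
      by (intro poly_over_monom subfieldD[OF F] poly_overD less.prems g)
    then have f': "poly_over F f'" unfolding f'_def by (intro poly_over_diff less.prems poly_over_mult g)
    have t0: "t \<noteq> 0" "degree t = degree f - degree g" and tl: "lead_coeff t = lead_coeff f / lead_coeff g"
      using False g unfolding t_def by (auto simp: degree_monom_eq)
    have dt: "degree (g * t) = degree f" using t0 False g by (simp add: degree_mult_eq)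
    have "lead_coeff (g * t) = lead_coeff f" unfolding lead_coeff_mult tl using g by simp
    then have dl: "coeff (g * t) (degree f) = lead_coeff f" unfolding dt .
    show ?thesis
    proof (cases "f' = 0")
      case True
      then have "f = g * t + 0" unfolding f'_def by simp
      then show ?thesis using t poly_over_0 by blast
    next
      case f0: False
      have "degree f' \<le> degree f" unfolding f'_def by (intro degree_diff_le) (auto simp: dt)
      moreover have "coeff f' (degree f) = 0" unfolding f'_def using dl by simp
      ultimately have "degree f' < degree f" using f0 by (metis le_neq_implies_less leading_coeff_0_iff)
      from less.hyps[OF this f'] obtain q r where "poly_over F q" "poly_over F r" "f' = g * q + r" "r = 0 \<or> degree r < degree g"
        by blast
      moreover then have "f = g * (q + t) + r" unfolding f'_def by (simp add: algebra_simps)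
      ultimately show ?thesis using t poly_over_add by blast
    qed
  qed
qed

text \<open>The remainder of the division over \<open>F\<close> is itself a multiple of
  \<open>g\<close> and has smaller degree, hence is zero; so \<open>h\<close> equals a quotient that
  is over \<open>F\<close>.\<close>

lemma poly_over_dvd_quotient:
  assumes "poly_over F g" "g \<noteq> 0" "poly_over F (g * h)" shows "poly_over F h"
proof -
  from poly_over_division[OF assms] obtain q r where q: "poly_over F q" and r: "g * h = g * q + r" "r = 0 \<or> degree r < degree g"
    by blast
  have "r = g * (h - q)" using r(1) by (simp add: algebra_simps)
  then have "h - q = 0 \<or> degree r = degree g + degree (h - q)" using assms(2) degree_mult_eq by blast
  then have "h = q" using r \<open>r = g * (h - q)\<close> assms(2) by auto
  then show ?thesis using q by simp
qed

text \<open>An element of least degree, made monic, leaves remainder zero on all others. The ideal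
  is given by closure properties only, so that the same statement serves Bezout relations and
  contents.\<close>

lemma poly_over_ideal_generator:
  assumes I0: "\<And>p. p \<in> I \<Longrightarrow> poly_over F p" and I1: "\<And>p q. p \<in> I \<Longrightarrow> q \<in> I \<Longrightarrow> p - q \<in> I"
    and I2: "\<And>p q. p \<in> I \<Longrightarrow> poly_over F q \<Longrightarrow> p * q \<in> I" and ne: "\<exists>p\<in>I. p \<noteq> 0"
  obtains g where "g \<in> I" "lead_coeff g = 1" "\<And>p. p \<in> I \<Longrightarrow> \<exists>q. poly_over F q \<and> p = g * q"
proof -
  define g0 where "g0 = arg_min degree (\<lambda>p. p \<in> I \<and> p \<noteq> 0)"
  have g0: "g0 \<in> I" "g0 \<noteq> 0" and min: "\<And>p. p \<in> I \<Longrightarrow> p \<noteq> 0 \<Longrightarrow> degree g0 \<le> degree p"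
    using arg_min_natI[of "\<lambda>p. p \<in> I \<and> p \<noteq> 0" _ degree] arg_min_nat_le[of "\<lambda>p. p \<in> I \<and> p \<noteq> 0" _ degree] ne
    unfolding g0_def by auto
  define c where "c = inverse (lead_coeff g0)"
  define g where "g = Polynomial.smult c g0"
  have c: "c \<in> F" "c \<noteq> 0" unfolding c_def using g0 I0 by (auto intro: subfieldD[OF F] poly_overD)
  have "g = g0 * [:c:]" unfolding g_def by simp
  then have gI: "g \<in> I" using I2[OF g0(1), of "[:c:]"] c poly_over_0 by (simp add: poly_over_pCons_iff)
  have lc: "lead_coeff g = 1" unfolding g_def c_def using g0 by simp
  have dg: "degree g = degree g0" unfolding g_def using c by simp
  have "\<exists>q. poly_over F q \<and> p = g * q" if "p \<in> I" for p
  proof -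
    have "g \<noteq> 0" using lc by auto
    from poly_over_division[OF I0[OF gI] this I0[OF that]] obtain q r where
      qr: "poly_over F q" "p = g * q + r" "r = 0 \<or> degree r < degree g" by blast
    have "r = p - g * q" using qr by simp
    then have "r \<in> I" using I1[OF that I2[OF gI qr(1)]] by simp
    then have "r = 0" using min[of r] qr(3) dg by fastforce
    then show ?thesis using qr by auto
  qed
  then show ?thesis using that gI lc by blast
qed

lemma poly_over_bezout:
  assumes p: "poly_over F p" and q: "poly_over F q" and ne: "p \<noteq> 0 \<or> q \<noteq> 0"
  obtains g u v p' q' where "poly_over F g" "poly_over F u" "poly_over F v" "poly_over F p'" "poly_over F q'"
    "g = u * p + v * q" "p = g * p'" "q = g * q'" "lead_coeff g = 1"
proof -
  define I where "I = {u * p + v * q | u v. poly_over F u \<and> poly_over F v}"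
  have "p = 1 * p + 0 * q" "q = 0 * p + 1 * q" by auto
  then have pI: "p \<in> I" "q \<in> I" unfolding I_def using poly_over_0 poly_over_1 by blast+
  have 0: "poly_over F x" if "x \<in> I" for x using that p q unfolding I_def by (auto intro: poly_over_add poly_over_mult)
  have 1: "x - y \<in> I" if xy: "x \<in> I" "y \<in> I" for x y
  proof -
    obtain u v u' v' where "x = u * p + v * q" "y = u' * p + v' * q" "poly_over F u" "poly_over F v" "poly_over F u'" "poly_over F v'"
      using xy unfolding I_def by auto
    moreover then have "x - y = (u - u') * p + (v - v') * q" by (simp add: algebra_simps)
    ultimately show ?thesis unfolding I_def using poly_over_diff by blast
  qed
  have 2: "x * y \<in> I" if xy: "x \<in> I" "poly_over F y" for x y
  proof -
    obtain u v where "x = u * p + v * q" "poly_over F u" "poly_over F v" using xy unfolding I_def by auto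
    moreover then have "x * y = (u * y) * p + (v * y) * q" by (simp add: algebra_simps)
    ultimately show ?thesis unfolding I_def using poly_over_mult xy by blast
  qed
  obtain g where g: "g \<in> I" "lead_coeff g = 1" "\<And>p. p \<in> I \<Longrightarrow> \<exists>q. poly_over F q \<and> p = g * q"
    using poly_over_ideal_generator[of I, OF 0 1 2] ne pI by metis
  show ?thesis using g(1) g(2) g(3)[OF pI(1)] g(3)[OF pI(2)] 0[OF g(1)] that unfolding I_def by blast
qed

end

lemma coprime_poly_bezout:
  fixes p q :: "'a::field poly"
  assumes "coprime p q" shows "\<exists>u v. u * p + v * q = 1"
proof (cases "p = 0 \<and> q = 0")
  case False
  then obtain g u v p' q' where g: "g = u * p + v * q" "p = g * p'" "q = g * q'"
    using poly_over_bezout[OF subfield_UNIV, of p q] unfolding poly_over_def by (metis UNIV_I)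
  then have "is_unit g" using assms by (metis coprime_common_divisor dvd_triv_left)
  then obtain h where "g * h = 1" by (metis dvdE)
  then have "(h * u) * p + (h * v) * q = 1" using g(1) by (simp add: algebra_simps)
  then show ?thesis by blast
qed (use assms in auto)

section \<open>Hensel's lemma and Puiseux series\<close>

text \<open>Multiply the Bezout relation by \<open>h\<close> and reduce the cofactor
  \<open>v * h\<close> modulo \<open>f\<close>; what is left is divisible by \<open>f\<close>, and
  comparing degrees bounds the other cofactor. These bounds keep both degrees fixed during Hensel
  lifting.\<close>

lemma coprime_poly_bezout_bounded:
  fixes f g h :: "'a::field poly"
  assumes "u * f + v * g = 1" "degree h < degree f + degree g" "degree f > 0" "degree g > 0"
  obtains a b where "f * b + g * a = h" "degree a < degree f" "degree b < degree g"
proof -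
  define a where "a = (v * h) mod f"
  have f0: "f \<noteq> 0" using assms by auto
  have da: "degree a < degree f" unfolding a_def using assms(3) f0
    by (metis degree_mod_less' degree_0 )
  have 1: "g * a = g * v * h - f * (g * ((v * h) div f))"
    unfolding a_def by (metis (no_types, lifting) minus_div_mult_eq_mod mult.assoc mult.commute right_diff_distrib')
  have 2: "g * v * h = h - u * f * h" using assms(1)
    by (metis add_diff_cancel_left' left_diff_distrib mult.commute mult_1)
  have "h - g * a = f * (u * h + g * ((v * h) div f))"
    unfolding 1 2 by (simp add: algebra_simps)
  then obtain b where b: "h - g * a = f * b" by blast
  have "degree b < degree g"
  proof (cases "b = 0")
    case False
    have "degree (g * a) < degree f + degree g" using da
      by (metis add.commute add_less_cancel_left assms(4) degree_mult_le le_less_trans)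
    then have "degree (h - g * a) < degree f + degree g" using assms(2) by (simp add: degree_diff_less)
    then show ?thesis unfolding b using False f0 by (simp add: degree_mult_eq)
  qed (use assms in auto)
  moreover have "f * b + g * a = h" using b by (metis diff_add_cancel)
  ultimately show ?thesis using da that by blast
qed

text \<open>Hensel lifting written on the powers of the series variable: \<open>P j\<close> stands
  for the part of order \<open>j\<close> of a polynomial with power series coefficients. At order
  \<open>j\<close> the product condition reads \<open>f * G j + g * F j = P j\<close> minus terms of
  lower index, a bounded Bezout equation that is solvable at every stage.\<close>

lemma hensel_sequence:
  fixes f g :: "'a::field poly" and P :: "nat \<Rightarrow> 'a poly"
  assumes bez: "u * f + v * g = 1" and df: "degree f > 0" and dg: "degree g > 0"
    and P0: "P 0 = f * g" and dP: "\<And>j. j > 0 \<Longrightarrow> degree (P j) < degree f + degree g"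
  obtains F G where "F 0 = f" "G 0 = g"
    "\<And>j. j > 0 \<Longrightarrow> degree (F j) < degree f" "\<And>j. j > 0 \<Longrightarrow> degree (G j) < degree g"
    "\<And>j. (\<Sum>i\<le>j. F i * G (j - i)) = P j"
proof -
  \<comment> \<open>\<open>Q H x r\<close> says that \<open>r\<close> is admissible at
    \<open>x\<close> given the earlier values of \<open>H\<close>; well-founded dependent choice
    then yields the whole sequence.\<close>
  define Q where "Q = (\<lambda>(H::nat \<Rightarrow> 'a poly \<times> 'a poly) x r. if x = 0 then r = (f, g) else
     degree (fst r) < degree f \<and> degree (snd r) < degree g \<and>
     f * snd r + g * fst r = P x - (\<Sum>i\<in>{0<..<x}. fst (H i) * snd (H (x - i))))"
  have "\<exists>H. \<forall>x. Q H x (H x)"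
  proof (rule dependent_wellorder_choice)
    fix r :: "'a poly \<times> 'a poly" and H H' :: "nat \<Rightarrow> 'a poly \<times> 'a poly" and x :: nat
    assume "\<And>y. y < x \<Longrightarrow> H y = H' y"
    then have "(\<Sum>i\<in>{0<..<x}. fst (H i) * snd (H (x - i))) = (\<Sum>i\<in>{0<..<x}. fst (H' i) * snd (H' (x - i)))"
      by (intro sum.cong) auto
    then show "Q H x r = Q H' x r" unfolding Q_def by simp
  next
    fix x :: nat and H assume IH: "\<And>y. y < x \<Longrightarrow> Q H y (H y)"
    show "\<exists>r. Q H x r"
    proof (cases "x = 0")
      case False
      define h where "h = P x - (\<Sum>i\<in>{0<..<x}. fst (H i) * snd (H (x - i)))"
      have "degree (fst (H i) * snd (H (x - i))) < degree f + degree g" if "i \<in> {0<..<x}" for i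
      proof -
        have "degree (fst (H i)) < degree f" "degree (snd (H (x - i))) < degree g"
          using that IH[of i] IH[of "x - i"] unfolding Q_def by auto
        then show ?thesis by (metis add_less_mono degree_mult_le le_less_trans)
      qed
      then have "degree (\<Sum>i\<in>{0<..<x}. fst (H i) * snd (H (x - i))) < degree f + degree g"
        using df by (intro degree_sum_less) auto
      then have "degree h < degree f + degree g" unfolding h_def using dP False by (simp add: degree_diff_less)
      from coprime_poly_bezout_bounded[OF bez this df dg] obtain a b where
        "f * b + g * a = h" "degree a < degree f" "degree b < degree g" by blast
      then have "Q H x (a, b)" unfolding Q_def h_def using False by simp
      then show ?thesis by blast
    qed (auto simp: Q_def)
  qed
  then obtain H where H: "\<And>x. Q H x (H x)" by blast
  define F G where "F = fst \<circ> H" and "G = snd \<circ> H"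
  have 0: "F 0 = f" "G 0 = g" using H[of 0] unfolding Q_def F_def G_def by auto
  have "(\<Sum>i\<le>j. F i * G (j - i)) = P j" for j
  proof (cases "j = 0")
    case False
    then have "{..j} = insert 0 (insert j {0<..<j})" by auto
    then have "(\<Sum>i\<le>j. F i * G (j - i)) = F 0 * G j + (F j * G 0 + (\<Sum>i\<in>{0<..<j}. F i * G (j - i)))"
      using False by simp
    also have "\<dots> = P j" using H[of j] False unfolding Q_def 0 by (simp add: F_def G_def algebra_simps)
    finally show ?thesis .
  qed (simp add: 0 P0)
  with 0 show ?thesis using H that[of F G] unfolding Q_def F_def G_def
    by (metis comp_apply less_numeral_extra(3))
qed

text \<open>The leading coefficient has to be a constant series: then the parts of positive order
  have degree below \<open>degree f + degree g\<close>, and all corrections preserve the degrees of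
  the two factors.\<close>

lemma hensel_fps:
  fixes p :: "'a::field fps poly"
  assumes p: "degree p = degree f + degree g" and lc: "\<And>j. j > 0 \<Longrightarrow> fps_nth (lead_coeff p) j = 0"
    and bez: "u * f + v * g = 1" and df: "degree f > 0" and dg: "degree g > 0"
    and res: "map_poly (\<lambda>c. fps_nth c 0) p = f * g"
  obtains F G where "p = F * G" "degree F = degree f" "degree G = degree g"
    "map_poly (\<lambda>c. fps_nth c 0) F = f" "map_poly (\<lambda>c. fps_nth c 0) G = g"
    "lead_coeff F = fps_const (lead_coeff f)" "lead_coeff G = fps_const (lead_coeff g)"
proof -
  define P where "P j = map_poly (\<lambda>c. fps_nth c j) p" for j
  have cP: "coeff (P j) k = fps_nth (coeff p k) j" for j k unfolding P_def by (simp add: coeff_map_poly)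
  have "degree (P j) < degree f + degree g" if "j > 0" for j
  proof (rule ccontr)
    assume a: "\<not> ?thesis"
    then have "P j \<noteq> 0" using df by auto
    then have l: "lead_coeff (P j) \<noteq> 0" by simp
    have "degree (P j) \<le> degree p" unfolding P_def by (simp add: degree_map_poly_le)
    then have "degree (P j) = degree p" using a p by simp
    then show False using l cP[of j "degree p"] lc[OF that] by metis
  qed
  note dP = this
  have P0: "P 0 = f * g" unfolding P_def using res .
  obtain F G where F0: "F 0 = f" and G0: "G 0 = g"
    and dF: "\<And>j. j > 0 \<Longrightarrow> degree (F j) < degree f" and dG: "\<And>j. j > 0 \<Longrightarrow> degree (G j) < degree g"
    and FG: "\<And>j. (\<Sum>i\<le>j. F i * G (j - i)) = P j"
    by (rule hensel_sequence[where P = P, OF bez df dg P0 dP]) (assumption, rule that)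
  \<comment> \<open>Exchanges the two expansions: a sequence of polynomials, indexed by the order in
    the series variable, becomes a polynomial whose coefficients are power series.\<close>
  define A where "A H m = (\<Sum>i\<le>m. monom (Abs_fps (\<lambda>j. coeff (H j) i)) i)" for H :: "nat \<Rightarrow> 'a poly" and m
  have cA: "coeff (A H m) i = Abs_fps (\<lambda>j. coeff (H j) i)" if "\<And>j. degree (H j) \<le> m" for H m i
  proof -
    have "coeff (A H m) i = (\<Sum>k\<le>m. if k = i then Abs_fps (\<lambda>j. coeff (H j) k) else 0)"
      unfolding A_def by (simp add: coeff_sum)
    also have "\<dots> = Abs_fps (\<lambda>j. coeff (H j) i)"
    proof (cases "i \<le> m")
      case False
      then have "coeff (H j) i = 0" for j using that[of j] by (intro coeff_eq_0) simp
      then show ?thesis using False by (auto simp: fps_eq_iff)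
    qed simp
    finally show ?thesis .
  qed
  define F' G' where "F' = A F (degree f)" and "G' = A G (degree g)"
  have dF': "degree (F j) \<le> degree f" for j using dF[of j] F0 by (cases "j = 0") auto
  have dG': "degree (G j) \<le> degree g" for j using dG[of j] G0 by (cases "j = 0") auto
  have cF: "coeff F' i = Abs_fps (\<lambda>j. coeff (F j) i)" for i unfolding F'_def by (rule cA) (rule dF')
  have cG: "coeff G' i = Abs_fps (\<lambda>j. coeff (G j) i)" for i unfolding G'_def by (rule cA) (rule dG')
  have 1: "coeff F' (degree f) = fps_const (lead_coeff f)" unfolding cF fps_eq_iff
    using dF F0 by (auto simp: coeff_eq_0)
  have 2: "coeff G' (degree g) = fps_const (lead_coeff g)" unfolding cG fps_eq_iff
    using dG G0 by (auto simp: coeff_eq_0)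
  have f0: "lead_coeff f \<noteq> 0" "lead_coeff g \<noteq> 0" using df dg by auto
  have "degree F' \<le> degree f" unfolding F'_def A_def by (intro degree_sum_le) (auto intro: order.trans[OF degree_monom_le])
  then have d1: "degree F' = degree f" using 1 f0 by (metis fps_const_eq_0_iff le_antisym le_degree)
  have "degree G' \<le> degree g" unfolding G'_def A_def by (intro degree_sum_le) (auto intro: order.trans[OF degree_monom_le])
  then have d2: "degree G' = degree g" using 2 f0 by (metis fps_const_eq_0_iff le_antisym le_degree)
  have "p = F' * G'"
  proof (intro poly_eqI fps_ext)
    fix k j
    have "fps_nth (coeff (F' * G') k) j = (\<Sum>i\<le>k. \<Sum>l=0..j. coeff (F l) i * coeff (G (j - l)) (k - i))"
      by (simp add: coeff_mult fps_sum_nth fps_mult_nth cF cG)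
    also have "\<dots> = (\<Sum>l\<le>j. \<Sum>i\<le>k. coeff (F l) i * coeff (G (j - l)) (k - i))"
      by (subst sum.swap) (simp add: atMost_atLeast0)
    also have "\<dots> = coeff (\<Sum>l\<le>j. F l * G (j - l)) k" by (simp add: coeff_sum coeff_mult)
    also have "\<dots> = fps_nth (coeff p k) j" unfolding FG cP ..
    finally show "fps_nth (coeff p k) j = fps_nth (coeff (F' * G') k) j" ..
  qed
  moreover have "map_poly (\<lambda>c. fps_nth c 0) F' = f" "map_poly (\<lambda>c. fps_nth c 0) G' = g"
    by (auto intro!: poly_eqI simp: coeff_map_poly cF cG F0 G0)
  ultimately show ?thesis using that d1 d2 1 2 by metis
qed

section \<open>Ramified substitutions and Puiseux expansions\<close>

definition ramified :: "nat \<Rightarrow> ('a::field fls \<Rightarrow> 'a fls) \<Rightarrow> bool" where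
  "ramified e \<phi> \<longleftrightarrow> e > 0 \<and> field_hom \<phi> \<and> \<phi> fls_X = fls_X ^ e \<and> (\<forall>c. \<phi> (fls_const c) = fls_const c) \<and>
     (\<forall>f. fls_subdegree (\<phi> f) = int e * fls_subdegree f)"

lemma ramified_compose: "ramified e \<phi> \<Longrightarrow> ramified e' \<psi> \<Longrightarrow> ramified (e * e') (\<psi> \<circ> \<phi>)"
  unfolding ramified_def
proof (elim conjE, intro conjI)
  assume h: "field_hom \<phi>" "field_hom \<psi>" and x: "\<phi> fls_X = fls_X ^ e" "\<psi> fls_X = fls_X ^ e'"
  interpret a: field_hom \<phi> by fact
  interpret b: field_hom \<psi> by fact
  show "field_hom (\<psi> \<circ> \<phi>)" by unfold_locales (auto simp: a.hom_add b.hom_add a.hom_mult b.hom_mult)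
  show "(\<psi> \<circ> \<phi>) fls_X = fls_X ^ (e * e')" using x
    by (simp add: b.hom_power power_mult[symmetric] mult.commute)
qed (auto simp: mult_ac)

lemma ramified_id: "ramified 1 id"
  unfolding ramified_def by (auto intro!: field_hom.intro) (unfold_locales, auto)

text \<open>Adjoining an \<open>e\<close>-th root of \<open>X\<close> gives a Laurent series field
  again, so the extension is realised inside the same type by the substitution
  \<open>X -> X^e\<close>, which multiplies orders by \<open>e\<close>.\<close>

lemma ramified_exists:
  assumes "e > 0" shows "ramified e (\<lambda>f::'a::field fls. fls_compose_fps f (fps_X ^ e))"
proof -
  have x: "(fps_X ^ e :: 'a fps) \<noteq> 0" "fps_nth (fps_X ^ e :: 'a fps) 0 = 0" using assms by auto
  show ?thesis unfolding ramified_def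
  proof (intro conjI allI)
    show "field_hom (\<lambda>f::'a::field fls. fls_compose_fps f (fps_X ^ e))"
      by unfold_locales (auto simp: fls_compose_fps_add[OF x] fls_compose_fps_mult[OF x])
    fix f :: "'a fls"
    show "fls_subdegree (fls_compose_fps f (fps_X ^ e)) = int e * fls_subdegree f"
    proof (cases "f = 0")
      case False
      then have "fls_base_factor_to_fps f oo fps_X ^ e \<noteq> 0" using fls_compose_fps_eq_0_iff[OF x, of f]
        by (auto simp: fls_compose_fps_def)
      moreover have "subdegree (fls_base_factor_to_fps f oo fps_X ^ e) = 0"
        using False assms by (intro subdegreeI) auto
      ultimately show ?thesis using False assms
        by (simp add: fls_compose_fps_def fls_subdegree_fls_to_fps fps_to_fls_power)
    qed simp
  qed (use assms x in \<open>auto simp: fps_to_fls_power\<close>)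
qed

text \<open>Integral Laurent coefficients come from power series. Monicity of \<open>p\<close> and
  \<open>f\<close> forces that of \<open>g\<close>, so the lifted factors are monic too.\<close>

lemma hensel_fls:
  fixes p :: "'a::field fls poly"
  assumes p: "lead_coeff p = 1" "\<And>i. fls_subdegree (coeff p i) \<ge> 0"
    and res: "map_poly (\<lambda>c. fls_nth c 0) p = f * g" and cop: "coprime f g"
    and df: "degree f > 0" and dg: "degree g > 0" and fg: "lead_coeff f = 1"
  obtains F G where "p = F * G" "degree F = degree f" "degree G = degree g"
    "lead_coeff F = 1" "lead_coeff G = 1" "\<And>i. fls_subdegree (coeff F i) \<ge> 0" "\<And>i. fls_subdegree (coeff G i) \<ge> 0"
    "map_poly (\<lambda>c. fls_nth c 0) F = f" "map_poly (\<lambda>c. fls_nth c 0) G = g"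
proof -
  define q where "q = map_poly fls_regpart p"
  interpret h: inj_comm_ring_hom "fps_to_fls :: 'a fps \<Rightarrow> 'a fls"
    by unfold_locales (simp_all add: fls_times_fps_to_fls)
  interpret H: map_poly_inj_comm_ring_hom "fps_to_fls :: 'a fps \<Rightarrow> 'a fls" ..
  have pq: "p = map_poly fps_to_fls q" unfolding q_def
    by (intro poly_eqI) (simp add: coeff_map_poly p(2))
  have lq: "lead_coeff q = 1" using p(1) unfolding pq by (metis h.hom_lead_coeff h.hom_one h.injectivity)
  have p0: "p \<noteq> 0" using p(1) by auto
  have res': "map_poly (\<lambda>c. fps_nth c 0) q = f * g" unfolding res[symmetric] pq
    by (intro poly_eqI) (simp add: coeff_map_poly)
  have lp: "coeff (map_poly (\<lambda>c. fls_nth c 0) p) (degree p) = 1" using p(1) by (simp add: coeff_map_poly)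
  have "degree (map_poly (\<lambda>c. fls_nth c 0) p) = degree p"
    using lp by (metis degree_map_poly_le le_antisym le_degree zero_neq_one)
  then have d: "degree p = degree f + degree g" using df dg unfolding res by (metis degree_0 degree_mult_eq less_irrefl)
  have lg: "lead_coeff g = 1" using lp unfolding res d using fg coeff_mult_degree_sum[of f g] by simp
  obtain u v where uv: "u * f + v * g = 1" using coprime_poly_bezout[OF cop] by blast
  have dq: "degree q = degree f + degree g" using d unfolding pq by simp
  obtain F G where FG: "q = F * G" "degree F = degree f" "degree G = degree g"
    "map_poly (\<lambda>c. fps_nth c 0) F = f" "map_poly (\<lambda>c. fps_nth c 0) G = g"
    "lead_coeff F = fps_const (lead_coeff f)" "lead_coeff G = fps_const (lead_coeff g)"
    by (rule hensel_fps[OF dq _ uv df dg res']) (use lq in auto)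
  show ?thesis
  proof (rule that[of "map_poly fps_to_fls F" "map_poly fps_to_fls G"])
    show "p = map_poly fps_to_fls F * map_poly fps_to_fls G" unfolding pq FG(1) H.hom_mult ..
  qed (use FG fg lg in \<open>auto simp: fls_subdegree_fls_to_fps_gt0 intro!: poly_eqI simp: coeff_map_poly\<close>)
qed

lemma poly_single_root_power:
  fixes p :: "'a::alg_closed_field poly"
  assumes "lead_coeff p = 1" "\<And>y. poly p y = 0 \<Longrightarrow> y = x"
  shows "p = [:-x, 1:] ^ degree p"
proof -
  have "p \<noteq> 0" using assms by auto
  from alg_closed_imp_factorization[OF this] obtain A where A: "size A = degree p"
    "p = (\<Prod>x\<in>#A. [:-x, 1:])" using assms(1) by auto
  have "y = x" if "y \<in># A" for y
  proof (rule assms(2))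
    show "poly p y = 0" unfolding A(2) using that by (simp add: poly_prod_mset prod_mset_zero_iff)
  qed
  then have "A = replicate_mset (size A) x" by (intro set_mset_subset_singletonD) auto
  then have "p = (\<Prod>x\<in>#replicate_mset (degree p) x. [:-x, 1:])" using A by metis
  then show ?thesis by simp
qed

text \<open>A Newton polygon argument. The minimal slope \<open>v(c_i) / (n - i)\<close>, attained
  at \<open>i0\<close>, becomes integral after \<open>X -> X^\<beta>\<close>; rescaling the unknown
  then makes all coefficients integral, with a unit at \<open>i0\<close>. Since the coefficient of
  degree \<open>n - 1\<close> vanishes, the residue polynomial is not a power of one linear factor,
  so it has two distinct roots and Hensel's lemma splits it.\<close>

lemma puiseux_step_normalized:
  fixes p :: "'a::{alg_closed_field,field_char_0} fls poly"
  assumes n: "degree p \<ge> 2" and lc: "lead_coeff p = 1" and c1: "coeff p (degree p - 1) = 0"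
  shows "\<exists>e \<phi> f g. ramified e \<phi> \<and> map_poly \<phi> p = f * g \<and> degree f > 0 \<and> degree g > 0"
proof -
  define n where "n = degree p"
  define I where "I = {i. i < n \<and> coeff p i \<noteq> 0}"
  have fI: "finite I" unfolding I_def by auto
  show ?thesis
  proof (cases "I = {}")
    case True
    have "p = monom 1 n"
    proof (rule poly_eqI)
      fix i show "coeff p i = coeff (monom 1 n) i"
        using True lc n_def coeff_eq_0[of p i] unfolding I_def by (cases i n rule: linorder_cases) auto
    qed
    then have "p = monom 1 1 * monom 1 (n - 1)" using n n_def by (simp add: mult_monom)
    moreover have "degree (monom 1 1 :: 'a fls poly) > 0" "degree (monom 1 (n - 1) :: 'a fls poly) > 0"
      using n n_def by (auto simp: degree_monom_eq)
    ultimately show ?thesis using ramified_id by (metis map_poly_id)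
  next
    case False
    define r :: "nat \<Rightarrow> rat" where "r i = of_int (fls_subdegree (coeff p i)) / of_nat (n - i)" for i :: nat
    define i0 where "i0 = arg_min_on r I"
    have i0: "i0 \<in> I" and min: "\<And>i. i \<in> I \<Longrightarrow> r i0 \<le> r i"
      using arg_min_if_finite(1)[OF fI False] arg_min_least[OF fI False] unfolding i0_def by auto
    define \<alpha> \<beta> where "\<alpha> = fls_subdegree (coeff p i0)" and "\<beta> = n - i0"
    have b: "\<beta> > 0" using i0 unfolding \<beta>_def I_def by auto
    obtain \<phi> :: "'a fls \<Rightarrow> 'a fls" where \<phi>: "ramified \<beta> \<phi>" using ramified_exists[OF b] by (metis (no_types))
    interpret h: field_hom \<phi> using \<phi> unfolding ramified_def by auto
    interpret H: map_poly_comm_ring_hom \<phi> ..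
    define p1 where "p1 = map_poly \<phi> p"
    have d1: "degree p1 = n" unfolding p1_def n_def by (simp)
    define s where "s = (fls_X powi \<alpha> :: 'a fls)"
    define s' where "s' = (fls_X powi (-\<alpha>) :: 'a fls)"
    have s: "s * s' = 1" "s \<noteq> 0" "s' \<noteq> 0" unfolding s_def s'_def by (auto simp: power_int_minus)
    have sd: "fls_subdegree s = \<alpha>" "fls_subdegree s' = - \<alpha>" unfolding s_def s'_def by auto
    \<comment> \<open>This is \<open>s^(-n) * p1(s * y)\<close> with \<open>s = X^\<alpha>\<close>:
      the coefficient of degree \<open>i\<close> is multiplied by \<open>s^(i - n)\<close>, which
      turns its order into \<open>\<beta> * v(c_i) - (n - i) * \<alpha>\<close>.\<close>
    define p2 where "p2 = smult (s' ^ n) (pcompose p1 [:0, s:])"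
    have c2: "coeff p2 i = s' ^ n * s ^ i * \<phi> (coeff p i)" for i
      unfolding p2_def p1_def by (simp add: coeff_pcompose_linear)
    have ss: "s' ^ n * s ^ i = s' ^ (n - i)" if "i \<le> n" for i
    proof -
      have "s' ^ n = s' ^ (n - i) * s' ^ i" using that by (simp add: power_add[symmetric])
      then have "s' ^ n * s ^ i = s' ^ (n - i) * (s * s') ^ i" by (simp add: power_mult_distrib mult_ac)
      then show ?thesis using s(1) by simp
    qed
    have d2: "degree p2 = n" unfolding p2_def using d1 s by simp
    have lc2: "lead_coeff p2 = 1" using lc unfolding d2 c2 by (simp add: ss n_def[symmetric])
    have sub2: "fls_subdegree (coeff p2 i) = int \<beta> * fls_subdegree (coeff p i) - int (n - i) * \<alpha>" if "i \<in> I" for i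
    proof -
      have "coeff p2 i = s' ^ (n - i) * \<phi> (coeff p i)" using that ss unfolding c2 I_def by simp
      moreover have "\<phi> (coeff p i) \<noteq> 0" using that unfolding I_def by simp
      ultimately show ?thesis using s sd \<phi> unfolding ramified_def by (simp add: fls_subdegree_pow)
    qed
    have z2: "coeff p2 i = 0" if "i < n" "i \<notin> I" for i using that unfolding c2 I_def by simp
    have int2: "fls_subdegree (coeff p2 i) \<ge> 0" for i
    proof (cases "i \<in> I")
      case True
      then have pos: "n - i > 0" unfolding I_def by auto
      have "of_int \<alpha> / of_nat \<beta> \<le> (of_int (fls_subdegree (coeff p i)) / of_nat (n - i) :: rat)"
        using min[OF True] unfolding r_def \<alpha>_def \<beta>_def .
      then have "of_int \<alpha> * of_nat (n - i) \<le> (of_int (fls_subdegree (coeff p i)) * of_nat \<beta> :: rat)"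
        using pos b by (simp add: field_simps)
      then have "of_int (\<alpha> * int (n - i)) \<le> (of_int (fls_subdegree (coeff p i) * int \<beta>) :: rat)" by simp
      then have "\<alpha> * int (n - i) \<le> fls_subdegree (coeff p i) * int \<beta>" by linarith
      then show ?thesis unfolding sub2[OF True] by (simp add: mult.commute)
    next
      case False
      then show ?thesis using z2[of i] lc2 d2 coeff_eq_0[of p2 i] by (cases i n rule: linorder_cases) auto
    qed
    define q where "q = map_poly (\<lambda>c. fls_nth c 0) p2"
    have cq: "coeff q i = fls_nth (coeff p2 i) 0" for i unfolding q_def by (simp add: coeff_map_poly)
    have lq: "coeff q n = 1" unfolding cq using lc2 d2 by simp
    have dq: "degree q = n" using lq degree_map_poly_le[of "\<lambda>c. fls_nth c 0" p2] d2 unfolding q_def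
      by (metis le_antisym le_degree zero_neq_one)
    have q1: "coeff q (n - 1) = 0" unfolding cq c2 using c1 n_def by simp
    have "fls_subdegree (coeff p2 i0) = 0" unfolding sub2[OF i0] \<alpha>_def \<beta>_def by simp
    moreover have "coeff p2 i0 \<noteq> 0" unfolding c2 using s i0 unfolding I_def by simp
    ultimately have q0: "coeff q i0 \<noteq> 0" unfolding cq by (metis nth_fls_subdegree_zero_iff)
    have n2: "n \<ge> 2" using n n_def by simp
    have "degree q > 0" using dq n2 by simp
    then obtain x where x: "poly q x = 0" using alg_closed_imp_poly_has_root by blast
    have "\<exists>y. poly q y = 0 \<and> y \<noteq> x"
    proof (rule ccontr)
      assume "\<not> ?thesis"
      then have "q = [:-x, 1:] ^ degree q" using lq dq by (intro poly_single_root_power) auto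
      then have qe: "q = [:-x, 1:] ^ n" unfolding dq .
      have "coeff q (n - 1) = of_nat (n choose (n - 1)) * (- x)" unfolding qe using n2
        by (simp add: coeff_linear_poly_power)
      also have "n choose (n - 1) = n" using n2 by (subst binomial_symmetric) auto
      finally have "coeff q (n - 1) = of_nat n * (- x)" .
      then have "x = 0" using q1 n2 by simp
      then have "q = monom 1 n" unfolding qe by (simp add: monom_altdef)
      then show False using q0 i0 unfolding I_def by auto
    qed
    then obtain y where y: "poly q y = 0" "x \<noteq> y" by blast
    obtain f0 g0 where fg0: "degree f0 > 0" "degree g0 > 0" "coprime f0 g0" "q = f0 * g0"
      using alg_closed_imp_poly_splits_coprime[OF _ x y] dq n2 by auto
    define f1 g1 where "f1 = smult (inverse (lead_coeff f0)) f0" and "g1 = smult (lead_coeff f0) g0"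
    have l0: "lead_coeff f0 \<noteq> 0" using fg0 by auto
    have fg1: "degree f1 > 0" "degree g1 > 0" "coprime f1 g1" "q = f1 * g1" "lead_coeff f1 = 1"
      using fg0 l0 unfolding f1_def g1_def by (auto simp: coprime_def smult_dvd_iff dvd_smult_iff)
    obtain F G where FG: "p2 = F * G" "degree F = degree f1" "degree G = degree g1"
      by (rule hensel_fls[OF lc2 int2 fg1(4)[unfolded q_def] fg1(3,1,2,5)]) (rule that)
    have "pcompose p2 [:0, s':] = smult (s' ^ n) (pcompose (pcompose p1 [:0, s:]) [:0, s':])"
      unfolding p2_def by (simp add: pcompose_smult)
    also have "pcompose (pcompose p1 [:0, s:]) [:0, s':] = p1"
      using s(1) by (simp add: pcompose_assoc[symmetric] pcompose_pCons pcompose_const)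
    finally have "smult (s ^ n) (pcompose p2 [:0, s':]) = p1"
      using s(1) by (simp add: power_mult_distrib[symmetric])
    then have "p1 = smult (s ^ n) (pcompose F [:0, s':]) * pcompose G [:0, s':]"
      unfolding FG(1) pcompose_mult by simp
    moreover have "degree (smult (s ^ n) (pcompose F [:0, s':])) > 0" "degree (pcompose G [:0, s':]) > 0"
      using FG fg1 s by (auto simp: degree_pcompose)
    ultimately show ?thesis using \<phi> unfolding p1_def by blast
  qed
qed

text \<open>Translating the unknown by \<open>a\<close>, the coefficient of degree
  \<open>n - 1\<close> divided by \<open>n\<close>, removes that coefficient; this is where
  characteristic zero enters.\<close>

lemma puiseux_step:
  fixes p :: "'a::{alg_closed_field,field_char_0} fls poly"
  assumes n: "degree p \<ge> 2" and lc: "lead_coeff p = 1"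
  shows "\<exists>e \<phi> f g. ramified e \<phi> \<and> map_poly \<phi> p = f * g \<and> degree f > 0 \<and> degree g > 0"
proof -
  define n where "n = degree p"
  define a where "a = coeff p (n - 1) / of_nat n"
  define q where "q = pcompose p [:-a, 1:]"
  have dq: "degree q = n" unfolding q_def n_def by (simp add: degree_pcompose)
  have lq: "lead_coeff q = 1" unfolding q_def using lc by (subst lead_coeff_comp) auto
  obtain r where r: "p = monom 1 n + r" "degree r < n"
  proof -
    have "degree (p - monom 1 n) < n"
    proof (rule ccontr)
      assume as: "\<not> ?thesis"
      have "degree (p - monom 1 n) \<le> n" by (intro degree_diff_le) (auto simp: n_def degree_monom_eq)
      then have "degree (p - monom 1 n) = n" using as by simp
      then have "lead_coeff (p - monom 1 n) = 0" using lc by (simp add: n_def)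
      then have "p - monom 1 n = 0" using leading_coeff_0_iff by blast
      then show False using as n n_def by simp
    qed
    then show ?thesis using that[of "p - monom 1 n"] by simp
  qed
  have "coeff q (n - 1) = coeff ([:-a,1:] ^ n) (n - 1) + coeff (pcompose r [:-a,1:]) (n - 1)"
    unfolding q_def r(1) pcompose_add by (simp add: monom_altdef pcompose_smult pcompose_hom.hom_power pcompose_pCons)
  also have "coeff ([:-a,1:] ^ n) (n - 1) = - (of_nat n * a)"
  proof -
    have "n choose (n - 1) = n" using n n_def by (subst binomial_symmetric) auto
    then show ?thesis using n n_def by (simp add: coeff_linear_poly_power)
  qed
  also have "of_nat n * a = coeff p (n - 1)" unfolding a_def using n n_def by simp
  also have "coeff (pcompose r [:-a,1:]) (n - 1) = coeff r (n - 1)"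
  proof (cases "degree r = n - 1")
    case True
    have "lead_coeff (pcompose r [:-a,1:]) = lead_coeff r" by (subst lead_coeff_comp) auto
    then show ?thesis using True by (simp add: degree_pcompose)
  next
    case False
    then have "degree r < n - 1" using r(2) by simp
    then show ?thesis by (simp add: coeff_eq_0 degree_pcompose)
  qed
  also have "- coeff p (n - 1) + coeff r (n - 1) = 0" unfolding r(1) using n n_def by simp
  finally have "coeff q (degree q - 1) = 0" unfolding dq .
  from puiseux_step_normalized[OF _ lq this] dq n n_def obtain e \<phi> f g where
    R: "ramified e \<phi>" and fg: "map_poly \<phi> q = f * g" "degree f > 0" "degree g > 0" by auto
  interpret h: field_hom \<phi> using R unfolding ramified_def by auto
  have "p = pcompose q [:a, 1:]" unfolding q_def by (simp add: pcompose_assoc[symmetric] pcompose_pCons)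
  then have "map_poly \<phi> p = pcompose f [:\<phi> a, 1:] * pcompose g [:\<phi> a, 1:]"
    by (simp add: h.map_poly_pcompose fg(1) pcompose_mult map_poly_pCons)
  moreover have "degree (pcompose f [:\<phi> a, 1:]) > 0" "degree (pcompose g [:\<phi> a, 1:]) > 0"
    using fg by (auto simp: degree_pcompose)
  ultimately show ?thesis using R by blast
qed

text \<open>The second factor is split only after the substitution belonging to the first has been
  applied to it, so that one composite substitution splits both.\<close>

theorem puiseux_splits:
  fixes p :: "'a::{alg_closed_field,field_char_0} fls poly"
  assumes "lead_coeff p = 1"
  shows "\<exists>e \<phi> xs. ramified e \<phi> \<and> map_poly \<phi> p = (\<Prod>x\<leftarrow>xs. [:-x, 1:])"
  using assms
proof (induction "degree p" arbitrary: p rule: less_induct)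
  case less
  consider "degree p = 0" | "degree p = 1" | "degree p \<ge> 2" by linarith
  then show ?case
  proof cases
    case 1
    then have "p = 1" using less.prems by (metis degree_eq_zeroE lead_coeff_pCons(2) one_pCons)
    then show ?thesis using ramified_id by (intro exI[of _ 1] exI[of _ id] exI[of _ "[]"]) auto
  next
    case 2
    then have "p = [:- (- coeff p 0), 1:]" using less.prems
      by (intro poly_eqI) (auto simp: coeff_pCons coeff_eq_0 split: nat.splits)
    then show ?thesis using ramified_id by (intro exI[of _ 1] exI[of _ id] exI[of _ "[- coeff p 0]"]) auto
  next
    case 3
    from puiseux_step[OF this less.prems] obtain e0 \<phi>0 f g where 0: "ramified e0 \<phi>0"
      and fg: "map_poly \<phi>0 p = f * g" "degree f > 0" "degree g > 0" by blast
    interpret h0: field_hom \<phi>0 using 0 unfolding ramified_def by auto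
    interpret H0: map_poly_comm_ring_hom \<phi>0 ..
    have lfg: "lead_coeff f * lead_coeff g = 1" using less.prems fg(1)
      by (metis h0.hom_lead_coeff h0.hom_one lead_coeff_mult)
    define f' g' where "f' = smult (inverse (lead_coeff f)) f" and "g' = smult (lead_coeff f) g"
    have l0: "lead_coeff f \<noteq> 0" using fg by auto
    have f'g': "map_poly \<phi>0 p = f' * g'" "lead_coeff f' = 1" "lead_coeff g' = 1" "degree f' = degree f" "degree g' = degree g"
      using fg lfg l0 unfolding f'_def g'_def by auto
    have "degree p = degree f + degree g" using fg
      by (metis degree_0 degree_mult_eq h0.degree_map_poly_hom less_numeral_extra(3))
    then have df: "degree f' < degree p" "degree g' < degree p" using fg f'g' by auto
    obtain e1 \<phi>1 xs where 1: "ramified e1 \<phi>1" "map_poly \<phi>1 f' = (\<Prod>x\<leftarrow>xs. [:-x, 1:])"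
      using less.hyps[OF df(1) f'g'(2)] by blast
    interpret h1: field_hom \<phi>1 using 1 unfolding ramified_def by auto
    interpret H1: map_poly_comm_ring_hom \<phi>1 ..
    obtain e2 \<phi>2 ys where 2: "ramified e2 \<phi>2" "map_poly \<phi>2 (map_poly \<phi>1 g') = (\<Prod>x\<leftarrow>ys. [:-x, 1:])"
      using less.hyps[of "map_poly \<phi>1 g'"] df f'g'(3) by auto
    interpret h2: field_hom \<phi>2 using 2 unfolding ramified_def by auto
    interpret H2: map_poly_comm_ring_hom \<phi>2 ..
    have "map_poly (\<phi>2 \<circ> (\<phi>1 \<circ> \<phi>0)) p = map_poly \<phi>2 (map_poly \<phi>1 (map_poly \<phi>0 p))"
      by (simp add: map_poly_map_poly o_assoc)
    also have "\<dots> = map_poly \<phi>2 (\<Prod>x\<leftarrow>xs. [:-x, 1:]) * (\<Prod>x\<leftarrow>ys. [:-x, 1:])"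
      unfolding f'g'(1) H1.hom_mult H2.hom_mult 1 2 ..
    also have "map_poly \<phi>2 (\<Prod>x\<leftarrow>xs. [:-x, 1:]) = (\<Prod>x\<leftarrow>map \<phi>2 xs. [:-x, 1:])"
      by (simp add: H2.hom_prod_list o_def map_poly_pCons h2.hom_uminus)
    finally have "map_poly (\<phi>2 \<circ> (\<phi>1 \<circ> \<phi>0)) p = (\<Prod>x\<leftarrow>map \<phi>2 xs @ ys. [:-x, 1:])" by (simp add: o_def)
    moreover have "ramified (e0 * e1 * e2) (\<phi>2 \<circ> (\<phi>1 \<circ> \<phi>0))"
      using ramified_compose[OF ramified_compose[OF 0 1(1)] 2(1)] .
    ultimately show ?thesis by blast
  qed
qed

text \<open>A simple root of the residue polynomial splits off a linear factor without any
  substitution. This is the source of unramified expansions at almost all points.\<close>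

lemma hensel_splits_simple:
  fixes p :: "'a::{alg_closed_field,field_char_0} fls poly"
  assumes "lead_coeff p = 1" "\<And>i. fls_subdegree (coeff p i) \<ge> 0" "rsquarefree (map_poly (\<lambda>c. fls_nth c 0) p)"
  shows "\<exists>xs. p = (\<Prod>x\<leftarrow>xs. [:-x, 1:]) \<and> (\<forall>x\<in>set xs. fls_subdegree x \<ge> 0)"
  using assms
proof (induction "degree p" arbitrary: p rule: less_induct)
  case less
  define q where "q = map_poly (\<lambda>c. fls_nth c 0) p"
  have lp: "coeff q (degree p) = 1" using less.prems(1) by (simp add: coeff_map_poly q_def)
  then have dq: "degree q = degree p" unfolding q_def
    by (metis degree_map_poly_le le_antisym le_degree zero_neq_one)
  consider "degree p = 0" | "degree p = 1" | "degree p \<ge> 2" by linarith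
  then show ?case
  proof cases
    case 1
    then have "p = 1" using less.prems by (metis degree_eq_zeroE lead_coeff_pCons(2) one_pCons)
    then show ?thesis by (intro exI[of _ "[]"]) auto
  next
    case 2
    then have "p = [:- (- coeff p 0), 1:]" using less.prems
      by (intro poly_eqI) (auto simp: coeff_pCons coeff_eq_0 split: nat.splits)
    then show ?thesis using less.prems(2)[of 0] by (intro exI[of _ "[- coeff p 0]"]) auto
  next
    case 3
    then obtain x where x: "poly q x = 0" using alg_closed_imp_poly_has_root[of q] dq by auto
    then obtain g where g: "q = [:-x, 1:] * g" using poly_eq_0_iff_dvd by blast
    have q0: "q \<noteq> 0" using dq 3 by auto
    then have g0: "g \<noteq> 0" using g by auto
    have dg: "degree q = Suc (degree g)" unfolding g using g0 by (subst degree_mult_eq) auto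
    have rs: "rsquarefree q" using less.prems unfolding q_def by simp
    have "order x q = 1" using rs x q0 unfolding rsquarefree_def by (metis order_root)
    moreover have "order x q = order x [:-x, 1:] + order x g" using q0 unfolding g by (rule order_mult)
    moreover have "order x [:-x, 1:] = 1" using order_power_n_n[of x 1] by simp
    ultimately have "poly g x \<noteq> 0" using g0 by (metis add_cancel_right_right order_root)
    then have nd: "\<not> [:-x, 1:] dvd g" by (simp add: poly_eq_0_iff_dvd)
    have cop: "coprime [:-x, 1:] g"
    proof (rule coprimeI)
      fix d assume d: "d dvd [:-x, 1:]" "d dvd g"
      then obtain z where z: "[:-x, 1:] = d * z" by blast
      have "d \<noteq> 0" "z \<noteq> 0" using z by auto
      then have "degree d + degree z = degree [:-x, 1:]" unfolding z by (simp add: degree_mult_eq)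
      then have dz: "degree d + degree z = 1" by simp
      have "degree z \<noteq> 0"
      proof
        assume "degree z = 0"
        then obtain c where c: "z = [:c:]" by (metis degree_eq_zeroE)
        then have "c \<noteq> 0" using \<open>z \<noteq> 0\<close> by auto
        then have "d = [:-x, 1:] * [:inverse c:]" unfolding z c by simp
        then have "[:-x, 1:] dvd d" by (rule dvdI)
        then show False using nd d(2) dvd_trans by blast
      qed
      then have "degree d = 0" using dz by linarith
      then show "is_unit d" using \<open>d \<noteq> 0\<close> by (simp add: is_unit_iff_degree)
    qed
    have *: "degree [:-x, 1:] > 0" by simp
    have ***: "lead_coeff [:-x, 1:] = 1" by simp
    have **: "degree g > 0" using dg dq 3 by linarith
    obtain F G where FG: "p = F * G" "degree F = degree [:-x,1:]" "degree G = degree g"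
      "lead_coeff F = 1" "lead_coeff G = 1" "\<And>i. fls_subdegree (coeff F i) \<ge> 0" "\<And>i. fls_subdegree (coeff G i) \<ge> 0"
      "map_poly (\<lambda>c. fls_nth c 0) G = g"
      by (rule hensel_fls[OF less.prems(1,2) g[unfolded q_def] cop * ** ***]) (rule that)
    have rg: "rsquarefree g" unfolding rsquarefree_def
    proof (intro conjI allI)
      fix a have "order a q = order a [:-x, 1:] + order a g" using q0 unfolding g by (rule order_mult)
      moreover from rs have "order a q = 0 \<or> order a q = 1" unfolding rsquarefree_def by blast
      ultimately show "order a g = 0 \<or> order a g = 1" by linarith
    qed (use g0 in auto)
    obtain xs where xs: "G = (\<Prod>x\<leftarrow>xs. [:-x, 1:])" "\<forall>x\<in>set xs. fls_subdegree x \<ge> 0"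
      using less.hyps[of G] FG dg dq rg by auto
    have "F = [:- (- coeff F 0), 1:]" using FG(2,4)
      by (intro poly_eqI) (auto simp: coeff_pCons coeff_eq_0 split: nat.splits)
    then have "p = (\<Prod>x\<leftarrow>(- coeff F 0) # xs. [:-x, 1:])" using FG(1) xs by simp
    moreover have "\<forall>x\<in>set ((- coeff F 0) # xs). fls_subdegree x \<ge> 0" using xs FG(6)[of 0] by simp
    ultimately show ?thesis by blast
  qed
qed

section \<open>Function fields of curves\<close>

text \<open>Gaussian elimination over a field that is a set and not a type: a pivot
  \<open>x j0\<close> with nonzero coefficient at \<open>i0\<close> eliminates \<open>e i0\<close>
  from all other vectors.\<close>

lemma subfield_dependent:
  fixes F :: "'a::field set" and x :: "'j \<Rightarrow> 'a" and e :: "'i \<Rightarrow> 'a"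
  assumes F: "is_subfield F" and "finite I" "finite J" "card I < card J"
    and "\<And>j. j \<in> J \<Longrightarrow> \<exists>c. (\<forall>i\<in>I. c i \<in> F) \<and> x j = (\<Sum>i\<in>I. c i * e i)"
  shows "\<exists>a. (\<forall>j\<in>J. a j \<in> F) \<and> (\<exists>j\<in>J. a j \<noteq> 0) \<and> (\<Sum>j\<in>J. a j * x j) = 0"
  using assms(2-)
proof (induction I arbitrary: J x rule: finite_induct)
  case empty
  then have "J \<noteq> {}" by auto
  then show ?case using empty subfieldD[OF F] by (intro exI[of _ "\<lambda>_. 1"]) auto
next
  case (insert i0 I)
  then obtain c where c: "\<And>j i. j \<in> J \<Longrightarrow> i \<in> insert i0 I \<Longrightarrow> c j i \<in> F"
    and xc: "\<And>j. j \<in> J \<Longrightarrow> x j = (\<Sum>i\<in>insert i0 I. c j i * e i)" by metis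
  have xc': "x j = c j i0 * e i0 + (\<Sum>i\<in>I. c j i * e i)" if "j \<in> J" for j using xc[OF that] insert.hyps by simp
  show ?case
  proof (cases "\<forall>j\<in>J. c j i0 = 0")
    case True
    show ?thesis
    proof (rule insert.IH)
      show "card I < card J" using insert by simp
      show "\<exists>c. (\<forall>i\<in>I. c i \<in> F) \<and> x j = (\<Sum>i\<in>I. c i * e i)" if "j \<in> J" for j
        using True xc'[OF that] c that by (intro exI[of _ "c j"]) auto
    qed (use insert in auto)
  next
    case False
    then obtain j0 where j0: "j0 \<in> J" "c j0 i0 \<noteq> 0" by blast
    define r where "r j = c j i0 / c j0 i0" for j
    have r: "r j \<in> F" if "j \<in> J" for j unfolding r_def using c that j0 by (auto intro: subfieldD[OF F])
    define y where "y j = x j - r j * x j0" for j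
    have "\<exists>a. (\<forall>j\<in>J - {j0}. a j \<in> F) \<and> (\<exists>j\<in>J - {j0}. a j \<noteq> 0) \<and> (\<Sum>j\<in>J - {j0}. a j * y j) = 0"
    proof (rule insert.IH)
      show "card I < card (J - {j0})" using insert j0 by simp
      fix j assume j: "j \<in> J - {j0}"
      have "y j = (\<Sum>i\<in>I. (c j i - r j * c j0 i) * e i)"
        unfolding y_def using j j0 xc'[of j] xc'[of j0]
        by (simp add: r_def algebra_simps sum_subtractf sum_distrib_left sum.distrib)
      then show "\<exists>c. (\<forall>i\<in>I. c i \<in> F) \<and> y j = (\<Sum>i\<in>I. c i * e i)"
        using j j0 c r by (intro exI[of _ "\<lambda>i. c j i - r j * c j0 i"]) (auto intro!: subfieldD[OF F])
    qed (use insert in auto)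
    then obtain a where a: "\<forall>j\<in>J - {j0}. a j \<in> F" "\<exists>j\<in>J - {j0}. a j \<noteq> 0" "(\<Sum>j\<in>J - {j0}. a j * y j) = 0" by blast
    define b where "b = a(j0 := - (\<Sum>j\<in>J - {j0}. a j * r j))"
    have "(\<Sum>j\<in>J. b j * x j) = b j0 * x j0 + (\<Sum>j\<in>J - {j0}. b j * x j)"
      using insert j0 by (simp add: sum.remove)
    also have "\<dots> = (\<Sum>j\<in>J - {j0}. a j * x j) - (\<Sum>j\<in>J - {j0}. a j * r j) * x j0"
      unfolding b_def by simp
    also have "\<dots> = (\<Sum>j\<in>J - {j0}. a j * y j)" unfolding y_def
      by (simp add: algebra_simps sum_subtractf sum_distrib_left)
    finally have "(\<Sum>j\<in>J. b j * x j) = 0" using a by simp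
    moreover have "b j \<in> F" if "j \<in> J" for j
    proof (cases "j = j0")
      case True
      have "(\<Sum>j\<in>J - {j0}. a j * r j) \<in> F" using a r by (intro subfield_sum[OF F] subfieldD(5)[OF F]) auto
      then show ?thesis unfolding b_def True using subfieldD(7)[OF F] by simp
    qed (use that a in \<open>auto simp: b_def\<close>)
    moreover have "\<exists>j\<in>J. b j \<noteq> 0" using a(2) unfolding b_def by auto
    ultimately show ?thesis by blast
  qed
qed

section \<open>Polynomials in two variables over a subfield\<close>

definition eval2 :: "('a::comm_ring_1 \<Rightarrow> 'b::comm_ring_1) \<Rightarrow> 'b \<Rightarrow> 'b \<Rightarrow> 'a poly poly \<Rightarrow> 'b" where
  "eval2 h x y f = poly (map_poly (\<lambda>c. poly (map_poly h c) x) f) y"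

definition bipoly_over :: "'a::zero set \<Rightarrow> 'a poly poly \<Rightarrow> bool" where
  "bipoly_over k f \<longleftrightarrow> (\<forall>i. poly_over k (coeff f i))"

lemma (in comm_ring_hom) eval1_hom: "comm_ring_hom (\<lambda>c. poly (map_poly hom c) x)"
proof -
  interpret H: map_poly_comm_ring_hom hom ..
  show ?thesis by unfold_locales (auto simp: H.hom_add H.hom_mult)
qed

context comm_ring_hom begin

lemma eval2_hom: "comm_ring_hom (eval2 hom x y)"
proof -
  interpret e: comm_ring_hom "\<lambda>c. poly (map_poly hom c) x" by (rule eval1_hom)
  interpret H: map_poly_comm_ring_hom "\<lambda>c. poly (map_poly hom c) x" ..
  show ?thesis unfolding eval2_def by unfold_locales (auto simp: H.hom_add H.hom_mult)
qed

lemma eval2_const: "eval2 hom x y [:c:] = poly (map_poly hom c) x"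
proof -
  interpret e: comm_ring_hom "\<lambda>c. poly (map_poly hom c) x" by (rule eval1_hom)
  show ?thesis unfolding eval2_def by (simp add: e.map_poly_pCons_hom)
qed

lemma eval2_pCons: "eval2 hom x y (pCons c f) = poly (map_poly hom c) x + y * eval2 hom x y f"
proof -
  interpret e: comm_ring_hom "\<lambda>c. poly (map_poly hom c) x" by (rule eval1_hom)
  show ?thesis unfolding eval2_def by (simp add: e.map_poly_pCons_hom)
qed

lemma eval2_smult: "eval2 hom x y (smult c f) = poly (map_poly hom c) x * eval2 hom x y f"
proof -
  interpret e: comm_ring_hom "\<lambda>c. poly (map_poly hom c) x" by (rule eval1_hom)
  show ?thesis unfolding eval2_def by (simp add: e.map_poly_hom_smult)
qed

lemma eval2_altdef: "eval2 hom x y f = (\<Sum>i\<le>degree f. poly (map_poly hom (coeff f i)) x * y ^ i)"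
proof -
  interpret e: comm_ring_hom "\<lambda>c. poly (map_poly hom c) x" by (rule eval1_hom)
  define P where "P = map_poly (\<lambda>c. poly (map_poly hom c) x) f"
  have "eval2 hom x y f = (\<Sum>i\<le>degree P. coeff P i * y ^ i)" unfolding eval2_def P_def by (rule poly_altdef)
  also have "\<dots> = (\<Sum>i\<le>degree f. coeff P i * y ^ i)"
  proof (rule sum.mono_neutral_left)
    have "degree P \<le> degree f" unfolding P_def by (rule degree_map_poly_le)
    then show "{..degree P} \<subseteq> {..degree f}" by auto
  qed (auto simp: coeff_eq_0)
  finally have "eval2 hom x y f = (\<Sum>i\<le>degree f. coeff P i * y ^ i)" .
  then show ?thesis by (simp add: coeff_map_poly P_def)
qed

end

context
  fixes k :: "'a::field set"
  assumes k: "is_subfield k"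
begin

lemma bipoly_over_add: "bipoly_over k f \<Longrightarrow> bipoly_over k g \<Longrightarrow> bipoly_over k (f + g)"
  unfolding bipoly_over_def by (auto intro: poly_over_add[OF k])
lemma bipoly_over_diff: "bipoly_over k f \<Longrightarrow> bipoly_over k g \<Longrightarrow> bipoly_over k (f - g)"
  unfolding bipoly_over_def by (auto intro: poly_over_diff[OF k])
lemma bipoly_over_mult: "bipoly_over k f \<Longrightarrow> bipoly_over k g \<Longrightarrow> bipoly_over k (f * g)"
  unfolding bipoly_over_def coeff_mult by (auto intro: poly_over_sum[OF k] poly_over_mult[OF k])
lemma bipoly_over_smult: "poly_over k c \<Longrightarrow> bipoly_over k g \<Longrightarrow> bipoly_over k (smult c g)"
  unfolding bipoly_over_def by (auto intro: poly_over_mult[OF k])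
lemma bipoly_over_0: "bipoly_over k 0" unfolding bipoly_over_def by (auto intro: poly_over_0[OF k])
lemma bipoly_over_1: "bipoly_over k 1" unfolding bipoly_over_def
  by (auto simp: coeff_1 intro: poly_over_0[OF k] poly_over_1[OF k])
lemma bipoly_over_monom: "poly_over k c \<Longrightarrow> bipoly_over k (monom c n)" unfolding bipoly_over_def
  by (auto intro: poly_over_0[OF k])
lemma bipoly_over_const: "poly_over k c \<Longrightarrow> bipoly_over k [:c:]" 
  using bipoly_over_monom[of c 0] by (simp add: monom_0)
lemma bipoly_over_sum: "(\<And>i. i \<in> A \<Longrightarrow> bipoly_over k (f i)) \<Longrightarrow> bipoly_over k (sum f A)"
  by (induction A rule: infinite_finite_induct) (auto intro: bipoly_over_0 bipoly_over_add)
lemma bipoly_over_pderiv: "bipoly_over k f \<Longrightarrow> bipoly_over k (pderiv f)"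
  unfolding bipoly_over_def coeff_pderiv
  by (auto intro!: poly_over_smult[OF k] subfield_of_nat[OF k] simp: of_nat_poly simp del: of_nat_Suc)

text \<open>Pseudo-division: the coefficients are polynomials, so each step multiplies
  \<open>f\<close> by the leading coefficient of \<open>g\<close> instead of dividing by it.\<close>

lemma bipoly_over_division:
  assumes g: "bipoly_over k g" "g \<noteq> 0" and f: "bipoly_over k f"
  shows "\<exists>c q r. poly_over k c \<and> c \<noteq> 0 \<and> bipoly_over k q \<and> bipoly_over k r \<and> smult c f = g * q + r \<and> (r = 0 \<or> degree r < degree g)
    \<and> (\<exists>n. c = lead_coeff g ^ n)"
  using f
proof (induction "degree f" arbitrary: f rule: less_induct)
  case less
  show ?case
  proof (cases "f = 0 \<or> degree f < degree g")
    case True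
    then show ?thesis using less.prems bipoly_over_0 poly_over_1[OF k]
      by (intro exI[of _ 1] exI[of _ 0] exI[of _ f]) (auto intro: exI[of _ 0])
  next
    case False
    define l where "l = lead_coeff g"
    have l: "poly_over k l" "l \<noteq> 0" unfolding l_def using g by (auto simp: bipoly_over_def)
    define t where "t = monom (lead_coeff f) (degree f - degree g)"
    define f' where "f' = smult l f - g * t"
    have t: "bipoly_over k t" unfolding t_def using less.prems by (intro bipoly_over_monom) (simp add: bipoly_over_def)
    then have f': "bipoly_over k f'" unfolding f'_def
      by (intro bipoly_over_diff less.prems bipoly_over_mult bipoly_over_smult g l)
    have t0: "t \<noteq> 0" "degree t = degree f - degree g" and tl: "lead_coeff t = lead_coeff f"
      using False g unfolding t_def by (auto simp: degree_monom_eq)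
    have dt: "degree (g * t) = degree f" using t0 False g by (simp add: degree_mult_eq)
    have "lead_coeff (g * t) = l * lead_coeff f" unfolding lead_coeff_mult tl l_def ..
    then have dl: "coeff (g * t) (degree f) = l * lead_coeff f" unfolding dt .
    show ?thesis
    proof (cases "f' = 0")
      case True
      then have "smult l f = g * t + 0" unfolding f'_def by simp
      moreover have "l = lead_coeff g ^ 1" unfolding l_def by simp
      ultimately show ?thesis using t bipoly_over_0 l by blast
    next
      case f0: False
      have "degree f' \<le> degree f" unfolding f'_def by (intro degree_diff_le) (auto simp: dt)
      moreover have "coeff f' (degree f) = 0" unfolding f'_def using dl by simp
      ultimately have "degree f' < degree f" using f0 by (metis le_neq_implies_less leading_coeff_0_iff)
      from less.hyps[OF this f'] obtain c q r n where 1: "poly_over k c" "c \<noteq> 0" "bipoly_over k q" "bipoly_over k r"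
        "smult c f' = g * q + r" "r = 0 \<or> degree r < degree g" "c = lead_coeff g ^ n" by blast
      have "smult (c * l) f = smult c f' + smult c (g * t)" unfolding f'_def by (simp add: smult_diff_right)
      also have "\<dots> = g * (q + smult c t) + r" unfolding 1(5) by (simp add: algebra_simps)
      finally have "smult (c * l) f = g * (q + smult c t) + r" .
      moreover have "c * l = lead_coeff g ^ (Suc n)" unfolding 1 l_def by simp
      moreover have "poly_over k (c * l)" "c * l \<noteq> 0" "bipoly_over k (q + smult c t)"
        using 1 l t by (auto intro: poly_over_mult[OF k] bipoly_over_add bipoly_over_smult)
      ultimately show ?thesis using 1 by blast
    qed
  qed
qed

end

lemma id_hom: "comm_ring_hom (id :: 'a::comm_ring_1 \<Rightarrow> 'a)" by unfold_locales auto

section \<open>The function field as fractions of polynomials in \<open>t\<close> and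
  \<open>u\<close>\<close>

locale function_field =
  fixes k K :: "'a::{alg_closed_field,field_char_0} set" and t u :: 'a
  assumes k: "alg_closed_subfield k" and kK: "k \<subseteq> K" and K: "is_subfield K" and tK: "t \<in> K" and uK: "u \<in> K"
    and t: "\<not> algebraic_over k t" and u: "algebraic_over (field_gen (k \<union> {t})) u"
    and gen: "K = field_gen (k \<union> {t, u})"
begin

lemma ks: "is_subfield k" using k unfolding alg_closed_subfield_def by auto

interpretation ih: comm_ring_hom "id :: 'a \<Rightarrow> 'a" by (rule id_hom)

abbreviation ev where "ev \<equiv> eval2 id t u"

sublocale ev: comm_ring_hom ev by (rule ih.eval2_hom)

lemma t_transcendental: "poly_over k c \<Longrightarrow> poly c t = 0 \<Longrightarrow> c = 0"
  using t unfolding algebraic_over_def by auto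

lemma ev_const: "ev [:c:] = poly c t" using ih.eval2_const[of t u c] by simp
lemma ev_smult: "ev (smult c f) = poly c t * ev f" using ih.eval2_smult[of t u c f] by simp
lemma ev_monom: "ev (monom c n) = poly c t * u ^ n"
  unfolding eval2_def by (simp add: map_poly_monom poly_monom)

lemma field_gen_t: "field_gen (k \<union> {t}) \<subseteq> {poly p t / poly q t | p q. poly_over k p \<and> poly_over k q \<and> q \<noteq> 0}" (is "_ \<subseteq> ?S")
proof -
  have c: "poly_over k [:a:]" if "a \<in> k" for a using that poly_over_pCons_iff[OF ks] poly_over_0[OF ks] by auto
  have "is_subfield ?S" unfolding is_subfield_def
  proof (intro conjI ballI)
    have "0 = poly 0 t / poly 1 t" "1 = poly 1 t / poly 1 t" by auto
    then show "0 \<in> ?S" "1 \<in> ?S" using poly_over_0[OF ks] poly_over_1[OF ks] zero_neq_one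
      by (metis (mono_tags, lifting) mem_Collect_eq)+
    fix x y assume "x \<in> ?S" "y \<in> ?S"
    then obtain p q p' q' where x: "x = poly p t / poly q t" "poly_over k p" "poly_over k q" "q \<noteq> 0"
      and y: "y = poly p' t / poly q' t" "poly_over k p'" "poly_over k q'" "q' \<noteq> 0" by blast
    have nz: "poly q t \<noteq> 0" "poly q' t \<noteq> 0" using x y t_transcendental by auto
    have "x + y = poly (p * q' + p' * q) t / poly (q * q') t" "x - y = poly (p * q' - p' * q) t / poly (q * q') t"
      "x * y = poly (p * p') t / poly (q * q') t" using nz unfolding x y by (auto simp: field_simps)
    moreover have "poly_over k (p * q' + p' * q)" "poly_over k (p * q' - p' * q)" "poly_over k (p * p')" "poly_over k (q * q')"
      using x y by (auto intro: poly_over_add[OF ks] poly_over_diff[OF ks] poly_over_mult[OF ks])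
    moreover have "q * q' \<noteq> 0" using x y by auto
    ultimately show "x + y \<in> ?S" "x - y \<in> ?S" "x * y \<in> ?S" by blast+
  next
    fix x assume "x \<in> ?S"
    then obtain p q where x: "x = poly p t / poly q t" "poly_over k p" "poly_over k q" "q \<noteq> 0" by blast
    show "inverse x \<in> ?S"
    proof (cases "p = 0")
      case True
      then have "inverse x = poly 0 t / poly 1 t" using x by auto
      then show ?thesis using poly_over_0[OF ks] poly_over_1[OF ks] zero_neq_one
        by (metis (mono_tags, lifting) mem_Collect_eq)
    next
      case False
      then have "inverse x = poly q t / poly p t" using x by auto
      then show ?thesis using x False by blast
    qed
  qed
  moreover have "k \<union> {t} \<subseteq> ?S"
  proof -
    have "a \<in> ?S" if "a \<in> k" for a
    proof -
      have "a = poly [:a:] t / poly 1 t" by simp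
      then show ?thesis using c[OF that] poly_over_1[OF ks] zero_neq_one by (metis (mono_tags, lifting) mem_Collect_eq)
    qed
    moreover have "t \<in> ?S"
    proof -
      have "poly_over k [:0,1:]" by (simp add: poly_over_pCons_iff[OF ks] poly_over_0[OF ks] subfieldD[OF ks])
      then show ?thesis using poly_over_1[OF ks]
        by (intro CollectI exI[of _ "[:0,1:]"] exI[of _ "1"]) simp
    qed
    ultimately show ?thesis by auto
  qed
  ultimately show ?thesis unfolding field_gen_def by blast
qed

definition kt where "kt = {poly p t / poly q t | p q. poly_over k p \<and> poly_over k q \<and> q \<noteq> 0}"

lemma clear_denominators:
  assumes "\<And>i. i \<in> I \<Longrightarrow> c i \<in> kt" "finite I"
  obtains b a where "poly_over k b" "b \<noteq> 0" "\<And>i. i \<in> I \<Longrightarrow> poly_over k (a i)" "\<And>i. i \<in> I \<Longrightarrow> poly (a i) t = poly b t * c i"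
proof -
  have "\<forall>i\<in>I. \<exists>p q. poly_over k p \<and> poly_over k q \<and> q \<noteq> 0 \<and> c i = poly p t / poly q t" using assms(1) unfolding kt_def by blast
  then obtain p q where pq: "\<And>i. i \<in> I \<Longrightarrow> poly_over k (p i)" "\<And>i. i \<in> I \<Longrightarrow> poly_over k (q i)" "\<And>i. i \<in> I \<Longrightarrow> q i \<noteq> 0"
    "\<And>i. i \<in> I \<Longrightarrow> c i = poly (p i) t / poly (q i) t" by metis
  define b where "b = (\<Prod>i\<in>I. q i)"
  show ?thesis
  proof (rule that[of b "\<lambda>i. p i * (\<Prod>j\<in>I - {i}. q j)"])
    show "poly_over k b" "b \<noteq> 0" unfolding b_def using pq assms(2) by (auto intro: poly_over_prod[OF ks])
    fix i assume i: "i \<in> I"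
    show "poly_over k (p i * (\<Prod>j\<in>I - {i}. q j))" using i pq by (intro poly_over_mult[OF ks] poly_over_prod[OF ks]) auto
    have "poly (q i) t \<noteq> 0" using t_transcendental pq i by blast
    moreover have "b = q i * (\<Prod>j\<in>I - {i}. q j)" unfolding b_def using i assms(2) by (simp add: prod.remove)
    ultimately show "poly (p i * (\<Prod>j\<in>I - {i}. q j)) t = poly b t * c i" using pq(4)[OF i] by simp
  qed
qed

lemma algebraic_bipoly:
  assumes "finite I" "\<And>i. i \<in> I \<Longrightarrow> c i \<in> kt" "\<exists>i\<in>I. c i \<noteq> 0" "(\<Sum>i\<in>I. c i * x ^ i) = 0"
  obtains H where "bipoly_over k H" "H \<noteq> 0" "eval2 id t x H = 0"
proof -
  obtain b a where ba: "poly_over k b" "b \<noteq> 0" "\<And>i. i \<in> I \<Longrightarrow> poly_over k (a i)" "\<And>i. i \<in> I \<Longrightarrow> poly (a i) t = poly b t * c i"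
    by (rule clear_denominators[OF assms(2,1)]) auto
  define H where "H = (\<Sum>i\<in>I. monom (a i) i)"
  interpret e: comm_ring_hom "eval2 id t x" by (rule ih.eval2_hom)
  have "eval2 id t x (monom (a i) i) = poly (a i) t * x ^ i" for i
    unfolding eval2_def by (simp add: map_poly_monom poly_monom)
  then have "eval2 id t x H = (\<Sum>i\<in>I. poly (a i) t * x ^ i)" unfolding H_def by (simp add: e.hom_sum)
  also have "\<dots> = poly b t * (\<Sum>i\<in>I. c i * x ^ i)" using ba(4) by (simp add: sum_distrib_left mult_ac)
  finally have "eval2 id t x H = 0" using assms by simp
  moreover have "bipoly_over k H" unfolding H_def using ba by (intro bipoly_over_sum[OF ks] bipoly_over_monom[OF ks]) auto
  moreover have "H \<noteq> 0"
  proof -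
    obtain i where i: "i \<in> I" "c i \<noteq> 0" using assms by blast
    have "coeff H i = a i" unfolding H_def using i assms(1) by (simp add: coeff_sum)
    moreover have "poly (a i) t \<noteq> 0" using ba(4)[OF i(1)] i t_transcendental[OF ba(1)] ba(2) by auto
    ultimately show ?thesis by auto
  qed
  ultimately show ?thesis using that by blast
qed

lemma ev_relation: "\<exists>f. bipoly_over k f \<and> f \<noteq> 0 \<and> ev f = 0"
proof -
  obtain p where p: "p \<noteq> 0" "poly_over (field_gen (k \<union> {t})) p" "poly p u = 0" using u unfolding algebraic_over_def by blast
  have "\<exists>i\<in>{..degree p}. coeff p i \<noteq> 0" using p(1) by (intro bexI[of _ "degree p"]) auto
  moreover have "coeff p i \<in> kt" for i using p(2) field_gen_t unfolding kt_def poly_over_def by blast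
  ultimately show ?thesis using p(3)[unfolded poly_altdef] by (metis algebraic_bipoly finite_atMost)
qed

text \<open>An equation of \<open>u\<close> over \<open>k(t)\<close> with cleared denominators and
  least degree in \<open>u\<close>. Minimality of this degree takes the place of
  irreducibility.\<close>

definition G where "G = arg_min degree (\<lambda>f. bipoly_over k f \<and> f \<noteq> 0 \<and> ev f = 0)"

lemma G: "bipoly_over k G" "G \<noteq> 0" "ev G = 0"
  and G_min: "bipoly_over k f \<Longrightarrow> ev f = 0 \<Longrightarrow> degree f < degree G \<Longrightarrow> f = 0"
  using arg_min_natI[of "\<lambda>f. bipoly_over k f \<and> f \<noteq> 0 \<and> ev f = 0" _ degree]
    arg_min_nat_le[of "\<lambda>f. bipoly_over k f \<and> f \<noteq> 0 \<and> ev f = 0" _ degree] ev_relation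
  unfolding G_def by (auto, fastforce)

lemma degG: "degree G > 0"
proof (rule ccontr)
  assume "\<not> ?thesis"
  then obtain c where "G = [:c:]" by (metis degree_eq_zeroE neq0_conv)
  then have "poly_over k c" "poly c t = 0" "c \<noteq> 0" using G ev_const[of c] by (auto simp: bipoly_over_def dest: spec[of _ 0])
  then show False using t_transcendental by blast
qed

text \<open>Pseudo-division by \<open>G\<close> leaves a remainder that still vanishes at
  \<open>(t, u)\<close> and has smaller degree in \<open>u\<close>, hence is zero.\<close>

lemma ev_kernel:
  assumes "bipoly_over k f" "ev f = 0"
  obtains c q where "poly_over k c" "c \<noteq> 0" "bipoly_over k q" "smult c f = G * q"
proof -
  obtain c q r where 1: "poly_over k c" "c \<noteq> 0" "bipoly_over k q" "bipoly_over k r" "smult c f = G * q + r" "r = 0 \<or> degree r < degree G"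
    using bipoly_over_division[OF ks G(1,2) assms(1)] by blast
  have "ev (smult c f) = ev (G * q + r)" unfolding 1 ..
  then have "ev r = 0" using assms(2) G(3) by (simp add: ev_smult ev.hom_add ev.hom_mult)
  then have "r = 0" using G_min 1 by blast
  then show ?thesis using that 1 by auto
qed

text \<open>Elimination of \<open>u\<close>. A combination of \<open>f\<close> and \<open>G\<close>
  of least degree in \<open>u\<close> divides both up to factors from \<open>k[t]\<close>; were its
  degree positive, the cofactor of \<open>G\<close> would vanish at \<open>(t, u)\<close> and have
  smaller degree than \<open>G\<close>. The relation makes \<open>ev f\<close> invertible up to a
  denominator in \<open>k[t]\<close>, and it can be evaluated at every other solution of
  \<open>G\<close> as well.\<close>

lemma ev_inverse:
  assumes f: "bipoly_over k f" "ev f \<noteq> 0"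
  obtains a b c where "bipoly_over k a" "bipoly_over k b" "poly_over k c" "c \<noteq> 0" "a * f + b * G = [:c:]"
proof -
  define J where "J = {a * f + b * G | a b. bipoly_over k a \<and> bipoly_over k b}"
  have J0: "bipoly_over k x" if "x \<in> J" for x using that f G unfolding J_def
    by (auto intro: bipoly_over_add[OF ks] bipoly_over_mult[OF ks])
  have J1: "smult c x - y * q \<in> J" if xy: "x \<in> J" "y \<in> J" "poly_over k c" "bipoly_over k q" for x y c q
  proof -
    obtain a b a' b' where 1: "x = a * f + b * G" "y = a' * f + b' * G" "bipoly_over k a" "bipoly_over k b" "bipoly_over k a'" "bipoly_over k b'"
      using xy unfolding J_def by auto
    have "smult c x - y * q = (smult c a - a' * q) * f + (smult c b - b' * q) * G" unfolding 1 by (simp add: algebra_simps smult_add_right)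
    moreover have "bipoly_over k (smult c a - a' * q)" "bipoly_over k (smult c b - b' * q)"
      using 1 xy by (auto intro!: bipoly_over_diff[OF ks] bipoly_over_smult[OF ks] bipoly_over_mult[OF ks])
    ultimately show ?thesis unfolding J_def by blast
  qed
  have "f = 1 * f + 0 * G" "G = 0 * f + 1 * G" by auto
  then have fJ: "f \<in> J" "G \<in> J" unfolding J_def using bipoly_over_0[OF ks] bipoly_over_1[OF ks] by blast+
  define g where "g = arg_min degree (\<lambda>g. g \<in> J \<and> g \<noteq> 0)"
  have g: "g \<in> J" "g \<noteq> 0" and min: "\<And>h. h \<in> J \<Longrightarrow> degree h < degree g \<Longrightarrow> h = 0"
    using arg_min_natI[of "\<lambda>g. g \<in> J \<and> g \<noteq> 0" G degree] arg_min_nat_le[of "\<lambda>g. g \<in> J \<and> g \<noteq> 0" _ degree] fJ G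
    unfolding g_def by (auto, fastforce)
  have div: "\<exists>c q. poly_over k c \<and> c \<noteq> 0 \<and> bipoly_over k q \<and> smult c x = g * q" if x: "x \<in> J" for x
  proof -
    obtain c q r where 1: "poly_over k c" "c \<noteq> 0" "bipoly_over k q" "bipoly_over k r" "smult c x = g * q + r" "r = 0 \<or> degree r < degree g"
      using bipoly_over_division[OF ks J0[OF g(1)] g(2) J0[OF x]] by blast
    have "r = smult c x - g * q" using 1 by simp
    then have "r \<in> J" using J1[OF x g(1) 1(1,3)] by simp
    then have "r = 0" using min 1 by blast
    then show ?thesis using 1 by auto
  qed
  have evg: "ev g \<noteq> 0"
  proof
    assume "ev g = 0"
    obtain c q where "poly_over k c" "c \<noteq> 0" "smult c f = g * q" using div[OF fJ(1)] by blast
    then have "poly c t * ev f = 0" using \<open>ev g = 0\<close> by (metis ev.hom_mult ev_smult mult_zero_left)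
    then show False using f t_transcendental \<open>poly_over k c\<close> \<open>c \<noteq> 0\<close> by auto
  qed
  have "degree g = 0"
  proof (rule ccontr)
    assume d: "degree g \<noteq> 0"
    obtain c q where 1: "poly_over k c" "c \<noteq> 0" "bipoly_over k q" "smult c G = g * q" using div[OF fJ(2)] by blast
    then have "ev g * ev q = 0" using G by (metis ev.hom_mult ev_smult mult_zero_right)
    then have q0: "ev q = 0" using evg by simp
    have "g * q \<noteq> 0" using 1(2) G(2) unfolding 1(4)[symmetric] by simp
    then have q: "q \<noteq> 0" by auto
    have "degree G = degree (smult c G)" using 1(2) by simp
    also have "\<dots> = degree g + degree q" unfolding 1(4) using g(2) q by (rule degree_mult_eq)
    finally have "degree G = degree g + degree q" .
    then show False using G_min[OF 1(3) q0] d q by simp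
  qed
  then obtain c where c: "g = [:c:]" by (metis degree_eq_zeroE)
  then have "poly_over k c" "c \<noteq> 0" using J0[OF g(1)] g(2) by (auto simp: bipoly_over_def dest: spec[of _ 0])
  then show ?thesis using g(1) c that unfolding J_def by blast
qed

text \<open>Fractions with denominator in \<open>k[t]\<close> already form a field, because
  \<open>ev_inverse\<close> removes \<open>u\<close> from any denominator.\<close>

lemma K_repr:
  assumes "x \<in> K"
  obtains f c where "bipoly_over k f" "poly_over k c" "c \<noteq> 0" "x = ev f / poly c t"
proof -
  define S where "S = {ev f / poly c t | f c. bipoly_over k f \<and> poly_over k c \<and> c \<noteq> 0}"
  have SI: "x \<in> S" if "bipoly_over k f" "poly_over k c" "c \<noteq> 0" "x = ev f / poly c t" for x f c using that unfolding S_def by blast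
  have S1: "ev f \<in> S" if "bipoly_over k f" for f by (rule SI[OF that poly_over_1[OF ks]]) auto
  have "is_subfield S" unfolding is_subfield_def
  proof (intro conjI ballI)
    show "0 \<in> S" "1 \<in> S" using S1[OF bipoly_over_0[OF ks]] S1[OF bipoly_over_1[OF ks]] by auto
    fix x y assume "x \<in> S" "y \<in> S"
    then obtain p q p' q' where x: "x = ev p / poly q t" "bipoly_over k p" "poly_over k q" "q \<noteq> 0"
      and y: "y = ev p' / poly q' t" "bipoly_over k p'" "poly_over k q'" "q' \<noteq> 0" unfolding S_def by blast
    have nz: "poly q t \<noteq> 0" "poly q' t \<noteq> 0" using x y t_transcendental by auto
    have "x + y = ev (smult q' p + smult q p') / poly (q * q') t" "x - y = ev (smult q' p - smult q p') / poly (q * q') t"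
      "x * y = ev (p * p') / poly (q * q') t" using nz unfolding x y
      by (auto simp: field_simps ev.hom_mult ev.hom_add ev.hom_minus ev_smult)
    moreover have "bipoly_over k (smult q' p + smult q p')" "bipoly_over k (smult q' p - smult q p')" "bipoly_over k (p * p')" "poly_over k (q * q')"
      using x y by (auto intro!: poly_over_mult[OF ks] bipoly_over_add[OF ks] bipoly_over_diff[OF ks] bipoly_over_mult[OF ks] bipoly_over_smult[OF ks])
    moreover have "q * q' \<noteq> 0" using x y by auto
    ultimately show "x + y \<in> S" "x - y \<in> S" "x * y \<in> S" unfolding S_def by blast+
  next
    fix x assume "x \<in> S"
    then obtain p q where x: "x = ev p / poly q t" "bipoly_over k p" "poly_over k q" "q \<noteq> 0" unfolding S_def by blast
    show "inverse x \<in> S"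
    proof (cases "ev p = 0")
      case True
      then show ?thesis using S1[OF bipoly_over_0[OF ks]] x by auto
    next
      case False
      obtain a b c where 1: "bipoly_over k a" "bipoly_over k b" "poly_over k c" "c \<noteq> 0" "a * p + b * G = [:c:]"
        by (rule ev_inverse[OF x(2) False])
      have "ev (a * p + b * G) = poly c t" unfolding 1 ev_const ..
      then have 2: "ev a * ev p = poly c t" using G by (simp add: ev.hom_add ev.hom_mult)
      have "inverse x = ev (smult q a) / poly c t" using x False t_transcendental[OF 1(3)] 1(4)
        unfolding 2[symmetric] by (auto simp: ev_smult field_simps)
      then show ?thesis using SI 1 x bipoly_over_smult[OF ks] by blast
    qed
  qed
  moreover have "k \<union> {t, u} \<subseteq> S"
  proof -
    have "a \<in> S" if "a \<in> k" for a
    proof -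
      have p: "poly_over k [:a:]" using that poly_over_pCons_iff[OF ks] poly_over_0[OF ks] by auto
      show ?thesis using S1[OF bipoly_over_const[OF ks p]] by (simp add: ev_const)
    qed
    moreover have "poly_over k [:0,1:]" by (simp add: poly_over_pCons_iff[OF ks] poly_over_0[OF ks] subfieldD[OF ks])
    then have "t \<in> S" using S1[OF bipoly_over_const[OF ks, of "[:0,1:]"]] by (simp add: ev_const)
    moreover have "u \<in> S" using S1[OF bipoly_over_monom[OF ks poly_over_1[OF ks], of 1]] by (simp add: ev_monom)
    ultimately show ?thesis by blast
  qed
  ultimately have "K \<subseteq> S" unfolding gen field_gen_def by blast
  then show ?thesis using assms that unfolding S_def by blast
qed

lemma polyt_in_K: "poly_over k c \<Longrightarrow> poly c t \<in> K"
  using kK tK by (intro poly_over_poly[OF K]) (auto simp: poly_over_def subset_iff)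

lemma ev_in_K: "bipoly_over k f \<Longrightarrow> ev f \<in> K"
  unfolding ih.eval2_altdef using polyt_in_K uK
  by (intro subfield_sum[OF K] subfieldD(5)[OF K] subfield_power[OF K]) (auto simp: bipoly_over_def)

end

section \<open>Places\<close>

lemma is_subfield_field_gen: "is_subfield (field_gen S)"
  unfolding field_gen_def is_subfield_def by auto

lemma field_gen_incl: "S \<subseteq> field_gen S" unfolding field_gen_def by auto

interpretation fc: comm_ring_hom "fls_const :: 'a::field \<Rightarrow> 'a fls"
  by unfold_locales (auto simp: fls_plus_const fls_const_mult_const)

abbreviation evf :: "'a::field poly \<Rightarrow> 'a fls \<Rightarrow> 'a fls" where
  "evf c \<tau> \<equiv> poly (map_poly fls_const c) \<tau>"

lemma evf_hom: "comm_ring_hom (\<lambda>c. evf c \<tau>)" by (rule fc.eval1_hom)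

text \<open>Phrased with lower bounds \<open>m\<close> and \<open>n\<close> in place of exact
  orders, so that callers need no case distinction for zero or higher order.\<close>

lemma fls_nth_mult_lowest:
  fixes f g :: "'a::field fls"
  assumes "\<And>i. i < m \<Longrightarrow> fls_nth f i = 0" "\<And>i. i < n \<Longrightarrow> fls_nth g i = 0"
  shows "fls_nth (f * g) (m + n) = fls_nth f m * fls_nth g n" "\<And>i. i < m + n \<Longrightarrow> fls_nth (f * g) i = 0"
proof -
  have ge: "f \<noteq> 0 \<Longrightarrow> fls_subdegree f \<ge> m" "g \<noteq> 0 \<Longrightarrow> fls_subdegree g \<ge> n"
    using assms by (auto intro: fls_subdegree_geI)
  show "fls_nth (f * g) i = 0" if "i < m + n" for i
  proof (cases "f = 0 \<or> g = 0")
    case False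
    then show ?thesis using ge that by (intro fls_times_nth_eq0) auto
  qed auto
  show "fls_nth (f * g) (m + n) = fls_nth f m * fls_nth g n"
  proof (cases "f = 0 \<or> g = 0 \<or> fls_subdegree f > m \<or> fls_subdegree g > n")
    case True
    then have "fls_nth f m = 0 \<or> fls_nth g n = 0" by (auto intro: fls_eq0_below_subdegree)
    moreover have "fls_nth (f * g) (m + n) = 0"
    proof (cases "f = 0 \<or> g = 0")
      case False
      then show ?thesis using ge True by (intro fls_times_nth_eq0) auto
    qed auto
    ultimately show ?thesis by auto
  next
    case False
    then have "fls_subdegree f = m" "fls_subdegree g = n" using ge by auto
    then show ?thesis by (metis fls_times_base)
  qed
qed

lemma fls_integral_mult:
  fixes f g :: "'a::field fls"
  assumes "fls_subdegree f \<ge> 0" "fls_subdegree g \<ge> 0"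
  shows "fls_subdegree (f * g) \<ge> 0" "fls_nth (f * g) 0 = fls_nth f 0 * fls_nth g 0"
  using assms fls_nth_mult_lowest(1)[of 0 f 0 g] by (auto intro!: fls_mult_subdegree_ge_0)

lemma fls_integral_add:
  fixes f g :: "'a::field fls"
  assumes "fls_subdegree f \<ge> 0" "fls_subdegree g \<ge> 0"
  shows "fls_subdegree (f + g) \<ge> 0"
  using assms by (intro fls_subdegree_ge0I) auto

lemma fls_integral_eval:
  fixes c :: "'a::field poly"
  assumes "fls_subdegree \<tau> \<ge> 0"
  shows "fls_subdegree (evf c \<tau>) \<ge> 0 \<and> fls_nth (evf c \<tau>) 0 = poly c (fls_nth \<tau> 0)"
proof (induction c)
  case (pCons a c)
  then have "fls_subdegree (fls_const a + \<tau> * evf c \<tau>) \<ge> 0" using assms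
    by (intro fls_integral_add fls_integral_mult) auto
  moreover have "fls_nth (fls_const a + \<tau> * evf c \<tau>) 0 = a + fls_nth \<tau> 0 * poly c (fls_nth \<tau> 0)"
    using fls_integral_mult(2)[OF assms, of "evf c \<tau>"] pCons by simp
  ultimately show ?case by (simp add: fc.map_poly_pCons_hom)
qed simp

text \<open>The order of a polynomial at a point of the projective line, with \<open>None\<close> as
  the point at infinity.\<close>

definition point_ord :: "'a::field option \<Rightarrow> 'a poly \<Rightarrow> int" where
  "point_ord P c = (case P of None \<Rightarrow> - int (degree c) | Some a \<Rightarrow> int (order a c))"

text \<open>The local parametrisation \<open>t = a + X^e\<close> at a finite point, \<open>t = X^(-e)\<close> at infinity.\<close>
definition param :: "'a::field option \<Rightarrow> nat \<Rightarrow> 'a fls" where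
  "param P e = (case P of None \<Rightarrow> inverse (fls_X ^ e) | Some a \<Rightarrow> fls_const a + fls_X ^ e)"

lemma fls_X_pow_nth: "fls_nth (fls_X ^ e :: 'a::field fls) n = (if n = int e then 1 else 0)"
  by (simp add: fls_X_power_nth)

lemma param_Some_integral: "e > 0 \<Longrightarrow> fls_subdegree (param (Some a) e) \<ge> 0 \<and> fls_nth (param (Some a) e) 0 = a"
  unfolding param_def by (auto simp: fls_X_pow_nth intro!: fls_integral_add)

text \<open>At infinity the leading term dominates; at a finite point \<open>a\<close> the factor
  \<open>[:-a, 1:] ^ order a c\<close> becomes a power of \<open>X^e\<close> and the cofactor is a
  unit.\<close>

lemma param_ord:
  fixes c :: "'a::field poly"
  assumes e: "e > 0" and c: "c \<noteq> 0"
  shows "evf c (param P e) \<noteq> 0 \<and> fls_subdegree (evf c (param P e)) = int e * point_ord P c"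
proof (cases P)
  case None
  have X: "fls_subdegree (inverse (fls_X ^ e :: 'a fls)) = - int e" by simp
  show ?thesis using c
  proof (induction c)
    case (pCons a c)
    show ?case
    proof (cases "c = 0")
      case True
      then show ?thesis using pCons None by (auto simp: point_ord_def fc.map_poly_pCons_hom)
    next
      case False
      let ?g = "param P e * evf c (param P e)"
      have g: "?g \<noteq> 0" "fls_subdegree ?g = - int e * (1 + int (degree c))"
        using pCons False None X by (auto simp: param_def point_ord_def algebra_simps)
      have neg: "fls_subdegree ?g < 0" unfolding g(2) using e by (simp add: mult_neg_pos)
      have s: "fls_subdegree (fls_const a + ?g) = fls_subdegree ?g"
      proof (rule fls_subdegree_eqI)
        show "fls_nth (fls_const a + ?g) (fls_subdegree ?g) \<noteq> 0" using neg g(1) by simp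
        show "fls_nth (fls_const a + ?g) i = 0" if "i < fls_subdegree ?g" for i using neg that
          by (simp add: fls_eq0_below_subdegree)
      qed
      then have "fls_const a + ?g \<noteq> 0" using neg by (metis fls_zero_subdegree less_irrefl)
      then show ?thesis using s g(2) False None by (simp add: fc.map_poly_pCons_hom point_ord_def algebra_simps)
    qed
  qed simp
next
  case (Some a)
  interpret E: comm_ring_hom "\<lambda>c. evf c (param P e)" by (rule evf_hom)
  obtain q where q: "c = [:-a, 1:] ^ order a c * q" "\<not> [:-a, 1:] dvd q" using order_decomp[OF c] by blast
  have qa: "poly q a \<noteq> 0" using q(2) by (simp add: poly_eq_0_iff_dvd)
  have int: "fls_subdegree (evf q (param P e)) \<ge> 0" "fls_nth (evf q (param P e)) 0 \<noteq> 0"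
    using fls_integral_eval[of "param P e" q] param_Some_integral[OF e, of a] qa unfolding Some by auto
  then have "fls_subdegree (evf q (param P e)) = 0" "evf q (param P e) \<noteq> 0"
    using fls_subdegree_leI[OF int(2)] by auto
  moreover have "evf [:-a, 1:] (param P e) = fls_X ^ e" unfolding param_def Some
    by (simp add: fc.map_poly_pCons_hom fc.hom_uminus)
  then have "evf ([:-a, 1:] ^ order a c * q) (param P e) = (fls_X ^ e) ^ order a c * evf q (param P e)"
    by (simp only: E.hom_mult E.hom_power)
  then have "evf c (param P e) = (fls_X ^ e) ^ order a c * evf q (param P e)" unfolding q(1)[symmetric] .
  ultimately show ?thesis unfolding point_ord_def Some by (simp add: fls_subdegree_pow)
qed

lemma param_deriv:
  assumes "e > 0"
  shows "fls_deriv (param P e :: 'a::field_char_0 fls) \<noteq> 0"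
    "fls_subdegree (fls_deriv (param P e :: 'a fls)) = (case P of None \<Rightarrow> - int e - 1 | Some a \<Rightarrow> int e - 1)"
proof -
  have "fls_deriv z \<noteq> 0 \<and> fls_subdegree (fls_deriv z) = fls_subdegree z - 1" if "fls_subdegree z \<noteq> 0" for z :: "'a fls"
  proof -
    have "fls_deriv z \<noteq> 0"
    proof
      assume "fls_deriv z = 0"
      then have "z = fls_const (fls_nth z 0)" unfolding fls_deriv_eq_0_iff .
      then show False using that by (metis fls_const_subdegree)
    qed
    then show ?thesis using fls_subdegree_deriv[OF that] by simp
  qed
  from this[of "fls_X ^ e"] this[of "inverse (fls_X ^ e)"] show
    "fls_deriv (param P e :: 'a::field_char_0 fls) \<noteq> 0"
    "fls_subdegree (fls_deriv (param P e :: 'a fls)) = (case P of None \<Rightarrow> - int e - 1 | Some a \<Rightarrow> int e - 1)"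
    using assms unfolding param_def by (auto split: option.splits)
qed

lemma ramified_param: "ramified e \<phi> \<Longrightarrow> \<phi> (param P e') = param P (e' * e)"
proof -
  assume r: "ramified e \<phi>"
  interpret h: field_hom \<phi> using r unfolding ramified_def by auto
  show ?thesis using r unfolding ramified_def param_def
    by (auto split: option.splits simp: h.hom_inverse h.hom_add h.hom_power power_mult[symmetric] mult.commute)
qed

lemma ramified_evf: "ramified e \<phi> \<Longrightarrow> \<phi> (evf c \<tau>) = evf c (\<phi> \<tau>)"
proof -
  assume r: "ramified e \<phi>"
  interpret h: field_hom \<phi> using r unfolding ramified_def by auto
  have "\<phi> (evf c \<tau>) = poly (map_poly \<phi> (map_poly fls_const c)) (\<phi> \<tau>)" by simp
  also have "map_poly \<phi> (map_poly fls_const c) = map_poly fls_const c"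
    using r unfolding ramified_def by (intro poly_eqI) (simp add: coeff_map_poly)
  finally show ?thesis .
qed

section \<open>Embeddings of the function field into Laurent series\<close>

context function_field begin

interpretation ih: comm_ring_hom "id :: 'a \<Rightarrow> 'a" by (rule id_hom)

abbreviation "evl \<equiv> eval2 (fls_const :: 'a \<Rightarrow> 'a fls)"

text \<open>A solution \<open>(\<tau>, \<eta>)\<close> of \<open>G\<close> in Laurent series is an
  embedding of \<open>K\<close> sending \<open>t\<close> to \<open>\<tau>\<close> and
  \<open>u\<close> to \<open>\<eta>\<close>. The first condition keeps \<open>\<tau>\<close>
  transcendental over the whole ambient field, the second makes the derivation
  \<open>d/d\<tau>\<close> available.\<close>

definition place :: "'a fls \<Rightarrow> 'a fls \<Rightarrow> bool" where
  "place \<tau> \<eta> \<longleftrightarrow> (\<forall>c. c \<noteq> 0 \<longrightarrow> evf c \<tau> \<noteq> 0) \<and> fls_deriv \<tau> \<noteq> 0 \<and> evl \<tau> \<eta> G = 0"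

text \<open>The choice ranges over all representations of \<open>x\<close> as a fraction;
  \<open>sigma_eq\<close> shows that they give one and the same value.\<close>

definition sigma where
  "sigma \<tau> \<eta> x = (SOME z. \<exists>f c. bipoly_over k f \<and> poly_over k c \<and> c \<noteq> 0 \<and> x = ev f / poly c t \<and> z = evl \<tau> \<eta> f / evf c \<tau>)"

definition dtau :: "'a fls \<Rightarrow> 'a fls \<Rightarrow> 'a fls" where "dtau \<tau> z = fls_deriv z / fls_deriv \<tau>"

lemma dtau_add: "dtau \<tau> (x + y) = dtau \<tau> x + dtau \<tau> y" unfolding dtau_def by (simp add: add_divide_distrib)
lemma dtau_mult: "dtau \<tau> (x * y) = x * dtau \<tau> y + dtau \<tau> x * y" unfolding dtau_def by (simp add: add_divide_distrib)
lemma dtau_const: "dtau \<tau> (fls_const a) = 0" unfolding dtau_def by simp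

context
  fixes \<tau> \<eta> assumes pl: "place \<tau> \<eta>"
begin

interpretation E: comm_ring_hom "evl \<tau> \<eta>" by (rule fc.eval2_hom)

lemma evf_nz: "c \<noteq> 0 \<Longrightarrow> evf c \<tau> \<noteq> 0" using pl unfolding place_def by auto

lemma evlG: "evl \<tau> \<eta> G = 0" using pl unfolding place_def by auto

lemma place_kernel: assumes "bipoly_over k f" "ev f = 0" shows "evl \<tau> \<eta> f = 0"
proof -
  obtain c q where c: "c \<noteq> 0" "smult c f = G * q" using ev_kernel[OF assms] by metis
  have "evf c \<tau> * evl \<tau> \<eta> f = evl \<tau> \<eta> (smult c f)" by (simp add: fc.eval2_smult)
  also have "\<dots> = 0" unfolding c E.hom_mult evlG by simp
  finally show ?thesis using evf_nz[OF c(1)] by simp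
qed

text \<open>The elimination relation for \<open>f\<close> and \<open>G\<close> can be evaluated at
  \<open>(\<tau>, \<eta>)\<close>, and its right-hand side \<open>c(\<tau>)\<close> is
  nonzero.\<close>

lemma place_nonzero: assumes "bipoly_over k f" "ev f \<noteq> 0" shows "evl \<tau> \<eta> f \<noteq> 0"
proof
  assume 0: "evl \<tau> \<eta> f = 0"
  obtain a b c where c: "c \<noteq> 0" "a * f + b * G = [:c:]" using ev_inverse[OF assms] by metis
  have "evf c \<tau> = evl \<tau> \<eta> (a * f + b * G)" unfolding c by (simp add: fc.eval2_const)
  also have "\<dots> = 0" using 0 evlG by (simp add: E.hom_add E.hom_mult)
  finally show False using evf_nz[OF c(1)] by simp
qed

lemma sigma_eq:
  assumes f: "bipoly_over k f" and c: "poly_over k c" "c \<noteq> 0"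
  shows "sigma \<tau> \<eta> (ev f / poly c t) = evl \<tau> \<eta> f / evf c \<tau>"
  unfolding sigma_def
proof (rule some_equality)
  fix z assume "\<exists>f' c'. bipoly_over k f' \<and> poly_over k c' \<and> c' \<noteq> 0 \<and> ev f / poly c t = ev f' / poly c' t \<and> z = evl \<tau> \<eta> f' / evf c' \<tau>"
  then obtain f' c' where 1: "bipoly_over k f'" "poly_over k c'" "c' \<noteq> 0" "ev f / poly c t = ev f' / poly c' t" "z = evl \<tau> \<eta> f' / evf c' \<tau>"
    by blast
  have nz: "poly c t \<noteq> 0" "poly c' t \<noteq> 0" using t_transcendental c 1 by auto
  have "ev (smult c' f - smult c f') = 0" using 1(4) nz by (simp add: ev.hom_minus ev_smult field_simps)
  then have "evl \<tau> \<eta> (smult c' f - smult c f') = 0"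
    using c f 1 by (intro place_kernel bipoly_over_diff[OF ks] bipoly_over_smult[OF ks])
  then show "z = evl \<tau> \<eta> f / evf c \<tau>" using evf_nz[OF c(2)] evf_nz[OF 1(3)]
    unfolding 1(5) by (simp add: E.hom_minus fc.eval2_smult field_simps)
qed (use assms in blast)

lemma sigma_ev: "bipoly_over k f \<Longrightarrow> sigma \<tau> \<eta> (ev f) = evl \<tau> \<eta> f"
  using sigma_eq[of f 1] poly_over_1[OF ks] by simp

lemma sigma_add: assumes "x \<in> K" "y \<in> K" shows "sigma \<tau> \<eta> (x + y) = sigma \<tau> \<eta> x + sigma \<tau> \<eta> y"
  and sigma_mult: "sigma \<tau> \<eta> (x * y) = sigma \<tau> \<eta> x * sigma \<tau> \<eta> y"
proof -
  obtain f c where x: "bipoly_over k f" "poly_over k c" "c \<noteq> 0" "x = ev f / poly c t" by (rule K_repr[OF assms(1)])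
  obtain g d where y: "bipoly_over k g" "poly_over k d" "d \<noteq> 0" "y = ev g / poly d t" by (rule K_repr[OF assms(2)])
  have nz: "poly c t \<noteq> 0" "poly d t \<noteq> 0" "evf c \<tau> \<noteq> 0" "evf d \<tau> \<noteq> 0" using t_transcendental x y evf_nz by auto
  interpret e: comm_ring_hom "\<lambda>c. evf c \<tau>" by (rule evf_hom)
  have cd: "poly_over k (c * d)" "c * d \<noteq> 0" using x y by (auto intro: poly_over_mult[OF ks])
  have "x + y = ev (smult d f + smult c g) / poly (c * d) t" using nz unfolding x y
    by (simp add: field_simps ev.hom_add ev_smult)
  moreover have "bipoly_over k (smult d f + smult c g)" using x y by (intro bipoly_over_add[OF ks] bipoly_over_smult[OF ks])
  ultimately have "sigma \<tau> \<eta> (x + y) = evl \<tau> \<eta> (smult d f + smult c g) / evf (c * d) \<tau>" using sigma_eq cd by metis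
  then show "sigma \<tau> \<eta> (x + y) = sigma \<tau> \<eta> x + sigma \<tau> \<eta> y" using nz unfolding x(4) y(4) sigma_eq[OF x(1-3)] sigma_eq[OF y(1-3)]
    by (simp add: E.hom_add fc.eval2_smult e.hom_mult field_simps)
  have "x * y = ev (f * g) / poly (c * d) t" unfolding x y by (simp add: ev.hom_mult)
  then have "sigma \<tau> \<eta> (x * y) = evl \<tau> \<eta> (f * g) / evf (c * d) \<tau>" using sigma_eq cd bipoly_over_mult[OF ks x(1) y(1)] by metis
  then show "sigma \<tau> \<eta> (x * y) = sigma \<tau> \<eta> x * sigma \<tau> \<eta> y" unfolding x(4) y(4) sigma_eq[OF x(1-3)] sigma_eq[OF y(1-3)]
    by (simp add: E.hom_mult e.hom_mult)
qed

lemma sigma_const: assumes "a \<in> k" shows "sigma \<tau> \<eta> a = fls_const a"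
proof -
  have p: "poly_over k [:a:]" using assms by (simp add: poly_over_pCons_iff[OF ks] poly_over_0[OF ks])
  have "a = ev [:[:a:]:]" by (simp add: ev_const)
  then show ?thesis using sigma_ev[OF bipoly_over_const[OF ks p]] by (simp add: fc.eval2_const fc.map_poly_pCons_hom)
qed

lemma sigma_t: "sigma \<tau> \<eta> t = \<tau>"
proof -
  have p: "poly_over k [:0,1:]" by (simp add: poly_over_pCons_iff[OF ks] poly_over_0[OF ks] subfieldD[OF ks])
  have "t = ev [:[:0,1:]:]" by (simp add: ev_const)
  then show ?thesis using sigma_ev[OF bipoly_over_const[OF ks p]] by (simp add: fc.eval2_const fc.map_poly_pCons_hom)
qed

lemma sigma_u: "sigma \<tau> \<eta> u = \<eta>"
proof -
  have "bipoly_over k (monom 1 1)" by (rule bipoly_over_monom[OF ks poly_over_1[OF ks]])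
  moreover have "ev (monom 1 1) = u" by (simp add: ev_monom)
  moreover have "evl \<tau> \<eta> (monom 1 1) = \<eta>" unfolding eval2_def by (simp add: map_poly_monom poly_monom)
  ultimately show ?thesis using sigma_ev by metis
qed

lemma sigma_0: "sigma \<tau> \<eta> 0 = 0" using sigma_const[OF subfieldD(1)[OF ks]] by simp
lemma sigma_1: "sigma \<tau> \<eta> 1 = 1" using sigma_const[OF subfieldD(2)[OF ks]] by simp

lemma sigma_eq_0: assumes "x \<in> K" shows "sigma \<tau> \<eta> x = 0 \<longleftrightarrow> x = 0"
proof
  assume 0: "sigma \<tau> \<eta> x = 0"
  show "x = 0"
  proof (rule ccontr)
    assume "x \<noteq> 0"
    then have "x * inverse x = 1" by simp
    then show False using sigma_mult[OF assms subfieldD(6)[OF K assms]] 0 sigma_1 by simp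
  qed
qed (simp add: sigma_0)

lemma sigma_uminus: assumes "x \<in> K" shows "sigma \<tau> \<eta> (- x) = - sigma \<tau> \<eta> x"
  using sigma_add[OF assms subfieldD(7)[OF K assms]] sigma_0 by (simp add: eq_neg_iff_add_eq_0 add.commute)

lemma sigma_diff: assumes "x \<in> K" "y \<in> K" shows "sigma \<tau> \<eta> (x - y) = sigma \<tau> \<eta> x - sigma \<tau> \<eta> y"
  using sigma_add[OF assms(1) subfieldD(7)[OF K assms(2)]] sigma_uminus[OF assms(2)] by simp

lemma sigma_inverse: assumes "x \<in> K" shows "sigma \<tau> \<eta> (inverse x) = inverse (sigma \<tau> \<eta> x)"
proof (cases "x = 0")
  case False
  then have "sigma \<tau> \<eta> (inverse x) * sigma \<tau> \<eta> x = 1"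
    using sigma_mult[OF subfieldD(6)[OF K assms] assms] sigma_1 by simp
  then show ?thesis by (metis inverse_unique mult.commute)
qed (simp add: sigma_0)

lemma sigma_sum: "(\<And>i. i \<in> A \<Longrightarrow> f i \<in> K) \<Longrightarrow> sigma \<tau> \<eta> (sum f A) = (\<Sum>i\<in>A. sigma \<tau> \<eta> (f i))"
  by (induction A rule: infinite_finite_induct) (auto simp: sigma_0 sigma_add subfield_sum[OF K])

lemma sigma_power: "x \<in> K \<Longrightarrow> sigma \<tau> \<eta> (x ^ n) = sigma \<tau> \<eta> x ^ n"
  by (induction n) (auto simp: sigma_1 sigma_mult subfield_power[OF K])

lemma sigma_polyt: "poly_over k c \<Longrightarrow> sigma \<tau> \<eta> (poly c t) = evf c \<tau>"
  using sigma_ev[OF bipoly_over_const[OF ks], of c] by (simp add: ev_const fc.eval2_const)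

lemma sigma_eval2:
  assumes "bipoly_over k H" "x \<in> K" shows "sigma \<tau> \<eta> (eval2 id t x H) = evl \<tau> (sigma \<tau> \<eta> x) H"
  unfolding ih.eval2_altdef fc.eval2_altdef using assms
  by (simp add: sigma_sum sigma_mult sigma_power sigma_polyt polyt_in_K bipoly_over_def subfieldD(5)[OF K] subfield_power[OF K])

lemma dtau_tau: "dtau \<tau> \<tau> = 1" unfolding dtau_def using pl unfolding place_def by simp

lemma dtau_evf: "dtau \<tau> (evf c \<tau>) = evf (pderiv c) \<tau>"
proof (induction c)
  case (pCons a c)
  interpret e: comm_ring_hom "\<lambda>c. evf c \<tau>" by (rule evf_hom)
  have "evf (pderiv (pCons a c)) \<tau> = evf c \<tau> + \<tau> * evf (pderiv c) \<tau>"
    by (simp add: pderiv_pCons e.hom_add fc.map_poly_pCons_hom)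
  then show ?case using pCons by (simp add: fc.map_poly_pCons_hom dtau_add dtau_mult dtau_const dtau_tau add.commute)
qed (simp add: dtau_def)

text \<open>The chain rule: \<open>map_poly pderiv f\<close> is the partial derivative in the inner
  variable, \<open>pderiv f\<close> the one in the outer variable.\<close>

lemma dtau_evl: "dtau \<tau> (evl \<tau> \<eta> f) = evl \<tau> \<eta> (map_poly pderiv f) + dtau \<tau> \<eta> * evl \<tau> \<eta> (pderiv f)"
proof (induction f)
  case (pCons c f)
  have "map_poly pderiv (pCons c f) = pCons (pderiv c) (map_poly pderiv f)"
    by (rule poly_eqI) (auto simp: coeff_map_poly coeff_pCons split: nat.splits)
  moreover have "evl \<tau> \<eta> (pderiv (pCons c f)) = evl \<tau> \<eta> f + \<eta> * evl \<tau> \<eta> (pderiv f)"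
    by (simp add: pderiv_pCons E.hom_add fc.eval2_pCons)
  ultimately show ?case using pCons
    by (simp add: fc.eval2_pCons dtau_add dtau_mult dtau_evf algebra_simps)
qed (simp add: dtau_def)

end

end

section \<open>The norm to \<open>k(t)\<close> as a determinant\<close>

lemma det_scaled_rows_cols:
  assumes "A \<in> carrier_mat n n"
  shows "det (mat n n (\<lambda>(i, j). f i * g j * A $$ (i, j))) = (\<Prod>i<n. f i) * (\<Prod>j<n. g j) * det (A :: 'a::comm_ring_1 mat)"
proof -
  have "det (mat n n (\<lambda>(i, j). f i * g j * A $$ (i, j))) =
      (\<Sum>p | p permutes {0..<n}. signof p * (\<Prod>i = 0..<n. f i * g (p i) * A $$ (i, p i)))"
    by (subst det_def'[of _ n]) (auto intro!: sum.cong prod.cong simp: permutes_in_image)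
  also have "\<dots> = (\<Sum>p | p permutes {0..<n}. (\<Prod>i<n. f i) * (\<Prod>j<n. g j) * (signof p * (\<Prod>i = 0..<n. A $$ (i, p i))))"
  proof (rule sum.cong[OF refl])
    fix p assume "p \<in> {p. p permutes {0..<n}}"
    then have "(\<Prod>i = 0..<n. g (p i)) = (\<Prod>j<n. g j)" using prod.permute[of p "{0..<n}" g] by (simp add: o_def lessThan_atLeast0)
    then show "signof p * (\<Prod>i = 0..<n. f i * g (p i) * A $$ (i, p i)) = (\<Prod>i<n. f i) * (\<Prod>j<n. g j) * (signof p * (\<Prod>i = 0..<n. A $$ (i, p i)))"
      by (simp add: prod.distrib mult_ac lessThan_atLeast0)
  qed
  also have "\<dots> = (\<Prod>i<n. f i) * (\<Prod>j<n. g j) * det A"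
    by (subst det_def'[OF assms]) (simp add: sum_distrib_left)
  finally show ?thesis .
qed

text \<open>A kernel vector is the coefficient list of a polynomial of degree below \<open>n\<close>
  with \<open>n\<close> roots.\<close>

lemma vandermonde_det_nonzero:
  fixes xs :: "'a::field list"
  assumes "distinct xs" "length xs = n"
  shows "det (mat n n (\<lambda>(i, j). (xs ! i) ^ j)) \<noteq> 0"
proof
  let ?A = "mat n n (\<lambda>(i, j). (xs ! i) ^ j)"
  assume "det ?A = 0"
  then obtain v where v: "v \<in> carrier_vec n" "v \<noteq> 0\<^sub>v n" "?A *\<^sub>v v = 0\<^sub>v n"
    using det_0_iff_vec_prod_zero_field[of ?A n] by auto
  define p where "p = (\<Sum>j<n. monom (v $ j) j)"
  have cp: "coeff p j = (if j < n then v $ j else 0)" for j unfolding p_def by (simp add: coeff_sum)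
  have "poly p (xs ! i) = 0" if "i < n" for i
  proof -
    have "(?A *\<^sub>v v) $ i = (\<Sum>j<n. (xs ! i) ^ j * v $ j)" using that v(1)
      by (simp add: scalar_prod_def lessThan_atLeast0)
    then have "(\<Sum>j<n. (xs ! i) ^ j * v $ j) = 0" using v(3) that by simp
    then show ?thesis unfolding p_def by (simp add: poly_sum poly_monom mult.commute)
  qed
  then have "set xs \<subseteq> {x. poly p x = 0}" using assms by (auto simp: in_set_conv_nth)
  moreover have "p = 0 \<or> degree p < n"
  proof (cases "n = 0")
    case False
    then have "degree p \<le> n - 1" by (intro degree_le) (auto simp: cp)
    then show ?thesis using False by auto
  qed (simp add: p_def)
  ultimately have "p = 0" using card_poly_roots_bound[of p] card_mono[of "{x. poly p x = 0}" "set xs"] assms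
    by (metis distinct_card leD le_trans poly_roots_finite)
  then have "v $ j = 0" if "j < n" for j using cp[of j] that by simp
  then have "v = 0\<^sub>v n" using v(1) by (intro eq_vecI) auto
  then show False using v(2) by simp
qed

context function_field begin

interpretation ih: comm_ring_hom "id :: 'a \<Rightarrow> 'a" by (rule id_hom)

text \<open>The quotient \<open>n / c\<close> is the norm of \<open>f\<close>. Up to the
  denominators \<open>c j\<close>, column \<open>j\<close> of \<open>M\<close> expresses
  \<open>f * u^j\<close> in the powers of \<open>u\<close> below \<open>degree G\<close>. At all
  solutions of \<open>G\<close> together, these powers become a Vandermonde matrix \<open>V\<close>,
  and \<open>V * M'\<close> is \<open>V\<close> with rows scaled by the values of \<open>f\<close>
  and columns by the \<open>c j\<close>. The norm reduces the product formula on the curve to that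
  on the projective line.\<close>

lemma norm_exists:
  assumes f: "bipoly_over k f"
  shows "\<exists>n c. poly_over k n \<and> poly_over k c \<and> c \<noteq> 0 \<and>
    (\<forall>\<tau> xs. distinct xs \<and> length xs = degree G \<and> (\<forall>\<eta>\<in>set xs. place \<tau> \<eta>) \<longrightarrow>
       evf n \<tau> = evf c \<tau> * (\<Prod>i<degree G. evl \<tau> (xs ! i) f))"
proof -
  define n where "n = degree G"
  have "\<exists>c q r. poly_over k c \<and> c \<noteq> 0 \<and> bipoly_over k r \<and> smult c (f * monom 1 j) = G * q + r \<and> (r = 0 \<or> degree r < n)" for j
    using bipoly_over_division[OF ks G(1,2) bipoly_over_mult[OF ks f bipoly_over_monom[OF ks poly_over_1[OF ks], of j]]]
    unfolding n_def by blast
  then obtain c q r where c: "\<And>j. poly_over k (c j)" "\<And>j. c j \<noteq> 0" "\<And>j. bipoly_over k (r j)"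
    "\<And>j. smult (c j) (f * monom 1 j) = G * q j + r j" "\<And>j. r j = 0 \<or> degree (r j) < n" by metis
  define M where "M = mat n n (\<lambda>(l, j). coeff (r j) l)"
  define C where "C = (\<Prod>j<n. c j)"
  have "poly_over k (det M)" unfolding M_def det_def
    using c(3) by (auto intro!: poly_over_sum[OF ks] poly_over_mult[OF ks] poly_over_prod[OF ks] simp: sign_def bipoly_over_def
      poly_over_1[OF ks] poly_over_uminus[OF ks] permutes_in_image)
  moreover have "poly_over k C" "C \<noteq> 0" unfolding C_def using c by (auto intro: poly_over_prod[OF ks])
  moreover have "evf (det M) \<tau> = evf C \<tau> * (\<Prod>i<n. evl \<tau> (xs ! i) f)"
    if xs: "distinct xs" "length xs = n" "\<forall>\<eta>\<in>set xs. place \<tau> \<eta>" for \<tau> xs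
  proof -
    interpret e: comm_ring_hom "\<lambda>c. evf c \<tau>" by (rule evf_hom)
    define V where "V = mat n n (\<lambda>(i, j). (xs ! i) ^ j)"
    define M' where "M' = map_mat (\<lambda>c. evf c \<tau>) M"
    have VM: "V * M' = mat n n (\<lambda>(i, j). evl \<tau> (xs ! i) f * evf (c j) \<tau> * V $$ (i, j))"
    proof (rule eq_matI)
      fix i j assume "i < dim_row (mat n n (\<lambda>(i, j). evl \<tau> (xs ! i) f * evf (c j) \<tau> * V $$ (i, j)))"
        "j < dim_col (mat n n (\<lambda>(i, j). evl \<tau> (xs ! i) f * evf (c j) \<tau> * V $$ (i, j)))"
      then have ij: "i < n" "j < n" by auto
      interpret E: comm_ring_hom "evl \<tau> (xs ! i)" by (rule fc.eval2_hom)
      have pl: "place \<tau> (xs ! i)" using xs ij by auto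
      have "evl \<tau> (xs ! i) (r j) = (\<Sum>l\<le>degree (r j). evf (coeff (r j) l) \<tau> * (xs ! i) ^ l)" by (rule fc.eval2_altdef)
      also have "\<dots> = (\<Sum>l<n. evf (coeff (r j) l) \<tau> * (xs ! i) ^ l)"
      proof (cases "r j = 0")
        case False
        then have "degree (r j) < n" using c(5)[of j] by auto
        then show ?thesis by (intro sum.mono_neutral_left) (auto simp: coeff_eq_0)
      qed auto
      also have "\<dots> = (V * M') $$ (i, j)" unfolding V_def M'_def M_def using ij
        by (simp add: scalar_prod_def lessThan_atLeast0 mult.commute)
      finally have 1: "(V * M') $$ (i, j) = evl \<tau> (xs ! i) (r j)" ..
      have "evl \<tau> (xs ! i) (smult (c j) (f * monom 1 j)) = evl \<tau> (xs ! i) (r j)"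
        unfolding c(4) using evlG[OF pl] by (simp add: E.hom_add E.hom_mult)
      moreover have "evl \<tau> (xs ! i) (monom 1 j) = (xs ! i) ^ j"
        unfolding eval2_def by (simp add: map_poly_monom poly_monom)
      ultimately show "(V * M') $$ (i, j) = mat n n (\<lambda>(i, j). evl \<tau> (xs ! i) f * evf (c j) \<tau> * V $$ (i, j)) $$ (i, j)"
        unfolding 1 using ij by (simp add: V_def E.hom_mult fc.eval2_smult mult_ac)
    qed (auto simp: V_def M'_def M_def)
    have cV: "V \<in> carrier_mat n n" "M' \<in> carrier_mat n n" unfolding V_def M'_def M_def by auto
    have "det V * det M' = det (V * M')" using det_mult[OF cV] by simp
    also have "\<dots> = (\<Prod>i<n. evl \<tau> (xs ! i) f) * (\<Prod>j<n. evf (c j) \<tau>) * det V"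
      unfolding VM by (rule det_scaled_rows_cols[OF cV(1)])
    finally have "det M' = (\<Prod>i<n. evl \<tau> (xs ! i) f) * (\<Prod>j<n. evf (c j) \<tau>)"
      using vandermonde_det_nonzero[OF xs(1,2)] unfolding V_def by (simp add: mult_ac)
    moreover have "det M' = evf (det M) \<tau>" unfolding M'_def by simp
    moreover have "(\<Prod>j<n. evf (c j) \<tau>) = evf C \<tau>" unfolding C_def by (simp add: e.hom_prod)
    ultimately show ?thesis by (simp add: mult.commute)
  qed
  ultimately show ?thesis unfolding n_def by blast
qed

text \<open>The powers \<open>1, x, ..., x^(degree G)\<close> are more elements than the powers of
  \<open>u\<close> that span \<open>K\<close> over \<open>k(t)\<close>.\<close>

lemma algebraic_K:
  assumes x: "x \<in> K"
  obtains H where "bipoly_over k H" "H \<noteq> 0" "eval2 id t x H = 0"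
proof -
  define F0 where "F0 = field_gen (k \<union> {t})"
  have F0: "is_subfield F0" unfolding F0_def by (rule is_subfield_field_gen)
  have F0kt: "F0 \<subseteq> kt" using field_gen_t unfolding F0_def kt_def .
  have inF: "poly c t \<in> F0" if "poly_over k c" for c
    using that field_gen_incl[of "k \<union> {t}"] unfolding F0_def
    by (intro poly_over_poly[OF is_subfield_field_gen]) (auto simp: poly_over_def)
  have span: "\<exists>c. (\<forall>i\<in>{..<degree G}. c i \<in> F0) \<and> y = (\<Sum>i<degree G. c i * u ^ i)" if y: "y \<in> K" for y
  proof -
    obtain f c where f: "bipoly_over k f" "poly_over k c" "c \<noteq> 0" "y = ev f / poly c t" by (rule K_repr[OF y])
    obtain c' q r where 1: "poly_over k c'" "c' \<noteq> 0" "bipoly_over k r" "smult c' f = G * q + r" "r = 0 \<or> degree r < degree G"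
      using bipoly_over_division[OF ks G(1,2) f(1)] by blast
    have "poly c' t * ev f = ev r" using arg_cong[OF 1(4), of ev] G(3) by (simp add: ev_smult ev.hom_add ev.hom_mult)
    also have "ev r = (\<Sum>i\<le>degree r. poly (coeff r i) t * u ^ i)" by (subst ih.eval2_altdef) simp
    also have "\<dots> = (\<Sum>i<degree G. poly (coeff r i) t * u ^ i)"
    proof (cases "r = 0")
      case False
      then have "degree r < degree G" using 1 by auto
      then show ?thesis by (intro sum.mono_neutral_left) (auto simp: coeff_eq_0)
    qed auto
    finally have "poly c' t * ev f = (\<Sum>i<degree G. poly (coeff r i) t * u ^ i)" .
    moreover have nz: "poly c' t \<noteq> 0" "poly c t \<noteq> 0" using 1 f t_transcendental by auto
    ultimately have "y = (\<Sum>i<degree G. poly (coeff r i) t * u ^ i) / (poly c' t * poly c t)" unfolding f by (simp add: field_simps)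
    also have "\<dots> = (\<Sum>i<degree G. (poly (coeff r i) t / (poly c' t * poly c t)) * u ^ i)" by (simp add: sum_divide_distrib)
    finally have "y = (\<Sum>i<degree G. (poly (coeff r i) t / (poly c' t * poly c t)) * u ^ i)" .
    moreover have "poly (coeff r i) t / (poly c' t * poly c t) \<in> F0" for i
      using inF 1 f by (intro subfieldD(8)[OF F0] subfieldD(5)[OF F0]) (auto simp: bipoly_over_def)
    ultimately show ?thesis by (intro exI[of _ "\<lambda>i. poly (coeff r i) t / (poly c' t * poly c t)"]) auto
  qed
  have "\<exists>a. (\<forall>j\<in>{..degree G}. a j \<in> F0) \<and> (\<exists>j\<in>{..degree G}. a j \<noteq> 0) \<and> (\<Sum>j\<in>{..degree G}. a j * x ^ j) = 0"
    by (rule subfield_dependent[OF F0, of "{..<degree G}" _ _ "\<lambda>i. u ^ i"]) (use span subfield_power[OF K x] in auto)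
  then obtain a where "\<And>j. j \<in> {..degree G} \<Longrightarrow> a j \<in> kt" "\<exists>j\<in>{..degree G}. a j \<noteq> 0" "(\<Sum>j\<in>{..degree G}. a j * x ^ j) = 0"
    using F0kt by blast
  then show ?thesis using algebraic_bipoly[of "{..degree G}" a x] that by blast
qed

text \<open>Roots of \<open>p\<close> can be split off inside \<open>k\<close> one at a time until
  \<open>a\<close> itself appears.\<close>

lemma root_in_k:
  assumes "poly_over k p" "p \<noteq> 0" "poly p a = 0" shows "a \<in> k"
  using assms
proof (induction "degree p" arbitrary: p rule: less_induct)
  case less
  have "degree p > 0" using less.prems by (metis degree_eq_zeroE gr0I poly_const_conv pCons_0_0)
  then obtain b where b: "b \<in> k" "poly p b = 0" using k less.prems unfolding alg_closed_subfield_def by blast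
  then obtain q where q: "p = [:-b, 1:] * q" using poly_eq_0_iff_dvd by blast
  have l: "poly_over k [:-b,1:]" using b by (simp add: poly_over_pCons_iff[OF ks] poly_over_0[OF ks] subfieldD[OF ks])
  have pq: "poly_over k q" by (rule poly_over_dvd_quotient[OF ks l]) (use less.prems(1) in \<open>auto simp: q[symmetric] simp del: mult_pCons_left\<close>)
  have q0: "q \<noteq> 0" using q less.prems by auto
  show ?case
  proof (cases "a = b")
    case False
    then have "poly q a = 0" using less.prems q by simp
    moreover have "degree q < degree p" unfolding q using q0 by (simp add: degree_mult_eq del: mult_pCons_left)
    ultimately show ?thesis using less.hyps pq q0 by blast
  qed (use b in simp)
qed

section \<open>Residues in \<open>k\<close> and the derivation \<open>d/dt\<close>\<close>

lemma param_coeffs_k: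
  assumes "P \<in> insert None (Some ` k)" "e > 0" "poly_over k c"
  shows "fls_nth (evf c (param P e)) n \<in> k"
proof -
  have kmul: "fls_nth (f * g) m \<in> k" if "\<And>m. fls_nth f m \<in> k" "\<And>m. fls_nth g m \<in> k" for f g m
    unfolding fls_times_nth(1) using that by (intro subfield_sum[OF ks] subfieldD(5)[OF ks])
  have tk: "fls_nth (param P e) m \<in> k" for m
  proof (cases P)
    case None
    have "param P e = fls_X_inv ^ e" unfolding param_def None by (simp add: power_inverse[symmetric] fls_inverse_X)
    then show ?thesis using subfieldD[OF ks] by (simp add: fls_X_inv_power_nth)
  next
    case (Some a)
    then show ?thesis using assms subfieldD[OF ks] by (auto simp: param_def fls_X_pow_nth)
  qed
  show ?thesis using assms(3)
  proof (induction c arbitrary: n)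
    case (pCons a c)
    then have "fls_nth (param P e * evf c (param P e)) m \<in> k" for m
      using tk by (intro kmul) (auto simp: poly_over_pCons_iff[OF ks])
    then show ?case using pCons.prems subfieldD[OF ks] by (auto simp: fc.map_poly_pCons_hom poly_over_pCons_iff[OF ks])
  qed (use subfieldD[OF ks] in auto)
qed

text \<open>The series have coefficients in the ambient field, so the constants of the curve must be
  recovered. An equation of \<open>x\<close> over \<open>k[t]\<close> has coefficients that expand
  over \<open>k\<close>; its part of lowest order is a nonzero polynomial over \<open>k\<close> that
  has the residue as a root.\<close>

lemma residue_in_k:
  assumes P: "P \<in> insert None (Some ` k)" "e > 0" and pl: "place (param P e) \<eta>" and x: "x \<in> K"
    and int: "fls_subdegree (sigma (param P e) \<eta> x) \<ge> 0"
  shows "fls_nth (sigma (param P e) \<eta> x) 0 \<in> k"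
proof -
  define z where "z = sigma (param P e) \<eta> x"
  obtain H where H: "bipoly_over k H" "H \<noteq> 0" "eval2 id t x H = 0" by (rule algebraic_K[OF x])
  have "evl (param P e) z H = 0" using sigma_eval2[OF pl H(1) x] H(3) sigma_0[OF pl] unfolding z_def by simp
  then have 0: "(\<Sum>i\<le>degree H. evf (coeff H i) (param P e) * z ^ i) = 0" unfolding fc.eval2_altdef .
  define h where "h i = evf (coeff H i) (param P e)" for i
  define I where "I = {i. i \<le> degree H \<and> coeff H i \<noteq> 0}"
  have fI: "finite I" "I \<noteq> {}" unfolding I_def using H by auto
  \<comment> \<open>The least order among the coefficients: at this order only residues of the
    powers of \<open>z\<close> enter, and at least one coefficient survives.\<close>
  define m where "m = Min ((\<lambda>i. fls_subdegree (h i)) ` I)"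
  have mI: "m \<in> (\<lambda>i. fls_subdegree (h i)) ` I" unfolding m_def using fI by (intro Min_in) auto
  have low: "fls_nth (h i) j = 0" if "i \<le> degree H" "j < m" for i j
  proof (cases "i \<in> I")
    case True
    then have "m \<le> fls_subdegree (h i)" unfolding m_def using fI by (intro Min_le) auto
    then show ?thesis using that by simp
  next
    case False
    then show ?thesis using that unfolding h_def I_def by simp
  qed
  have zp: "fls_subdegree (z ^ i) \<ge> 0 \<and> fls_nth (z ^ i) 0 = fls_nth z 0 ^ i" for i
  proof (induction i)
    case (Suc i)
    then show ?case using int fls_integral_mult[of z "z ^ i"] unfolding z_def[symmetric] by simp
  qed simp
  define p where "p = (\<Sum>i\<le>degree H. monom (fls_nth (h i) m) i)"
  have hk: "fls_nth (h i) j \<in> k" for i j unfolding h_def using param_coeffs_k[OF P] H(1) unfolding bipoly_over_def by blast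
  have pk: "poly_over k p" unfolding p_def by (intro poly_over_sum[OF ks] poly_over_monom[OF ks] hk)
  have "poly p (fls_nth z 0) = (\<Sum>i\<le>degree H. fls_nth (h i) m * fls_nth z 0 ^ i)" unfolding p_def by (simp add: poly_sum poly_monom)
  also have "\<dots> = (\<Sum>i\<le>degree H. fls_nth (h i * z ^ i) m)"
  proof (rule sum.cong[OF refl])
    fix i assume "i \<in> {..degree H}"
    then show "fls_nth (h i) m * fls_nth z 0 ^ i = fls_nth (h i * z ^ i) m"
      using fls_nth_mult_lowest(1)[of m "h i" 0 "z ^ i"] low zp[of i] by simp
  qed
  also have "\<dots> = fls_nth (\<Sum>i\<le>degree H. h i * z ^ i) m" by (simp add: fls_nth_sum)
  also have "\<dots> = 0" using 0 unfolding h_def by simp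
  finally have r: "poly p (fls_nth z 0) = 0" .
  have "p \<noteq> 0"
  proof -
    obtain i where i: "i \<in> I" "m = fls_subdegree (h i)" using mI by blast
    then have "h i \<noteq> 0" using param_ord[OF P(2)] unfolding h_def I_def by auto
    then have "fls_nth (h i) m \<noteq> 0" unfolding i(2) by simp
    moreover have "coeff p i = fls_nth (h i) m" unfolding p_def using i by (simp add: coeff_sum I_def)
    ultimately show ?thesis by auto
  qed
  then show ?thesis using root_in_k[OF pk _ r] unfolding z_def by simp
qed

lemma pderiv_G: "bipoly_over k (pderiv G)" "ev (pderiv G) \<noteq> 0"
proof -
  show 1: "bipoly_over k (pderiv G)" using bipoly_over_pderiv[OF ks G(1)] .
  have "pderiv G \<noteq> 0" using degG by (simp add: pderiv_eq_0_iff)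
  moreover have "degree (pderiv G) < degree G" using degG by (simp add: degree_pderiv)
  ultimately show "ev (pderiv G) \<noteq> 0" using G_min[OF 1] by blast
qed

text \<open>Elements with one derivative valid at all places form a subfield containing
  \<open>k\<close>, \<open>t\<close> and \<open>u\<close>; for \<open>u\<close> it is found by
  differentiating \<open>G(t, u) = 0\<close> implicitly.\<close>

lemma derivative_exists:
  assumes "x \<in> K" shows "\<exists>x'\<in>K. \<forall>\<tau> \<eta>. place \<tau> \<eta> \<longrightarrow> sigma \<tau> \<eta> x' = dtau \<tau> (sigma \<tau> \<eta> x)"
proof -
  define S where "S = {x\<in>K. \<exists>x'\<in>K. \<forall>\<tau> \<eta>. place \<tau> \<eta> \<longrightarrow> sigma \<tau> \<eta> x' = dtau \<tau> (sigma \<tau> \<eta> x)}"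
  have SI: "x \<in> S" if "x \<in> K" "x' \<in> K" "\<And>\<tau> \<eta>. place \<tau> \<eta> \<Longrightarrow> sigma \<tau> \<eta> x' = dtau \<tau> (sigma \<tau> \<eta> x)" for x x'
    using that unfolding S_def by blast
  note Kc = subfieldD(3-8)[OF K]
  have kS: "x \<in> S" if "x \<in> k" for x
    using that kK subfieldD(1)[OF K] by (intro SI[of x 0]) (auto simp: sigma_const sigma_0 dtau_const)
  have "is_subfield S" unfolding is_subfield_def
  proof (intro conjI ballI)
    show "0 \<in> S" "1 \<in> S" using kS subfieldD[OF ks] by auto
    fix x y assume "x \<in> S" "y \<in> S"
    then obtain x' y' where 1: "x \<in> K" "y \<in> K" "x' \<in> K" "y' \<in> K"
      "\<And>\<tau> \<eta>. place \<tau> \<eta> \<Longrightarrow> sigma \<tau> \<eta> x' = dtau \<tau> (sigma \<tau> \<eta> x)"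
      "\<And>\<tau> \<eta>. place \<tau> \<eta> \<Longrightarrow> sigma \<tau> \<eta> y' = dtau \<tau> (sigma \<tau> \<eta> y)" unfolding S_def by blast
    show "x + y \<in> S" by (rule SI[of _ "x' + y'"]) (use 1 in \<open>auto simp: sigma_add dtau_add Kc\<close>)
    show "x - y \<in> S" by (rule SI[of _ "x' - y'"])
      (use 1 in \<open>auto simp: sigma_diff Kc dtau_def diff_divide_distrib\<close>)
    show "x * y \<in> S" by (rule SI[of _ "x * y' + x' * y"])
      (use 1 in \<open>auto simp: sigma_add sigma_mult Kc dtau_mult\<close>)
  next
    fix x assume "x \<in> S"
    then obtain x' where 1: "x \<in> K" "x' \<in> K"
      "\<And>\<tau> \<eta>. place \<tau> \<eta> \<Longrightarrow> sigma \<tau> \<eta> x' = dtau \<tau> (sigma \<tau> \<eta> x)" unfolding S_def by blast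
    show "inverse x \<in> S"
    proof (cases "x = 0")
      case True
      then show ?thesis using kS[of 0] subfieldD(1)[OF ks] by simp
    next
      case False
      show ?thesis
      proof (rule SI[of _ "- (x' * inverse x * inverse x)"])
        fix \<tau> \<eta> assume pl: "place \<tau> \<eta>"
        define z where "z = sigma \<tau> \<eta> x"
        have z: "z \<noteq> 0" using sigma_eq_0[OF pl 1(1)] False unfolding z_def by simp
        have "dtau \<tau> (z * inverse z) = 0" using z by (simp add: dtau_def)
        then have "z * dtau \<tau> (inverse z) + dtau \<tau> z * inverse z = 0" unfolding dtau_mult .
        then have "dtau \<tau> (inverse z) = - (dtau \<tau> z * inverse z * inverse z)" using z by (simp add: field_simps eq_neg_iff_add_eq_0)
        then show "sigma \<tau> \<eta> (- (x' * inverse x * inverse x)) = dtau \<tau> (sigma \<tau> \<eta> (inverse x))"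
          using 1 pl unfolding z_def by (simp add: sigma_uminus sigma_mult sigma_inverse Kc)
      qed (use 1 in \<open>auto simp: Kc\<close>)
    qed
  qed
  moreover have "t \<in> S" by (rule SI[of _ 1]) (auto simp: tK subfieldD(2)[OF K] sigma_1 sigma_t dtau_tau)
  moreover have "u \<in> S"
  proof (rule SI[of _ "- ev (map_poly pderiv G) / ev (pderiv G)"])
    have GT: "bipoly_over k (map_poly pderiv G)" using G(1) unfolding bipoly_over_def
      by (auto simp: coeff_map_poly intro: poly_over_pderiv[OF ks])
    show "- ev (map_poly pderiv G) / ev (pderiv G) \<in> K" by (intro Kc(6) Kc(5) ev_in_K GT pderiv_G)
    fix \<tau> \<eta> assume pl: "place \<tau> \<eta>"
    have "dtau \<tau> (evl \<tau> \<eta> G) = 0" using evlG[OF pl] by (simp add: dtau_def)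
    then have "dtau \<tau> \<eta> * evl \<tau> \<eta> (pderiv G) = - evl \<tau> \<eta> (map_poly pderiv G)"
      unfolding dtau_evl[OF pl] by (simp add: eq_neg_iff_add_eq_0 add.commute)
    then have "dtau \<tau> \<eta> = - evl \<tau> \<eta> (map_poly pderiv G) / evl \<tau> \<eta> (pderiv G)"
      using place_nonzero[OF pl pderiv_G] by (simp add: field_simps)
    then show "sigma \<tau> \<eta> (- ev (map_poly pderiv G) / ev (pderiv G)) = dtau \<tau> (sigma \<tau> \<eta> u)"
      using ev_in_K[OF GT] ev_in_K[OF pderiv_G(1)]
      by (simp add: divide_inverse sigma_mult[OF pl] sigma_uminus[OF pl] sigma_inverse[OF pl] Kc sigma_ev[OF pl] GT pderiv_G sigma_u[OF pl])
  qed (rule uK)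
  moreover note kS
  ultimately have "field_gen (k \<union> {t, u}) \<subseteq> S" unfolding field_gen_def by (intro Inter_lower) auto
  then have "K \<subseteq> S" using gen by simp
  then show ?thesis using assms unfolding S_def by blast
qed

end

text \<open>All that is used of a function field: its normalised places, the product formula, and a
  derivation that lowers the order at almost every place by exactly one.\<close>
locale valued_function_field =
  fixes k K :: "'a::field_char_0 set" and W Wb :: "'w set" and v :: "'w \<Rightarrow> 'a \<Rightarrow> int" and D :: "'a \<Rightarrow> 'a" and c0 :: int
  assumes ks: "is_subfield k" and Ks: "is_subfield K" and kK: "k \<subseteq> K" and Wb: "finite Wb" "Wb \<subseteq> W" and c0: "c0 \<ge> 0"
    and v_mult: "\<And>w x y. w \<in> W \<Longrightarrow> x \<in> K \<Longrightarrow> y \<in> K \<Longrightarrow> x \<noteq> 0 \<Longrightarrow> y \<noteq> 0 \<Longrightarrow> v w (x * y) = v w x + v w y"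
    and v_add: "\<And>w x y. w \<in> W \<Longrightarrow> x \<in> K \<Longrightarrow> y \<in> K \<Longrightarrow> x \<noteq> 0 \<Longrightarrow> y \<noteq> 0 \<Longrightarrow> x + y \<noteq> 0 \<Longrightarrow> v w (x + y) \<ge> min (v w x) (v w y)"
    and v_finite: "\<And>x. x \<in> K \<Longrightarrow> x \<noteq> 0 \<Longrightarrow> finite {w\<in>W. v w x \<noteq> 0}"
    and product_formula: "\<And>x. x \<in> K \<Longrightarrow> x \<noteq> 0 \<Longrightarrow> (\<Sum>w | w \<in> W \<and> v w x \<noteq> 0. v w x) = 0"
    and v_k: "\<And>w x. w \<in> W \<Longrightarrow> x \<in> k \<Longrightarrow> x \<noteq> 0 \<Longrightarrow> v w x = 0"
    and integral_const: "\<And>x. x \<in> K \<Longrightarrow> x \<noteq> 0 \<Longrightarrow> (\<And>w. w \<in> W \<Longrightarrow> v w x \<ge> 0) \<Longrightarrow> x \<in> k"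
    and D_K: "\<And>x. x \<in> K \<Longrightarrow> D x \<in> K"
    and D_add: "\<And>x y. x \<in> K \<Longrightarrow> y \<in> K \<Longrightarrow> D (x + y) = D x + D y"
    and D_mult: "\<And>x y. x \<in> K \<Longrightarrow> y \<in> K \<Longrightarrow> D (x * y) = x * D y + D x * y"
    and D_zero: "\<And>x. x \<in> K \<Longrightarrow> D x = 0 \<Longrightarrow> x \<in> k"
    and D_const: "\<And>x. x \<in> k \<Longrightarrow> D x = 0"
    and v_D: "\<And>w x. w \<in> W \<Longrightarrow> x \<in> K \<Longrightarrow> D x \<noteq> 0 \<Longrightarrow> v w (D x) \<ge> v w x - c0"
    and v_D_integral: "\<And>w x. w \<in> W - Wb \<Longrightarrow> x \<in> K \<Longrightarrow> D x \<noteq> 0 \<Longrightarrow> v w x \<ge> 0 \<Longrightarrow> v w (D x) \<ge> 0"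
    and v_D_simple: "\<And>w x. w \<in> W - Wb \<Longrightarrow> x \<in> K \<Longrightarrow> x \<noteq> 0 \<Longrightarrow> v w x > 0 \<Longrightarrow> D x \<noteq> 0 \<and> v w (D x) = v w x - 1"

section \<open>Solutions over each point of the line and the assembly of the places\<close>

lemma order_prod_linear: "order a (\<Prod>x\<in>#A. [:-x, 1:] :: 'a::field poly) = count A a"
proof (induction A)
  case (add x A)
  have "(\<Prod>x\<in>#add_mset x A. [:-x, 1:]) \<noteq> (0 :: 'a poly)" unfolding prod_mset_zero_iff by auto
  then have "order a (\<Prod>x\<in>#add_mset x A. [:-x, 1:]) = order a [:-x,1:] + count A a"
    using add by (simp add: order_mult del: mult_pCons_left)
  moreover have "order a [:-x,1:] = (if x = a then 1 else 0)"
  proof (cases "x = a")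
    case True
    then show ?thesis using order_power_n_n[of a 1] by simp
  qed (auto intro: order_0I)
  ultimately show ?case by auto
qed (simp add: order_0I)

lemma sum_order_eq_degree:
  fixes q :: "'a::alg_closed_field poly"
  assumes "q \<noteq> 0" "finite S" "{a. poly q a = 0} \<subseteq> S"
  shows "(\<Sum>a\<in>S. order a q) = degree q"
proof -
  obtain A where A: "size A = degree q" "q = smult (lead_coeff q) (\<Prod>x\<in>#A. [:-x, 1:])"
    using alg_closed_imp_factorization[OF assms(1)] by blast
  have o: "order a q = count A a" for a
    by (subst A(2)) (use assms(1) in \<open>simp add: order_smult order_prod_linear\<close>)
  have "set_mset A \<subseteq> S"
  proof
    fix a assume "a \<in># A"
    then have "order a q \<noteq> 0" unfolding o by simp
    then show "a \<in> S" using assms(1,3) order_root[of q a] by auto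
  qed
  then have "(\<Sum>a\<in>S. count A a) = size A" using assms(2)
    unfolding size_multiset_overloaded_eq by (intro sum.mono_neutral_right) (auto simp: not_in_iff)
  then show ?thesis using o A(1) by simp
qed

context function_field begin

interpretation ih: comm_ring_hom "id :: 'a \<Rightarrow> 'a" by (rule id_hom)

text \<open>At a double root the place would kill \<open>ev (pderiv G)\<close>, which is nonzero,
  while \<open>place_nonzero\<close> keeps nonzero elements nonzero.\<close>

lemma roots_are_places:
  assumes nz: "\<And>c. c \<noteq> 0 \<Longrightarrow> evf c \<tau> \<noteq> 0" and d: "fls_deriv \<tau> \<noteq> 0"
    and sp: "map_poly (\<lambda>c. evf c \<tau>) G = smult a (\<Prod>x\<leftarrow>xs. [:-x, 1:])"
  shows "distinct xs \<and> length xs = degree G \<and> (\<forall>\<eta>\<in>set xs. place \<tau> \<eta>)"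
proof -
  interpret e: comm_ring_hom "\<lambda>c. evf c \<tau>" by (rule evf_hom)
  interpret e: idom_hom "\<lambda>c. evf c \<tau>" ..
  have cG: "coeff (map_poly (\<lambda>c. evf c \<tau>) G) (degree G) \<noteq> 0" using nz[of "lead_coeff G"] G(2) by simp
  have dG: "degree (map_poly (\<lambda>c. evf c \<tau>) G) = degree G" using cG degree_map_poly_le[of _ G] by (metis le_antisym le_degree)
  have a: "a \<noteq> 0" using cG unfolding sp by auto
  have "degree (smult a (\<Prod>x\<leftarrow>xs. [:-x, 1:])) = length xs" using a degree_linear_factors[of uminus xs] by simp
  then have len: "length xs = degree G" using dG unfolding sp by simp
  have pl: "place \<tau> \<eta>" if "\<eta> \<in> set xs" for \<eta>
  proof -
    have "poly (\<Prod>x\<leftarrow>xs. [:-x, 1:]) \<eta> = 0" using that by (auto simp: poly_prod_list prod_list_zero_iff)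
    then show ?thesis unfolding place_def eval2_def sp using nz d by simp
  qed
  have "distinct xs"
  proof (rule ccontr)
    assume "\<not> distinct xs"
    then obtain as bs cs y where xs: "xs = as @ [y] @ bs @ [y] @ cs" using not_distinct_decomp by blast
    define q where "q = smult a (prod_list (map (\<lambda>x. [:-x,1:]) as) * prod_list (map (\<lambda>x. [:-x,1:]) bs) * prod_list (map (\<lambda>x. [:-x,1:]) cs))"
    have "map_poly (\<lambda>c. evf c \<tau>) G = [:-y,1:] * ([:-y,1:] * q)" unfolding sp xs q_def by (simp add: mult_ac del: mult_pCons_left mult_pCons_right)
    then have "poly (pderiv (map_poly (\<lambda>c. evf c \<tau>) G)) y = 0" by (simp add: pderiv_mult del: mult_pCons_left)
    then have "evl \<tau> y (pderiv G) = 0" unfolding eval2_def e.map_poly_pderiv .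
    moreover have "place \<tau> y" using pl xs by auto
    ultimately show False using place_nonzero pderiv_G by blast
  qed
  then show ?thesis using len pl by blast
qed

definition splits_at where
  "splits_at P e \<longleftrightarrow> e > 0 \<and> (\<exists>xs. distinct xs \<and> length xs = degree G \<and> (\<forall>\<eta>\<in>set xs. place (param P e) \<eta>))"

lemma splits_at_exists: "\<exists>e. splits_at P e"
proof -
  define \<tau> where "\<tau> = (param P 1 :: 'a fls)"
  define p where "p = map_poly (\<lambda>c. evf c \<tau>) G"
  interpret e: comm_ring_hom "\<lambda>c. evf c \<tau>" by (rule evf_hom)
  have nz: "evf c \<tau> \<noteq> 0" if "c \<noteq> 0" for c unfolding \<tau>_def using param_ord[of 1 c P] that by simp
  have "coeff p (degree G) \<noteq> 0" using nz[of "lead_coeff G"] G(2) unfolding p_def by simp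
  then have l: "lead_coeff p \<noteq> 0" by auto
  have "lead_coeff (smult (inverse (lead_coeff p)) p) = 1" using l by simp
  from puiseux_splits[OF this] obtain e \<phi> xs where r: "ramified e \<phi>"
    and xs: "map_poly \<phi> (smult (inverse (lead_coeff p)) p) = (\<Prod>x\<leftarrow>xs. [:-x, 1:])" by blast
  interpret h: field_hom \<phi> using r unfolding ramified_def by auto
  have e: "e > 0" using r unfolding ramified_def by auto
  have "p = smult (lead_coeff p) (smult (inverse (lead_coeff p)) p)" using l by simp
  then have "map_poly \<phi> p = smult (\<phi> (lead_coeff p)) (map_poly \<phi> (smult (inverse (lead_coeff p)) p))"
    by (metis h.map_poly_hom_smult)
  moreover have "map_poly \<phi> p = map_poly (\<lambda>c. evf c (param P e)) G"
    unfolding p_def \<tau>_def using ramified_evf[OF r] ramified_param[OF r, of P 1]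
    by (intro poly_eqI) (simp add: coeff_map_poly)
  ultimately have "map_poly (\<lambda>c. evf c (param P e)) G = smult (\<phi> (lead_coeff p)) (\<Prod>x\<leftarrow>xs. [:-x, 1:])" using xs by simp
  then have "distinct xs \<and> length xs = degree G \<and> (\<forall>\<eta>\<in>set xs. place (param P e) \<eta>)"
    using param_ord[OF e] param_deriv[OF e] by (intro roots_are_places) auto
  then show ?thesis unfolding splits_at_def using e by blast
qed

text \<open>Allows one common ramification index for all exceptional points.\<close>

lemma splits_at_mult: assumes "splits_at P e" "m > 0" shows "splits_at P (e * m)"
proof -
  obtain xs where e: "e > 0" and xs: "distinct xs" "length xs = degree G" "\<forall>\<eta>\<in>set xs. place (param P e) \<eta>"
    using assms unfolding splits_at_def by blast
  obtain \<phi> :: "'a fls \<Rightarrow> 'a fls" where r: "ramified m \<phi>" using ramified_exists[OF assms(2)] by (metis (no_types))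
  interpret h: field_hom \<phi> using r unfolding ramified_def by auto
  have em: "e * m > 0" using e assms by simp
  have "evl (param P (e * m)) (\<phi> \<eta>) G = 0" if "\<eta> \<in> set xs" for \<eta>
  proof -
    have "\<phi> (evl (param P e) \<eta> G) = evl (param P (e * m)) (\<phi> \<eta>) G"
      unfolding fc.eval2_altdef by (simp add: h.hom_sum h.hom_mult h.hom_power ramified_evf[OF r] ramified_param[OF r])
    then show ?thesis using xs that evlG by simp
  qed
  then have "\<forall>\<eta>\<in>set (map \<phi> xs). place (param P (e * m)) \<eta>"
    unfolding place_def using param_ord[OF em] param_deriv[OF em] by auto
  moreover have "distinct (map \<phi> xs)" using xs(1) by (auto simp: distinct_map inj_on_def)
  moreover have "length (map \<phi> xs) = degree G" using xs by simp
  ultimately show ?thesis unfolding splits_at_def using em by blast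
qed

text \<open>\<open>c1\<close> plays the part of a discriminant: it lies in the ideal of
  \<open>G\<close> and \<open>pderiv G\<close>. Off its zeros and those of the leading coefficient,
  the reduction of \<open>G\<close> at \<open>a\<close> keeps its degree and has simple roots, so
  Hensel's lemma expands all of them without ramification.\<close>

lemma splits_at_unramified:
  "\<exists>bad. finite bad \<and> (\<forall>a. a \<notin> bad \<longrightarrow> (\<exists>xs. distinct xs \<and> length xs = degree G \<and>
     (\<forall>\<eta>\<in>set xs. place (param (Some a) 1) \<eta> \<and> fls_subdegree \<eta> \<ge> 0)))"
proof -
  obtain a' b c1 where 1: "bipoly_over k a'" "bipoly_over k b" "poly_over k c1" "c1 \<noteq> 0" "a' * pderiv G + b * G = [:c1:]"
    by (rule ev_inverse[OF pderiv_G])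
  define l where "l = lead_coeff G"
  have l0: "l \<noteq> 0" unfolding l_def using G by simp
  define bad where "bad = {a. poly (l * c1) a = 0}"
  have "finite bad" unfolding bad_def using l0 1 by (intro poly_roots_finite) auto
  moreover have "\<exists>xs. distinct xs \<and> length xs = degree G \<and> (\<forall>\<eta>\<in>set xs. place (param (Some a) 1) \<eta> \<and> fls_subdegree \<eta> \<ge> 0)"
    if "a \<notin> bad" for a
  proof -
    define \<tau> where "\<tau> = (param (Some a) 1 :: 'a fls)"
    have la: "poly l a \<noteq> 0" "poly c1 a \<noteq> 0" using that unfolding bad_def by auto
    have \<tau>: "fls_subdegree \<tau> \<ge> 0" "fls_nth \<tau> 0 = a" using param_Some_integral[of 1 a] unfolding \<tau>_def by auto
    have ei: "fls_subdegree (evf c \<tau>) \<ge> 0" "fls_nth (evf c \<tau>) 0 = poly c a" for c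
      using fls_integral_eval[OF \<tau>(1), of c] \<tau>(2) by auto
    define p0 where "p0 = map_poly (\<lambda>c. evf c \<tau>) G"
    interpret e: comm_ring_hom "\<lambda>c. evf c \<tau>" by (rule evf_hom)
    have nz: "evf c \<tau> \<noteq> 0" if "c \<noteq> 0" for c unfolding \<tau>_def using param_ord[of 1 c "Some a"] that by simp
    have "coeff p0 (degree G) = evf l \<tau>" unfolding p0_def l_def by simp
    moreover have "degree p0 \<le> degree G" unfolding p0_def by (rule degree_map_poly_le)
    ultimately have lp0: "lead_coeff p0 = evf l \<tau>" using nz[OF l0] by (metis le_antisym le_degree)
    define p where "p = smult (inverse (evf l \<tau>)) p0"
    have sl: "fls_subdegree (evf l \<tau>) = 0" using ei[of l] la fls_subdegree_leI[of "evf l \<tau>" 0] by auto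
    have "lead_coeff p = 1" unfolding p_def using lp0 nz[OF l0] by simp
    moreover have inv: "fls_subdegree (inverse (evf l \<tau>)) \<ge> 0" using sl by simp
    moreover have inv0: "fls_nth (inverse (evf l \<tau>)) 0 = inverse (poly l a)"
    proof -
      have "fls_nth (inverse (evf l \<tau>) * evf l \<tau>) 0 = fls_nth (inverse (evf l \<tau>)) 0 * poly l a"
        using fls_integral_mult(2)[OF inv ei(1)] ei(2) by simp
      moreover have "inverse (evf l \<tau>) * evf l \<tau> = 1" using nz[OF l0] by simp
      ultimately show ?thesis using la by (simp add: field_simps)
    qed
    moreover have ip: "fls_subdegree (coeff p i) \<ge> 0" for i unfolding p_def p0_def
      using fls_integral_mult(1)[OF inv ei(1)] by (simp add: coeff_map_poly)
    moreover have "rsquarefree (map_poly (\<lambda>c. fls_nth c 0) p)"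
    proof -
      define g where "g = map_poly (\<lambda>c. poly c a) G"
      have "map_poly (\<lambda>c. fls_nth c 0) p = smult (inverse (poly l a)) g" unfolding p_def p0_def g_def
        using fls_integral_mult(2)[OF inv ei(1)] ei(2) inv0 by (intro poly_eqI) (simp add: coeff_map_poly)
      moreover have "\<not> (poly g y = 0 \<and> poly (pderiv g) y = 0)" for y
      proof -
        interpret Pa: map_poly_comm_ring_hom "\<lambda>c. poly c a" ..
        have "poly (map_poly (\<lambda>c. poly c a) (a' * pderiv G + b * G)) y = poly c1 a"
        proof -
          have "map_poly (\<lambda>c. poly c a) [:c1:] = [:poly c1 a:]"
            by (rule poly_eqI) (simp add: coeff_map_poly coeff_pCons split: nat.split)
          then show ?thesis unfolding 1(5) by simp
        qed
        then have "poly (map_poly (\<lambda>c. poly c a) a') y * poly (pderiv g) y + poly (map_poly (\<lambda>c. poly c a) b) y * poly g y = poly c1 a"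
          unfolding g_def by (simp add: Pa.hom_add Pa.hom_mult poly_hom.map_poly_pderiv)
        then show ?thesis using la by auto
      qed
      ultimately show ?thesis unfolding rsquarefree_roots using la by (simp add: pderiv_smult)
    qed
    ultimately obtain xs where xs: "p = (\<Prod>x\<leftarrow>xs. [:-x, 1:])" "\<forall>x\<in>set xs. fls_subdegree x \<ge> 0"
      using hensel_splits_simple by blast
    have "p0 = smult (evf l \<tau>) p" unfolding p_def using nz[OF l0] by simp
    then have "map_poly (\<lambda>c. evf c \<tau>) G = smult (evf l \<tau>) (\<Prod>x\<leftarrow>xs. [:-x, 1:])" using xs unfolding p0_def by simp
    then have "distinct xs \<and> length xs = degree G \<and> (\<forall>\<eta>\<in>set xs. place \<tau> \<eta>)"
      using nz param_deriv(1)[of 1 "Some a"] unfolding \<tau>_def by (intro roots_are_places) auto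
    then show ?thesis using xs unfolding \<tau>_def by blast
  qed
  ultimately show ?thesis by blast
qed

lemma evl_integral:
  assumes "fls_subdegree \<tau> \<ge> 0" "fls_subdegree \<eta> \<ge> 0"
  shows "fls_subdegree (evl \<tau> \<eta> f) \<ge> 0"
proof (induction f)
  case (pCons c f)
  then show ?case unfolding fc.eval2_pCons
    using fls_integral_eval[OF assms(1), of c] fls_integral_mult(1)[OF assms(2)] by (intro fls_integral_add) auto
qed (simp add: eval2_def)

lemma fls_deriv_subdegree_ge: "fls_deriv z \<noteq> 0 \<Longrightarrow> fls_subdegree (fls_deriv z) \<ge> fls_subdegree (z :: 'a fls) - 1"
  using fls_subdegree_deriv[of z] fls_deriv_subdegree0[of z] by (cases "fls_subdegree z = 0") auto

text \<open>Every solution of \<open>G\<close> over every point of the line counts as a place, so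
  conjugate expansions appear repeatedly. Exceptional points, which form \<open>Wb\<close>, get the
  common index \<open>e0\<close>; elsewhere the index is 1, as the exact drop of the order under
  \<open>D\<close> demands. The third component of a place repeats those of index 1 exactly
  \<open>e0\<close> times, which restores equal weights in the product formula.\<close>

theorem valued_function_field_exists:
  "\<exists>(W :: ('a option \<times> nat \<times> nat) set) Wb v D c0. valued_function_field k K W Wb v D c0"
proof -
  obtain bad where bad: "finite bad" "\<And>a. a \<notin> bad \<Longrightarrow> \<exists>xs. distinct xs \<and> length xs = degree G \<and>
     (\<forall>\<eta>\<in>set xs. place (param (Some a) 1) \<eta> \<and> fls_subdegree \<eta> \<ge> 0)" using splits_at_unramified by metis
  define PP where "PP = insert None (Some ` k)"
  define BP where "BP = insert None (Some ` (bad \<inter> k))"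
  have fBP: "finite BP" and BPP: "BP \<subseteq> PP" unfolding BP_def PP_def using bad by auto
  obtain e where e: "\<And>P. splits_at P (e P)" using splits_at_exists by metis
  define e0 where "e0 = (\<Prod>P\<in>BP. e P)"
  have epos: "e P > 0" for P using e[of P] unfolding splits_at_def by auto
  have e0: "e0 > 0" unfolding e0_def using epos by (simp add: prod_pos)
  have se0: "splits_at P e0" if "P \<in> BP" for P
  proof -
    have "e0 = e P * (\<Prod>Q\<in>BP - {P}. e Q)" unfolding e0_def by (rule prod.remove[OF fBP that])
    moreover have "(\<Prod>Q\<in>BP - {P}. e Q) > 0" using epos by (simp add: prod_pos)
    ultimately show ?thesis using splits_at_mult[OF e[of P]] by metis
  qed
  define eP where "eP P = (if P \<in> BP then e0 else 1)" for P :: "'a option"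
  define cP where "cP P = (if P \<in> BP then 1 else e0)" for P :: "'a option"
  \<comment> \<open>Ramification index times multiplicity is \<open>e0\<close> at every point; this
    is the equal weight just mentioned.\<close>
  have ec: "eP P * cP P = e0" "eP P > 0" for P unfolding eP_def cP_def using e0 by auto
  define n where "n = degree G"
  have "\<exists>xs. distinct xs \<and> length xs = n \<and> (\<forall>\<eta>\<in>set xs. place (param P (eP P)) \<eta> \<and> (P \<notin> BP \<longrightarrow> fls_subdegree \<eta> \<ge> 0))"
    if P: "P \<in> PP" for P
  proof (cases "P \<in> BP")
    case True
    then show ?thesis using se0[OF True] unfolding splits_at_def eP_def n_def by auto
  next
    case False
    then obtain a where "P = Some a" "a \<notin> bad" using P unfolding PP_def BP_def by auto
    then show ?thesis using bad(2)[of a] False unfolding eP_def n_def by auto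
  qed
  then obtain xs where xs: "\<And>P. P \<in> PP \<Longrightarrow> distinct (xs P)" "\<And>P. P \<in> PP \<Longrightarrow> length (xs P) = n"
    "\<And>P \<eta>. P \<in> PP \<Longrightarrow> \<eta> \<in> set (xs P) \<Longrightarrow> place (param P (eP P)) \<eta>"
    "\<And>P \<eta>. P \<in> PP \<Longrightarrow> \<eta> \<in> set (xs P) \<Longrightarrow> P \<notin> BP \<Longrightarrow> fls_subdegree \<eta> \<ge> 0" by metis
  define sg where "sg P i = sigma (param P (eP P)) (xs P ! i)" for P i
  have pl: "place (param P (eP P)) (xs P ! i)" if "P \<in> PP" "i < n" for P i using xs that by auto
  define W where "W = (SIGMA P:PP. {..<n} \<times> {..<cP P})"
  define Wb where "Wb = (SIGMA P:BP. {..<n} \<times> {..<cP P})"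
  define v where "v = (\<lambda>(P, i, j::nat) x. fls_subdegree (sg P i x))"
  have WD: "\<exists>P i j. w = (P, i, j) \<and> P \<in> PP \<and> i < n \<and> place (param P (eP P)) (xs P ! i) \<and> v w = (\<lambda>x. fls_subdegree (sg P i x))"
    if "w \<in> W" for w using that pl unfolding W_def v_def by auto
  define D where "D x = (SOME x'. x' \<in> K \<and> (\<forall>\<tau> \<eta>. place \<tau> \<eta> \<longrightarrow> sigma \<tau> \<eta> x' = dtau \<tau> (sigma \<tau> \<eta> x)))" for x
  have D: "D x \<in> K \<and> (\<forall>\<tau> \<eta>. place \<tau> \<eta> \<longrightarrow> sigma \<tau> \<eta> (D x) = dtau \<tau> (sigma \<tau> \<eta> x))" if "x \<in> K" for x
    unfolding D_def by (rule someI_ex) (use derivative_exists[OF that] in blast)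
  have nNone: "None \<in> PP" unfolding PP_def by auto
  have npos: "n > 0" unfolding n_def by (rule degG)
  define \<tau>0 \<eta>0 where "\<tau>0 = (param None (eP None) :: 'a fls)" and "\<eta>0 = xs None ! 0"
  have pl0: "place \<tau>0 \<eta>0" unfolding \<tau>0_def \<eta>0_def using pl[OF nNone npos] .
  have inj: "x = y" if "x \<in> K" "y \<in> K" "sigma \<tau>0 \<eta>0 x = sigma \<tau>0 \<eta>0 y" for x y
    using sigma_eq_0[OF pl0, of "x - y"] sigma_diff[OF pl0, of x y] that subfieldD(4)[OF K] by auto
  have w0: "(None, 0, 0) \<in> W" unfolding W_def using nNone npos e0 by (auto simp: cP_def BP_def)
  have nz: "sg P i x \<noteq> 0" if "P \<in> PP" "i < n" "x \<in> K" "x \<noteq> 0" for P i x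
    unfolding sg_def using sigma_eq_0[OF pl] that by blast
  have main: "finite {w\<in>W. v w x \<noteq> 0} \<and> (\<Sum>w | w \<in> W \<and> v w x \<noteq> 0. v w x) = 0" if x: "x \<in> K" "x \<noteq> 0" for x
  proof -
    obtain f c where f: "bipoly_over k f" "poly_over k c" "c \<noteq> 0" "x = ev f / poly c t" by (rule K_repr[OF x(1)])
    have evf0: "ev f \<noteq> 0" using x f by auto
    obtain nn cc where nc: "poly_over k nn" "poly_over k cc" "cc \<noteq> 0" "\<And>\<tau> xs. distinct xs \<Longrightarrow> length xs = degree G \<Longrightarrow> (\<forall>\<eta>\<in>set xs. place \<tau> \<eta>) \<Longrightarrow>
       evf nn \<tau> = evf cc \<tau> * (\<Prod>i<degree G. evl \<tau> (xs ! i) f)" using norm_exists[OF f(1)] by blast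
    have nP: "evf nn (param P (eP P)) = evf cc (param P (eP P)) * (\<Prod>i<n. evl (param P (eP P)) (xs P ! i) f)" if "P \<in> PP" for P
      using nc(4)[of "xs P"] xs that unfolding n_def by auto
    have fnz: "evl (param P (eP P)) (xs P ! i) f \<noteq> 0" if "P \<in> PP" "i < n" for P i
      using place_nonzero[OF pl[OF that] f(1) evf0] .
    have ord: "evf q (param P (eP P)) \<noteq> 0" "fls_subdegree (evf q (param P (eP P))) = int (eP P) * point_ord P q" if "q \<noteq> 0" for q P
      using param_ord[OF ec(2) that] by auto
    have nn0: "nn \<noteq> 0"
    proof
      assume "nn = 0"
      then show False using nP[OF nNone] fnz[OF nNone] ord(1)[OF nc(3)] by auto
    qed
    have sgx: "sg P i x = evl (param P (eP P)) (xs P ! i) f / evf c (param P (eP P))" if "P \<in> PP" "i < n" for P i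
      unfolding sg_def f(4) by (rule sigma_eq[OF pl[OF that] f(1-3)])
    have vP: "fls_subdegree (sg P i x) = fls_subdegree (evl (param P (eP P)) (xs P ! i) f) - int (eP P) * point_ord P c" if "P \<in> PP" "i < n" for P i
      unfolding sgx[OF that] using fnz[OF that] ord[OF f(3), of P] by (simp add: fls_divide_subdegree)
    \<comment> \<open>The order at \<open>P\<close> of the norm of \<open>x\<close>: that of
      \<open>nn / cc\<close>, the norm of the numerator, less \<open>n\<close> times that of the
      denominator.\<close>
    define d where "d P = point_ord P nn - point_ord P cc - int n * point_ord P c" for P
    have sumP: "(\<Sum>i<n. fls_subdegree (sg P i x)) = int (eP P) * d P" if P: "P \<in> PP" for P
    proof -
      have pr: "fls_subdegree (\<Prod>i<n. evl (param P (eP P)) (xs P ! i) f) = (\<Sum>i<n. fls_subdegree (evl (param P (eP P)) (xs P ! i) f))"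
        by (rule fls_subdegree_prod) (use fnz[OF P] in auto)
      have "fls_subdegree (evf nn (param P (eP P))) = fls_subdegree (evf cc (param P (eP P))) + (\<Sum>i<n. fls_subdegree (evl (param P (eP P)) (xs P ! i) f))"
        unfolding nP[OF P] using ord(1)[OF nc(3), of P] fnz[OF P] pr by simp
      then have "(\<Sum>i<n. fls_subdegree (evl (param P (eP P)) (xs P ! i) f)) = int (eP P) * (point_ord P nn - point_ord P cc)"
        unfolding ord(2)[OF nn0] ord(2)[OF nc(3)] by (simp add: algebra_simps)
      moreover have "(\<Sum>i<n. fls_subdegree (sg P i x)) =
          (\<Sum>i<n. fls_subdegree (evl (param P (eP P)) (xs P ! i) f) - int (eP P) * point_ord P c)"
        by (rule sum.cong[OF refl]) (rule vP[OF P], simp)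
      ultimately show ?thesis unfolding d_def by (simp add: sum_subtractf algebra_simps)
    qed
    define R where "R = {a. poly (nn * cc * c) a = 0}"
    have fR: "finite R" unfolding R_def using nn0 nc f by (intro poly_roots_finite) auto
    have Rk: "R \<subseteq> k" unfolding R_def using nn0 nc f
      by (auto intro!: root_in_k[of "nn * cc * c"] poly_over_mult[OF ks])
    define S where "S = R \<union> (bad \<inter> k)"
    have fS: "finite S" and Sk: "S \<subseteq> k" unfolding S_def using fR Rk bad by auto
    define PT where "PT = insert None (Some ` S)"
    have fPT: "finite PT" and PTP: "PT \<subseteq> PP" and BPT: "BP \<subseteq> PT" unfolding PT_def PP_def BP_def S_def using fR Rk bad by auto
    \<comment> \<open>Over a point outside \<open>PT\<close> the orders of \<open>x\<close> are
      nonnegative and sum to the order of its norm, which is zero; so each of them is zero.\<close>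
    have out: "fls_subdegree (sg P i x) = 0" if P: "P \<in> PP - PT" "i < n" for P i
    proof -
      obtain a where a: "P = Some a" "a \<notin> S" "a \<in> k" using P unfolding PP_def PT_def by auto
      then have "poly nn a \<noteq> 0" "poly cc a \<noteq> 0" "poly c a \<noteq> 0" unfolding S_def R_def by auto
      then have o: "point_ord P nn = 0" "point_ord P cc = 0" "point_ord P c = 0" using a unfolding point_ord_def by (auto intro: order_0I)
      have nB: "P \<notin> BP" using P BPT by auto
      have e1: "eP P = 1" unfolding eP_def using nB by simp
      have ge: "fls_subdegree (sg P i x) \<ge> 0" if "i < n" for i
      proof -
        have "fls_subdegree (evl (param P (eP P)) (xs P ! i) f) \<ge> 0"
          using xs(4)[of P] xs(2)[of P] P nB that param_Some_integral[of 1 a] a(1) e1 by (intro evl_integral) auto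
        then show ?thesis using vP[of P i] P that o by simp
      qed
      have "(\<Sum>i<n. fls_subdegree (sg P i x)) = 0" using sumP[of P] P unfolding d_def o by simp
      then show ?thesis using ge P(2) by (subst (asm) sum_nonneg_eq_0_iff) auto
    qed
    define WT where "WT = (SIGMA P:PT. {..<n} \<times> {..<cP P})"
    have fWT: "finite WT" unfolding WT_def using fPT by auto
    have WTW: "WT \<subseteq> W" unfolding WT_def W_def using PTP by auto
    have sub: "{w\<in>W. v w x \<noteq> 0} \<subseteq> WT"
    proof
      fix w assume w: "w \<in> {w\<in>W. v w x \<noteq> 0}"
      then obtain P i j where "w = (P, i, j)" "P \<in> PP" "i < n" "j < cP P" unfolding W_def by auto
      then show "w \<in> WT" using w out[of P i] unfolding WT_def v_def by auto
    qed
    have "(\<Sum>w | w \<in> W \<and> v w x \<noteq> 0. v w x) = (\<Sum>w\<in>WT. v w x)"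
      using fWT sub WTW by (intro sum.mono_neutral_left) auto
    also have "\<dots> = (\<Sum>P\<in>PT. \<Sum>ij\<in>{..<n} \<times> {..<cP P}. v (P, ij) x)" unfolding WT_def
      using fPT by (subst sum.Sigma) auto
    also have "\<dots> = (\<Sum>P\<in>PT. int (cP P) * (\<Sum>i<n. fls_subdegree (sg P i x)))"
    proof (rule sum.cong[OF refl])
      fix P
      have "(\<Sum>ij\<in>{..<n} \<times> {..<cP P}. v (P, ij) x) = (\<Sum>i<n. \<Sum>j<cP P. v (P, i, j) x)"
        by (subst sum.cartesian_product) (auto intro: sum.cong)
      then show "(\<Sum>ij\<in>{..<n} \<times> {..<cP P}. v (P, ij) x) = int (cP P) * (\<Sum>i<n. fls_subdegree (sg P i x))"
        unfolding v_def by (simp add: sum_distrib_left)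
    qed
    also have "\<dots> = (\<Sum>P\<in>PT. int e0 * d P)"
    proof (rule sum.cong[OF refl])
      fix P assume "P \<in> PT"
      then have "int (cP P) * (\<Sum>i<n. fls_subdegree (sg P i x)) = int (eP P * cP P) * d P" using sumP[of P] PTP by (auto simp: mult_ac)
      then show "int (cP P) * (\<Sum>i<n. fls_subdegree (sg P i x)) = int e0 * d P" unfolding ec .
    qed
    also have "\<dots> = int e0 * ((\<Sum>P\<in>PT. point_ord P nn) - (\<Sum>P\<in>PT. point_ord P cc) - int n * (\<Sum>P\<in>PT. point_ord P c))"
      unfolding d_def by (simp add: sum_subtractf sum_distrib_left right_diff_distrib)
    also have "(\<Sum>P\<in>PT. point_ord P q) = 0" if "q \<noteq> 0" "{a. poly q a = 0} \<subseteq> R" for q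
    proof -
      have "(\<Sum>P\<in>PT. point_ord P q) = point_ord None q + (\<Sum>a\<in>S. point_ord (Some a) q)"
        unfolding PT_def using fS by (simp add: sum.reindex)
      moreover have "(\<Sum>a\<in>S. order a q) = degree q" using that fS unfolding S_def by (intro sum_order_eq_degree) auto
      ultimately show ?thesis unfolding point_ord_def by (simp flip: of_nat_sum)
    qed
    note o = this
    have "int e0 * ((\<Sum>P\<in>PT. point_ord P nn) - (\<Sum>P\<in>PT. point_ord P cc) - int n * (\<Sum>P\<in>PT. point_ord P c)) = 0"
    proof -
      have "(\<Sum>P\<in>PT. point_ord P nn) = 0" by (rule o[OF nn0]) (auto simp: R_def)
      moreover have "(\<Sum>P\<in>PT. point_ord P cc) = 0" by (rule o[OF nc(3)]) (auto simp: R_def)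
      moreover have "(\<Sum>P\<in>PT. point_ord P c) = 0" by (rule o[OF f(3)]) (auto simp: R_def)
      ultimately show ?thesis by simp
    qed
    finally have "(\<Sum>w | w \<in> W \<and> v w x \<noteq> 0. v w x) = 0" .
    then show ?thesis using finite_subset[OF sub fWT] by blast
  qed
  have "valued_function_field k K W Wb v D (int e0)"
  proof
    show "is_subfield k" "is_subfield K" "k \<subseteq> K" by (rule ks K kK)+
    show "finite Wb" "Wb \<subseteq> W" unfolding Wb_def W_def using fBP BPP by auto
    show "int e0 \<ge> 0" by simp
    show "finite {w\<in>W. v w x \<noteq> 0}" "(\<Sum>w | w \<in> W \<and> v w x \<noteq> 0. v w x) = 0" if "x \<in> K" "x \<noteq> 0" for x using main that by auto
    show "D x \<in> K" if "x \<in> K" for x using D that by blast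
    show "D (x + y) = D x + D y" if "x \<in> K" "y \<in> K" for x y
      using D[of x] D[of y] D[of "x + y"] that pl0 subfieldD(3)[OF K]
      by (intro inj) (auto simp: sigma_add dtau_add)
    show "D (x * y) = x * D y + D x * y" if "x \<in> K" "y \<in> K" for x y
      using D[of x] D[of y] D[of "x * y"] that pl0 subfieldD(3,5)[OF K]
      by (intro inj) (auto simp: sigma_add sigma_mult dtau_mult)
    show "D x = 0" if "x \<in> k" for x
      using D[of x] that kK pl0 subfieldD(1)[OF K] by (intro inj) (auto simp: sigma_const sigma_0 dtau_const)
    show "x \<in> k" if x: "x \<in> K" "D x = 0" for x
    proof -
      have "fls_deriv (sigma \<tau>0 \<eta>0 x) = 0" using D[OF x(1)] pl0 x(2) sigma_0[OF pl0] unfolding place_def dtau_def by auto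
      then obtain a where a: "sigma \<tau>0 \<eta>0 x = fls_const a" unfolding fls_deriv_eq_0_iff by blast
      then have "fls_nth (sigma (param None (eP None)) \<eta>0 x) 0 \<in> k"
        using ec(2) pl0 x unfolding \<tau>0_def by (intro residue_in_k) auto
      then have "a \<in> k" using a unfolding \<tau>0_def by simp
      then show ?thesis using inj[of x a] a sigma_const[OF pl0] x kK by auto
    qed
    fix w assume "w \<in> W"
    then obtain P i j where w: "w = (P, i, j)" "P \<in> PP" "i < n" "place (param P (eP P)) (xs P ! i)" "v w = (\<lambda>x. fls_subdegree (sg P i x))"
      using WD by blast
    show "v w (x * y) = v w x + v w y" if "x \<in> K" "y \<in> K" "x \<noteq> 0" "y \<noteq> 0" for x y
      unfolding w(5) using nz[OF w(2,3)] that by (simp add: sg_def sigma_mult[OF w(4)])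
    show "v w (x + y) \<ge> min (v w x) (v w y)" if "x \<in> K" "y \<in> K" "x \<noteq> 0" "y \<noteq> 0" "x + y \<noteq> 0" for x y
      unfolding w(5) using nz[OF w(2,3), of "x + y"] that subfieldD(3)[OF K]
      by (auto simp: sg_def sigma_add[OF w(4)] intro!: fls_plus_subdegree)
    show "v w x = 0" if "x \<in> k" "x \<noteq> 0" for x unfolding w(5) sg_def sigma_const[OF w(4) that(1)] by simp
    show "v w (D x) \<ge> v w x - int e0" if x: "x \<in> K" "D x \<noteq> 0" for x
    proof -
      let ?z = "sg P i x"
      have 1: "sg P i (D x) = fls_deriv ?z / fls_deriv (param P (eP P))" unfolding sg_def using D[OF x(1)] w(4) unfolding dtau_def by auto
      have 2: "fls_deriv ?z \<noteq> 0" using nz[OF w(2,3) _ x(2)] D[OF x(1)] unfolding 1 by auto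
      have "eP P \<le> e0" using ec[of P] e0 unfolding eP_def by auto
      \<comment> \<open>Origin of the constant \<open>e0\<close>: differentiating a series loses at
        most one order, and the derivative of the parametrisation has order at most
        \<open>e0 - 1\<close>.\<close>
      then have "fls_subdegree (fls_deriv (param P (eP P))) \<le> int e0 - 1" using param_deriv(2)[OF ec(2), of P] by (auto split: option.splits)
      then show ?thesis unfolding w(5) 1 using fls_deriv_subdegree_ge[OF 2] 2 param_deriv(1)[OF ec(2), of P]
        by (simp add: fls_divide_subdegree)
    qed
  next
    fix x assume x: "x \<in> K" "x \<noteq> 0" and ge: "\<And>w. w \<in> W \<Longrightarrow> v w x \<ge> 0"
    have v0: "v (None, 0, 0) y = fls_subdegree (sigma \<tau>0 \<eta>0 y)" for y unfolding v_def sg_def \<tau>0_def \<eta>0_def by simp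
    \<comment> \<open>Subtracting the residue at one place leaves an element without poles and with
      a zero at that place, which the product formula forbids unless it is zero.\<close>
    define a where "a = fls_nth (sigma \<tau>0 \<eta>0 x) 0"
    have "fls_subdegree (sigma \<tau>0 \<eta>0 x) \<ge> 0" using ge[OF w0] v0 by simp
    then have a: "a \<in> k" unfolding a_def \<tau>0_def using ec(2) pl0 x unfolding \<tau>0_def by (intro residue_in_k) auto
    have "x = a"
    proof (rule ccontr)
      assume "x \<noteq> a"
      define y where "y = x - a"
      have y: "y \<in> K" "y \<noteq> 0" unfolding y_def using \<open>x \<noteq> a\<close> x a kK subfieldD(4)[OF K] by auto
      have gey: "v w y \<ge> 0" if w: "w \<in> W" for w
      proof -
        obtain P i j where w': "P \<in> PP" "i < n" "place (param P (eP P)) (xs P ! i)" "v w = (\<lambda>x. fls_subdegree (sg P i x))"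
          using WD[OF w] by blast
        have "sg P i y = sg P i x + fls_const (- a)" unfolding sg_def y_def
          using sigma_diff[OF w'(3), of x a] x a kK sigma_const[OF w'(3) a] by (auto simp: fc.hom_uminus)
        moreover have "fls_subdegree (sg P i x) \<ge> 0" using ge[OF w] unfolding w'(4) .
        ultimately show ?thesis unfolding w'(4) using fls_integral_add[of "sg P i x" "fls_const (- a)"] by simp
      qed
      have "sigma \<tau>0 \<eta>0 y = sigma \<tau>0 \<eta>0 x - fls_const a" unfolding y_def
        using sigma_diff[OF pl0, of x a] x a kK sigma_const[OF pl0 a] by auto
      then have "fls_nth (sigma \<tau>0 \<eta>0 y) 0 = 0" unfolding a_def by simp
      moreover have "sigma \<tau>0 \<eta>0 y \<noteq> 0" using sigma_eq_0[OF pl0] y by blast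
      ultimately have "v (None, 0, 0) y \<noteq> 0" unfolding v0 by (metis nth_fls_subdegree_zero_iff)
      then have "v (None, 0, 0) y > 0" using gey[OF w0] by simp
      then have "(\<Sum>w | w \<in> W \<and> v w y \<noteq> 0. v w y) > 0"
        using main[OF y] gey w0 by (intro sum_pos2[of _ "(None, 0, 0)"]) auto
      then show False using main[OF y] by simp
    qed
    then show "x \<in> k" using a by simp
  next
    fix w x assume w: "w \<in> W - Wb" and x: "x \<in> K"
    obtain P i j where w': "w = (P, i, j)" "P \<in> PP" "i < n" "place (param P (eP P)) (xs P ! i)" "v w = (\<lambda>x. fls_subdegree (sg P i x))"
      using WD w by blast
    have nB: "P \<notin> BP" using w w'(1) unfolding Wb_def W_def by auto
    then obtain a where P: "P = Some a" "eP P = 1" using w'(2) unfolding PP_def BP_def eP_def by auto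
    have "param P (eP P) = fls_const a + fls_X" unfolding P(2) by (simp add: param_def P(1))
    then have pd: "fls_deriv (param P (eP P)) = 1" by simp
    have 1: "sg P i (D x) = fls_deriv (sg P i x)"
      unfolding sg_def using D[OF x] w'(4) pd unfolding dtau_def by auto
    show "v w (D x) \<ge> 0" if "D x \<noteq> 0" "v w x \<ge> 0"
      using that fls_subdegree_deriv[of "sg P i x"] fls_deriv_subdegree0[of "sg P i x"] unfolding w'(5) 1
      by (cases "fls_subdegree (sg P i x) = 0") auto
    show "D x \<noteq> 0 \<and> v w (D x) = v w x - 1" if "x \<noteq> 0" "v w x > 0"
    proof -
      have s: "fls_subdegree (fls_deriv (sg P i x)) = fls_subdegree (sg P i x) - 1"
        using that unfolding w'(5) by (intro fls_subdegree_deriv) auto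
      have "D x \<noteq> 0"
      proof
        assume "D x = 0"
        then have "sg P i (D x) = 0" unfolding sg_def using sigma_0[OF w'(4)] by simp
        then have "fls_deriv (sg P i x) = 0" using 1 by simp
        then have "sg P i x = fls_const (fls_nth (sg P i x) 0)" unfolding fls_deriv_eq_0_iff .
        then have "fls_subdegree (sg P i x) = 0" by (metis fls_const_subdegree)
        then show False using that unfolding w'(5) by simp
      qed
      then show ?thesis unfolding w'(5) 1 using s by simp
    qed
  qed
  then show ?thesis by blast
qed

end

lemma valued_function_field_of_curve:
  fixes k K :: "'a::{alg_closed_field,field_char_0} set"
  assumes "alg_closed_subfield k" "curve_function_field k K"
  shows "\<exists>(W :: ('a option \<times> nat \<times> nat) set) Wb v D c0. valued_function_field k K W Wb v D c0"
proof -
  obtain t u where "function_field k K t u" using assms unfolding curve_function_field_def function_field_def by blast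
  then interpret function_field k K t u .
  show ?thesis by (rule valued_function_field_exists)
qed

section \<open>Heights and the ultrapower\<close>

text \<open>Zorn's lemma downwards: the infimum of a nonempty chain of proper filters is proper, and
  a minimal proper filter below \<open>sequentially\<close> decides every predicate.\<close>

lemma free_ultrafilter_exists:
  "\<exists>U :: nat filter. U \<noteq> bot \<and> U \<le> sequentially \<and> (\<forall>P. eventually P U \<or> eventually (\<lambda>x. \<not> P x) U)"
proof -
  define A where "A = {F :: nat filter. F \<noteq> bot \<and> F \<le> sequentially}"
  have "\<exists>m\<in>A. \<forall>a\<in>A. m \<ge> a \<longrightarrow> a = m"
  proof (rule predicate_Zorn[of A "(\<ge>)"])
    show "partial_order_on A (relation_of (\<ge>) A)"
      by (rule partial_order_on_relation_ofI) auto
    fix C assume C: "C \<in> Chains (relation_of (\<ge>) A)"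
    then have CA: "C \<subseteq> A" and ch: "\<And>F G. F \<in> C \<Longrightarrow> G \<in> C \<Longrightarrow> F \<ge> G \<or> G \<ge> F"
      unfolding Chains_def relation_of_def by auto
    show "\<exists>u\<in>A. \<forall>a\<in>C. a \<ge> u"
    proof (cases "C = {}")
      case True
      then show ?thesis unfolding A_def by (intro bexI[of _ sequentially]) auto
    next
      case False
      have "eventually P (Inf C) \<longleftrightarrow> (\<exists>b\<in>C. eventually P b)" for P
        using False ch by (intro eventually_Inf_base) (metis inf.absorb1 inf.absorb2 order_refl)+
      then have "Inf C \<noteq> bot" using CA unfolding A_def by (auto simp: trivial_limit_def)
      moreover have "Inf C \<le> sequentially" using False CA unfolding A_def
        by (metis (mono_tags, lifting) Inf_lower2 all_not_in_conv mem_Collect_eq subsetD)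
      ultimately show ?thesis unfolding A_def by (intro bexI[of _ "Inf C"]) (auto intro: Inf_lower)
    qed
  qed
  then obtain m where m: "m \<noteq> bot" "m \<le> sequentially" and min: "\<And>a. a \<noteq> bot \<Longrightarrow> a \<le> m \<Longrightarrow> a = m"
    unfolding A_def by (metis (mono_tags, lifting) mem_Collect_eq order_trans)
  have "eventually P m \<or> eventually (\<lambda>x. \<not> P x) m" for P
  proof (cases "inf m (principal {x. P x}) = bot")
    case True
    then have "eventually (\<lambda>_. False) (inf m (principal {x. P x}))" by simp
    then show ?thesis unfolding eventually_inf_principal by simp
  next
    case False
    then have "inf m (principal {x. P x}) = m" by (intro min) auto
    moreover have "eventually P (inf m (principal {x. P x}))" unfolding eventually_inf_principal by simp
    ultimately show ?thesis by simp
  qed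
  then show ?thesis using m by blast
qed

definition UF :: "nat filter" where
  "UF = (SOME U. U \<noteq> bot \<and> U \<le> sequentially \<and> (\<forall>P. eventually P U \<or> eventually (\<lambda>x. \<not> P x) U))"

lemma UF: "UF \<noteq> bot" "UF \<le> sequentially" "eventually P UF \<or> eventually (\<lambda>x. \<not> P x) UF"
  using someI_ex[OF free_ultrafilter_exists] unfolding UF_def by blast+

lemma UF_not: "\<not> eventually P UF \<longleftrightarrow> eventually (\<lambda>x. \<not> P x) UF"
  using UF(1) UF(3)[of P] eventually_conj[of P UF "\<lambda>x. \<not> P x"] by (auto simp: eventually_False)

lemma UF_ex: "eventually P UF \<Longrightarrow> \<exists>i. P i"
  using UF(1) eventually_happens by (metis)

section \<open>The ultrapower of a field\<close>

definition ultra_eq :: "(nat \<Rightarrow> 'a) \<Rightarrow> (nat \<Rightarrow> 'a) \<Rightarrow> bool" where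
  "ultra_eq f g \<longleftrightarrow> eventually (\<lambda>i. f i = g i) UF"

quotient_type 'a ultra = "nat \<Rightarrow> 'a" / ultra_eq
proof (rule equivpI)
  show "transp (ultra_eq :: (nat \<Rightarrow> 'a) \<Rightarrow> (nat \<Rightarrow> 'a) \<Rightarrow> bool)"
    unfolding ultra_eq_def transp_def by (auto elim: eventually_elim2)
  show "symp (ultra_eq :: (nat \<Rightarrow> 'a) \<Rightarrow> (nat \<Rightarrow> 'a) \<Rightarrow> bool)"
    unfolding ultra_eq_def symp_def by (auto elim: eventually_mono)
qed (auto simp: ultra_eq_def reflp_def)

instantiation ultra :: (field) field
begin

lift_definition zero_ultra :: "'a ultra" is "\<lambda>_. 0" .
lift_definition one_ultra :: "'a ultra" is "\<lambda>_. 1" .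
lift_definition plus_ultra :: "'a ultra \<Rightarrow> 'a ultra \<Rightarrow> 'a ultra" is "\<lambda>f g i. f i + g i"
  unfolding ultra_eq_def by (auto elim: eventually_elim2)
lift_definition minus_ultra :: "'a ultra \<Rightarrow> 'a ultra \<Rightarrow> 'a ultra" is "\<lambda>f g i. f i - g i"
  unfolding ultra_eq_def by (auto elim: eventually_elim2)
lift_definition times_ultra :: "'a ultra \<Rightarrow> 'a ultra \<Rightarrow> 'a ultra" is "\<lambda>f g i. f i * g i"
  unfolding ultra_eq_def by (auto elim: eventually_elim2)
lift_definition divide_ultra :: "'a ultra \<Rightarrow> 'a ultra \<Rightarrow> 'a ultra" is "\<lambda>f g i. f i / g i"
  unfolding ultra_eq_def by (auto elim: eventually_elim2)
lift_definition uminus_ultra :: "'a ultra \<Rightarrow> 'a ultra" is "\<lambda>f i. - f i"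
  unfolding ultra_eq_def by (auto elim: eventually_mono)
lift_definition inverse_ultra :: "'a ultra \<Rightarrow> 'a ultra" is "\<lambda>f i. inverse (f i)"
  unfolding ultra_eq_def by (auto elim: eventually_mono)

instance
proof
  fix a b c :: "'a ultra"
  show "a * b * c = a * (b * c)" by transfer (simp add: ultra_eq_def mult.assoc)
  show "a * b = b * a" by transfer (simp add: ultra_eq_def mult.commute)
  show "1 * a = a" by transfer (simp add: ultra_eq_def)
  show "a + b + c = a + (b + c)" by transfer (simp add: ultra_eq_def add.assoc)
  show "a + b = b + a" by transfer (simp add: ultra_eq_def add.commute)
  show "0 + a = a" by transfer (simp add: ultra_eq_def)
  show "- a + a = 0" by transfer (simp add: ultra_eq_def)
  show "a - b = a + - b" by transfer (simp add: ultra_eq_def)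
  show "(a + b) * c = a * c + b * c" by transfer (simp add: ultra_eq_def algebra_simps)
  show "(0 :: 'a ultra) \<noteq> 1" by transfer (simp add: ultra_eq_def UF eventually_False)
  show "inverse a * a = 1" if "a \<noteq> 0"
    using that by transfer (auto simp: ultra_eq_def UF_not elim: eventually_mono)
  show "a div b = a * inverse b" by transfer (simp add: ultra_eq_def divide_inverse)
  show "inverse 0 = (0 :: 'a ultra)" by transfer (simp add: ultra_eq_def)
qed

end

abbreviation star :: "(nat \<Rightarrow> 'a) \<Rightarrow> 'a ultra" where "star \<equiv> abs_ultra"

lemma star_eq_iff: "star f = star g \<longleftrightarrow> eventually (\<lambda>i. f i = g i) UF"
  unfolding ultra.abs_eq_iff ultra_eq_def ..

lemma star_arith:
  "star f + star g = star (\<lambda>i. f i + g i)" "star f - star g = star (\<lambda>i. f i - g i)"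
  "star f * star g = star (\<lambda>i. f i * g i)" "star f / star g = star (\<lambda>i. f i / g i)"
  "- star f = star (\<lambda>i. - f i)" "inverse (star f) = star (\<lambda>i. inverse (f i))"
  "0 = star (\<lambda>_. 0)" "1 = star (\<lambda>_. 1)"
  by (simp_all add: plus_ultra.abs_eq minus_ultra.abs_eq times_ultra.abs_eq divide_ultra.abs_eq
      uminus_ultra.abs_eq inverse_ultra.abs_eq zero_ultra.abs_eq one_ultra.abs_eq)

lemma star_0_iff: "star f = 0 \<longleftrightarrow> eventually (\<lambda>i. f i = 0) UF"
  unfolding star_arith(7) star_eq_iff ..

lemma star_power: "star f ^ n = star (\<lambda>i. f i ^ n)"
  by (induction n) (auto simp: star_arith(8) star_arith(3))

lemma star_sum: "(\<Sum>j\<in>A. star (f j)) = star (\<lambda>i. \<Sum>j\<in>A. f j i)"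
  by (induction A rule: infinite_finite_induct) (auto simp: star_arith(7) star_arith(1))

lemma star_of_nat: "of_nat n = star (\<lambda>_. of_nat n)"
  by (induction n) (auto simp: star_arith(1,7,8))

instance ultra :: (field_char_0) field_char_0
proof
  show "inj (of_nat :: nat \<Rightarrow> 'a ultra)"
    by (rule injI) (auto simp: star_of_nat star_eq_iff dest!: UF_ex)
qed

lift_definition ultra_map :: "('a \<Rightarrow> 'b) \<Rightarrow> 'a ultra \<Rightarrow> 'b ultra" is "\<lambda>F f i. F (f i)"
  unfolding ultra_eq_def by (auto elim: eventually_mono)

lemma ultra_map_star: "ultra_map F (star f) = star (\<lambda>i. F (f i))"
  by (simp add: ultra_map.abs_eq)

section \<open>Poles and heights\<close>

context valued_function_field begin

lemmas Kc = subfieldD[OF Ks]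
lemmas kc = subfieldD[OF ks]

definition pole :: "'a \<Rightarrow> 'w \<Rightarrow> nat" where "pole x w = (if x = 0 then 0 else nat (- v w x))"

definition height :: "'a \<Rightarrow> nat" where "height x = (\<Sum>w | w \<in> W \<and> pole x w \<noteq> 0. pole x w)"

lemma finite_poles: "x \<in> K \<Longrightarrow> finite {w\<in>W. pole x w \<noteq> 0}"
proof (cases "x = 0")
  case False
  assume "x \<in> K"
  then show ?thesis by (rule finite_subset[OF _ v_finite[OF _ False], rotated]) (auto simp: pole_def)
qed (simp add: pole_def)

lemma height_eq: "x \<in> K \<Longrightarrow> finite S \<Longrightarrow> S \<subseteq> W \<Longrightarrow> {w\<in>W. pole x w \<noteq> 0} \<subseteq> S \<Longrightarrow> height x = (\<Sum>w\<in>S. pole x w)"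
  unfolding height_def by (rule sum.mono_neutral_left) auto

text \<open>The bound is required place by place; \<open>E\<close> absorbs finitely many exceptional
  places at a cost of \<open>C\<close> each.\<close>

lemma height_le:
  assumes x: "x \<in> K" and J: "finite J" "\<And>j. j \<in> J \<Longrightarrow> y j \<in> K" and E: "finite E"
    and le: "\<And>w. w \<in> W \<Longrightarrow> pole x w \<le> (\<Sum>j\<in>J. m j * pole (y j) w) + (if w \<in> E then C else 0)"
  shows "height x \<le> (\<Sum>j\<in>J. m j * height (y j)) + C * card E"
proof -
  define S where "S = {w\<in>W. pole x w \<noteq> 0} \<union> (\<Union>j\<in>J. {w\<in>W. pole (y j) w \<noteq> 0})"
  have S: "finite S" "S \<subseteq> W" unfolding S_def using finite_poles x J by auto
  have "height x = (\<Sum>w\<in>S. pole x w)" using S by (intro height_eq x) (auto simp: S_def)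
  also have "\<dots> \<le> (\<Sum>w\<in>S. (\<Sum>j\<in>J. m j * pole (y j) w) + (if w \<in> E then C else 0))"
    using S by (intro sum_mono le) auto
  also have "\<dots> = (\<Sum>j\<in>J. m j * (\<Sum>w\<in>S. pole (y j) w)) + (\<Sum>w\<in>S. if w \<in> E then C else 0)"
    by (simp add: sum.distrib sum_distrib_left sum.swap[of _ S J])
  also have "(\<Sum>j\<in>J. m j * (\<Sum>w\<in>S. pole (y j) w)) = (\<Sum>j\<in>J. m j * height (y j))"
  proof (rule sum.cong[OF refl])
    fix j assume "j \<in> J"
    then have "{w\<in>W. pole (y j) w \<noteq> 0} \<subseteq> S" unfolding S_def by blast
    then show "m j * (\<Sum>w\<in>S. pole (y j) w) = m j * height (y j)" using height_eq[OF J(2)[OF \<open>j \<in> J\<close>] S] by simp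
  qed
  also have "(\<Sum>w\<in>S. if w \<in> E then C else 0) = C * card (S \<inter> E)" using S by (simp add: sum.If_cases)
  also have "\<dots> \<le> C * card E" using E by (simp add: card_mono)
  finally show ?thesis by simp
qed

lemma v_1: "w \<in> W \<Longrightarrow> v w 1 = 0" using v_k[of w 1] kc(2) by simp

lemma v_inverse: assumes "w \<in> W" "x \<in> K" "x \<noteq> 0" shows "v w (inverse x) = - v w x"
  using v_mult[OF assms(1,2) Kc(6)[OF assms(2)]] assms v_1 by simp

lemma v_power: assumes "w \<in> W" "x \<in> K" "x \<noteq> 0" shows "v w (x ^ n) = int n * v w x"
  by (induction n) (use assms in \<open>auto simp: v_1 v_mult subfield_power[OF Ks] algebra_simps\<close>)

lemma v_uminus: assumes "w \<in> W" "x \<in> K" "x \<noteq> 0" shows "v w (- x) = v w x"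
proof -
  have "v w (- 1) = 0" using v_k[OF assms(1), of "- 1"] kc(2,7) by simp
  then show ?thesis using v_mult[OF assms(1) _ assms(2), of "- 1"] assms Kc(2,7) by simp
qed

lemma pole_mult: "w \<in> W \<Longrightarrow> x \<in> K \<Longrightarrow> y \<in> K \<Longrightarrow> pole (x * y) w \<le> pole x w + pole y w"
  unfolding pole_def by (auto simp: v_mult)

lemma pole_add: "w \<in> W \<Longrightarrow> x \<in> K \<Longrightarrow> y \<in> K \<Longrightarrow> pole (x + y) w \<le> max (pole x w) (pole y w)"
  using v_add[of w x y] unfolding pole_def by auto

lemma pole_power: "w \<in> W \<Longrightarrow> x \<in> K \<Longrightarrow> x \<noteq> 0 \<Longrightarrow> pole (x ^ n) w = n * pole x w"
  unfolding pole_def by (simp add: v_power nat_mult_distrib flip: mult_minus_right)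

lemma pole_sum:
  assumes "w \<in> W" "finite A" "\<And>i. i \<in> A \<Longrightarrow> f i \<in> K" "\<And>i. i \<in> A \<Longrightarrow> pole (f i) w \<le> B"
  shows "pole (sum f A) w \<le> B"
  using assms(2-)
proof (induction A rule: finite_induct)
  case (insert a A)
  have "pole (f a + sum f A) w \<le> max (pole (f a) w) (pole (sum f A) w)"
    using insert by (intro pole_add[OF assms(1)] subfield_sum[OF Ks]) auto
  also have "\<dots> \<le> B" using insert by auto
  finally show ?case using insert by simp
qed (simp add: pole_def)

lemma height_mult: assumes "x \<in> K" "y \<in> K" shows "height (x * y) \<le> height x + height y"
  using height_le[of "x * y" "{True, False}" "\<lambda>b. if b then x else y" "{}" "\<lambda>_. 1" 0]
    assms pole_mult[OF _ assms] Kc(5)[OF assms] by simp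

lemma height_add: assumes "x \<in> K" "y \<in> K" shows "height (x + y) \<le> height x + height y"
proof -
  have "pole (x + y) w \<le> pole x w + pole y w" if "w \<in> W" for w using pole_add[OF that assms] by linarith
  then show ?thesis using height_le[of "x + y" "{True, False}" "\<lambda>b. if b then x else y" "{}" "\<lambda>_. 1" 0]
    assms Kc(3)[OF assms] by simp
qed

lemma height_power: assumes "x \<in> K" "x \<noteq> 0" shows "height (x ^ n) = n * height x"
proof -
  have S: "finite {w\<in>W. pole x w \<noteq> 0}" "{w\<in>W. pole x w \<noteq> 0} \<subseteq> W" using finite_poles[OF assms(1)] by auto
  have "height (x ^ n) = (\<Sum>w\<in>{w\<in>W. pole x w \<noteq> 0}. pole (x ^ n) w)"
    using assms by (intro height_eq[OF subfield_power[OF Ks] S]) (auto simp: pole_power)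
  also have "\<dots> = (\<Sum>w\<in>{w\<in>W. pole x w \<noteq> 0}. n * pole x w)" by (intro sum.cong) (use assms in \<open>auto simp: pole_power\<close>)
  finally show ?thesis unfolding height_def by (simp add: sum_distrib_left)
qed

text \<open>Poles of the inverse are zeros, and by the product formula zeros and poles
  balance.\<close>

lemma height_inverse: assumes x: "x \<in> K" shows "height (inverse x) = height x"
proof (cases "x = 0")
  case False
  define S where "S = {w\<in>W. v w x \<noteq> 0}"
  have S: "finite S" "S \<subseteq> W" unfolding S_def using v_finite[OF x False] by auto
  have "height x = (\<Sum>w\<in>S. pole x w)" by (rule height_eq[OF x S]) (auto simp: S_def pole_def)
  moreover have "height (inverse x) = (\<Sum>w\<in>S. pole (inverse x) w)"
    by (rule height_eq[OF Kc(6)[OF x] S]) (auto simp: S_def pole_def False v_inverse x)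
  moreover have "int (\<Sum>w\<in>S. pole (inverse x) w) - int (\<Sum>w\<in>S. pole x w) = (\<Sum>w\<in>S. v w x)"
    unfolding of_nat_sum sum_subtractf[symmetric] using S(2) x False
    by (intro sum.cong) (auto simp: pole_def v_inverse)
  ultimately have "int (height (inverse x)) - int (height x) = 0" using product_formula[OF x False] unfolding S_def by metis
  then show ?thesis by linarith
qed simp

lemma height_k: "x \<in> k \<Longrightarrow> height x = 0"
  unfolding height_def using v_k[of _ x] by (auto simp: pole_def)

lemma height_0_k: assumes "x \<in> K" "height x = 0" shows "x \<in> k"
proof (cases "x = 0")
  case False
  have "pole x w = 0" if "w \<in> W" for w
  proof (rule ccontr)
    assume "pole x w \<noteq> 0"
    then have "pole x w \<le> height x" unfolding height_def using that finite_poles[OF assms(1)]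
      by (intro member_le_sum) auto
    then show False using assms(2) \<open>pole x w \<noteq> 0\<close> by simp
  qed
  then show ?thesis using integral_const[OF assms(1) False] False unfolding pole_def by (metis diff_zero nat_0_iff neg_le_0_iff_le nat_eq_iff2 minus_le_iff neg_0_le_iff_le)
qed (use kc in simp)

lemma height_uminus: assumes "x \<in> K" shows "height (- x) = height x"
proof -
  have "pole (- x) w = pole x w" if "w \<in> W" for w using assms that by (simp add: pole_def v_uminus)
  then show ?thesis unfolding height_def by (intro sum.cong) auto
qed

text \<open>New poles arise only in \<open>Wb\<close>; elsewhere an existing pole grows by at most
  \<open>c0\<close>, hence by at most \<open>c0\<close> times its order.\<close>

lemma height_D: assumes x: "x \<in> K" shows "height (D x) \<le> (1 + nat c0) * height x + nat c0 * card Wb"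
proof -
  have "pole (D x) w \<le> (1 + nat c0) * pole x w + (if w \<in> Wb then nat c0 else 0)" if w: "w \<in> W" for w
  proof (cases "D x = 0")
    case False
    then have x0: "x \<noteq> 0" using D_const[OF kc(1)] by auto
    have 1: "v w (D x) \<ge> v w x - c0" by (rule v_D[OF w x False])
    show ?thesis
    proof (cases "pole x w = 0 \<and> w \<notin> Wb")
      case True
      then have "v w (D x) \<ge> 0" using v_D_integral[of w x] w x False x0 unfolding pole_def by auto
      then show ?thesis unfolding pole_def by simp
    next
      case F: False
      have "pole (D x) w \<le> pole x w + nat c0" using 1 c0 False x0 unfolding pole_def by simp
      also have "\<dots> \<le> (1 + nat c0) * pole x w + (if w \<in> Wb then nat c0 else 0)" using F by (cases "pole x w") auto
      finally show ?thesis .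
    qed
  qed (simp add: pole_def)
  then show ?thesis using height_le[of "D x" "{()}" "\<lambda>_. x" Wb "\<lambda>_. 1 + nat c0" "nat c0"] x D_K Wb(1) by simp
qed

text \<open>Zeros are poles of the inverse, which has the same height. With this inequality the
  auxiliary function argument reaches its contradiction.\<close>

lemma card_order_ge:
  assumes "x \<in> K" "x \<noteq> 0" "S \<subseteq> W" "\<And>w. w \<in> S \<Longrightarrow> v w x \<ge> int m" "m > 0"
  shows "finite S \<and> m * card S \<le> height x"
proof -
  have "S \<subseteq> {w\<in>W. v w x \<noteq> 0}" using assms by force
  then have fS: "finite S" using v_finite[OF assms(1,2)] finite_subset by blast
  have "height (inverse x) = (\<Sum>w\<in>S \<union> {w\<in>W. pole (inverse x) w \<noteq> 0}. pole (inverse x) w)"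
    using fS assms(3) finite_poles[OF Kc(6)[OF assms(1)]] by (intro height_eq Kc assms) auto
  also have "\<dots> \<ge> (\<Sum>w\<in>S. pole (inverse x) w)"
    using fS finite_poles[OF Kc(6)[OF assms(1)]] by (intro sum_mono2) auto
  finally have 1: "(\<Sum>w\<in>S. pole (inverse x) w) \<le> height x" using height_inverse[OF assms(1)] by simp
  have "m * card S = (\<Sum>w\<in>S. m)" by simp
  also have "\<dots> \<le> (\<Sum>w\<in>S. pole (inverse x) w)"
  proof (rule sum_mono)
    fix w assume w: "w \<in> S"
    then show "m \<le> pole (inverse x) w" using assms(4)[OF w] assms(1-3) unfolding pole_def by (auto simp: v_inverse subset_iff)
  qed
  finally show ?thesis using 1 fS by simp
qed

lemma card_poles_le: assumes "x \<in> K" shows "finite {w\<in>W. pole x w \<noteq> 0}" "card {w\<in>W. pole x w \<noteq> 0} \<le> height x"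
proof -
  show "finite {w\<in>W. pole x w \<noteq> 0}" by (rule finite_poles[OF assms])
  then have "card {w\<in>W. pole x w \<noteq> 0} = (\<Sum>w | w \<in> W \<and> pole x w \<noteq> 0. 1)" by simp
  also have "\<dots> \<le> height x" unfolding height_def by (intro sum_mono) auto
  finally show "card {w\<in>W. pole x w \<noteq> 0} \<le> height x" .
qed

end

section \<open>Exponentials over the field of small elements\<close>

context valued_function_field begin

text \<open>Zero is treated as having infinite order; the value \<open>v w 0\<close> itself carries
  no meaning.\<close>

definition vge :: "'w \<Rightarrow> int \<Rightarrow> 'a \<Rightarrow> bool" where "vge w m x \<longleftrightarrow> x = 0 \<or> v w x \<ge> m"

lemma vge_add: "w \<in> W \<Longrightarrow> x \<in> K \<Longrightarrow> y \<in> K \<Longrightarrow> vge w m x \<Longrightarrow> vge w m y \<Longrightarrow> vge w m (x + y)"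
  using v_add[of w x y] unfolding vge_def by force

lemma vge_uminus: "w \<in> W \<Longrightarrow> x \<in> K \<Longrightarrow> vge w m x \<Longrightarrow> vge w m (- x)"
  by (cases "x = 0") (auto simp: vge_def v_uminus)

lemma vge_mult: "w \<in> W \<Longrightarrow> x \<in> K \<Longrightarrow> y \<in> K \<Longrightarrow> vge w m x \<Longrightarrow> vge w n y \<Longrightarrow> vge w (m + n) (x * y)"
  by (cases "x = 0 \<or> y = 0") (auto simp: vge_def v_mult)

lemma vge_sum: "w \<in> W \<Longrightarrow> (\<And>i. i \<in> A \<Longrightarrow> f i \<in> K \<and> vge w m (f i)) \<Longrightarrow> vge w m (sum f A)"
proof (induction A rule: infinite_finite_induct)
  case (insert a A)
  then show ?case using subfield_sum[OF Ks, of A f] by (auto intro!: vge_add)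
qed (auto simp: vge_def)

lemma pole_0_iff: "pole x w = 0 \<longleftrightarrow> vge w 0 x"
  unfolding pole_def vge_def by auto

text \<open>Gauss's lemma for monic polynomials: take the lowest index at which each factor attains
  its minimal order.\<close>
lemma gauss_monic:
  assumes w: "w \<in> W" and p: "poly_over K p" "lead_coeff p = 1" and q: "poly_over K q" "lead_coeff q = 1"
    and pq: "\<And>i. vge w 0 (coeff (p * q) i)"
  shows "vge w 0 (coeff p i)"
proof -
  have minimal: "\<exists>m i0. m \<le> 0 \<and> coeff p i0 \<noteq> 0 \<and> v w (coeff p i0) = m \<and> (\<forall>i. vge w m (coeff p i)) \<and> (\<forall>i<i0. vge w (m + 1) (coeff p i))"
    if p: "lead_coeff p = 1" for p
  proof -
    define S where "S = {i. coeff p i \<noteq> 0}"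
    have "S \<subseteq> {..degree p}" unfolding S_def by (auto simp: le_degree)
    then have fS: "finite S" by (rule finite_subset) simp
    have dS: "degree p \<in> S" unfolding S_def using p by auto
    define m where "m = Min ((\<lambda>i. v w (coeff p i)) ` S)"
    have mle: "m \<le> v w (coeff p i)" if "i \<in> S" for i unfolding m_def using fS that by simp
    have "m \<in> (\<lambda>i. v w (coeff p i)) ` S" unfolding m_def using fS dS by (intro Min_in) auto
    then have ex: "\<exists>i. i \<in> S \<and> v w (coeff p i) = m" by auto
    define i0 where "i0 = (LEAST i. i \<in> S \<and> v w (coeff p i) = m)"
    have i0: "i0 \<in> S" "v w (coeff p i0) = m" unfolding i0_def using LeastI_ex[OF ex] by auto
    have less: "vge w (m + 1) (coeff p i)" if "i < i0" for i
    proof -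
      have "\<not> (i \<in> S \<and> v w (coeff p i) = m)" using not_less_Least that unfolding i0_def by blast
      then show ?thesis using mle[of i] unfolding vge_def S_def by force
    qed
    have "m \<le> 0" using mle[OF dS] p v_1[OF w] by simp
    moreover have "vge w m (coeff p i)" for i using mle[of i] unfolding vge_def S_def by auto
    ultimately show ?thesis using i0 less unfolding S_def by blast
  qed
  obtain m i0 where 1: "m \<le> 0" "coeff p i0 \<noteq> 0" "v w (coeff p i0) = m" "\<And>i. vge w m (coeff p i)" "\<And>i. i < i0 \<Longrightarrow> vge w (m + 1) (coeff p i)"
    using minimal[OF p(2)] by blast
  obtain n j0 where 2: "n \<le> 0" "coeff q j0 \<noteq> 0" "v w (coeff q j0) = n" "\<And>i. vge w n (coeff q i)" "\<And>i. i < j0 \<Longrightarrow> vge w (n + 1) (coeff q i)"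
    using minimal[OF q(2)] by blast
  have pK: "coeff p i \<in> K" and qK: "coeff q i \<in> K" for i using p q by (auto simp: poly_over_def)
  \<comment> \<open>The coefficient of the product at \<open>i0 + j0\<close> contains exactly one
    term of order \<open>m + n\<close>, all others having larger order, so a negative
    \<open>m + n\<close> would be visible in it. As \<open>m\<close> and \<open>n\<close> are at
    most 0, both then vanish.\<close>
  have "m + n \<ge> 0"
  proof (rule ccontr)
    assume neg: "\<not> ?thesis"
    define f where "f i = coeff p i * coeff q (i0 + j0 - i)" for i
    have fK: "f i \<in> K" for i unfolding f_def using pK qK Kc(5) by blast
    have sum: "coeff (p * q) (i0 + j0) = f i0 + (\<Sum>i\<in>{..i0 + j0} - {i0}. f i)"
      unfolding coeff_mult f_def by (simp add: sum.remove[of _ i0])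
    have "vge w (m + n + 1) (f i)" if "i \<in> {..i0 + j0} - {i0}" for i
    proof (cases "i < i0")
      case True
      show ?thesis unfolding f_def using vge_mult[OF w pK qK 1(5)[OF True] 2(4)] by (simp add: algebra_simps)
    next
      case False
      then have "i0 + j0 - i < j0" using that by auto
      then show ?thesis unfolding f_def using vge_mult[OF w pK qK 1(4) 2(5)] by (simp add: algebra_simps)
    qed
    then have rest: "vge w (m + n + 1) (\<Sum>i\<in>{..i0 + j0} - {i0}. f i)" using fK by (intro vge_sum[OF w]) auto
    have tot: "vge w (m + n + 1) (coeff (p * q) (i0 + j0))" using pq[of "i0 + j0"] neg unfolding vge_def by auto
    have K1: "coeff (p * q) (i0 + j0) \<in> K" "(\<Sum>i\<in>{..i0 + j0} - {i0}. f i) \<in> K"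
      using poly_over_mult[OF Ks p(1) q(1)] subfield_sum[OF Ks fK] by (auto simp: poly_over_def)
    have "f i0 = coeff (p * q) (i0 + j0) + - (\<Sum>i\<in>{..i0 + j0} - {i0}. f i)" unfolding sum by simp
    then have "vge w (m + n + 1) (f i0)" using vge_add[OF w K1(1) Kc(7)[OF K1(2)] tot vge_uminus[OF w K1(2) rest]] by simp
    moreover have "v w (f i0) = m + n" "f i0 \<noteq> 0" unfolding f_def using v_mult[OF w pK qK] 1 2 by auto
    ultimately show False unfolding vge_def by simp
  qed
  then show ?thesis using 1(1) 1(4)[of i] 2(1) unfolding vge_def by auto
qed

lemma D_0: "D 0 = 0" using D_const kc(1) by blast

lemma D_power: assumes "g \<in> K" "g \<noteq> 0" shows "D (g ^ n) = of_nat n * (D g / g) * g ^ n"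
proof (induction n)
  case (Suc n)
  then show ?case using D_mult[OF assms(1) subfield_power[OF Ks assms(1)], of n] assms by (simp add: field_simps)
qed (simp add: D_const kc)

end

section \<open>Exponentials along a sequence and the small field\<close>

locale exp_ring = valued_function_field k K W Wb v D c0
  for k K :: "'a::field_char_0 set" and W Wb :: "'w set" and v D c0 +
  fixes \<nu> :: "nat \<Rightarrow> nat" and \<Gamma> :: "'a set"
  assumes nu: "strict_mono \<nu>" and \<Gamma>K: "\<Gamma> \<subseteq> K" and \<Gamma>0: "0 \<notin> \<Gamma>" and \<Gamma>1: "1 \<in> \<Gamma>"
    and \<Gamma>m: "x \<in> \<Gamma> \<Longrightarrow> y \<in> \<Gamma> \<Longrightarrow> x * y \<in> \<Gamma>" and \<Gamma>i: "x \<in> \<Gamma> \<Longrightarrow> inverse x \<in> \<Gamma>" and \<Gamma>k: "\<Gamma> \<inter> k \<subseteq> {1}"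
begin

lemma nu_large: "eventually (\<lambda>i. c \<le> \<nu> i) UF"
proof -
  have "eventually (\<lambda>i. c \<le> \<nu> i) sequentially"
    using eventually_ge_at_top[of c] by eventually_elim (use strict_mono_imp_increasing[OF nu] le_trans in blast)
  then show ?thesis using UF(2) filter_leD by blast
qed

text \<open>The height of \<open>f i\<close> is o(\<open>\<nu> i\<close>) along the ultrafilter,
  expressed without division.\<close>

definition small :: "(nat \<Rightarrow> 'a) \<Rightarrow> bool" where
  "small f \<longleftrightarrow> (\<forall>i. f i \<in> K) \<and> (\<forall>q. eventually (\<lambda>i. q * height (f i) \<le> \<nu> i) UF)"

lemma smallD: "small f \<Longrightarrow> f i \<in> K" unfolding small_def by auto

lemma small_bounded:
  assumes g: "small g1" "small g2" and f: "\<And>i. f i \<in> K"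
    and le: "\<And>i. height (f i) \<le> a * height (g1 i) + b * height (g2 i) + c"
  shows "small f"
  unfolding small_def
proof (intro conjI allI f)
  fix q
  \<comment> \<open>The factor 3 shares \<open>\<nu> i\<close> among the three summands of the
    bound.\<close>
  have "eventually (\<lambda>i. 3 * (q * a) * height (g1 i) \<le> \<nu> i) UF" "eventually (\<lambda>i. 3 * (q * b) * height (g2 i) \<le> \<nu> i) UF"
    using g unfolding small_def by blast+
  moreover have "eventually (\<lambda>i. 3 * q * c \<le> \<nu> i) UF" by (rule nu_large)
  ultimately show "eventually (\<lambda>i. q * height (f i) \<le> \<nu> i) UF"
  proof eventually_elim
    case (elim i)
    have "3 * (q * height (f i)) \<le> 3 * (q * (a * height (g1 i) + b * height (g2 i) + c))" using le[of i] by simp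
    also have "\<dots> = 3 * (q * a) * height (g1 i) + 3 * (q * b) * height (g2 i) + 3 * q * c" by (simp add: algebra_simps)
    also have "\<dots> \<le> 3 * \<nu> i" using elim by simp
    finally show ?case by simp
  qed
qed

lemma small_const: "c \<in> K \<Longrightarrow> small (\<lambda>_. c)"
  unfolding small_def using nu_large by auto

lemma small_k: "(\<And>i. f i \<in> k) \<Longrightarrow> small f"
  unfolding small_def using kK by (auto simp: height_k)

lemma small_add: assumes "small f" "small g" shows "small (\<lambda>i. f i + g i)"
  by (rule small_bounded[OF assms, of _ 1 1 0]) (use assms in \<open>auto simp: height_add smallD Kc\<close>)

lemma small_mult: assumes "small f" "small g" shows "small (\<lambda>i. f i * g i)"
  by (rule small_bounded[OF assms, of _ 1 1 0]) (use assms in \<open>auto simp: height_mult smallD Kc\<close>)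

lemma small_uminus: assumes "small f" shows "small (\<lambda>i. - f i)"
  by (rule small_bounded[OF assms assms, of _ 1 0 0]) (use assms in \<open>auto simp: height_uminus smallD Kc\<close>)

lemma small_inverse: assumes "small f" shows "small (\<lambda>i. inverse (f i))"
  by (rule small_bounded[OF assms assms, of _ 1 0 0]) (use assms in \<open>auto simp: height_inverse smallD Kc\<close>)

lemma small_D: assumes "small f" shows "small (\<lambda>i. D (f i))"
  by (rule small_bounded[OF assms assms, of _ "1 + nat c0" 0 "nat c0 * card Wb"])
    (use assms height_D in \<open>auto simp: smallD D_K\<close>)

lemma small_sum: "(\<And>j. j \<in> A \<Longrightarrow> small (f j)) \<Longrightarrow> small (\<lambda>i. \<Sum>j\<in>A. f j i)"
  by (induction A rule: infinite_finite_induct) (auto simp: small_const Kc small_add)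

lemma small_power: "small f \<Longrightarrow> small (\<lambda>i. f i ^ n)"
  by (induction n) (auto simp: small_const Kc small_mult)

text \<open>Integers lie in \<open>k\<close> and have height 0, so the growing argument
  \<open>\<nu> i\<close> costs nothing.\<close>

lemma small_poly: "poly_over K p \<Longrightarrow> small (\<lambda>i. poly p (of_nat (\<nu> i)))"
  unfolding poly_altdef
  by (intro small_sum small_mult small_const small_power small_k subfield_of_nat[OF ks]) (auto simp: poly_over_def)

text \<open>\<open>Kst\<close> is the ultrapower of \<open>K\<close> inside that of the ambient
  field; \<open>Sm\<close>, defined next, is the field \<open>F\<close> of the overview.\<close>

definition Kst where "Kst = {star f | f. \<forall>i. f i \<in> K}"
definition Sm where "Sm = {star f | f. small f}"

lemma KstI: "(\<And>i. f i \<in> K) \<Longrightarrow> star f \<in> Kst" unfolding Kst_def by auto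
lemma SmI: "small f \<Longrightarrow> star f \<in> Sm" unfolding Sm_def by auto
lemma KstE: assumes "z \<in> Kst" obtains f where "z = star f" "\<And>i. f i \<in> K" using assms unfolding Kst_def by auto
lemma SmE: assumes "z \<in> Sm" obtains f where "z = star f" "small f" using assms unfolding Sm_def by auto
lemma Sm_Kst: "Sm \<subseteq> Kst" unfolding Sm_def Kst_def small_def by auto

lemma Kst: "is_subfield Kst"
  unfolding is_subfield_def
proof (intro conjI ballI)
  show "0 \<in> Kst" "1 \<in> Kst" unfolding star_arith(7,8) by (auto intro!: KstI Kc)
  fix x assume "x \<in> Kst"
  then obtain f where f: "x = star f" "\<And>i. f i \<in> K" using KstE by blast
  show "inverse x \<in> Kst" unfolding f star_arith using f by (auto intro!: KstI Kc)
  fix y assume "y \<in> Kst"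
  then obtain g where g: "y = star g" "\<And>i. g i \<in> K" using KstE by blast
  show "x + y \<in> Kst" "x - y \<in> Kst" "x * y \<in> Kst" unfolding f g star_arith using f g by (auto intro!: KstI Kc)
qed

lemma Sm: "is_subfield Sm"
  unfolding is_subfield_def
proof (intro conjI ballI)
  show "0 \<in> Sm" "1 \<in> Sm" unfolding star_arith(7,8) by (auto intro!: SmI small_const Kc)
  fix x assume "x \<in> Sm"
  then obtain f where f: "x = star f" "small f" by (rule SmE)
  show "inverse x \<in> Sm" unfolding f star_arith using f by (auto intro!: SmI small_inverse)
  fix y assume "y \<in> Sm"
  then obtain g where g: "y = star g" "small g" by (rule SmE)
  show "x + y \<in> Sm" "x * y \<in> Sm" unfolding f g star_arith using f g
    by (auto intro!: SmI small_add small_mult)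
  have "star (\<lambda>i. f i + - g i) \<in> Sm" by (intro SmI small_add small_uminus f g)
  then show "x - y \<in> Sm" unfolding f g star_arith by simp
qed

lemmas Sc = subfieldD[OF Sm]
lemmas Kstc = subfieldD[OF Kst]

abbreviation dst where "dst \<equiv> ultra_map D"

lemma dst_Kst: "z \<in> Kst \<Longrightarrow> dst z \<in> Kst" by (erule KstE) (auto simp: ultra_map_star intro!: KstI D_K)
lemma dst_Sm: "z \<in> Sm \<Longrightarrow> dst z \<in> Sm" by (erule SmE) (auto simp: ultra_map_star intro!: SmI small_D)

lemma dst_add: assumes "x \<in> Kst" "y \<in> Kst" shows "dst (x + y) = dst x + dst y"
proof -
  obtain f where f: "x = star f" "\<And>i. f i \<in> K" by (rule KstE[OF assms(1)]) (rule that)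
  obtain g where g: "y = star g" "\<And>i. g i \<in> K" by (rule KstE[OF assms(2)]) (rule that)
  show ?thesis unfolding f g star_arith ultra_map_star using D_add f g by simp
qed

lemma dst_mult: assumes "x \<in> Kst" "y \<in> Kst" shows "dst (x * y) = x * dst y + dst x * y"
proof -
  obtain f where f: "x = star f" "\<And>i. f i \<in> K" by (rule KstE[OF assms(1)]) (rule that)
  obtain g where g: "y = star g" "\<And>i. g i \<in> K" by (rule KstE[OF assms(2)]) (rule that)
  show ?thesis unfolding f g star_arith ultra_map_star using D_mult f g by simp
qed

lemma dst_0: "dst 0 = 0" unfolding star_arith(7) ultra_map_star by (simp add: D_0)

lemma dst_sum: "(\<And>i. i \<in> A \<Longrightarrow> f i \<in> Kst) \<Longrightarrow> dst (sum f A) = (\<Sum>i\<in>A. dst (f i))"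
  by (induction A rule: infinite_finite_induct) (auto simp: dst_0 dst_add subfield_sum[OF Kst])

lemma dst_divide: assumes "x \<in> Kst" "y \<in> Kst" "y \<noteq> 0" shows "dst (x / y) = (dst x - (x / y) * dst y) / y"
  using dst_mult[OF Kstc(8)[OF assms(1,2)] assms(2)] assms(3) by (simp add: field_simps)

text \<open>What the derivation kills is represented by constants from \<open>k\<close>, and these
  have height 0.\<close>

lemma dst_zero_Sm: assumes "z \<in> Kst" "dst z = 0" shows "z \<in> Sm"
proof -
  obtain f where f: "z = star f" "\<And>i. f i \<in> K" by (rule KstE[OF assms(1)]) (rule that)
  have "eventually (\<lambda>i. D (f i) = 0) UF" using assms(2) unfolding f ultra_map_star star_0_iff .
  then have ev: "eventually (\<lambda>i. f i \<in> k) UF" by (rule eventually_mono) (use D_zero f in blast)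
  define g where "g i = (if f i \<in> k then f i else 0)" for i
  have "z = star g" unfolding f star_eq_iff g_def using ev by (rule eventually_mono) auto
  moreover have "small g" by (rule small_k) (auto simp: g_def kc)
  ultimately show ?thesis using SmI by auto
qed

text \<open>\<open>chi g\<close> is the exponential with base \<open>g\<close> read along the
  sequence; \<open>om g\<close> is its logarithmic derivative, small because the factor
  \<open>\<nu> i\<close> has height 0.\<close>

definition chi :: "'a \<Rightarrow> 'a ultra" where "chi g = star (\<lambda>i. g ^ \<nu> i)"
definition om :: "'a \<Rightarrow> 'a ultra" where "om g = star (\<lambda>i. of_nat (\<nu> i) * (D g / g))"

lemma chi_mult: "chi (g * h) = chi g * chi h" unfolding chi_def star_arith by (simp add: power_mult_distrib)
lemma chi_1: "chi 1 = 1" unfolding chi_def star_arith by simp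
lemma chi_inverse: "chi (inverse g) = inverse (chi g)" unfolding chi_def star_arith by (simp add: power_inverse)
lemma chi_divide: "chi (g / h) = chi g / chi h" by (simp add: divide_inverse chi_mult chi_inverse)
lemma chi_power: "chi (g ^ n) = chi g ^ n" by (induction n) (auto simp: chi_1 chi_mult)
lemma chi_nz: "g \<noteq> 0 \<Longrightarrow> chi g \<noteq> 0" unfolding chi_def star_0_iff by (auto dest: UF_ex)
lemma chi_Kst: "g \<in> K \<Longrightarrow> chi g \<in> Kst" unfolding chi_def by (intro KstI subfield_power[OF Ks])
lemma om_Sm: assumes "g \<in> K" shows "om g \<in> Sm" unfolding om_def
  by (intro SmI small_mult small_const small_k subfield_of_nat[OF ks] Kc(8) D_K assms)
lemma dst_chi: "g \<in> K \<Longrightarrow> g \<noteq> 0 \<Longrightarrow> dst (chi g) = om g * chi g"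
  unfolding chi_def om_def ultra_map_star star_arith by (simp add: D_power)

text \<open>The height of \<open>g^n\<close> is exactly \<open>n\<close> times that of
  \<open>g\<close>, so smallness forces height 0.\<close>

lemma chi_Sm: assumes g: "g \<in> K" "g \<noteq> 0" "chi g \<in> Sm" shows "g \<in> k"
proof -
  obtain f where f: "chi g = star f" "small f" by (rule SmE[OF g(3)])
  have "eventually (\<lambda>i. g ^ \<nu> i = f i) UF" using f(1) unfolding chi_def star_eq_iff .
  moreover have "eventually (\<lambda>i. 2 * height (f i) \<le> \<nu> i) UF" using f(2) unfolding small_def by blast
  moreover have "eventually (\<lambda>i. 1 \<le> \<nu> i) UF" by (rule nu_large)
  ultimately have "eventually (\<lambda>i. height g = 0) UF"
  proof eventually_elim
    case (elim i)
    then have "2 * (\<nu> i * height g) \<le> \<nu> i" using height_power[OF g(1,2), of "\<nu> i"] by simp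
    then show ?case using elim(3) by (cases "height g") auto
  qed
  then have "height g = 0" by (auto dest: UF_ex)
  then show ?thesis using height_0_k g by blast
qed

text \<open>Artin's argument: apply the derivation to a shortest relation.\<close>
lemma chi_independent_nonzero:
  assumes "finite S" "S \<subseteq> \<Gamma>" "\<And>g. g \<in> S \<Longrightarrow> c g \<in> Sm \<and> c g \<noteq> 0" "(\<Sum>g\<in>S. c g * chi g) = 0"
  shows "S = {}"
  using assms
proof (induction "card S" arbitrary: S c rule: less_induct)
  case less
  show ?case
  proof (rule ccontr)
    assume "S \<noteq> {}"
    then obtain a where a: "a \<in> S" by blast
    have gK: "g \<in> K" "g \<noteq> 0" if "g \<in> S" for g using that less.prems(2) \<Gamma>K \<Gamma>0 by auto
    have cK: "c g \<in> Kst" if "g \<in> S" for g using less.prems(3)[OF that] Sm_Kst by auto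
    define z where "z g = c g * chi g" for g
    have zK: "z g \<in> Kst" "z g \<noteq> 0" if "g \<in> S" for g
      unfolding z_def using that gK chi_Kst chi_nz cK Kstc(5) less.prems(3) by auto
    define l where "l g = dst (c g) / c g + om g" for g
    have lS: "l g \<in> Sm" if "g \<in> S" for g unfolding l_def using that less.prems(3) om_Sm gK dst_Sm Sc(3,8) by auto
    have dz: "dst (z g) = l g * z g" if "g \<in> S" for g
      unfolding z_def l_def using that gK dst_mult[OF cK chi_Kst] less.prems(3) by (simp add: dst_chi field_simps)
    have s0: "(\<Sum>g\<in>S. z g) = 0" using less.prems(4) unfolding z_def .
    then have "dst (\<Sum>g\<in>S. z g) = 0" using dst_0 by simp
    then have "(\<Sum>g\<in>S. l g * z g) = 0" using zK dz by (simp add: dst_sum)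
    \<comment> \<open>Subtracting \<open>l a\<close> times the relation removes the term at
      \<open>a\<close>, so by induction no term has \<open>l g\<close> different from
      \<open>l a\<close>.\<close>
    then have "(\<Sum>g\<in>S. (l g - l a) * z g) = 0" using s0 by (simp add: left_diff_distrib sum_subtractf flip: sum_distrib_left)
    then have 1: "(\<Sum>g\<in>S. ((l g - l a) * c g) * chi g) = 0" unfolding z_def by (simp add: mult.assoc)
    define S' where "S' = {g\<in>S. l g \<noteq> l a}"
    have "(\<Sum>g\<in>S'. ((l g - l a) * c g) * chi g) = 0"
    proof -
      have "(\<Sum>g\<in>S'. ((l g - l a) * c g) * chi g) = (\<Sum>g\<in>S. ((l g - l a) * c g) * chi g)"
        unfolding S'_def using less.prems(1) by (intro sum.mono_neutral_left) auto
      then show ?thesis using 1 by simp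
    qed
    moreover have "card S' < card S" unfolding S'_def using less.prems(1) a by (intro psubset_card_mono) auto
    moreover have "(l g - l a) * c g \<in> Sm \<and> (l g - l a) * c g \<noteq> 0" if "g \<in> S'" for g
      using that lS a less.prems(3) Sc(4,5) unfolding S'_def by auto
    moreover have "finite S'" "S' \<subseteq> \<Gamma>" unfolding S'_def using less.prems(1,2) by auto
    ultimately have "S' = {}" by (intro less.hyps[of S' "\<lambda>g. (l g - l a) * c g"]) (assumption | blast)+
    have "g = a" if g: "g \<in> S" for g
    proof -
      have "l g = l a" using \<open>S' = {}\<close> g unfolding S'_def by auto
      \<comment> \<open>Equal logarithmic derivatives: the quotient is killed by the derivation,
        hence small. So \<open>chi (g / a)\<close> is small, \<open>g / a\<close> is constant, and
        as an element of \<open>\<Gamma>\<close> it is 1.\<close>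
      then have "dst (z g / z a) = 0" using dst_divide[OF zK(1)[OF g] zK(1)[OF a] zK(2)[OF a]] dz[OF g] dz[OF a] by simp
      then have za: "z g / z a \<in> Sm" by (intro dst_zero_Sm Kstc(8) zK g a)
      have "c a / c g \<in> Sm" using less.prems(3)[OF g] less.prems(3)[OF a] Sc(8) by blast
      with za have "(z g / z a) * (c a / c g) \<in> Sm" by (rule Sc(5))
      also have "(z g / z a) * (c a / c g) = chi (g / a)" unfolding z_def chi_divide using less.prems(3) g a by (simp add: field_simps)
      finally have "g / a \<in> k" using chi_Sm gK[OF g] gK[OF a] Kc(8) by auto
      moreover have "g / a \<in> \<Gamma>" unfolding divide_inverse using g a less.prems(2) \<Gamma>m \<Gamma>i by blast
      ultimately show ?thesis using \<Gamma>k gK[OF a] by auto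
    qed
    then have "S = {a}" using a by blast
    then show False using s0 zK(2)[OF a] by simp
  qed
qed

lemma chi_independent:
  assumes "finite S" "S \<subseteq> \<Gamma>" "\<And>g. g \<in> S \<Longrightarrow> c g \<in> Sm" "(\<Sum>g\<in>S. c g * chi g) = 0" "g \<in> S"
  shows "c g = 0"
proof -
  have "(\<Sum>g\<in>{g\<in>S. c g \<noteq> 0}. c g * chi g) = 0"
  proof -
    have "(\<Sum>g\<in>{g\<in>S. c g \<noteq> 0}. c g * chi g) = (\<Sum>g\<in>S. c g * chi g)"
      using assms(1) by (intro sum.mono_neutral_left) auto
    then show ?thesis using assms(4) by simp
  qed
  then have "{g\<in>S. c g \<noteq> 0} = {}" using assms by (intro chi_independent_nonzero[of _ c]) auto
  then show ?thesis using assms(5) by auto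
qed

section \<open>Integrality and vanishing at all but o(n) places\<close>

definition ae :: "(nat \<Rightarrow> 'w \<Rightarrow> bool) \<Rightarrow> bool" where
  "ae \<Phi> \<longleftrightarrow> (\<forall>q. eventually (\<lambda>i. finite {w\<in>W. \<not> \<Phi> i w} \<and> q * card {w\<in>W. \<not> \<Phi> i w} \<le> \<nu> i) UF)"

lemma ae_mono:
  assumes "ae \<Phi>" "eventually (\<lambda>i. \<forall>w\<in>W. \<Phi> i w \<longrightarrow> \<Psi> i w) UF" shows "ae \<Psi>"
  unfolding ae_def
proof
  fix q
  have "eventually (\<lambda>i. finite {w\<in>W. \<not> \<Phi> i w} \<and> q * card {w\<in>W. \<not> \<Phi> i w} \<le> \<nu> i) UF" using assms(1) unfolding ae_def by blast
  with assms(2) show "eventually (\<lambda>i. finite {w\<in>W. \<not> \<Psi> i w} \<and> q * card {w\<in>W. \<not> \<Psi> i w} \<le> \<nu> i) UF"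
  proof eventually_elim
    case (elim i)
    then have sub: "{w\<in>W. \<not> \<Psi> i w} \<subseteq> {w\<in>W. \<not> \<Phi> i w}" by auto
    then have "q * card {w\<in>W. \<not> \<Psi> i w} \<le> q * card {w\<in>W. \<not> \<Phi> i w}" using elim by (intro mult_left_mono card_mono) auto
    then show ?case using elim sub finite_subset by (meson le_trans)
  qed
qed

lemma ae_conj:
  assumes "ae \<Phi>" "ae \<Psi>" shows "ae (\<lambda>i w. \<Phi> i w \<and> \<Psi> i w)"
  unfolding ae_def
proof
  fix q
  have "eventually (\<lambda>i. finite {w\<in>W. \<not> \<Phi> i w} \<and> (2 * q) * card {w\<in>W. \<not> \<Phi> i w} \<le> \<nu> i) UF"
    "eventually (\<lambda>i. finite {w\<in>W. \<not> \<Psi> i w} \<and> (2 * q) * card {w\<in>W. \<not> \<Psi> i w} \<le> \<nu> i) UF"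
    using assms unfolding ae_def by blast+
  then show "eventually (\<lambda>i. finite {w\<in>W. \<not> (\<Phi> i w \<and> \<Psi> i w)} \<and> q * card {w\<in>W. \<not> (\<Phi> i w \<and> \<Psi> i w)} \<le> \<nu> i) UF"
  proof eventually_elim
    case (elim i)
    have eq: "{w\<in>W. \<not> (\<Phi> i w \<and> \<Psi> i w)} = {w\<in>W. \<not> \<Phi> i w} \<union> {w\<in>W. \<not> \<Psi> i w}" by auto
    have "q * card {w\<in>W. \<not> (\<Phi> i w \<and> \<Psi> i w)} \<le> q * (card {w\<in>W. \<not> \<Phi> i w} + card {w\<in>W. \<not> \<Psi> i w})"
      unfolding eq by (intro mult_left_mono card_Un_le) auto
    also have "2 * \<dots> \<le> 2 * \<nu> i" using elim by (simp add: algebra_simps)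
    finally show ?case unfolding eq using elim by simp
  qed
qed

lemma ae_finite: "finite S \<Longrightarrow> ae (\<lambda>i w. w \<notin> S)"
  unfolding ae_def
proof
  fix q assume S: "finite S"
  have "card {w\<in>W. \<not> w \<notin> S} \<le> card S" using S by (intro card_mono) auto
  then have "eventually (\<lambda>i. q * card {w\<in>W. \<not> w \<notin> S} \<le> \<nu> i) UF" using nu_large by blast
  then show "eventually (\<lambda>i. finite {w\<in>W. \<not> w \<notin> S} \<and> q * card {w\<in>W. \<not> w \<notin> S} \<le> \<nu> i) UF"
    by (rule eventually_mono) (use S in auto)
qed

lemma ae_small: assumes "small f" shows "ae (\<lambda>i w. vge w 0 (f i))"
  unfolding ae_def
proof
  fix q
  have "eventually (\<lambda>i. q * height (f i) \<le> \<nu> i) UF" using assms unfolding small_def by blast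
  then show "eventually (\<lambda>i. finite {w\<in>W. \<not> vge w 0 (f i)} \<and> q * card {w\<in>W. \<not> vge w 0 (f i)} \<le> \<nu> i) UF"
  proof (rule eventually_mono)
    fix i assume a: "q * height (f i) \<le> \<nu> i"
    have "finite {w\<in>W. \<not> vge w 0 (f i)} \<and> card {w\<in>W. \<not> vge w 0 (f i)} \<le> height (f i)"
      using card_poles_le[OF smallD[OF assms]] unfolding pole_0_iff by auto
    then show "finite {w\<in>W. \<not> vge w 0 (f i)} \<and> q * card {w\<in>W. \<not> vge w 0 (f i)} \<le> \<nu> i"
      using a by (meson le_trans mult_le_mono2)
  qed
qed

text \<open>Both \<open>f\<close> and its inverse are small, hence both have few poles.\<close>

lemma ae_small_unit: assumes "small f" "star f \<noteq> 0" shows "ae (\<lambda>i w. f i \<noteq> 0 \<and> v w (f i) = 0)"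
proof (rule ae_mono[OF ae_conj[OF ae_small[OF assms(1)] ae_small[OF small_inverse[OF assms(1)]]]])
  have "eventually (\<lambda>i. f i \<noteq> 0) UF" using assms(2) unfolding star_0_iff UF_not .
  then show "eventually (\<lambda>i. \<forall>w\<in>W. vge w 0 (f i) \<and> vge w 0 (inverse (f i)) \<longrightarrow> f i \<noteq> 0 \<and> v w (f i) = 0) UF"
    by (rule eventually_mono) (use smallD[OF assms(1)] in \<open>auto simp: vge_def v_inverse\<close>)
qed

lemma ae_chi_unit: assumes "g \<in> K" "g \<noteq> 0" shows "ae (\<lambda>i w. v w (g ^ \<nu> i) = 0)"
  by (rule ae_mono[OF ae_finite[OF v_finite[OF assms]]]) (use assms in \<open>auto simp: v_power intro!: always_eventually\<close>)

text \<open>\<open>Aint\<close> collects elements integral at all but o(\<open>\<nu> i\<close>)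
  places. \<open>Van\<close>, defined next, asks for a zero on the moving set \<open>Z i\<close>
  with the same tolerance and behaves like an ideal towards \<open>Aint\<close>.\<close>

definition Aint where "Aint = {star f | f. (\<forall>i. f i \<in> K) \<and> ae (\<lambda>i w. vge w 0 (f i))}"

definition Van where "Van Z = {star f | f. (\<forall>i. f i \<in> K) \<and> ae (\<lambda>i w. w \<in> Z i \<longrightarrow> vge w 1 (f i))}"

lemma AintI: "(\<And>i. f i \<in> K) \<Longrightarrow> ae (\<lambda>i w. vge w 0 (f i)) \<Longrightarrow> star f \<in> Aint" unfolding Aint_def by auto
lemma VanI: "(\<And>i. f i \<in> K) \<Longrightarrow> ae (\<lambda>i w. w \<in> Z i \<longrightarrow> vge w 1 (f i)) \<Longrightarrow> star f \<in> Van Z" unfolding Van_def by auto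

lemma AintD: assumes "star f \<in> Aint" shows "ae (\<lambda>i w. vge w 0 (f i))"
proof -
  obtain g where g: "star f = star g" "ae (\<lambda>i w. vge w 0 (g i))" using assms unfolding Aint_def by auto
  show ?thesis by (rule ae_mono[OF g(2)]) (use g(1) in \<open>auto simp: star_eq_iff elim: eventually_mono\<close>)
qed

lemma VanD: assumes "star f \<in> Van Z" shows "ae (\<lambda>i w. w \<in> Z i \<longrightarrow> vge w 1 (f i))"
proof -
  obtain g where g: "star f = star g" "ae (\<lambda>i w. w \<in> Z i \<longrightarrow> vge w 1 (g i))" using assms unfolding Van_def by auto
  show ?thesis by (rule ae_mono[OF g(2)]) (use g(1) in \<open>auto simp: star_eq_iff elim: eventually_mono\<close>)
qed

lemma Aint_Kst: "Aint \<subseteq> Kst" unfolding Aint_def Kst_def by auto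
lemma Aint_add: assumes "x \<in> Aint" "y \<in> Aint" shows "x + y \<in> Aint"
  and Aint_mult: "x * y \<in> Aint"
proof -
  obtain f where f: "x = star f" "\<And>i. f i \<in> K" "ae (\<lambda>i w. vge w 0 (f i))" using assms(1) unfolding Aint_def by auto
  obtain g where g: "y = star g" "\<And>i. g i \<in> K" "ae (\<lambda>i w. vge w 0 (g i))" using assms(2) unfolding Aint_def by auto
  show "x + y \<in> Aint" unfolding f(1) g(1) star_arith
    by (rule AintI[OF _ ae_mono[OF ae_conj[OF f(3) g(3)]]]) (use f g in \<open>auto intro!: Kc vge_add always_eventually\<close>)
  show "x * y \<in> Aint" unfolding f(1) g(1) star_arith
  proof (rule AintI[OF _ ae_mono[OF ae_conj[OF f(3) g(3)]]])
    show "eventually (\<lambda>i. \<forall>w\<in>W. vge w 0 (f i) \<and> vge w 0 (g i) \<longrightarrow> vge w 0 (f i * g i)) UF"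
      using vge_mult[of _ "f _" "g _" 0 0] f g by (intro always_eventually) auto
  qed (use f g in \<open>auto intro!: Kc\<close>)
qed

lemma Sm_Aint: "Sm \<subseteq> Aint" unfolding Sm_def by (auto intro!: AintI ae_small smallD)

lemma chi_Aint: assumes "g \<in> K" "g \<noteq> 0" shows "chi g \<in> Aint" unfolding chi_def
  by (rule AintI[OF _ ae_mono[OF ae_chi_unit[OF assms]]]) (use assms in \<open>auto simp: vge_def intro!: always_eventually subfield_power[OF Ks]\<close>)

lemma Aint_sum: "(\<And>i. i \<in> A \<Longrightarrow> f i \<in> Aint) \<Longrightarrow> sum f A \<in> Aint"
  using Sm_Aint Sc(1) by (induction A rule: infinite_finite_induct) (auto intro: Aint_add)

lemma Aint_power: "x \<in> Aint \<Longrightarrow> x ^ n \<in> Aint"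
  using Sm_Aint Sc(2) by (induction n) (auto intro: Aint_mult)

lemma Aint_poly: "poly_over Aint p \<Longrightarrow> x \<in> Aint \<Longrightarrow> poly p x \<in> Aint"
  unfolding poly_altdef by (intro Aint_sum Aint_mult Aint_power) (auto simp: poly_over_def)

lemma Van_add: assumes "x \<in> Van Z" "y \<in> Van Z" shows "x + y \<in> Van Z"
proof -
  obtain f where f: "x = star f" "\<And>i. f i \<in> K" "ae (\<lambda>i w. w \<in> Z i \<longrightarrow> vge w 1 (f i))" using assms(1) unfolding Van_def by auto
  obtain g where g: "y = star g" "\<And>i. g i \<in> K" "ae (\<lambda>i w. w \<in> Z i \<longrightarrow> vge w 1 (g i))" using assms(2) unfolding Van_def by auto
  show ?thesis unfolding f(1) g(1) star_arith
    by (rule VanI[OF _ ae_mono[OF ae_conj[OF f(3) g(3)]]]) (use f g in \<open>auto intro!: Kc vge_add always_eventually\<close>)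
qed

lemma Van_mult: assumes "x \<in> Aint" "y \<in> Van Z" shows "x * y \<in> Van Z"
proof -
  obtain f where f: "x = star f" "\<And>i. f i \<in> K" "ae (\<lambda>i w. vge w 0 (f i))" using assms(1) unfolding Aint_def by auto
  obtain g where g: "y = star g" "\<And>i. g i \<in> K" "ae (\<lambda>i w. w \<in> Z i \<longrightarrow> vge w 1 (g i))" using assms(2) unfolding Van_def by auto
  show ?thesis unfolding f(1) g(1) star_arith
  proof (rule VanI[OF _ ae_mono[OF ae_conj[OF f(3) g(3)]]])
    show "eventually (\<lambda>i. \<forall>w\<in>W. vge w 0 (f i) \<and> (w \<in> Z i \<longrightarrow> vge w 1 (g i)) \<longrightarrow> (w \<in> Z i \<longrightarrow> vge w 1 (f i * g i))) UF"
      using vge_mult[of _ "f _" "g _" 0 1] f g by (intro always_eventually) auto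
  qed (use f g in \<open>auto intro!: Kc\<close>)
qed

lemma star_poly_mult:
  fixes p q :: "'a ultra poly"
  assumes pf: "\<And>j. coeff p j = star (\<lambda>i. coeff (f i) j)" "\<And>i. degree (f i) \<le> n"
    and qg: "\<And>j. coeff q j = star (\<lambda>i. coeff (g i) j)" "\<And>i. degree (g i) \<le> m"
  shows "coeff (p * q) j = star (\<lambda>i. coeff (f i * g i) j)"
  unfolding coeff_mult pf qg star_arith star_sum ..

text \<open>Only finitely many coefficients matter, so the exceptional places of the product can be
  collected; at all other places Gauss's lemma applies to monic representatives of fixed
  degree.\<close>

lemma gauss_star:
  assumes p: "poly_over Kst p" "lead_coeff p = 1" and q: "poly_over Kst q" "lead_coeff q = 1"
    and pq: "poly_over Aint (p * q)"
  shows "poly_over Aint p"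
proof -
  have rep: "\<exists>f. \<forall>i. poly_over K (f i) \<and> lead_coeff (f i) = 1 \<and> degree (f i) = degree p \<and> (\<forall>j. coeff p j = star (\<lambda>i. coeff (f i) j))"
    if p: "poly_over Kst p" "lead_coeff p = 1" for p
  proof -
    have "\<forall>j. \<exists>h. coeff p j = star h \<and> (\<forall>i. h i \<in> K)" using p(1) unfolding poly_over_def Kst_def by auto
    then obtain h where h: "\<And>j. coeff p j = star (h j)" "\<And>j i. h j i \<in> K" by metis
    define f where "f i = monom 1 (degree p) + (\<Sum>j<degree p. monom (h j i) j)" for i
    have cf: "coeff (f i) j = (if j < degree p then h j i else if j = degree p then 1 else 0)" for i j
      unfolding f_def by (auto simp: coeff_sum)
    have df: "degree (f i) = degree p" for i
      by (rule antisym[OF degree_le le_degree]) (auto simp: cf)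
    have "coeff p j = star (\<lambda>i. coeff (f i) j)" for j
      using p(2) coeff_eq_0[of p j] h(1)[of j] unfolding cf by (cases j "degree p" rule: linorder_cases) (auto simp: star_arith)
    moreover have "poly_over K (f i)" for i unfolding poly_over_def cf using h Kc by auto
    ultimately show ?thesis using df cf by (intro exI[of _ f]) auto
  qed
  obtain f where f: "\<And>i. poly_over K (f i)" "\<And>i. lead_coeff (f i) = 1" "\<And>i. degree (f i) = degree p" "\<And>j. coeff p j = star (\<lambda>i. coeff (f i) j)"
    using rep[OF p] by blast
  obtain g where g: "\<And>i. poly_over K (g i)" "\<And>i. lead_coeff (g i) = 1" "\<And>i. degree (g i) = degree q" "\<And>j. coeff q j = star (\<lambda>i. coeff (g i) j)"
    using rep[OF q] by blast
  have "coeff (p * q) j = star (\<lambda>i. coeff (f i * g i) j)" for j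
    by (rule star_poly_mult[OF f(4) _ g(4)]) (use f g in auto)
  then have "ae (\<lambda>i w. vge w 0 (coeff (f i * g i) j))" for j
    using pq AintD[of "\<lambda>i. coeff (f i * g i) j"] unfolding poly_over_def by metis
  note a = this
  have all: "ae (\<lambda>i w. \<forall>j<n. vge w 0 (coeff (f i * g i) j))" for n
  proof (induction n)
    case (Suc n)
    show ?case by (rule ae_mono[OF ae_conj[OF Suc a[of n]]]) (auto simp: less_Suc_eq intro!: always_eventually)
  qed (use ae_finite[of "{}"] in simp)
  have big: "vge w 0 (coeff (f i * g i) j)" if "\<not> j < Suc (degree p + degree q)" for i w j
  proof -
    have "degree (f i * g i) \<le> degree p + degree q" using degree_mult_le[of "f i" "g i"] f(3) g(3) by simp
    then show ?thesis using that by (auto simp: vge_def coeff_eq_0)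
  qed
  have "ae (\<lambda>i w. vge w 0 (coeff (f i) j))" for j
  proof (rule ae_mono[OF all[of "Suc (degree p + degree q)"]], rule always_eventually, intro allI ballI impI)
    fix i w assume w: "w \<in> W" and h: "\<forall>j<Suc (degree p + degree q). vge w 0 (coeff (f i * g i) j)"
    show "vge w 0 (coeff (f i) j)"
      by (rule gauss_monic[OF w f(1,2) g(1,2)]) (use h big in blast)
  qed
  then have "coeff p j \<in> Aint" for j unfolding f(4) using f(1) by (intro AintI) (auto simp: poly_over_def)
  then show ?thesis unfolding poly_over_def by auto
qed

end

section \<open>Powers of polynomials\<close>

lemma poly_factor_multiplicity:
  fixes p q :: "'a::field poly"
  assumes "p \<noteq> 0" "degree q > 0" shows "\<exists>e r. p = q ^ e * r \<and> \<not> q dvd r"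
  using assms(1)
proof (induction "degree p" arbitrary: p rule: less_induct)
  case less
  show ?case
  proof (cases "q dvd p")
    case True
    then obtain r where r: "p = q * r" by blast
    then have "r \<noteq> 0" "q \<noteq> 0" using less.prems by auto
    then have "degree r < degree p" unfolding r using assms(2) by (simp add: degree_mult_eq)
    then obtain e s where "r = q ^ e * s" "\<not> q dvd s" using less.hyps \<open>r \<noteq> 0\<close> by blast
    then have "p = q ^ Suc e * s" "\<not> q dvd s" unfolding r by (auto simp: mult.assoc)
    then show ?thesis by blast
  qed (auto intro: exI[of _ 0])
qed

lemma monic_degree_0: "lead_coeff p = 1 \<Longrightarrow> degree p = 0 \<Longrightarrow> p = (1 :: 'a::comm_semiring_1 poly)"
  by (metis degree_eq_zeroE lead_coeff_pCons(2) one_pCons)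

lemma monic_mult_cancel: "lead_coeff (p * q) = 1 \<Longrightarrow> lead_coeff p = 1 \<Longrightarrow> lead_coeff q = (1 :: 'a::idom)"
  by (simp add: lead_coeff_mult)

text \<open>Split off \<open>d\<close>-th powers until the cofactor \<open>H0\<close> has least
  degree, and let \<open>P1\<close> be a nonconstant monic factor of \<open>H0\<close> over
  \<open>L\<close> of least degree. The choice of \<open>P1\<close> makes it irreducible over
  \<open>L\<close>, in the form of the Bezout clause; the choice of \<open>H0\<close> keeps the
  multiplicity of \<open>P1\<close> in it below \<open>d\<close>.\<close>

theorem perfect_power_or_simple_factor:
  fixes L :: "'a::field set"
  assumes L: "is_subfield L" and P: "poly_over L P" "lead_coeff P = 1" and d: "d > 0"
  obtains (power) G where "poly_over L G" "lead_coeff G = 1" "P = G ^ d"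
  | (factor) P1 H G e where "poly_over L P1" "lead_coeff P1 = 1" "poly_over L H" "lead_coeff H = 1"
      "poly_over L G" "lead_coeff G = 1" "P = P1 ^ e * H * G ^ d" "0 < e" "e < d" "degree P1 > 0" "\<not> P1 dvd H"
      "\<And>q. poly_over L q \<Longrightarrow> \<not> P1 dvd q \<Longrightarrow> \<exists>u v. poly_over L u \<and> poly_over L v \<and> u * P1 + v * q = 1"
proof -
  define good where "good H \<longleftrightarrow> (\<exists>G. poly_over L G \<and> lead_coeff G = 1 \<and> poly_over L H \<and> lead_coeff H = 1 \<and> P = H * G ^ d)" for H
  have "good P" unfolding good_def using P poly_over_1[OF L] by (intro exI[of _ 1]) auto
  define H0 where "H0 = arg_min degree good"
  have H0: "good H0" and min: "\<And>H. good H \<Longrightarrow> degree H0 \<le> degree H"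
    using arg_min_natI[of good, OF \<open>good P\<close>] arg_min_nat_le[of good] unfolding H0_def by auto
  then obtain G where G: "poly_over L G" "lead_coeff G = 1" "poly_over L H0" "lead_coeff H0 = 1" "P = H0 * G ^ d"
    unfolding good_def by blast
  show ?thesis
  proof (cases "degree H0 = 0")
    case True
    then have "H0 = 1" using G(4) monic_degree_0 by blast
    then show ?thesis using power[OF G(1,2)] G(5) by simp
  next
    case False
    define cand where "cand Q \<longleftrightarrow> poly_over L Q \<and> lead_coeff Q = 1 \<and> degree Q > 0 \<and> Q dvd H0" for Q
    have "cand H0" unfolding cand_def using G False by auto
    define P1 where "P1 = arg_min degree cand"
    have P1: "cand P1" and min1: "\<And>Q. cand Q \<Longrightarrow> degree P1 \<le> degree Q"
      using arg_min_natI[of cand, OF \<open>cand H0\<close>] arg_min_nat_le[of cand] unfolding P1_def by auto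
    have P1': "poly_over L P1" "lead_coeff P1 = 1" "degree P1 > 0" "P1 dvd H0" using P1 unfolding cand_def by auto
    have bez: "\<exists>u v. poly_over L u \<and> poly_over L v \<and> u * P1 + v * q = 1" if q: "poly_over L q" "\<not> P1 dvd q" for q
    proof -
      have ne: "P1 \<noteq> 0 \<or> q \<noteq> 0" using P1'(3) by auto
      obtain g u v p' q' where 1: "poly_over L g" "poly_over L u" "poly_over L v" "poly_over L p'" "poly_over L q'"
        "g = u * P1 + v * q" "P1 = g * p'" "q = g * q'" "lead_coeff g = 1"
        by (rule poly_over_bezout[OF L P1'(1) q(1) ne])
      have lp: "lead_coeff p' = 1" using monic_mult_cancel[of g p'] 1(7,9) P1'(2) by simp
      have "degree g = 0"
      proof (rule ccontr)
        assume dg: "degree g \<noteq> 0"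
        have "cand g" unfolding cand_def using 1 dg P1'(4) by (metis dvd_mult_left dvd_triv_left dvd_trans gr0I)
        then have "degree P1 \<le> degree g" by (rule min1)
        moreover have "degree P1 = degree g + degree p'"
        proof -
          have "g \<noteq> 0" "p' \<noteq> 0" using 1(9) lp by auto
          then show ?thesis unfolding 1(7) by (rule degree_mult_eq)
        qed
        ultimately have "p' = 1" using lp monic_degree_0[of p'] by simp
        then have "P1 dvd q" using 1(7,8) by simp
        then show False using q(2) by blast
      qed
      then have "g = 1" using 1(9) monic_degree_0 by blast
      then show ?thesis using 1 by metis
    qed
    have H00: "H0 \<noteq> 0" using G(4) by auto
    obtain e H where eH: "H0 = P1 ^ e * H" "\<not> P1 dvd H" using poly_factor_multiplicity[OF H00 P1'(3)] by blast
    have lPe: "lead_coeff (P1 ^ e) = 1" for e using P1'(2) by (simp add: lead_coeff_power)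
    then have nz: "P1 ^ e \<noteq> 0" for e by (metis leading_coeff_0_iff zero_neq_one)
    have LH: "poly_over L H" using poly_over_dvd_quotient[OF L poly_over_power[OF L P1'(1)] nz, of e H] G(3) eH(1) by simp
    have lH: "lead_coeff H = 1" using monic_mult_cancel[of "P1 ^ e" H] lPe eH(1) G(4) by simp
    have e0: "e > 0" using P1'(4) eH by (cases e) auto
    have "e < d"
    proof (rule ccontr)
      assume "\<not> e < d"
      then have e: "e = d + (e - d)" by simp
      define H' where "H' = P1 ^ (e - d) * H"
      have H0': "H0 = P1 ^ d * H'" unfolding H'_def eH(1) by (subst e) (simp add: power_add mult.assoc)
      have "good H'" unfolding good_def
      proof (intro exI[of _ "P1 * G"] conjI)
        show "poly_over L (P1 * G)" "poly_over L H'" unfolding H'_def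
          using P1' G LH by (auto intro!: poly_over_mult[OF L] poly_over_power[OF L])
        show "lead_coeff (P1 * G) = 1" unfolding lead_coeff_mult using P1'(2) G(2) by simp
        show "lead_coeff H' = 1" unfolding H'_def lead_coeff_mult using lPe lH by simp
        show "P = H' * (P1 * G) ^ d" using G(5) H0' by (simp add: power_mult_distrib mult_ac)
      qed
      then have "degree H0 \<le> degree H'" by (rule min)
      moreover have "H' \<noteq> 0" using H00 H0' by auto
      then have "degree H0 = degree (P1 ^ d) + degree H'" unfolding H0' using nz by (intro degree_mult_eq) auto
      moreover have "degree (P1 ^ d) = d * degree P1" using P1'(3) by (subst degree_power_eq) auto
      ultimately show False using d P1'(3) by simp
    qed
    then show ?thesis using factor[OF P1'(1,2) LH lH G(1,2) _ e0 _ P1'(3) eH(2) bez] G(5) eH(1) by simp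
  qed
qed

lemma coeff_mult_top:
  assumes "degree p \<le> m" "degree q \<le> n" shows "coeff (p * q) (m + n) = coeff p m * coeff (q :: 'a::comm_semiring_1 poly) n"
proof -
  have "coeff (p * q) (m + n) = (\<Sum>i\<le>m + n. coeff p i * coeff q (m + n - i))" by (rule coeff_mult)
  also have "\<dots> = (\<Sum>i\<in>{m}. coeff p i * coeff q (m + n - i))"
  proof (rule sum.mono_neutral_right)
    show "\<forall>i\<in>{..m + n} - {m}. coeff p i * coeff q (m + n - i) = 0"
    proof
      fix i assume "i \<in> {..m + n} - {m}"
      then consider "i > m" | "m + n - i > n" by force
      then show "coeff p i * coeff q (m + n - i) = 0"
        by cases (use assms in \<open>auto simp: coeff_eq_0\<close>)
    qed
  qed auto
  finally show ?thesis by simp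
qed

text \<open>Comparing coefficients from the top expresses the coefficients of a monic root by those of the power.\<close>
lemma root_coeffs_in_ring:
  fixes G :: "'a::field_char_0 poly"
  assumes B1: "1 \<in> B" and Ba: "\<And>x y. x \<in> B \<Longrightarrow> y \<in> B \<Longrightarrow> x + y \<in> B" and Bm: "\<And>x y. x \<in> B \<Longrightarrow> y \<in> B \<Longrightarrow> x * y \<in> B"
    and Bd: "\<And>x. x \<in> B \<Longrightarrow> x / of_nat d \<in> B" and Bn: "\<And>x. x \<in> B \<Longrightarrow> - x \<in> B" and d: "d > 0"
    and G: "lead_coeff G = 1" and Gd: "\<And>i. coeff (G ^ d) i \<in> B"
  shows "coeff G i \<in> B"
proof -
  have B0: "0 \<in> B" using Ba[OF B1 Bn[OF B1]] by simp
  have Bs: "sum f A \<in> B" if "\<And>i. i \<in> A \<Longrightarrow> f i \<in> B" for f :: "nat \<Rightarrow> 'a" and A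
    using that by (induction A rule: infinite_finite_induct) (auto intro: B0 Ba)
  define g where "g = degree G"
  have main: "coeff G (g - j) \<in> B" if "j \<le> g" for j
    using that
  proof (induction j rule: less_induct)
    case (less j)
    show ?case
    proof (cases "j = 0")
      case True
      then show ?thesis using G B1 by (simp add: g_def)
    next
      case False
      define m where "m = g - j"
      \<comment> \<open>\<open>Gh\<close> is the part of \<open>G\<close> above degree
        \<open>m\<close>, whose coefficients are already known to lie in \<open>B\<close>. In
        \<open>G^d - Gh^d = r * S\<close> the coefficient of \<open>G\<close> at \<open>m\<close>
        appears at the top, with factor \<open>d\<close>.\<close>
      define Gh where "Gh = (\<Sum>i\<in>{m<..g}. monom (coeff G i) i)"
      define r where "r = G - Gh"
      have cGh: "coeff Gh i = (if m < i \<and> i \<le> g then coeff G i else 0)" for i unfolding Gh_def by (simp add: coeff_sum)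
      have high: "coeff G i \<in> B" if "m < i" "i \<le> g" for i
        using less.IH[of "g - i"] that less.prems unfolding m_def by auto
      then have GhB: "coeff Gh i \<in> B" for i unfolding cGh using B0 by auto
      have "coeff (Gh ^ n) i \<in> B" for n i
      proof (induction n arbitrary: i)
        case 0
        then show ?case using B0 B1 by (simp add: coeff_1)
      next
        case (Suc n)
        then show ?case unfolding power_Suc coeff_mult using GhB by (intro Bs Bm)
      qed
      note GhdB = this
      have dr: "degree r \<le> m" unfolding r_def
        by (rule degree_le) (auto simp: cGh g_def coeff_eq_0)
      have cr: "coeff r m = coeff G m" unfolding r_def by (simp add: cGh)
      have dGh: "degree Gh \<le> g" by (rule degree_le) (auto simp: cGh)
      define S where "S = (\<Sum>i<d. Gh ^ (d - Suc i) * G ^ i)"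
      have diff: "G ^ d - Gh ^ d = r * S" unfolding S_def r_def by (rule power_diff_sumr2)
      have gm: "m < g" using False less.prems unfolding m_def by simp
      have pw: "degree (Q ^ n) \<le> n * g \<and> coeff (Q ^ n) (n * g) = 1" if "degree Q \<le> g" "coeff Q g = 1" for Q :: "'a poly" and n
      proof (induction n)
        case (Suc n)
        then have "degree (Q * Q ^ n) \<le> g + n * g" using that degree_mult_le[of Q "Q ^ n"] by linarith
        moreover have "coeff (Q * Q ^ n) (g + n * g) = 1" using coeff_mult_top[of Q g "Q ^ n" "n * g"] that Suc by simp
        ultimately show ?case by simp
      qed simp
      have Gh1: "coeff Gh g = 1" using cGh gm G by (simp add: g_def)
      have top: "degree (Gh ^ (d - Suc i) * G ^ i) \<le> (d - 1) * g \<and> coeff (Gh ^ (d - Suc i) * G ^ i) ((d - 1) * g) = 1" if "i < d" for i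
      proof -
        have "d - 1 = (d - Suc i) + i" using that by simp
        then have e: "(d - 1) * g = (d - Suc i) * g + i * g" by (simp only: add_mult_distrib)
        have a: "degree (Gh ^ (d - Suc i)) \<le> (d - Suc i) * g" "coeff (Gh ^ (d - Suc i)) ((d - Suc i) * g) = 1"
          using pw[OF dGh Gh1] by auto
        have "degree G \<le> g" "coeff G g = 1" using G by (auto simp: g_def)
        then have b: "degree (G ^ i) \<le> i * g" "coeff (G ^ i) (i * g) = 1" using pw by auto
        have "degree (Gh ^ (d - Suc i) * G ^ i) \<le> (d - Suc i) * g + i * g"
          using degree_mult_le[of "Gh ^ (d - Suc i)" "G ^ i"] a(1) b(1) by linarith
        then show ?thesis unfolding e coeff_mult_top[OF a(1) b(1)] using a(2) b(2) by simp
      qed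
      have dS: "degree S \<le> (d - 1) * g" unfolding S_def by (rule degree_sum_le) (use top in auto)
      have cS: "coeff S ((d - 1) * g) = of_nat d" unfolding S_def coeff_sum using top by simp
      have "coeff (r * S) (m + (d - 1) * g) = coeff G m * of_nat d"
        using coeff_mult_top[OF dr dS] cr cS by simp
      then have "coeff G m = (coeff (G ^ d) (m + (d - 1) * g) + - coeff (Gh ^ d) (m + (d - 1) * g)) / of_nat d"
        unfolding diff[symmetric] using d by simp
      then have "coeff G m \<in> B" by (simp only:) (intro Bd Ba Gd Bn GhdB)
      then show ?thesis unfolding m_def .
    qed
  qed
  show ?thesis
  proof (cases "i \<le> g")
    case True
    then show ?thesis using main[of "g - i"] by simp
  next
    case False
    then show ?thesis using B0 by (simp add: coeff_eq_0 g_def)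
  qed
qed

text \<open>Codimensions add. Hypotheses \<open>1\<close> and \<open>2\<close> say, through
  relations only, that \<open>S\<close> has codimension at most \<open>n\<close> in \<open>V\<close>
  and \<open>S'\<close> at most \<open>m\<close> in \<open>S\<close>. Applying \<open>1\<close>
  again and again to the vectors not yet used as pivots yields \<open>m + 1\<close> combinations in
  \<open>S\<close> with triangular coefficients; a nontrivial combination of them is therefore
  nontrivial in the original vectors.\<close>

lemma codimension_chain:
  fixes F :: "'a::field set"
  assumes F: "is_subfield F"
    and 1: "\<And>(J::'j set) x. finite J \<Longrightarrow> card J > n \<Longrightarrow> (\<And>j. j \<in> J \<Longrightarrow> x j \<in> V) \<Longrightarrow>
       \<exists>a. (\<forall>j\<in>J. a j \<in> F) \<and> (\<exists>j\<in>J. a j \<noteq> 0) \<and> (\<Sum>j\<in>J. a j * x j) \<in> S"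
    and 2: "\<And>(J::'j set) x. finite J \<Longrightarrow> card J > m \<Longrightarrow> (\<And>j. j \<in> J \<Longrightarrow> x j \<in> S) \<Longrightarrow>
       \<exists>a. (\<forall>j\<in>J. a j \<in> F) \<and> (\<exists>j\<in>J. a j \<noteq> 0) \<and> (\<Sum>j\<in>J. a j * x j) \<in> S'"
    and J: "finite (J::'j set)" "card J > n + m" "\<And>j. j \<in> J \<Longrightarrow> x j \<in> V"
  shows "\<exists>a. (\<forall>j\<in>J. a j \<in> F) \<and> (\<exists>j\<in>J. a j \<noteq> 0) \<and> (\<Sum>j\<in>J. a j * x j) \<in> S'"
proof -
  have "\<exists>I a. I \<subseteq> J \<and> card I = r \<and> (\<forall>l\<in>I. \<forall>j\<in>J. a l j \<in> F) \<and> (\<forall>l\<in>I. (\<Sum>j\<in>J. a l j * x j) \<in> S) \<and>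
      (\<forall>b. (\<exists>l\<in>I. b l \<noteq> 0) \<longrightarrow> (\<exists>j\<in>I. (\<Sum>l\<in>I. b l * a l j) \<noteq> 0))" if "r \<le> m + 1" for r
    using that
  proof (induction r)
    case (Suc r)
    have "r \<le> m + 1" using Suc.prems by simp
    from Suc.IH[OF this] obtain I a where I0: "I \<subseteq> J" "card I = r" "\<forall>l\<in>I. \<forall>j\<in>J. a l j \<in> F" "\<forall>l\<in>I. (\<Sum>j\<in>J. a l j * x j) \<in> S"
      "\<forall>b. (\<exists>l\<in>I. b l \<noteq> 0) \<longrightarrow> (\<exists>j\<in>I. (\<Sum>l\<in>I. b l * a l j) \<noteq> 0)" by (elim exE conjE)
    note I = I0(1,2) I0(3)[rule_format] I0(4)[rule_format] I0(5)[rule_format]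
    have fI: "finite I" using I(1) J(1) finite_subset by blast
    have "card (J - I) > n" using J(2) I(1,2) fI Suc.prems by (simp add: card_Diff_subset)
    then obtain c where c: "\<And>j. j \<in> J - I \<Longrightarrow> c j \<in> F" "\<exists>j\<in>J - I. c j \<noteq> 0" "(\<Sum>j\<in>J - I. c j * x j) \<in> S"
      using 1[of "J - I" x] J by auto
    then obtain p where p: "p \<in> J - I" "c p \<noteq> 0" by blast
    \<comment> \<open>The new combination vanishes at all earlier pivots, so the coefficient matrix
      on \<open>insert p I\<close> stays triangular with nonzero diagonal.\<close>
    define c' where "c' j = (if j \<in> I then 0 else c j)" for j
    define a' where "a' = a(p := c')"
    have nI: "p \<notin> I" using p by auto
    have c'S: "(\<Sum>j\<in>J. c' j * x j) \<in> S"
    proof -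
      have "(\<Sum>j\<in>J. c' j * x j) = (\<Sum>j\<in>J - I. c' j * x j)" using J(1) by (intro sum.mono_neutral_right) (auto simp: c'_def)
      also have "\<dots> = (\<Sum>j\<in>J - I. c j * x j)" by (intro sum.cong) (auto simp: c'_def)
      finally show ?thesis using c(3) by simp
    qed
    have a'I: "a' l = a l" if "l \<in> I" for l unfolding a'_def using that nI by auto
    have a'p: "a' p = c'" unfolding a'_def by simp
    have indep: "\<exists>j\<in>insert p I. (\<Sum>l\<in>insert p I. b l * a' l j) \<noteq> 0" if b: "\<exists>l\<in>insert p I. b l \<noteq> 0" for b
    proof -
      have s: "(\<Sum>l\<in>insert p I. b l * a' l j) = b p * c' j + (\<Sum>l\<in>I. b l * a l j)" for j
        using fI nI a'I by (simp add: a'p)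
      show ?thesis
      proof (cases "\<exists>l\<in>I. b l \<noteq> 0")
        case True
        then obtain j where j: "j \<in> I" "(\<Sum>l\<in>I. b l * a l j) \<noteq> 0" using I(5) by blast
        then have "(\<Sum>l\<in>insert p I. b l * a' l j) \<noteq> 0" unfolding s by (simp add: c'_def)
        then show ?thesis using j by blast
      next
        case False
        then have "b p \<noteq> 0" using b by auto
        moreover have "c' p \<noteq> 0" unfolding c'_def using p by auto
        ultimately have "(\<Sum>l\<in>insert p I. b l * a' l p) \<noteq> 0" unfolding s using False by simp
        then show ?thesis by blast
      qed
    qed
    show ?case
    proof (intro exI[of _ "insert p I"] exI[of _ a'] conjI ballI)
      show "insert p I \<subseteq> J" "card (insert p I) = Suc r" using p I fI by auto
      fix l assume l: "l \<in> insert p I"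
      show "(\<Sum>j\<in>J. a' l j * x j) \<in> S" using l a'I a'p c'S I(4) by (cases "l = p") auto
      fix j assume "j \<in> J"
      then show "a' l j \<in> F" using l a'I a'p I(3) c(1) subfieldD(1)[OF F] by (cases "l = p") (auto simp: c'_def)
    qed (use indep in blast)
  qed (auto intro: exI[of _ "{}"])
  from this[OF order.refl] obtain I a where I0: "I \<subseteq> J" "card I = m + 1" "\<forall>l\<in>I. \<forall>j\<in>J. a l j \<in> F" "\<forall>l\<in>I. (\<Sum>j\<in>J. a l j * x j) \<in> S"
      "\<forall>b. (\<exists>l\<in>I. b l \<noteq> 0) \<longrightarrow> (\<exists>j\<in>I. (\<Sum>l\<in>I. b l * a l j) \<noteq> 0)" by (elim exE conjE)
    note I = I0(1,2) I0(3)[rule_format] I0(4)[rule_format] I0(5)[rule_format]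
  have fI: "finite I" using I(1) J(1) finite_subset by blast
  obtain b where b: "\<And>l. l \<in> I \<Longrightarrow> b l \<in> F" "\<exists>l\<in>I. b l \<noteq> 0" "(\<Sum>l\<in>I. b l * (\<Sum>j\<in>J. a l j * x j)) \<in> S'"
    using 2[OF fI, of "\<lambda>l. \<Sum>j\<in>J. a l j * x j"] I(2,4) by auto
  define c where "c j = (\<Sum>l\<in>I. b l * a l j)" for j
  have "(\<Sum>j\<in>J. c j * x j) = (\<Sum>l\<in>I. b l * (\<Sum>j\<in>J. a l j * x j))"
    unfolding c_def by (simp add: sum_distrib_left sum_distrib_right mult_ac sum.swap[of _ J I])
  then have "(\<Sum>j\<in>J. c j * x j) \<in> S'" using b(3) by simp
  moreover have "c j \<in> F" if "j \<in> J" for j unfolding c_def using b(1) I(3) that by (intro subfield_sum[OF F] subfieldD(5)[OF F]) auto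
  moreover have "\<exists>j\<in>J. c j \<noteq> 0" using I(5)[OF b(2)] I(1) unfolding c_def by blast
  ultimately show ?thesis by blast
qed

text \<open>A discrete mean value estimate: a box of side \<open>a\<close> shrunk by
  \<open>b\<close> in all \<open>s\<close> directions loses at most \<open>s * b * a^(s - 1)\<close>
  points, one order less than its size.\<close>

lemma power_le_power_diff: "(a::nat) ^ s \<le> (a - b) ^ s + s * b * a ^ (s - 1)"
proof (induction s)
  case (Suc s)
  have "a ^ Suc s \<le> a * ((a - b) ^ s + s * b * a ^ (s - 1))" using Suc by simp
  also have "\<dots> = a * (a - b) ^ s + s * b * a ^ s"
    by (cases s) (auto simp: algebra_simps)
  also have "a * (a - b) ^ s \<le> ((a - b) + b) * (a - b) ^ s" by (intro mult_right_mono) auto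
  also have "\<dots> = (a - b) ^ Suc s + b * (a - b) ^ s" by (simp add: algebra_simps)
  also have "b * (a - b) ^ s \<le> b * a ^ s" by (intro mult_left_mono power_mono) auto
  finally show ?case by (simp add: algebra_simps)
qed simp

section \<open>The auxiliary function\<close>

text \<open>The exponential of \<open>\<gamma>\<close> becomes the variable, those of
  \<open>\<Gamma>'\<close> generate the coefficients. \<open>box M\<close> models the elements of
  \<open>\<Gamma>'\<close> with exponents at most \<open>M\<close> in absolute value in a basis of
  length \<open>s\<close>, through its size, its additivity and a linear bound on its poles.
  \<open>Y\<close> is a finite supply of poles for such bounds.\<close>

locale box_ring = exp_ring k K W Wb v D c0 \<nu> \<Gamma>
  for k K :: "'a::field_char_0 set" and W Wb :: "'w set" and v D c0 \<nu> \<Gamma> +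
  fixes \<gamma> :: 'a and \<Gamma>' :: "'a set" and box :: "nat \<Rightarrow> 'a set" and s :: nat and Y :: "'a set"
  assumes \<gamma>: "\<gamma> \<in> \<Gamma>" and \<Gamma>': "\<Gamma>' \<subseteq> \<Gamma>" and \<Gamma>'m: "\<And>x y. x \<in> \<Gamma>' \<Longrightarrow> y \<in> \<Gamma>' \<Longrightarrow> x * y \<in> \<Gamma>'"
    and box: "\<And>M. finite (box M)" "\<And>M. box M \<subseteq> \<Gamma>'" "\<And>M. card (box M) = (2 * M + 1) ^ s" "1 \<in> box 0"
    and box_mono: "\<And>M N. M \<le> N \<Longrightarrow> box M \<subseteq> box N"
    and box_mult: "\<And>x y M N. x \<in> box M \<Longrightarrow> y \<in> box N \<Longrightarrow> x * y \<in> box (M + N)"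
    and box_ex: "\<And>S. finite S \<Longrightarrow> S \<subseteq> \<Gamma>' \<Longrightarrow> \<exists>\<rho>. S \<subseteq> box \<rho>"
    and box_indep: "\<And>g h m n. g \<in> \<Gamma>' \<Longrightarrow> h \<in> \<Gamma>' \<Longrightarrow> g * \<gamma> ^ m = h * \<gamma> ^ n \<Longrightarrow> g = h \<and> m = n"
    and Y: "finite Y" "Y \<subseteq> K"
    and box_pole: "\<And>g M w. g \<in> box M \<Longrightarrow> w \<in> W \<Longrightarrow> pole g w \<le> M * (\<Sum>y\<in>Y. pole y w)"
    and \<gamma>_pole: "\<And>w. w \<in> W \<Longrightarrow> pole \<gamma> w \<le> (\<Sum>y\<in>Y. pole y w)"

section \<open>Spans of exponentials over the small field\<close>

context exp_ring begin

lemma chi_independent_family: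
  assumes I: "finite I" "inj_on e I" "e ` I \<subseteq> \<Gamma>" and c: "\<And>i. i \<in> I \<Longrightarrow> c i \<in> Sm" and 0: "(\<Sum>i\<in>I. c i * chi (e i)) = 0"
    and i: "i \<in> I"
  shows "c i = 0"
proof -
  define c' where "c' g = c (the_inv_into I e g)" for g
  have c': "c' (e j) = c j" if "j \<in> I" for j unfolding c'_def using the_inv_into_f_f[OF I(2) that] by simp
  have "(\<Sum>g\<in>e ` I. c' g * chi g) = (\<Sum>j\<in>I. c j * chi (e j))"
    unfolding sum.reindex[OF I(2)] by (intro sum.cong) (auto simp: c')
  then have z: "(\<Sum>g\<in>e ` I. c' g * chi g) = 0" using 0 by simp
  have m: "c' g \<in> Sm" if "g \<in> e ` I" for g using that c c' by auto
  have "c' (e i) = 0" by (rule chi_independent[OF _ I(3) m z]) (use I i in auto)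
  then show ?thesis using c' i by simp
qed

definition spn :: "'a set \<Rightarrow> 'a ultra set" where
  "spn S = {\<Sum>g\<in>T. c g * chi g | T c. finite T \<and> T \<subseteq> S \<and> (\<forall>g\<in>T. c g \<in> Sm)}"

lemma spnI: "finite T \<Longrightarrow> T \<subseteq> S \<Longrightarrow> (\<And>g. g \<in> T \<Longrightarrow> c g \<in> Sm) \<Longrightarrow> (\<Sum>g\<in>T. c g * chi g) \<in> spn S"
  unfolding spn_def by blast

lemma spn_0: "0 \<in> spn S" using spnI[of "{}" S] by simp

lemma spn_monom: "c \<in> Sm \<Longrightarrow> g \<in> S \<Longrightarrow> c * chi g \<in> spn S" using spnI[of "{g}" S "\<lambda>_. c"] by simp

lemma spn_common:
  assumes "z \<in> spn S" shows "\<exists>T c. finite T \<and> T \<subseteq> S \<and> (\<forall>g. c g \<in> Sm) \<and> (\<forall>g. g \<notin> T \<longrightarrow> c g = 0) \<and>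
    (\<forall>T'. finite T' \<longrightarrow> T \<subseteq> T' \<longrightarrow> z = (\<Sum>g\<in>T'. c g * chi g))"
proof -
  obtain T c where z: "z = (\<Sum>g\<in>T. c g * chi g)" "finite T" "T \<subseteq> S" "\<forall>g\<in>T. c g \<in> Sm" using assms unfolding spn_def by auto
  define c' where "c' g = (if g \<in> T then c g else 0)" for g
  have "z = (\<Sum>g\<in>T'. c' g * chi g)" if "finite T'" "T \<subseteq> T'" for T'
    unfolding z(1) using that by (intro sum.mono_neutral_cong_left) (auto simp: c'_def)
  moreover have "c' g \<in> Sm" "g \<notin> T \<Longrightarrow> c' g = 0" for g using z(4) Sc(1) by (auto simp: c'_def)
  ultimately show ?thesis using z(2,3) by blast
qed

lemma spn_finite: assumes "z \<in> spn S" "finite S" shows "\<exists>c. (\<forall>g. c g \<in> Sm) \<and> z = (\<Sum>g\<in>S. c g * chi g)"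
  using spn_common[OF assms(1)] assms(2) by blast

lemma spn_add: assumes "x \<in> spn S" "y \<in> spn S" shows "x + y \<in> spn S"
proof -
  obtain T1 c1 where 1: "finite T1" "T1 \<subseteq> S" "\<And>g. c1 g \<in> Sm" "\<And>T'. finite T' \<Longrightarrow> T1 \<subseteq> T' \<Longrightarrow> x = (\<Sum>g\<in>T'. c1 g * chi g)"
    using spn_common[OF assms(1)] by blast
  obtain T2 c2 where 2: "finite T2" "T2 \<subseteq> S" "\<And>g. c2 g \<in> Sm" "\<And>T'. finite T' \<Longrightarrow> T2 \<subseteq> T' \<Longrightarrow> y = (\<Sum>g\<in>T'. c2 g * chi g)"
    using spn_common[OF assms(2)] by blast
  have "x + y = (\<Sum>g\<in>T1 \<union> T2. (c1 g + c2 g) * chi g)"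
    using 1(4)[of "T1 \<union> T2"] 2(4)[of "T1 \<union> T2"] 1(1) 2(1) by (simp add: distrib_right sum.distrib)
  then show ?thesis using spnI[of "T1 \<union> T2" S "\<lambda>g. c1 g + c2 g"] 1 2 Sc(3) by simp
qed

lemma spn_sum: "(\<And>i. i \<in> A \<Longrightarrow> f i \<in> spn S) \<Longrightarrow> sum f A \<in> spn S"
  by (induction A rule: infinite_finite_induct) (auto simp: spn_0 spn_add)

lemma spn_mono: "S \<subseteq> S' \<Longrightarrow> spn S \<subseteq> spn S'" unfolding spn_def by blast

lemma spn_image:
  assumes "z \<in> spn S" "\<And>c g. c \<in> Sm \<Longrightarrow> g \<in> S \<Longrightarrow> c * chi g * y \<in> spn S'"
  shows "z * y \<in> spn S'"
proof -
  obtain T c where z: "z = (\<Sum>g\<in>T. c g * chi g)" "finite T" "T \<subseteq> S" "\<forall>g\<in>T. c g \<in> Sm" using assms(1) unfolding spn_def by auto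
  show ?thesis unfolding z(1) sum_distrib_right by (rule spn_sum) (use z assms(2) in auto)
qed

lemma spn_mult_monom:
  assumes "z \<in> spn S" "c \<in> Sm" "\<And>g. g \<in> S \<Longrightarrow> g * h \<in> S'" shows "z * (c * chi h) \<in> spn S'"
proof (rule spn_image[OF assms(1)])
  fix c' g assume "c' \<in> Sm" "g \<in> S"
  then have "(c' * c) * chi (g * h) \<in> spn S'" using assms by (intro spn_monom Sc(5))
  then show "c' * chi g * (c * chi h) \<in> spn S'" by (simp add: chi_mult mult_ac)
qed

lemma spn_mult:
  assumes "z \<in> spn S" "y \<in> spn S'" "\<And>g h. g \<in> S \<Longrightarrow> h \<in> S' \<Longrightarrow> g * h \<in> S''" shows "z * y \<in> spn S''"
proof (rule spn_image[OF assms(1)])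
  fix c g assume "c \<in> Sm" "g \<in> S"
  then have "y * (c * chi g) \<in> spn S''" using spn_mult_monom[OF assms(2)] assms(3) by (metis mult.commute)
  then show "c * chi g * y \<in> spn S''" by (simp add: mult_ac)
qed

lemma spn_Sm_mult: "c \<in> Sm \<Longrightarrow> z \<in> spn S \<Longrightarrow> c * z \<in> spn S"
  using spn_mult_monom[of z S c 1 S] by (simp add: chi_1 mult_ac)

lemma spn_uminus: "z \<in> spn S \<Longrightarrow> - z \<in> spn S"
  using spn_Sm_mult[of "- 1" z S] Sc(2,7) by simp

lemma spn_Sm: "1 \<in> S \<Longrightarrow> Sm \<subseteq> spn S"
  using spn_monom[of _ 1 S] by (auto simp: chi_1)

context
  fixes S assumes S: "S \<subseteq> \<Gamma>"
begin

lemma S_nz: "g \<in> S \<Longrightarrow> g \<in> K" "g \<in> S \<Longrightarrow> g \<noteq> 0" using S \<Gamma>K \<Gamma>0 by auto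

lemma spn_Aint: "spn S \<subseteq> Aint"
  unfolding spn_def using Sm_Aint S_nz by (auto intro!: Aint_sum Aint_mult chi_Aint)

lemma spn_Kst: "spn S \<subseteq> Kst" using spn_Aint Aint_Kst by blast

lemma dst_spn: assumes "z \<in> spn S" shows "dst z \<in> spn S"
proof -
  obtain T c where z: "z = (\<Sum>g\<in>T. c g * chi g)" "finite T" "T \<subseteq> S" "\<forall>g\<in>T. c g \<in> Sm" using assms unfolding spn_def by blast
  have K: "c g \<in> Kst" "chi g \<in> Kst" "g \<in> K" "g \<noteq> 0" if "g \<in> T" for g using that z S_nz[of g] Sm_Kst chi_Kst by auto
  have "dst z = (\<Sum>g\<in>T. dst (c g * chi g))" unfolding z(1) by (rule dst_sum) (intro Kstc(5) K)
  also have "\<dots> = (\<Sum>g\<in>T. (dst (c g) + c g * om g) * chi g)"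
  proof (rule sum.cong[OF refl])
    fix g assume "g \<in> T"
    note K = K[OF this]
    show "dst (c g * chi g) = (dst (c g) + c g * om g) * chi g"
      unfolding dst_mult[OF K(1,2)] dst_chi[OF K(3,4)] by (simp add: algebra_simps)
  qed
  also have "\<dots> \<in> spn S" by (rule spnI[OF z(2,3)]) (use z(4) K in \<open>intro Sc dst_Sm om_Sm; blast\<close>)
  finally show ?thesis .
qed

lemma dst_funpow_spn: "z \<in> spn S \<Longrightarrow> (dst ^^ n) z \<in> spn S" by (induction n) (auto simp: dst_spn)

end

text \<open>Off \<open>Wb\<close> a logarithmic derivative has at most simple poles, and only at
  zeros or poles of \<open>f\<close>; the zeros are few by assumption and the poles by integrality.
  The fixed set \<open>Wb\<close> contributes a bounded amount.\<close>

lemma small_logderiv: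
  assumes f: "\<And>i. f i \<in> K" "star f \<in> Aint" "star f \<noteq> 0" and few: "ae (\<lambda>i w. \<not> (f i \<noteq> 0 \<and> v w (f i) > 0))"
  shows "dst (star f) / star f \<in> Sm"
proof -
  define l where "l i = D (f i) / f i" for i
  have lK: "l i \<in> K" for i unfolding l_def using f(1) D_K Kc(8) by blast
  have nz: "eventually (\<lambda>i. f i \<noteq> 0) UF" using f(3) unfolding star_0_iff UF_not .
  have ae1: "ae (\<lambda>i w. f i \<noteq> 0 \<and> v w (f i) = 0)"
    by (rule ae_mono[OF ae_conj[OF few AintD[OF f(2)]]], use nz in eventually_elim) (force simp: vge_def)
  have h: "height (l i) \<le> card {w\<in>W. \<not> (f i \<noteq> 0 \<and> v w (f i) = 0)} + nat c0 * card Wb"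
    if fi: "f i \<noteq> 0" "finite {w\<in>W. \<not> (f i \<noteq> 0 \<and> v w (f i) = 0)}" for i
  proof -
    define E where "E = {w\<in>W. \<not> (f i \<noteq> 0 \<and> v w (f i) = 0)}"
    have vl: "v w (l i) = v w (D (f i)) - v w (f i)" if "w \<in> W" "D (f i) \<noteq> 0" for w
      unfolding l_def divide_inverse using that f(1) fi D_K Kc(6) by (simp add: v_mult v_inverse)
    have pole: "pole (l i) w \<le> (if w \<in> E then 1 else 0) + (if w \<in> Wb then nat c0 else 0)" if w: "w \<in> W" for w
    proof (cases "D (f i) = 0")
      case False
      show ?thesis
      proof (cases "w \<in> Wb")
        case True
        then have "pole (l i) w \<le> nat c0" using v_D[OF w f(1) False] vl[OF w False] by (auto simp: pole_def)
        then show ?thesis using True by simp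
      next
        case nb: False
        then have wW: "w \<in> W - Wb" using w by blast
        consider "v w (f i) > 0" | "v w (f i) = 0" | "v w (f i) < 0" by linarith
        then show ?thesis
        proof cases
          case 1
          then show ?thesis using v_D_simple[OF wW f(1) fi(1)] vl[OF w False] nb w by (auto simp: pole_def E_def)
        next
          case 2
          then show ?thesis using v_D_integral[OF wW f(1) False] vl[OF w False] nb w by (auto simp: pole_def E_def)
        next
          case 3
          \<comment> \<open>\<open>v_D_simple\<close> speaks of zeros only; a pole of
            \<open>f\<close> is treated as a zero of its inverse by means of
            \<open>D (f * g) = 0\<close>.\<close>
          define g where "g = inverse (f i)"
          have g: "g \<in> K" "g \<noteq> 0" "v w g > 0" unfolding g_def using f(1) fi 3 w Kc(6) by (auto simp: v_inverse)
          have "f i * g = 1" unfolding g_def using fi by simp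
          then have "D (f i * g) = 0" using D_const kc(2) by simp
          then have Dg: "f i * D g = - (D (f i) * g)" using D_mult[OF f(1) g(1)] by (simp add: add_eq_0_iff)
          have "D g \<noteq> 0" and vg: "v w (D g) = v w g - 1" using v_D_simple[OF wW g] by auto
          have "v w (f i * D g) = v w (f i) + v w (D g)" using \<open>D g \<noteq> 0\<close> f(1) fi D_K g w by (simp add: v_mult)
          moreover have "v w (- (D (f i) * g)) = v w (D (f i)) + v w g" using False f(1) D_K g w Kc(5) by (simp add: v_uminus v_mult)
          ultimately have "v w (D (f i)) = v w (f i) - 1" using Dg vg by simp
          then show ?thesis using vl[OF w False] nb w 3 by (auto simp: pole_def E_def)
        qed
      qed
    qed (simp add: l_def pole_def)
    have "height (l i) \<le> (\<Sum>w\<in>E \<union> Wb. pole (l i) w)"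
    proof -
      have "{w\<in>W. pole (l i) w \<noteq> 0} \<subseteq> E \<union> Wb" using pole by (force split: if_splits)
      then have "height (l i) = (\<Sum>w\<in>E \<union> Wb. pole (l i) w)" using fi(2) Wb lK by (intro height_eq) (auto simp: E_def)
      then show ?thesis by simp
    qed
    also have "\<dots> \<le> (\<Sum>w\<in>E \<union> Wb. (if w \<in> E then 1 else 0) + (if w \<in> Wb then nat c0 else 0))"
      by (rule sum_mono, rule pole) (use Wb in \<open>auto simp: E_def\<close>)
    also have "\<dots> = card E + nat c0 * card Wb"
    proof -
      have fin: "finite (E \<union> Wb)" using fi(2) Wb E_def by simp
      have "(E \<union> Wb) \<inter> {w. w \<in> E} = E" "(E \<union> Wb) \<inter> {w. w \<in> Wb} = Wb" by auto
      then show ?thesis using fin by (simp add: sum.distrib sum.If_cases)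
    qed
    finally show ?thesis unfolding E_def .
  qed
  define l' where "l' i = (if f i \<noteq> 0 then l i else 0)" for i
  have "small l"
    unfolding small_def
  proof (intro conjI allI lK)
    fix q
    have "eventually (\<lambda>i. finite {w\<in>W. \<not> (f i \<noteq> 0 \<and> v w (f i) = 0)} \<and> (2 * q) * card {w\<in>W. \<not> (f i \<noteq> 0 \<and> v w (f i) = 0)} \<le> \<nu> i) UF"
      using ae1 unfolding ae_def by blast
    moreover have "eventually (\<lambda>i. 2 * q * (nat c0 * card Wb) \<le> \<nu> i) UF" by (rule nu_large)
    ultimately show "eventually (\<lambda>i. q * height (l i) \<le> \<nu> i) UF"
      using nz
    proof eventually_elim
      case (elim i)
      have "2 * (q * height (l i)) \<le> 2 * (q * (card {w\<in>W. \<not> (f i \<noteq> 0 \<and> v w (f i) = 0)} + nat c0 * card Wb))"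
        using h elim by (intro mult_le_mono2) blast
      also have "\<dots> = 2 * q * card {w\<in>W. \<not> (f i \<noteq> 0 \<and> v w (f i) = 0)} + 2 * q * (nat c0 * card Wb)" by (simp only: algebra_simps)
      also have "\<dots> \<le> 2 * \<nu> i" using elim by linarith
      finally show ?case by simp
    qed
  qed
  then show ?thesis unfolding ultra_map_star star_arith l_def by (rule SmI)
qed

section \<open>Iterated derivatives modulo vanishing elements\<close>

lemma Van_0: "0 \<in> Van Z"
  unfolding star_arith(7) by (rule VanI) (use Kc ae_finite[of "{}"] in \<open>auto simp: vge_def\<close>)

lemma Van_sum: "(\<And>j. j \<in> A \<Longrightarrow> f j \<in> Van Z) \<Longrightarrow> sum f A \<in> Van Z"
  by (induction A rule: infinite_finite_induct) (auto simp: Van_0 intro: Van_add)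

lemma Van_Sm_mult: "a \<in> Sm \<Longrightarrow> x \<in> Van Z \<Longrightarrow> a * x \<in> Van Z"
  using Van_mult Sm_Aint by blast

lemma Van_diff: "x \<in> Van Z \<Longrightarrow> y \<in> Van Z \<Longrightarrow> x - y \<in> Van Z"
  using Van_add[of x Z "- 1 * y"] Van_Sm_mult[of "- 1" y] Sc(2,7) by simp

lemma dst_funpow_Kst: "x \<in> Kst \<Longrightarrow> (dst ^^ n) x \<in> Kst"
  by (induction n) (auto simp: dst_Kst)

lemma dst_funpow_add: "x \<in> Kst \<Longrightarrow> y \<in> Kst \<Longrightarrow> (dst ^^ n) (x + y) = (dst ^^ n) x + (dst ^^ n) y"
  by (induction n) (auto simp: dst_add dst_funpow_Kst)

lemma dst_funpow_sum: "(\<And>i. i \<in> A \<Longrightarrow> f i \<in> Kst) \<Longrightarrow> (dst ^^ n) (sum f A) = (\<Sum>i\<in>A. (dst ^^ n) (f i))"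
proof (induction A rule: infinite_finite_induct)
  case (insert a A)
  then show ?case using subfield_sum[OF Kst, of A f] by (simp add: dst_funpow_add)
qed (induction n; simp add: dst_0)+

text \<open>Modulo elements vanishing on \<open>Z\<close>, the first derivative that does not vanish on \<open>Z\<close> is linear
  over the small field, by Leibniz' rule.\<close>
lemma dst_funpow_linear_mod:
  assumes "a \<in> Sm" "x \<in> Kst" "\<And>i. i < n \<Longrightarrow> (dst ^^ i) x \<in> Van Z"
  shows "(dst ^^ n) (a * x) - a * (dst ^^ n) x \<in> Van Z"
  using assms
proof (induction n arbitrary: a x)
  case (Suc n)
  have aK: "a \<in> Kst" "dst a \<in> Sm" "dst a \<in> Kst" using Suc.prems Sm_Kst dst_Sm by auto
  have 1: "(dst ^^ n) (a * dst x) - a * (dst ^^ n) (dst x) \<in> Van Z"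
  proof (rule Suc.IH)
    show "(dst ^^ i) (dst x) \<in> Van Z" if "i < n" for i
      using Suc.prems(3)[of "Suc i"] that by (simp add: funpow_swap1)
  qed (use Suc.prems dst_Kst in auto)
  have 2: "(dst ^^ n) (dst a * x) - dst a * (dst ^^ n) x \<in> Van Z"
    by (rule Suc.IH) (use Suc.prems aK in auto)
  have 3: "dst a * (dst ^^ n) x \<in> Van Z" using Van_Sm_mult aK Suc.prems(3) by blast
  have "(dst ^^ Suc n) (a * x) = (dst ^^ n) (dst (a * x))" by (simp add: funpow_swap1)
  also have "\<dots> = (dst ^^ n) (a * dst x + dst a * x)" using dst_mult aK Suc.prems by simp
  also have "\<dots> = (dst ^^ n) (a * dst x) + (dst ^^ n) (dst a * x)"
    using dst_Kst aK Suc.prems Kstc(5) by (intro dst_funpow_add) auto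
  finally have "(dst ^^ Suc n) (a * x) - a * (dst ^^ Suc n) x
    = ((dst ^^ n) (a * dst x) - a * (dst ^^ n) (dst x)) + ((dst ^^ n) (dst a * x) - dst a * (dst ^^ n) x) + dst a * (dst ^^ n) x"
    by (simp add: funpow_swap1)
  then show ?case using Van_add[OF Van_add[OF 1 2] 3] by simp
qed (simp add: Van_0)

lemma dst_funpow_scale:
  assumes "a \<in> Sm" "x \<in> Kst" "\<And>i. i < n \<Longrightarrow> (dst ^^ i) x \<in> Van Z" "i < n"
  shows "(dst ^^ i) (a * x) \<in> Van Z"
proof -
  have "(dst ^^ i) (a * x) - a * (dst ^^ i) x \<in> Van Z" by (rule dst_funpow_linear_mod) (use assms in auto)
  then show ?thesis using Van_add[OF _ Van_Sm_mult[OF assms(1) assms(3)[OF assms(4)]]] by fastforce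
qed

lemma star_funpow_dst: "(dst ^^ n) (star f) = star (\<lambda>i. (D ^^ n) (f i))"
  by (induction n) (auto simp: ultra_map_star)

end

context valued_function_field begin

text \<open>Each derivative lowers a positive order by exactly one at such a place. If the order
  were some \<open>e < m\<close>, the \<open>e\<close>-th derivative would have order 0.\<close>

lemma order_ge_of_derivatives:
  assumes w: "w \<in> W - Wb" and x: "x \<in> K" "x \<noteq> 0" and m: "m > 0" and D: "\<And>i. i < m \<Longrightarrow> vge w 1 ((D ^^ i) x)"
  shows "v w x \<ge> int m"
proof (rule ccontr)
  assume "\<not> ?thesis"
  then have lt: "v w x < int m" by simp
  have step: "(D ^^ i) x \<in> K \<and> (D ^^ i) x \<noteq> 0 \<and> v w ((D ^^ i) x) = v w x - int i" if "i \<le> m" for i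
    using that
  proof (induction i)
    case (Suc i)
    then have IH: "(D ^^ i) x \<in> K" "(D ^^ i) x \<noteq> 0" "v w ((D ^^ i) x) = v w x - int i" by auto
    have "v w ((D ^^ i) x) \<ge> 1" using D[of i] Suc.prems IH(2) unfolding vge_def by auto
    then show ?case using v_D_simple[OF w IH(1,2)] IH D_K by simp
  qed (use x in simp)
  define e where "e = nat (v w x)"
  have "v w x \<ge> 1" using D[OF m] x unfolding vge_def by auto
  then have e: "e < m" "v w x = int e" using lt unfolding e_def by auto
  then have "(D ^^ e) x \<noteq> 0" "v w ((D ^^ e) x) = 0" using step[of e] by auto
  then show False using D[OF e(1)] unfolding vge_def by simp
qed

end

section \<open>Polynomials in one exponential and their derivation\<close>

context box_ring begin

lemma \<Gamma>'1: "1 \<in> \<Gamma>'" using box by blast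

lemma \<gamma>K: "\<gamma> \<in> K" "\<gamma> \<noteq> 0" using \<gamma> \<Gamma>K \<Gamma>0 by auto

lemma \<gamma>_power: "\<gamma> ^ n \<in> \<Gamma>"
  by (induction n) (auto simp: \<Gamma>1 \<Gamma>m \<gamma>)

lemma box_\<Gamma>: "g \<in> \<Gamma>' \<Longrightarrow> g * \<gamma> ^ n \<in> \<Gamma>"
  using \<Gamma>m \<Gamma>' \<gamma>_power by blast

definition X where "X = chi \<gamma>"
definition A where "A = spn \<Gamma>'"

lemma X_power: "X ^ n = chi (\<gamma> ^ n)" unfolding X_def chi_power ..

lemma X_nz: "X \<noteq> 0" unfolding X_def using chi_nz \<gamma>K by blast

lemma X_Aint: "X \<in> Aint" unfolding X_def using chi_Aint \<gamma>K by blast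

lemma A_closed: "0 \<in> A" "1 \<in> A" "x \<in> A \<Longrightarrow> y \<in> A \<Longrightarrow> x + y \<in> A" "x \<in> A \<Longrightarrow> y \<in> A \<Longrightarrow> x * y \<in> A" "x \<in> A \<Longrightarrow> - x \<in> A"
    "x \<in> A \<Longrightarrow> y \<in> A \<Longrightarrow> x - y \<in> A"
proof -
  show "0 \<in> A" "1 \<in> A" unfolding A_def using spn_0 spn_Sm[OF \<Gamma>'1] Sc(2) by auto
  show 1: "x + y \<in> A" if "x \<in> A" "y \<in> A" for x y using that spn_add unfolding A_def by blast
  show "x * y \<in> A" if "x \<in> A" "y \<in> A" using that spn_mult[of x \<Gamma>' y \<Gamma>' \<Gamma>'] \<Gamma>'m unfolding A_def by blast
  show 2: "- x \<in> A" if "x \<in> A" for x using that spn_uminus unfolding A_def by blast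
  show "x - y \<in> A" if "x \<in> A" "y \<in> A" using 1[OF that(1) 2[OF that(2)]] by simp
qed

lemma Sm_A: "Sm \<subseteq> A" unfolding A_def by (rule spn_Sm[OF \<Gamma>'1])

lemma A_Aint: "A \<subseteq> Aint" unfolding A_def by (rule spn_Aint[OF \<Gamma>'])

lemma A_sum: "(\<And>i. i \<in> I \<Longrightarrow> f i \<in> A) \<Longrightarrow> sum f I \<in> A" unfolding A_def by (rule spn_sum)

text \<open>Finitely many elements of \<open>A\<close> involve finitely many bases, and these fit
  into one box.\<close>

lemma spn_box: assumes "finite S" "S \<subseteq> A" shows "\<exists>\<rho>. S \<subseteq> spn (box \<rho>)"
  using assms
proof (induction S rule: finite_induct)
  case (insert x S)
  then obtain \<rho> where \<rho>: "S \<subseteq> spn (box \<rho>)" by auto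
  obtain T c where x: "x = (\<Sum>g\<in>T. c g * chi g)" "finite T" "T \<subseteq> \<Gamma>'" "\<forall>g\<in>T. c g \<in> Sm"
    using insert.prems unfolding A_def spn_def by blast
  obtain \<rho>' where "T \<subseteq> box \<rho>'" using box_ex x by blast
  then have "x \<in> spn (box \<rho>')" using x by (auto intro!: spnI)
  moreover have "spn (box \<rho>) \<subseteq> spn (box (\<rho> + \<rho>'))" "spn (box \<rho>') \<subseteq> spn (box (\<rho> + \<rho>'))"
    by (auto intro!: spn_mono box_mono)
  ultimately show ?case using \<rho> by blast
qed auto

lemma pairs_independent:
  assumes I: "finite I" "\<And>j g. (j, g) \<in> I \<Longrightarrow> g \<in> \<Gamma>'" and c: "\<And>p. p \<in> I \<Longrightarrow> c p \<in> Sm"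
    and 0: "(\<Sum>p\<in>I. c p * chi (snd p * \<gamma> ^ fst p)) = 0" and p: "p \<in> I"
  shows "c p = 0"
proof (rule chi_independent_family[OF I(1) _ _ c 0 p])
  show "inj_on (\<lambda>p. snd p * \<gamma> ^ fst p) I"
  proof (rule inj_onI)
    fix p q assume "p \<in> I" "q \<in> I" "snd p * \<gamma> ^ fst p = snd q * \<gamma> ^ fst q"
    then show "p = q" using box_indep[of "snd p" "snd q" "fst p" "fst q"] I(2) by (metis prod.collapse)
  qed
  show "(\<lambda>p. snd p * \<gamma> ^ fst p) ` I \<subseteq> \<Gamma>" using I(2) box_\<Gamma> by force
qed

text \<open>A polynomial relation unfolds into a linear one over \<open>Sm\<close> between
  exponentials with bases \<open>g * \<gamma> ^ i\<close>, which \<open>box_indep\<close> keeps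
  distinct.\<close>

lemma transcendental_A:
  assumes Q: "poly_over A Q" "poly Q X = 0" shows "Q = 0"
proof -
  have "\<forall>i. \<exists>c. coeff Q i \<in> spn \<Gamma>'" using Q unfolding poly_over_def A_def by auto
  have "finite (coeff Q ` {..degree Q})" "coeff Q ` {..degree Q} \<subseteq> A" using Q unfolding poly_over_def by auto
  then obtain \<rho> where \<rho>: "coeff Q ` {..degree Q} \<subseteq> spn (box \<rho>)" using spn_box by blast
  have "\<exists>c. (\<forall>g. c g \<in> Sm) \<and> coeff Q i = (\<Sum>g\<in>box \<rho>. c g * chi g)" if "i \<le> degree Q" for i
    using spn_finite[of "coeff Q i" "box \<rho>"] \<rho> that box(1) by auto
  then obtain c where c: "\<And>i g. i \<le> degree Q \<Longrightarrow> c i g \<in> Sm" "\<And>i. i \<le> degree Q \<Longrightarrow> coeff Q i = (\<Sum>g\<in>box \<rho>. c i g * chi g)"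
    by metis
  have "(\<Sum>p\<in>{..degree Q} \<times> box \<rho>. c (fst p) (snd p) * chi (snd p * \<gamma> ^ fst p)) = (\<Sum>i\<le>degree Q. (\<Sum>g\<in>box \<rho>. c i g * chi g) * X ^ i)"
    unfolding X_power chi_mult by (simp add: sum.cartesian_product sum_distrib_right mult.assoc split_def)
  also have "\<dots> = poly Q X" unfolding poly_altdef using c by simp
  finally have z: "(\<Sum>p\<in>{..degree Q} \<times> box \<rho>. c (fst p) (snd p) * chi (snd p * \<gamma> ^ fst p)) = 0" using Q(2) by simp
  have "c i g = 0" if "i \<le> degree Q" "g \<in> box \<rho>" for i g
    using pairs_independent[of "{..degree Q} \<times> box \<rho>" "\<lambda>p. c (fst p) (snd p)" "(i, g)"] z box c(1) that by force
  then have "coeff Q (degree Q) = 0" using c(2)[of "degree Q"] by simp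
  then show ?thesis by simp
qed

definition L where "L = {a / b | a b. a \<in> A \<and> b \<in> A \<and> b \<noteq> 0}"

lemma LI: "a \<in> A \<Longrightarrow> b \<in> A \<Longrightarrow> b \<noteq> 0 \<Longrightarrow> a / b \<in> L" unfolding L_def by blast

lemma A_L: "A \<subseteq> L" using LI[OF _ A_closed(2)] by auto

lemma L: "is_subfield L"
  unfolding is_subfield_def
proof (intro conjI ballI)
  show "0 \<in> L" "1 \<in> L" using A_L A_closed by auto
  fix x assume "x \<in> L"
  then obtain a b where x: "x = a / b" "a \<in> A" "b \<in> A" "b \<noteq> 0" unfolding L_def by blast
  show "inverse x \<in> L"
  proof (cases "a = 0")
    case True
    then show ?thesis using x A_L A_closed(1) by auto
  next
    case False
    then show ?thesis using LI[of b a] x by simp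
  qed
  fix y assume "y \<in> L"
  then obtain a' b' where y: "y = a' / b'" "a' \<in> A" "b' \<in> A" "b' \<noteq> 0" unfolding L_def by blast
  have "x + y = (a * b' + a' * b) / (b * b')" "x - y = (a * b' - a' * b) / (b * b')" "x * y = (a * a') / (b * b')"
    using x y by (auto simp: field_simps)
  then show "x + y \<in> L" "x - y \<in> L" "x * y \<in> L" using x y by (auto intro!: LI A_closed)
qed

lemmas Lc = subfieldD[OF L]

lemma L_Kst: "L \<subseteq> Kst" unfolding L_def using A_Aint Aint_Kst Kstc(8) by blast

lemma dst_A: "a \<in> A \<Longrightarrow> dst a \<in> A" unfolding A_def by (rule dst_spn[OF \<Gamma>'])

lemma dst_L: assumes "x \<in> L" shows "dst x \<in> L"
proof -
  obtain a b where x: "x = a / b" "a \<in> A" "b \<in> A" "b \<noteq> 0" using assms unfolding L_def by blast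
  have "a \<in> Kst" "b \<in> Kst" using x A_Aint Aint_Kst by auto
  then have "dst x = (dst a - (a / b) * dst b) / b" unfolding x(1) using x(4) by (rule dst_divide)
  moreover have "dst a \<in> L" "dst b \<in> L" "a \<in> L" "b \<in> L" using dst_A A_L x by auto
  ultimately show ?thesis using Lc(4,5,8) by auto
qed

lemma common_denominator:
  assumes "poly_over L Q" obtains b where "b \<in> A" "b \<noteq> 0" "poly_over A (smult b Q)"
proof -
  have "\<exists>b. b \<in> A \<and> b \<noteq> 0 \<and> (\<forall>i<n. b * coeff Q i \<in> A)" for n
  proof (induction n)
    case 0
    then show ?case using A_closed(2) by auto
  next
    case (Suc n)
    then obtain b where b: "b \<in> A" "b \<noteq> 0" "\<forall>i<n. b * coeff Q i \<in> A" by blast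
    obtain x y where xy: "coeff Q n = x / y" "x \<in> A" "y \<in> A" "y \<noteq> 0" using poly_overD[OF assms, of n] unfolding L_def by blast
    have "(b * y) * coeff Q i \<in> A" if "i < Suc n" for i
    proof (cases "i = n")
      case True
      then have e: "(b * y) * coeff Q i = b * x" using xy by simp
      show ?thesis unfolding e by (rule A_closed(4)[OF b(1) xy(2)])
    next
      case False
      then have "y * (b * coeff Q i) \<in> A" using A_closed(4) b xy that by simp
      then show ?thesis by (simp add: mult_ac)
    qed
    then show ?case using b xy A_closed(4) by (intro exI[of _ "b * y"]) auto
  qed
  then obtain b where b: "b \<in> A" "b \<noteq> 0" "\<forall>i<Suc (degree Q). b * coeff Q i \<in> A" by blast
  have "b * coeff Q i \<in> A" for i
    using b(3) A_closed(1) by (cases "i < Suc (degree Q)") (auto simp: coeff_eq_0)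
  then show ?thesis using that[OF b(1,2)] unfolding poly_over_def by simp
qed

lemma transcendental_L: assumes Q: "poly_over L Q" "poly Q X = 0" shows "Q = 0"
proof -
  obtain b where b: "b \<in> A" "b \<noteq> 0" "poly_over A (smult b Q)" by (rule common_denominator[OF Q(1)])
  have "smult b Q = 0" by (rule transcendental_A[OF b(3)]) (use Q in simp)
  then show ?thesis using b by simp
qed

text \<open>The derivation of \<open>L[X]\<close> that extends \<open>dst\<close> on
  \<open>L\<close> and sends \<open>X\<close> to \<open>om \<gamma> * X\<close>: the factor
  \<open>om (\<gamma> ^ i)\<close> is the logarithmic derivative of \<open>X^i\<close>.\<close>

definition del where "del Q = (\<Sum>i\<le>degree Q. monom (dst (coeff Q i) + coeff Q i * om (\<gamma> ^ i)) i)"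

lemma coeff_del: "coeff (del Q) i = dst (coeff Q i) + coeff Q i * om (\<gamma> ^ i)"
  unfolding del_def by (simp add: coeff_sum coeff_eq_0 dst_0)

lemma \<gamma>_powerK: "\<gamma> ^ i \<in> K" using subfield_power[OF Ks] \<gamma>K by blast

lemma del_L: assumes "poly_over L Q" shows "poly_over L (del Q)"
proof -
  have "om (\<gamma> ^ i) \<in> L" for i using om_Sm[OF \<gamma>_powerK] Sm_A A_L by blast
  then show ?thesis using assms dst_L Lc(3,5) unfolding poly_over_def coeff_del by blast
qed

lemma degree_del: "degree (del Q) \<le> degree Q"
  by (rule degree_le) (simp add: coeff_del coeff_eq_0 dst_0)

lemma poly_del: assumes "poly_over L Q" shows "dst (poly Q X) = poly (del Q) X"
proof -
  have K: "coeff Q i \<in> Kst" "chi (\<gamma> ^ i) \<in> Kst" for i using poly_overD[OF assms] L_Kst chi_Kst[OF \<gamma>_powerK] by auto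
  have "dst (poly Q X) = (\<Sum>i\<le>degree Q. dst (coeff Q i * chi (\<gamma> ^ i)))"
    unfolding poly_altdef X_power by (rule dst_sum) (intro Kstc(5) K)
  also have "\<dots> = (\<Sum>i\<le>degree Q. coeff (del Q) i * X ^ i)"
  proof (rule sum.cong[OF refl])
    fix i
    show "dst (coeff Q i * chi (\<gamma> ^ i)) = coeff (del Q) i * X ^ i"
      unfolding dst_mult[OF K] coeff_del X_power using dst_chi[OF \<gamma>_powerK] \<gamma>K by (simp add: algebra_simps)
  qed
  also have "\<dots> = poly (del Q) X"
    unfolding poly_altdef using degree_del[of Q] by (intro sum.mono_neutral_right) (auto simp: coeff_eq_0)
  finally show ?thesis .
qed

text \<open>The top coefficient identifies \<open>c\<close> as the logarithmic derivative of
  \<open>X^n\<close>, the bottom one as that of \<open>coeff Q 0\<close>. Their quotient is killed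
  by the derivation, hence small, and \<open>X^n\<close> would lie in \<open>L\<close>.\<close>

lemma del_eq_smult:
  assumes Q: "poly_over L Q" "lead_coeff Q = 1" "degree Q > 0" "coeff Q 0 \<noteq> 0" shows "del Q \<noteq> smult c Q"
proof
  assume e: "del Q = smult c Q"
  define n where "n = degree Q"
  have "coeff (del Q) n = c" unfolding e n_def using Q(2) by simp
  then have c: "c = om (\<gamma> ^ n)" unfolding coeff_del using Q(2) dst_mult[of 1 1] Kstc(2) by (simp add: n_def)
  have "om (\<gamma> ^ 0) = 0" unfolding om_def using D_const kc(2) by (simp add: star_arith)
  then have d0: "dst (coeff Q 0) = c * coeff Q 0" using e coeff_del[of Q 0] by simp
  have K: "coeff Q 0 \<in> Kst" "chi (\<gamma> ^ n) \<in> Kst" "chi (\<gamma> ^ n) \<noteq> 0"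
    using poly_overD[OF Q(1)] L_Kst chi_Kst[OF \<gamma>_powerK] chi_nz \<gamma>K by auto
  have "dst (chi (\<gamma> ^ n)) = c * chi (\<gamma> ^ n)" unfolding c using dst_chi[OF \<gamma>_powerK] \<gamma>K by simp
  then have "dst (coeff Q 0 / chi (\<gamma> ^ n)) = 0" using dst_divide[OF K] d0 K(3) by simp
  then have "coeff Q 0 / X ^ n \<in> Sm" using dst_zero_Sm[of "coeff Q 0 / X ^ n"] K Kstc(8) unfolding X_power by blast
  then have "coeff Q 0 / X ^ n \<in> L" using Sm_A A_L by blast
  then have "coeff Q 0 / (coeff Q 0 / X ^ n) \<in> L" using poly_overD[OF Q(1)] Lc(8) by blast
  then have XL: "X ^ n \<in> L" using Q(4) X_nz by (simp add: divide_divide_eq_left)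
  have "monom 1 n - [:X ^ n:] = 0"
    by (rule transcendental_L) (use XL Lc in \<open>auto simp: poly_monom intro!: poly_over_diff[OF L] poly_over_monom[OF L] simp: poly_over_pCons_iff[OF L] poly_over_0[OF L]\<close>)
  then have "coeff (monom 1 n - [:X ^ n:]) n = 0" by simp
  then show False using Q(3) by (cases n) (auto simp: n_def)
qed

section \<open>The counting argument\<close>

lemma box_subset: "g \<in> box M \<Longrightarrow> g \<in> \<Gamma>'" using box(2) by blast

lemma box_subset_\<Gamma>: "g \<in> box M \<Longrightarrow> g \<in> \<Gamma>" using box_subset \<Gamma>' by blast

lemma \<Gamma>'_nz: "g \<in> \<Gamma>' \<Longrightarrow> g \<in> K" "g \<in> \<Gamma>' \<Longrightarrow> g \<noteq> 0" using \<Gamma>' \<Gamma>K \<Gamma>0 by auto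

text \<open>All exponents are at most multiples of \<open>N\<close>, so the poles grow like
  \<open>\<nu> i * N\<close>. The summand \<open>+ 1\<close> pays for the small coefficients, whose
  total height is eventually at most \<open>\<nu> i\<close>.\<close>

lemma box_combination_height:
  assumes T: "finite T" "\<And>j g. (j, g) \<in> T \<Longrightarrow> j < N \<and> g \<in> box (m * N)"
    and c: "\<And>p. p \<in> T \<Longrightarrow> small (c p)" and N: "N > 0"
  defines "f \<equiv> \<lambda>i. \<Sum>p\<in>T. c p i * (snd p * \<gamma> ^ fst p) ^ \<nu> i"
  shows "eventually (\<lambda>i. f i \<in> K \<and> height (f i) \<le> \<nu> i * (N * ((m + 1) * (\<Sum>y\<in>Y. height y) + 1))) UF"
proof -
  define PY where "PY w = (\<Sum>y\<in>Y. pole y w)" for w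
  have gK: "snd p \<in> K" "snd p \<noteq> 0" if "p \<in> T" for p using T(2)[of "fst p" "snd p"] that box_subset \<Gamma>'_nz by auto
  have eK: "snd p * \<gamma> ^ fst p \<in> K" "snd p * \<gamma> ^ fst p \<noteq> 0" if "p \<in> T" for p
    using gK[OF that] \<gamma>K \<gamma>_powerK Kc(5) by auto
  have cK: "c p i \<in> K" if "p \<in> T" for p i using smallD[OF c[OF that]] .
  have tK: "c p i * (snd p * \<gamma> ^ fst p) ^ \<nu> i \<in> K" if "p \<in> T" for p i
    using cK[OF that] subfield_power[OF Ks eK(1)[OF that]] Kc(5) by blast
  have fK: "f i \<in> K" for i unfolding f_def by (rule subfield_sum[OF Ks tK])
  have polef: "pole (f i) w \<le> (\<Sum>p\<in>T. pole (c p i) w) + \<nu> i * (N * (m + 1)) * PY w" if w: "w \<in> W" for i w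
    unfolding f_def
  proof (rule pole_sum[OF w T(1) tK])
    fix p assume p: "p \<in> T"
    have "pole (snd p * \<gamma> ^ fst p) w \<le> pole (snd p) w + fst p * pole \<gamma> w"
      using pole_mult[OF w gK(1)[OF p] \<gamma>_powerK] pole_power[OF w \<gamma>K] by simp
    also have "\<dots> \<le> (m * N) * PY w + N * PY w"
      using box_pole[OF _ w, of "snd p" "m * N"] \<gamma>_pole[OF w] T(2)[of "fst p" "snd p"] p unfolding PY_def
      by (intro add_mono mult_mono) auto
    finally have 1: "pole (snd p * \<gamma> ^ fst p) w \<le> (N * (m + 1)) * PY w" by (simp add: algebra_simps)
    have "pole (c p i * (snd p * \<gamma> ^ fst p) ^ \<nu> i) w \<le> pole (c p i) w + \<nu> i * pole (snd p * \<gamma> ^ fst p) w"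
      using pole_mult[OF w cK[OF p] subfield_power[OF Ks eK(1)[OF p]]] pole_power[OF w eK[OF p]] by simp
    also have "\<dots> \<le> (\<Sum>p\<in>T. pole (c p i) w) + \<nu> i * ((N * (m + 1)) * PY w)"
      using 1 p T(1) by (intro add_mono mult_left_mono member_le_sum) auto
    finally show "pole (c p i * (snd p * \<gamma> ^ fst p) ^ \<nu> i) w \<le> (\<Sum>p\<in>T. pole (c p i) w) + \<nu> i * (N * (m + 1)) * PY w"
      by (simp add: mult.assoc)
  qed
  have heightf: "height (f i) \<le> (\<Sum>p\<in>T. height (c p i)) + \<nu> i * (N * (m + 1)) * (\<Sum>y\<in>Y. height y)" for i
  proof -
    define y where "y = case_sum (\<lambda>p. c p i) (\<lambda>y. y)"
    define e where "e = case_sum (\<lambda>p::nat \<times> 'a. 1) (\<lambda>y::'a. \<nu> i * (N * (m + 1)))"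
    have "height (f i) \<le> (\<Sum>j\<in>T <+> Y. e j * height (y j)) + 0 * card ({} :: 'w set)"
      by (rule height_le[OF fK]) (use polef[of _ i] T(1) Y cK in \<open>auto simp: y_def e_def PY_def sum.Plus sum_distrib_left\<close>)
    then show ?thesis using T(1) Y by (simp add: y_def e_def sum.Plus sum_distrib_left)
  qed
  have "eventually (\<lambda>i. \<forall>p\<in>T. card T * height (c p i) \<le> \<nu> i) UF"
    using c T(1) unfolding small_def by (simp add: eventually_ball_finite)
  then show ?thesis
  proof (rule eventually_mono)
    fix i assume a: "\<forall>p\<in>T. card T * height (c p i) \<le> \<nu> i"
    have "card T * (\<Sum>p\<in>T. height (c p i)) \<le> card T * \<nu> i"
      unfolding sum_distrib_left using sum_mono[of T "\<lambda>p. card T * height (c p i)" "\<lambda>_. \<nu> i"] a by simp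
    then have "(\<Sum>p\<in>T. height (c p i)) \<le> \<nu> i" using T(1) by (cases "T = {}") auto
    also have "\<dots> \<le> \<nu> i * N" using N by simp
    finally have "height (f i) \<le> \<nu> i * N + \<nu> i * (N * (m + 1)) * (\<Sum>y\<in>Y. height y)" using heightf[of i] by linarith
    also have "\<dots> = \<nu> i * (N * ((m + 1) * (\<Sum>y\<in>Y. height y) + 1))" by (simp only: algebra_simps)
    finally show "f i \<in> K \<and> height (f i) \<le> \<nu> i * (N * ((m + 1) * (\<Sum>y\<in>Y. height y) + 1))" using fK by blast
  qed
qed

text \<open>A dimension count in \<open>VT\<close> modulo multiples of \<open>poly P X\<close> and
  \<open>R\<close>, which vanish on \<open>Z\<close>. The radius \<open>M j\<close> grows by
  \<open>\<pi>\<close> whenever the power of \<open>X\<close> drops by one, which gives the lower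
  coefficients of the monic \<open>P\<close> the room they need; multiples of \<open>R\<close> need
  a margin of \<open>\<rho>\<close>. The chosen multiples are independent, so what they leave over
  has only the dimension of thin boundary layers of the lowest \<open>n\<close> boxes.\<close>

lemma relation_mod_Van:
  assumes P: "poly_over A P" "lead_coeff P = 1" "poly P X \<in> Van Z" and R: "R \<in> A" "R \<noteq> 0" "R \<in> Van Z"
    and n: "n = degree P" "\<And>i. i < n \<Longrightarrow> coeff P i \<in> spn (box \<pi>)" and \<rho>: "R \<in> spn (box \<rho>)" and N: "N \<ge> n" "N \<ge> \<rho>"
  defines "M \<equiv> \<lambda>j. N + \<pi> * (N - j)"
  defines "T \<equiv> Sigma {..<N} (\<lambda>j. box (M j))"
  defines "VT \<equiv> spn ((\<lambda>p. snd p * \<gamma> ^ fst p) ` T)"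
  assumes J: "finite (J::'j set)" "card J > (\<Sum>j<n. (2 * M j + 1) ^ s - (2 * (M j - \<rho>) + 1) ^ s)" "\<And>j. j \<in> J \<Longrightarrow> z j \<in> VT"
  shows "\<exists>a. (\<forall>j\<in>J. a j \<in> Sm) \<and> (\<exists>j\<in>J. a j \<noteq> 0) \<and> (\<Sum>j\<in>J. a j * z j) \<in> Van Z"
proof -
  \<comment> \<open>\<open>I1\<close> indexes multiples of \<open>P\<close> by
    \<open>h * X^b\<close>, and \<open>I2\<close> multiples of \<open>R\<close> by
    \<open>h * X^j\<close> with \<open>j < n\<close>.\<close>
  define I1 where "I1 = Sigma {..<N - n} (\<lambda>b. box (M (b + n)))"
  define I2 where "I2 = Sigma {..<n} (\<lambda>j. box (M j - \<rho>))"
  define E where "E p = snd p * \<gamma> ^ fst p" for p :: "nat \<times> 'a"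
  have VT: "VT = spn (E ` T)" unfolding VT_def E_def ..
  define fam where "fam = case_sum z (case_sum (\<lambda>p. chi (E p) * poly P X) (\<lambda>p. chi (E p) * R))"
  define I where "I = J <+> (I1 <+> I2)"
  have fin: "finite T" "finite I1" "finite I2" unfolding T_def I1_def I2_def using box(1) by auto
  have cT: "card T = (\<Sum>j<N. (2 * M j + 1) ^ s)" unfolding T_def using box by (subst card_SigmaI) auto
  have c1: "card I1 = (\<Sum>b<N - n. (2 * M (b + n) + 1) ^ s)" unfolding I1_def using box by (subst card_SigmaI) auto
  have c2: "card I2 = (\<Sum>j<n. (2 * (M j - \<rho>) + 1) ^ s)" unfolding I2_def using box by (subst card_SigmaI) auto
  have "(\<Sum>j<N. (2 * M j + 1) ^ s) = (\<Sum>j<n. (2 * M j + 1) ^ s) + card I1"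
  proof -
    have "(\<Sum>j<N. (2 * M j + 1) ^ s) = (\<Sum>j<n. (2 * M j + 1) ^ s) + (\<Sum>j\<in>{n..<N}. (2 * M j + 1) ^ s)"
      using N(1) by (simp add: sum.atLeastLessThan_concat[of 0 n N, symmetric] flip: atLeast0LessThan)
    also have "(\<Sum>j\<in>{n..<N}. (2 * M j + 1) ^ s) = card I1"
      unfolding c1 by (rule sum.reindex_bij_witness[of _ "\<lambda>b. b + n" "\<lambda>j. j - n"]) auto
    finally show ?thesis .
  qed
  moreover have "(\<Sum>j<n. (2 * M j + 1) ^ s) = (\<Sum>j<n. (2 * M j + 1) ^ s - (2 * (M j - \<rho>) + 1) ^ s) + card I2"
    unfolding c2 by (simp add: power_mono flip: sum.distrib)
  ultimately have "card T < card J + card I1 + card I2" unfolding cT using J(2) by linarith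
  then have card: "card (E ` T) < card I" unfolding I_def using J(1) fin card_image_le[OF fin(1), of E] by (simp add: card_Plus)
  have mem1: "chi (E p) * poly P X \<in> VT" if p: "p \<in> I1" for p
  proof -
    obtain b h where p': "p = (b, h)" "b < N - n" "h \<in> box (M (b + n))" using p unfolding I1_def by auto
    have tm: "coeff P i * (1 * chi (h * \<gamma> ^ (b + i))) \<in> VT" if i: "i \<le> n" for i
    proof (cases "i = n")
      case True
      have "(b + n, h) \<in> T" unfolding T_def using p' by auto
      then have "E (b + n, h) \<in> E ` T" by blast
      then have "1 * chi (E (b + n, h)) \<in> VT" unfolding VT by (rule spn_monom[OF Sc(2)])
      then show ?thesis using True P(2) n(1) by (simp add: E_def)
    next
      case False
      then have i': "i < n" using i by simp
      show ?thesis unfolding VT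
      proof (rule spn_mult_monom[OF n(2)[OF i'] Sc(2)])
        fix g assume "g \<in> box \<pi>"
        then have "g * h \<in> box (\<pi> + M (b + n))" using box_mult p' by blast
        \<comment> \<open>As \<open>i < n\<close>, going down from exponent \<open>b + n\<close> to
          \<open>b + i\<close> enlarges the radius by at least \<open>\<pi>\<close>.\<close>
        moreover have "\<pi> + M (b + n) \<le> M (b + i)"
        proof -
          have "\<pi> * Suc (N - (b + n)) \<le> \<pi> * (N - (b + i))" using i' p'(2) by (intro mult_le_mono2) linarith
          then show ?thesis unfolding M_def by simp
        qed
        ultimately have "g * h \<in> box (M (b + i))" using box_mono by blast
        then have "(b + i, g * h) \<in> T" unfolding T_def using p' i' by auto
        then have "E (b + i, g * h) \<in> E ` T" by blast
        then show "g * (h * \<gamma> ^ (b + i)) \<in> E ` T" by (simp add: E_def mult.assoc)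
      qed
    qed
    have "chi (E p) * poly P X = (\<Sum>i\<le>n. coeff P i * (1 * chi (h * \<gamma> ^ (b + i))))"
      unfolding poly_altdef X_power E_def p' n(1) by (simp add: sum_distrib_left chi_mult power_add mult_ac)
    also have "\<dots> \<in> VT" using tm unfolding VT by (intro spn_sum) auto
    finally show ?thesis .
  qed
  have mem2: "chi (E p) * R \<in> VT" if p: "p \<in> I2" for p
  proof -
    obtain j h where p': "p = (j, h)" "j < n" "h \<in> box (M j - \<rho>)" using p unfolding I2_def by auto
    have "R * (1 * chi (h * \<gamma> ^ j)) \<in> VT" unfolding VT
    proof (rule spn_mult_monom[OF \<rho> Sc(2)])
      fix g assume "g \<in> box \<rho>"
      then have "g * h \<in> box (\<rho> + (M j - \<rho>))" using box_mult p' by blast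
      moreover have "\<rho> \<le> M j" unfolding M_def using N(2) by simp
      ultimately have "(j, g * h) \<in> T" unfolding T_def using p' N(1) by auto
      then have "E (j, g * h) \<in> E ` T" by blast
      then show "g * (h * \<gamma> ^ j) \<in> E ` T" by (simp add: E_def mult.assoc)
    qed
    then show ?thesis unfolding p' E_def by (simp add: mult.commute)
  qed
  have mem: "fam j \<in> VT" if "j \<in> I" for j using that mem1 mem2 J(3) unfolding I_def fam_def by auto
  have "\<exists>a. (\<forall>j\<in>I. a j \<in> Sm) \<and> (\<exists>j\<in>I. a j \<noteq> 0) \<and> (\<Sum>j\<in>I. a j * fam j) = 0"
  proof (rule subfield_dependent[OF Sm _ _ card])
    fix j assume "j \<in> I"
    then show "\<exists>c. (\<forall>i\<in>E ` T. c i \<in> Sm) \<and> fam j = (\<Sum>i\<in>E ` T. c i * chi i)"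
      using spn_finite[of "fam j" "E ` T"] mem fin(1) unfolding VT by blast
  qed (use J(1) fin in \<open>auto simp: I_def\<close>)
  then obtain a where a: "\<And>j. j \<in> I \<Longrightarrow> a j \<in> Sm" "\<exists>j\<in>I. a j \<noteq> 0" "(\<Sum>j\<in>I. a j * fam j) = 0" by blast
  define a1 where "a1 p = a (Inr (Inl p))" for p
  define a2 where "a2 p = a (Inr (Inr p))" for p
  have aS: "a1 p \<in> Sm" if "p \<in> I1" for p unfolding a1_def using a(1) that by (auto simp: I_def)
  have aS2: "a2 p \<in> Sm" if "p \<in> I2" for p unfolding a2_def using a(1) that by (auto simp: I_def)
  define z1 where "z1 = (\<Sum>p\<in>I1. a1 p * (chi (E p) * poly P X))"
  define z2 where "z2 = (\<Sum>p\<in>I2. a2 p * (chi (E p) * R))"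
  have rel: "(\<Sum>j\<in>J. a (Inl j) * z j) + (z1 + z2) = 0"
    using a(3) J(1) fin unfolding I_def z1_def z2_def a1_def a2_def by (simp add: sum.Plus fam_def)
  have EK: "E p \<in> K" "E p \<noteq> 0" if "snd p \<in> \<Gamma>'" for p unfolding E_def using box_\<Gamma>[OF that, of "fst p"] \<Gamma>K \<Gamma>0 by (blast, metis)
  have I\<Gamma>: "p \<in> I1 \<Longrightarrow> snd p \<in> \<Gamma>'" "p \<in> I2 \<Longrightarrow> snd p \<in> \<Gamma>'" for p unfolding I1_def I2_def using box_subset by auto
  have "z1 \<in> Van Z" unfolding z1_def by (intro Van_sum Van_Sm_mult aS Van_mult chi_Aint P(3) EK I\<Gamma>)
  moreover have "z2 \<in> Van Z" unfolding z2_def by (intro Van_sum Van_Sm_mult aS2 Van_mult chi_Aint R(3) EK I\<Gamma>)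
  ultimately have "0 - (z1 + z2) \<in> Van Z" by (intro Van_diff Van_add Van_0)
  moreover have "(\<Sum>j\<in>J. a (Inl j) * z j) = 0 - (z1 + z2)" using rel by (simp only: diff_0 eq_neg_iff_add_eq_0)
  ultimately have inVan: "(\<Sum>j\<in>J. a (Inl j) * z j) \<in> Van Z" by (simp only:)
  \<comment> \<open>Otherwise the relation reads \<open>p1 * P + R * p2 = 0\<close> with
    \<open>p2\<close> of degree below that of the monic \<open>P\<close>. Degrees force
    \<open>p1 = 0\<close> and \<open>p2 = 0\<close>, and independence of the exponentials then kills
    all remaining coefficients.\<close>
  have "\<exists>j\<in>J. a (Inl j) \<noteq> 0"
  proof (rule ccontr)
    assume no: "\<not> ?thesis"
    then have z12: "z1 + z2 = 0" using rel by simp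
    define q1 where "q1 b = (\<Sum>h\<in>box (M (b + n)). a1 (b, h) * chi h)" for b
    define q2 where "q2 j = (\<Sum>h\<in>box (M j - \<rho>). a2 (j, h) * chi h)" for j
    define p1 where "p1 = (\<Sum>b<N - n. monom (q1 b) b)"
    define p2 where "p2 = (\<Sum>j<n. monom (q2 j) j)"
    have cp1: "coeff p1 b = (if b < N - n then q1 b else 0)" for b unfolding p1_def by (simp add: coeff_sum)
    have cp2: "coeff p2 j = (if j < n then q2 j else 0)" for j unfolding p2_def by (simp add: coeff_sum)
    have q1A: "q1 b \<in> A" if "b < N - n" for b unfolding q1_def A_def
      by (rule spnI) (use that box aS in \<open>auto simp: I1_def\<close>)
    have q2A: "q2 j \<in> A" if "j < n" for j unfolding q2_def A_def
      by (rule spnI) (use that box aS2 in \<open>auto simp: I2_def\<close>)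
    have pA: "poly_over A p1" "poly_over A p2" unfolding poly_over_def cp1 cp2 using q1A q2A A_closed(1) by auto
    have nest: "(\<Sum>p\<in>Sigma {..<n'} S. a' p * (chi (E p) * y)) = poly (\<Sum>b<n'. monom (\<Sum>h\<in>S b. a' (b, h) * chi h) b) X * y"
      if "\<And>b. finite (S b)" for n' S a' y
    proof -
      have "poly (\<Sum>b<n'. monom (\<Sum>h\<in>S b. a' (b, h) * chi h) b) X * y = (\<Sum>b<n'. \<Sum>h\<in>S b. a' (b, h) * (chi (E (b, h)) * y))"
        by (simp add: poly_sum poly_monom X_power chi_mult sum_distrib_left sum_distrib_right mult_ac E_def)
      also have "\<dots> = (\<Sum>(b, h)\<in>Sigma {..<n'} S. a' (b, h) * (chi (E (b, h)) * y))" by (rule sum.Sigma) (use that in auto)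
      finally show ?thesis by (simp add: split_def)
    qed
    have z1: "z1 = poly p1 X * poly P X" unfolding z1_def p1_def q1_def I1_def by (rule nest) (rule box(1))
    have z2: "z2 = poly p2 X * R" unfolding z2_def p2_def q2_def I2_def by (rule nest) (rule box(1))
    have "p1 * P + smult R p2 = 0"
    proof (rule transcendental_L)
      have "poly_over L p1" "poly_over L p2" "poly_over L P" "R \<in> L" using pA P(1) R(1) A_L unfolding poly_over_def by auto
      then show "poly_over L (p1 * P + smult R p2)" by (intro poly_over_add[OF L] poly_over_mult[OF L] poly_over_smult[OF L])
      show "poly (p1 * P + smult R p2) X = 0" using z12 unfolding z1 z2 by (simp add: mult.commute)
    qed
    then have eq: "p1 * P = smult (- R) p2" by (simp add: eq_neg_iff_add_eq_0)
    have "p1 = 0"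
    proof (rule ccontr)
      assume p1: "p1 \<noteq> 0"
      have P0: "P \<noteq> 0" using P(2) by auto
      then have dp: "degree (p1 * P) = degree p1 + n" using p1 n(1) by (simp add: degree_mult_eq)
      have "p2 \<noteq> 0" using eq p1 P0 R(2) by auto
      then have "degree p2 < n" using cp2[of "degree p2"] by (metis leading_coeff_0_iff)
      then show False using dp eq R(2) by simp
    qed
    then have "p2 = 0" using eq R(2) by simp
    have "a1 p = 0" if p: "p \<in> I1" for p
    proof -
      obtain b h where p': "p = (b, h)" "b < N - n" "h \<in> box (M (b + n))" using p unfolding I1_def by auto
      have "(\<Sum>h\<in>box (M (b + n)). a1 (b, h) * chi h) = 0" using cp1[of b] \<open>p1 = 0\<close> p'(2) unfolding q1_def by simp
      then show ?thesis unfolding p'(1)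
        by (intro chi_independent[of "box (M (b + n))" "\<lambda>h. a1 (b, h)" h]) (use p' box(1) box_subset_\<Gamma> aS in \<open>auto simp: I1_def\<close>)
    qed
    moreover have "a2 p = 0" if p: "p \<in> I2" for p
    proof -
      obtain j h where p': "p = (j, h)" "j < n" "h \<in> box (M j - \<rho>)" using p unfolding I2_def by auto
      have "(\<Sum>h\<in>box (M j - \<rho>). a2 (j, h) * chi h) = 0" using cp2[of j] \<open>p2 = 0\<close> p'(2) unfolding q2_def by simp
      then show ?thesis unfolding p'(1)
        by (intro chi_independent[of "box (M j - \<rho>)" "\<lambda>h. a2 (j, h)" h]) (use p' box(1) box_subset_\<Gamma> aS2 in \<open>auto simp: I2_def\<close>)
    qed
    ultimately show False using a(2) no unfolding I_def a1_def a2_def by auto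
  qed
  then show ?thesis using inVan a(1) by (intro exI[of _ "\<lambda>j. a (Inl j)"]) (auto simp: I_def)
qed

text \<open>The auxiliary function argument: if \<open>P(X)\<close> and \<open>R\<close> vanished on a set \<open>Z\<close> of many places, linear
  algebra would produce a nonzero exponential polynomial of small height vanishing on \<open>Z\<close> to high order.\<close>
lemma few_common_zeros:
  assumes Z: "\<And>i. finite (Z i)" "\<And>i. Z i \<subseteq> W - Wb"
    and P: "poly_over A P" "lead_coeff P = 1" "poly P X \<in> Van Z" and R: "R \<in> A" "R \<noteq> 0" "R \<in> Van Z"
  shows "ae (\<lambda>i w. w \<notin> Z i)"
proof (rule ccontr)
  assume "\<not> ?thesis"
  then obtain q0 where "\<not> eventually (\<lambda>i. finite {w\<in>W. \<not> w \<notin> Z i} \<and> q0 * card {w\<in>W. \<not> w \<notin> Z i} \<le> \<nu> i) UF"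
    unfolding ae_def by blast
  moreover have "{w\<in>W. \<not> w \<notin> Z i} = Z i" for i using Z(2)[of i] by auto
  ultimately have many: "eventually (\<lambda>i. \<nu> i < q0 * card (Z i)) UF" using Z(1) unfolding UF_not by (simp add: not_le)
  define n where "n = degree P"
  have "finite (coeff P ` {..<n})" "coeff P ` {..<n} \<subseteq> A" using P(1) unfolding poly_over_def by auto
  then obtain \<pi> where \<pi>: "coeff P ` {..<n} \<subseteq> spn (box \<pi>)" using spn_box by blast
  obtain \<rho> where \<rho>: "R \<in> spn (box \<rho>)" using spn_box[of "{R}"] R(1) by auto
  \<comment> \<open>Choice of constants: \<open>\<kappa>\<close> bounds \<open>q * N\<close> in
    terms of \<open>(2 * N + 1) ^ s\<close>; \<open>C\<close> bounds the height of the auxiliary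
    function divided by \<open>\<nu> i * N\<close>; \<open>B\<close> makes zeros of order
    \<open>m = N * B\<close> at \<open>\<nu> i / (2 * q0)\<close> places exceed that height; and
    \<open>N > B * \<kappa>\<close> leaves more unknowns than the \<open>m * q\<close>
    conditions.\<close>
  define \<kappa> where "\<kappa> = n * (s * (2 * \<rho>) * (1 + \<pi>) ^ s)"
  define C where "C = ((1 + \<pi>) + 1) * (\<Sum>y\<in>Y. height y) + 1"
  define B where "B = 2 * q0 * C + 1"
  define N where "N = n + \<rho> + B * \<kappa> + 1"
  define m where "m = N * B"
  define M where "M j = N + \<pi> * (N - j)" for j
  define T where "T = Sigma {..<N} (\<lambda>j. box (M j))"
  define E where "E p = snd p * \<gamma> ^ fst p" for p :: "nat \<times> 'a"
  define q where "q = (\<Sum>j<n. (2 * M j + 1) ^ s - (2 * (M j - \<rho>) + 1) ^ s)"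
  have N: "N \<ge> n" "N \<ge> \<rho>" "N > 0" "N > B * \<kappa>" unfolding N_def by auto
  have m0: "m > 0" unfolding m_def B_def using N by simp
  have fT: "finite T" unfolding T_def using box(1) by auto
  have T\<Gamma>: "snd p \<in> \<Gamma>'" if "p \<in> T" for p using that box_subset unfolding T_def by auto
  have rel: "\<exists>a. (\<forall>j\<in>J. a j \<in> Sm) \<and> (\<exists>j\<in>J. a j \<noteq> 0) \<and> (\<Sum>j\<in>J. a j * z j) \<in> Van Z"
    if "finite J" "card J > q" "\<And>j. j \<in> J \<Longrightarrow> z j \<in> spn (E ` T)" for J :: "(nat \<times> 'a) set" and z
  proof (rule relation_mod_Van[OF P R n_def _ \<rho> N(1,2) that(1)])
    show "coeff P i \<in> spn (box \<pi>)" if "i < n" for i using \<pi> that by auto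
    show "card J > (\<Sum>j<n. (2 * (N + \<pi> * (N - j)) + 1) ^ s - (2 * (N + \<pi> * (N - j) - \<rho>) + 1) ^ s)"
      using that(2) unfolding q_def M_def .
    show "z j \<in> spn ((\<lambda>p. snd p * \<gamma> ^ fst p) ` Sigma {..<N} (\<lambda>j. box (N + \<pi> * (N - j))))" if "j \<in> J" for j
      using \<open>\<And>j. j \<in> J \<Longrightarrow> z j \<in> spn (E ` T)\<close>[OF that] unfolding E_def T_def M_def .
  qed
  have ET: "E ` T \<subseteq> \<Gamma>" using T\<Gamma> box_\<Gamma> unfolding E_def by auto
  \<comment> \<open>Elements of the span whose derivatives of order below \<open>j\<close> vanish on
    \<open>Z\<close>; each further derivative costs codimension at most \<open>q\<close>.\<close>
  define Sv where "Sv j = {z \<in> spn (E ` T). \<forall>i<j. (dst ^^ i) z \<in> Van Z}" for j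
  have chain: "\<exists>a. (\<forall>j\<in>J. a j \<in> Sm) \<and> (\<exists>j\<in>J. a j \<noteq> 0) \<and> (\<Sum>j\<in>J. a j * z j) \<in> Sv r"
    if "finite J" "card J > r * q" "\<And>j. j \<in> J \<Longrightarrow> z j \<in> spn (E ` T)" for J :: "(nat \<times> 'a) set" and z r
    using that
  proof (induction r arbitrary: J z)
    case 0
    then have "J \<noteq> {}" by auto
    moreover have "(\<Sum>j\<in>J. 1 * z j) \<in> Sv 0" unfolding Sv_def using 0 by (auto intro: spn_sum)
    ultimately show ?case using Sc(2) by (intro exI[of _ "\<lambda>_. 1"]) auto
  next
    case (Suc r)
    show ?case
    proof (rule codimension_chain[OF Sm _ _ Suc.prems(1), where n = "r * q" and V = "spn (E ` T)" and S = "Sv r" and m = q])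
      fix J :: "(nat \<times> 'a) set" and x assume J: "finite J" "card J > q" "\<And>j. j \<in> J \<Longrightarrow> x j \<in> Sv r"
      have xs: "x j \<in> spn (E ` T)" "x j \<in> Kst" if "j \<in> J" for j using J(3)[OF that] spn_Kst[OF ET] unfolding Sv_def by auto
      obtain a where a: "\<forall>j\<in>J. a j \<in> Sm" "\<exists>j\<in>J. a j \<noteq> 0" "(\<Sum>j\<in>J. a j * (dst ^^ r) (x j)) \<in> Van Z"
        using rel[OF J(1,2), of "\<lambda>j. (dst ^^ r) (x j)"] dst_funpow_spn[OF ET] xs by auto
      have axK: "a j * x j \<in> Kst" if "j \<in> J" for j using a(1) xs(2)[OF that] Sm_Kst that by (intro Kstc(5)) auto
      have "(dst ^^ i) (\<Sum>j\<in>J. a j * x j) \<in> Van Z" if i: "i < Suc r" for i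
      proof -
        have e: "(dst ^^ i) (\<Sum>j\<in>J. a j * x j) = (\<Sum>j\<in>J. (dst ^^ i) (a j * x j))" by (rule dst_funpow_sum) (rule axK)
        show ?thesis
        proof (cases "i < r")
          case True
          have "(dst ^^ i) (a j * x j) \<in> Van Z" if "j \<in> J" for j
            by (rule dst_funpow_scale[of _ _ r]) (use a J(3)[OF that] xs[OF that] that True in \<open>auto simp: Sv_def\<close>)
          then show ?thesis unfolding e by (rule Van_sum)
        next
          case False
          then have i: "i = r" using i by simp
          have "(dst ^^ r) (a j * x j) - a j * (dst ^^ r) (x j) \<in> Van Z" if "j \<in> J" for j
            by (rule dst_funpow_linear_mod) (use a J(3)[OF that] xs[OF that] that in \<open>auto simp: Sv_def\<close>)
          then have "(\<Sum>j\<in>J. (dst ^^ r) (a j * x j) - a j * (dst ^^ r) (x j)) \<in> Van Z" by (rule Van_sum)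
          from Van_add[OF this a(3)] show ?thesis unfolding e unfolding i by (simp add: sum_subtractf)
        qed
      qed
      moreover have "(\<Sum>j\<in>J. a j * x j) \<in> spn (E ` T)" using a xs by (intro spn_sum spn_Sm_mult) auto
      ultimately have "(\<Sum>j\<in>J. a j * x j) \<in> Sv (Suc r)" unfolding Sv_def by simp
      then show "\<exists>a. (\<forall>j\<in>J. a j \<in> Sm) \<and> (\<exists>j\<in>J. a j \<noteq> 0) \<and> (\<Sum>j\<in>J. a j * x j) \<in> Sv (Suc r)" using a by blast
    qed (use Suc in auto)
  qed
  have Mle: "2 * M j + 1 \<le> (1 + \<pi>) * (2 * N + 1)" for j
  proof -
    have "\<pi> * (N - j) \<le> \<pi> * N" by simp
    then show ?thesis unfolding M_def by (simp add: algebra_simps)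
  qed
  have "q * N \<le> \<kappa> * (2 * N + 1) ^ s"
  proof -
    have "((2 * M j + 1) ^ s - (2 * (M j - \<rho>) + 1) ^ s) * N \<le> s * (2 * \<rho>) * ((1 + \<pi>) * (2 * N + 1)) ^ s" for j
    proof (cases "s = 0")
      case False
      have "(2 * M j + 1) ^ s \<le> (2 * M j + 1 - 2 * \<rho>) ^ s + s * (2 * \<rho>) * (2 * M j + 1) ^ (s - 1)" by (rule power_le_power_diff)
      also have "(2 * M j + 1 - 2 * \<rho>) ^ s \<le> (2 * (M j - \<rho>) + 1) ^ s" by (intro power_mono) auto
      finally have bd: "((2 * M j + 1) ^ s - (2 * (M j - \<rho>) + 1) ^ s) \<le> s * (2 * \<rho>) * (2 * M j + 1) ^ (s - 1)" by linarith
      have "((2 * M j + 1) ^ s - (2 * (M j - \<rho>) + 1) ^ s) * N \<le> s * (2 * \<rho>) * (2 * M j + 1) ^ (s - 1) * (2 * M j + 1)"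
        by (rule mult_mono[OF bd]) (auto simp: M_def)
      also have "\<dots> = s * (2 * \<rho>) * (2 * M j + 1) ^ s" using power_minus_mult[of s "2 * M j + 1"] False by (simp only: mult.assoc)
      also have "\<dots> \<le> s * (2 * \<rho>) * ((1 + \<pi>) * (2 * N + 1)) ^ s" by (intro mult_left_mono power_mono Mle) auto
      finally show ?thesis .
    qed simp
    then have "q * N \<le> (\<Sum>j<n. s * (2 * \<rho>) * ((1 + \<pi>) * (2 * N + 1)) ^ s)" unfolding q_def sum_distrib_right by (intro sum_mono)
    also have "\<dots> = \<kappa> * (2 * N + 1) ^ s" unfolding \<kappa>_def power_mult_distrib by (simp only: sum_constant card_lessThan mult_ac of_nat_id)
    finally show ?thesis .
  qed
  then have "B * (q * N) \<le> B * (\<kappa> * (2 * N + 1) ^ s)" by (rule mult_left_mono) simp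
  then have "m * q \<le> B * \<kappa> * (2 * N + 1) ^ s" unfolding m_def by (simp add: mult_ac)
  also have "\<dots> < N * (2 * N + 1) ^ s" using N(4) by simp
  also have "\<dots> = (\<Sum>j<N. (2 * N + 1) ^ s)" by simp
  also have "\<dots> \<le> (\<Sum>j<N. (2 * M j + 1) ^ s)" by (intro sum_mono power_mono) (auto simp: M_def)
  also have "\<dots> = card T" unfolding T_def using box by (subst card_SigmaI) auto
  finally have "card T > m * q" .
  moreover have "chi (E p) \<in> spn (E ` T)" if "p \<in> T" for p using spn_monom[OF Sc(2), of "E p" "E ` T"] that by simp
  ultimately obtain a where a: "\<And>p. p \<in> T \<Longrightarrow> a p \<in> Sm" "\<exists>p\<in>T. a p \<noteq> 0" and F: "(\<Sum>p\<in>T. a p * chi (E p)) \<in> Sv m"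
    using chain[OF fT, of m "\<lambda>p. chi (E p)"] by blast
  have "\<exists>c. \<forall>p\<in>T. a p = star (c p) \<and> small (c p)" using a(1) unfolding Sm_def by (intro bchoice) blast
  then obtain c where c: "\<And>p. p \<in> T \<Longrightarrow> a p = star (c p)" "\<And>p. p \<in> T \<Longrightarrow> small (c p)" by blast
  define f where "f i = (\<Sum>p\<in>T. c p i * (snd p * \<gamma> ^ fst p) ^ \<nu> i)" for i
  have Ff: "(\<Sum>p\<in>T. a p * chi (E p)) = star f"
  proof -
    have "(\<Sum>p\<in>T. a p * chi (E p)) = (\<Sum>p\<in>T. star (\<lambda>i. c p i * (snd p * \<gamma> ^ fst p) ^ \<nu> i))"
      by (rule sum.cong) (auto simp: c(1) chi_def E_def star_arith)
    then show ?thesis unfolding star_sum f_def .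
  qed
  have fK: "f i \<in> K" for i unfolding f_def
  proof (rule subfield_sum[OF Ks], rule Kc(5))
    fix p assume p: "p \<in> T"
    then show "c p i \<in> K" using c(2) smallD by blast
    show "(snd p * \<gamma> ^ fst p) ^ \<nu> i \<in> K" using \<Gamma>'_nz(1)[OF T\<Gamma>[OF p]] \<gamma>_powerK Kc(5) by (intro subfield_power[OF Ks]) auto
  qed
  have "star f \<noteq> 0"
  proof
    assume "star f = 0"
    then have "(\<Sum>p\<in>T. a p * chi (snd p * \<gamma> ^ fst p)) = 0" using Ff unfolding E_def by simp
    then have "a p = 0" if "p \<in> T" for p by (rule pairs_independent[OF fT _ a(1) _ that, rotated -1]) (use T\<Gamma> in auto)
    then show False using a(2) by blast
  qed
  then have nz: "eventually (\<lambda>i. f i \<noteq> 0) UF" unfolding star_0_iff UF_not .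
  have ht: "eventually (\<lambda>i. f i \<in> K \<and> height (f i) \<le> \<nu> i * (N * C)) UF"
    unfolding f_def C_def
  proof (rule box_combination_height[OF fT])
    fix j g assume jg: "(j, g) \<in> T"
    then have "M j \<le> (1 + \<pi>) * N" "g \<in> box (M j)" "j < N" unfolding T_def M_def by auto
    then show "j < N \<and> g \<in> box ((1 + \<pi>) * N)" using box_mono by blast
  qed (use c N in auto)
  have "ae (\<lambda>i w. w \<in> Z i \<longrightarrow> (\<forall>j<r. vge w 1 ((D ^^ j) (f i))))" if "r \<le> m" for r
    using that
  proof (induction r)
    case (Suc r)
    then have "(dst ^^ r) (star f) \<in> Van Z" using F unfolding Ff Sv_def by simp
    then have "ae (\<lambda>i w. w \<in> Z i \<longrightarrow> vge w 1 ((D ^^ r) (f i)))" unfolding star_funpow_dst by (rule VanD)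
    moreover have "ae (\<lambda>i w. w \<in> Z i \<longrightarrow> (\<forall>j<r. vge w 1 ((D ^^ j) (f i))))" using Suc by simp
    ultimately show ?case by (rule ae_mono[OF ae_conj]) (auto simp: less_Suc_eq intro!: always_eventually)
  qed (use ae_finite[of "{}"] in simp)
  from this[OF order.refl] have "ae (\<lambda>i w. w \<in> Z i \<longrightarrow> (\<forall>j<m. vge w 1 ((D ^^ j) (f i))))" .
  then have ex: "eventually (\<lambda>i. finite {w\<in>W. \<not> (w \<in> Z i \<longrightarrow> (\<forall>j<m. vge w 1 ((D ^^ j) (f i))))} \<and>
      (2 * q0) * card {w\<in>W. \<not> (w \<in> Z i \<longrightarrow> (\<forall>j<m. vge w 1 ((D ^^ j) (f i))))} \<le> \<nu> i) UF"
    unfolding ae_def by blast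
  have "eventually (\<lambda>i. False) UF"
    using many nz ht ex nu_large[of 1]
  proof eventually_elim
    case (elim i)
    define Ex where "Ex = {w\<in>W. \<not> (w \<in> Z i \<longrightarrow> (\<forall>j<m. vge w 1 ((D ^^ j) (f i))))}"
    define S where "S = Z i - Ex"
    have Ex: "finite Ex" "2 * q0 * card Ex \<le> \<nu> i" using elim(4) unfolding Ex_def by auto
    \<comment> \<open>\<open>Z i\<close> has more than \<open>\<nu> i / q0\<close> places and at
      most half of that number is exceptional, hence the factor \<open>2 * q0\<close>.\<close>
    have "card (Z i) \<le> card S + card Ex" unfolding S_def using diff_card_le_card_Diff[OF Ex(1), of "Z i"] by linarith
    then have "2 * q0 * card (Z i) \<le> 2 * q0 * (card S + card Ex)" by (rule mult_left_mono) simp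
    then have big: "\<nu> i \<le> 2 * q0 * card S" using elim(1) Ex(2) by (simp only: distrib_left)
    have "int m \<le> v w (f i)" if "w \<in> S" for w
    proof (rule order_ge_of_derivatives[OF _ fK elim(2) m0])
      show "w \<in> W - Wb" using that Z(2)[of i] unfolding S_def by blast
      then show "vge w 1 ((D ^^ j) (f i))" if "j < m" for j using \<open>w \<in> S\<close> that unfolding S_def Ex_def by blast
    qed
    then have "m * card S \<le> height (f i)" using card_order_ge[OF fK elim(2), of S m] m0 Z(2)[of i] unfolding S_def by blast
    also have "\<dots> \<le> \<nu> i * (N * C)" using elim(3) by blast
    finally have "2 * q0 * (m * card S) \<le> 2 * q0 * (\<nu> i * (N * C))" by (rule mult_left_mono) simp
    moreover have "m * \<nu> i \<le> m * (2 * q0 * card S)" using big by (rule mult_left_mono) simp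
    ultimately have "m * \<nu> i \<le> 2 * q0 * (\<nu> i * (N * C))" by (simp only: mult_ac)
    moreover have "m * \<nu> i = 2 * q0 * (\<nu> i * (N * C)) + N * \<nu> i" unfolding m_def B_def by (simp add: algebra_simps)
    ultimately show False using N(3) elim(5) by simp
  qed
  then show False using UF_ex by blast
qed

section \<open>From ramification to a perfect power\<close>

lemma poly_over_A_Aint: "poly_over A P \<Longrightarrow> poly_over Aint P" unfolding poly_over_def using A_Aint by blast
lemma poly_over_A_L: "poly_over A P \<Longrightarrow> poly_over L P" unfolding poly_over_def using A_L by blast
lemma poly_over_L_Kst: "poly_over L P \<Longrightarrow> poly_over Kst P" unfolding poly_over_def using L_Kst by blast

text \<open>\<open>del\<close> does not raise the degree, so the quotient would be a constant, which
  \<open>del_eq_smult\<close> excludes.\<close>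

lemma del_dvd:
  assumes "poly_over L P" "lead_coeff P = 1" "degree P > 0" "coeff P 0 \<noteq> 0" shows "\<not> P dvd del P"
proof
  assume "P dvd del P"
  then obtain Q where Q: "del P = P * Q" by blast
  have P0: "P \<noteq> 0" using assms(2) by auto
  show False
  proof (cases "Q = 0")
    case True
    then show False using del_eq_smult[OF assms, of 0] Q by simp
  next
    case False
    then have "degree P + degree Q \<le> degree P" using degree_del[of P] P0 unfolding Q by (simp add: degree_mult_eq)
    then obtain c where "Q = [:c:]" using degree_eq_zeroE by (metis add_le_same_cancel1 le_zero_eq)
    then show False using del_eq_smult[OF assms, of c] Q by simp
  qed
qed

text \<open>Otherwise \<open>P = P1 ^ e * H * G ^ d\<close> with \<open>0 < e < d\<close>. At a zero
  of \<open>p1\<close> off \<open>Wb\<close>, up to few exceptions, the order of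
  \<open>p1 ^ e * h\<close> is divisible by \<open>d\<close>, so \<open>h\<close> vanishes as well
  or the zero is multiple; either way \<open>h * dst p1\<close> vanishes. A Bezout relation then
  produces a nonzero \<open>R\<close> in \<open>A\<close> vanishing at these zeros, so they are few,
  \<open>dst p1 / p1\<close> is small, and \<open>del P1\<close> is a multiple of \<open>P1\<close>,
  against \<open>del_eq_smult\<close>.\<close>

theorem perfect_power_of_values:
  assumes P: "poly_over A P" "lead_coeff P = 1" "coeff P 0 \<noteq> 0" and d: "d > 0"
    and y: "y \<in> Kst" "s0 \<in> Sm" "s0 \<noteq> 0" "g0 \<in> \<Gamma>" "y ^ d = s0 * chi g0 * poly P X"
  shows "\<exists>G. poly_over L G \<and> lead_coeff G = 1 \<and> P = G ^ d"
proof (rule perfect_power_or_simple_factor[OF L poly_over_A_L[OF P(1)] P(2) d])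
  fix G assume "poly_over L G" "lead_coeff G = 1" "P = G ^ d"
  then show ?thesis by blast
next
  fix P1 H G e
  assume P1: "poly_over L P1" "lead_coeff P1 = 1" and H: "poly_over L H" "lead_coeff H = 1" and G: "poly_over L G" "lead_coeff G = 1"
    and PF: "P = P1 ^ e * H * G ^ d" and e: "0 < e" "e < d" and P1': "degree P1 > 0" "\<not> P1 dvd H"
    and bez: "\<And>q. poly_over L q \<Longrightarrow> \<not> P1 dvd q \<Longrightarrow> \<exists>u v. poly_over L u \<and> poly_over L v \<and> u * P1 + v * q = 1"
  note polyL = poly_over_mult[OF L] poly_over_power[OF L] poly_over_add[OF L] poly_over_smult[OF L] poly_over_diff[OF L]
  obtain e' where e': "e = Suc e'" using e by (cases e) auto
  obtain d' where d': "d = Suc d'" using d by (cases d) auto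
  have pAint: "poly_over Aint (P1 * (P1 ^ e' * H * G ^ d))" "poly_over Aint (H * (P1 ^ e * G ^ d))" "poly_over Aint (G * (G ^ d' * (P1 ^ e * H)))"
    using poly_over_A_Aint[OF P(1)] unfolding PF e' d' by (simp_all add: mult_ac)
  have lc: "lead_coeff (P1 ^ e' * H * G ^ d) = 1" "lead_coeff (P1 ^ e * G ^ d) = 1" "lead_coeff (G ^ d' * (P1 ^ e * H)) = 1"
    using P1(2) H(2) G(2) by (simp_all only: lead_coeff_mult lead_coeff_power power_one mult_1)
  \<comment> \<open>The factors have coefficients in the fraction field of \<open>A\<close>; Gauss's
    lemma makes them integral at almost all places.\<close>
  have Pint: "poly_over Aint P1" by (rule gauss_star[OF _ P1(2) _ lc(1) pAint(1)]) (intro poly_over_L_Kst polyL P1 H G)+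
  have Hint: "poly_over Aint H" by (rule gauss_star[OF _ H(2) _ lc(2) pAint(2)]) (intro poly_over_L_Kst polyL P1 H G)+
  have Gint: "poly_over Aint G" by (rule gauss_star[OF _ G(2) _ lc(3) pAint(3)]) (intro poly_over_L_Kst polyL P1 H G)+
  define p1 where "p1 = poly P1 X"
  define h where "h = poly H X"
  define g where "g = poly G X"
  have int: "p1 \<in> Aint" "h \<in> Aint" "g \<in> Aint" unfolding p1_def h_def g_def using Pint Hint Gint X_Aint by (auto intro: Aint_poly)
  have nz: "p1 \<noteq> 0" "h \<noteq> 0" "g \<noteq> 0"
    unfolding p1_def h_def g_def using transcendental_L P1 H G by (metis leading_coeff_0_iff zero_neq_one)+
  have PX: "poly P X = p1 ^ e * h * g ^ d" unfolding PF p1_def h_def g_def by simp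
  have c0: "coeff P1 0 \<noteq> 0"
  proof
    assume "coeff P1 0 = 0"
    then have "poly P1 0 = 0" by (simp add: poly_0_coeff_0)
    then have "poly P 0 = 0" unfolding PF using e by simp
    then show False using P(3) by (simp add: poly_0_coeff_0)
  qed
  have dp: "dst p1 = poly (del P1) X" unfolding p1_def by (rule poly_del[OF P1(1)])
  obtain r t where uv: "poly_over L r" "poly_over L t" "r * P1 + t * H = 1" using bez[OF H(1) P1'(2)] by blast
  obtain r' t' where uv': "poly_over L r'" "poly_over L t'" "r' * P1 + t' * del P1 = 1"
    using bez[OF del_L[OF P1(1)] del_dvd[OF P1 P1'(1) c0]] by blast
  \<comment> \<open>Multiplying the Bezout relation for \<open>H\<close> with the one for
    \<open>del P1\<close> gives a relation for \<open>H * del P1\<close>.\<close>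
  define U where "U = r * (r' * P1 + t' * del P1) + t * H * r'"
  define V where "V = t * t'"
  have UV: "poly_over L U" "poly_over L V" unfolding U_def V_def by (intro polyL uv uv' P1 H del_L)+
  have "U * P1 + V * (H * del P1) = (r * P1 + t * H) * (r' * P1 + t' * del P1)" unfolding U_def V_def by (simp add: algebra_simps)
  then have one: "U * P1 + V * (H * del P1) = 1" using uv uv' by simp
  obtain bu where bu: "bu \<in> A" "bu \<noteq> 0" "poly_over A (smult bu U)" by (rule common_denominator[OF UV(1)])
  obtain bv where bv: "bv \<in> A" "bv \<noteq> 0" "poly_over A (smult bv V)" by (rule common_denominator[OF UV(2)])
  \<comment> \<open>A common denominator of both cofactors; it lies in \<open>A\<close>, as
    \<open>few_common_zeros\<close> requires.\<close>
  define R where "R = bu * bv"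
  define uu where "uu = bv * poly (smult bu U) X"
  define vv where "vv = bu * poly (smult bv V) X"
  have RA: "R \<in> A" "R \<noteq> 0" unfolding R_def using bu bv A_closed(4) by auto
  have uvint: "uu \<in> Aint" "vv \<in> Aint" unfolding uu_def vv_def
    using Aint_poly[OF poly_over_A_Aint[OF bu(3)] X_Aint] Aint_poly[OF poly_over_A_Aint[OF bv(3)] X_Aint] bu(1) bv(1) A_Aint
    by (blast intro: Aint_mult)+
  have "R * poly (U * P1 + V * (H * del P1)) X = uu * p1 + vv * (h * dst p1)"
    unfolding R_def uu_def vv_def p1_def h_def dp[unfolded p1_def] by (simp add: algebra_simps)
  then have R: "R = uu * p1 + vv * (h * dst p1)" unfolding one by simp
  obtain f where f: "p1 = star f" "\<And>i. f i \<in> K" using int(1) unfolding Aint_def by blast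
  obtain fh where fh: "h = star fh" "\<And>i. fh i \<in> K" using int(2) unfolding Aint_def by blast
  obtain fg where fg: "g = star fg" "\<And>i. fg i \<in> K" using int(3) unfolding Aint_def by blast
  obtain fy where fy: "y = star fy" "\<And>i. fy i \<in> K" by (rule KstE[OF y(1)]) (rule that)
  obtain fs where fs: "s0 = star fs" "small fs" by (rule SmE[OF y(2)])
  have g0: "g0 \<in> K" "g0 \<noteq> 0" using y(4) \<Gamma>K \<Gamma>0 by auto
  define Z where "Z i = {w\<in>W - Wb. f i \<noteq> 0 \<and> v w (f i) > 0}" for i
  have Z: "finite (Z i)" "Z i \<subseteq> W - Wb" for i
  proof -
    show "finite (Z i)"
    proof (cases "f i = 0")
      case False
      have "Z i \<subseteq> {w\<in>W. v w (f i) \<noteq> 0}" unfolding Z_def by auto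
      then show ?thesis using v_finite[OF f(2) False] finite_subset by blast
    qed (simp add: Z_def)
  qed (auto simp: Z_def)
  have p1V: "p1 \<in> Van Z" unfolding f(1)
    by (rule VanI[OF f(2) ae_mono[OF ae_finite[of "{}"]]]) (auto simp: Z_def vge_def intro!: always_eventually)
  have "p1 ^ e' * h * g ^ d \<in> Aint" using int by (intro Aint_mult Aint_power)
  from Van_mult[OF this p1V] have PV: "poly P X \<in> Van Z" unfolding PX e' by (simp add: mult_ac)
  have rel: "eventually (\<lambda>i. fy i ^ d = fs i * g0 ^ \<nu> i * (f i ^ e * fh i * fg i ^ d)) UF"
    using y(5) unfolding PX f(1) fh(1) fg(1) fy(1) fs(1) chi_def star_power star_arith star_eq_iff .
  have ev: "eventually (\<lambda>i. f i \<noteq> 0) UF" "eventually (\<lambda>i. fh i \<noteq> 0) UF" "eventually (\<lambda>i. fg i \<noteq> 0) UF"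
    using nz unfolding f(1) fh(1) fg(1) star_0_iff UF_not by auto
  have hV: "h * dst p1 \<in> Van Z"
    unfolding f(1) fh(1) ultra_map_star star_arith
  proof (rule VanI)
    show "fh i * D (f i) \<in> K" for i using fh(2) f(2) D_K Kc(5) by blast
    have 1: "ae (\<lambda>i w. ((vge w 0 (fh i) \<and> vge w 0 (fg i)) \<and> fs i \<noteq> 0 \<and> v w (fs i) = 0) \<and> v w (g0 ^ \<nu> i) = 0)"
      using int(2,3) y(3) unfolding fh(1) fg(1) fs(1) by (intro ae_conj AintD ae_small_unit[OF fs(2)] ae_chi_unit[OF g0])
    show "ae (\<lambda>i w. w \<in> Z i \<longrightarrow> vge w 1 (fh i * D (f i)))"
    proof (rule ae_mono[OF 1], use rel ev in eventually_elim, intro ballI impI)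
      fix i w
      assume rel: "fy i ^ d = fs i * g0 ^ \<nu> i * (f i ^ e * fh i * fg i ^ d)" and nz: "f i \<noteq> 0" "fh i \<noteq> 0" "fg i \<noteq> 0"
        and w: "w \<in> W" "w \<in> Z i"
        and 1: "((vge w 0 (fh i) \<and> vge w 0 (fg i)) \<and> fs i \<noteq> 0 \<and> v w (fs i) = 0) \<and> v w (g0 ^ \<nu> i) = 0"
      have fsK: "fs i \<in> K" using smallD[OF fs(2)] .
      have pw: "g0 ^ \<nu> i \<in> K" "f i ^ e \<in> K" "fg i ^ d \<in> K" using g0 f fg by (auto intro: subfield_power[OF Ks])
      have y0: "fy i \<noteq> 0"
      proof
        assume "fy i = 0"
        then have "fy i ^ d = 0" using d by simp
        then show False unfolding rel using nz 1 g0 by simp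
      qed
      have "int d * v w (fy i) = v w (fy i ^ d)" using v_power[OF w(1) fy(2) y0] by simp
      also have "\<dots> = int e * v w (f i) + v w (fh i) + int d * v w (fg i)"
        unfolding rel using nz 1 g0 w(1) pw fsK f(2) fh(2) fg(2) Kc(5) by (simp add: v_mult v_power)
      finally have eq: "int e * v w (f i) + v w (fh i) = int d * (v w (fy i) - v w (fg i))" by (simp add: algebra_simps)
      have wW: "w \<in> W - Wb" and pos: "v w (f i) > 0" using w unfolding Z_def by auto
      have Df: "D (f i) \<noteq> 0" "v w (D (f i)) = v w (f i) - 1" using v_D_simple[OF wW f(2) nz(1) pos] by auto
      have "v w (fh i) \<ge> 0" using 1 nz unfolding vge_def by auto
      moreover have "\<not> (v w (fh i) = 0 \<and> v w (f i) = 1)"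
      proof
        assume "v w (fh i) = 0 \<and> v w (f i) = 1"
        then have "int d dvd int e" using eq by (simp add: dvd_def)
        then show False using e by (simp add: int_dvd_int_iff nat_dvd_not_less)
      qed
      ultimately have "v w (fh i) + (v w (f i) - 1) \<ge> 1" using pos by linarith
      then show "vge w 1 (fh i * D (f i))"
        unfolding vge_def using v_mult[OF w(1) fh(2) D_K[OF f(2)] nz(2) Df(1)] Df(2) by simp
    qed
  qed
  have RV: "R \<in> Van Z" unfolding R using Van_add[OF Van_mult[OF uvint(1) p1V] Van_mult[OF uvint(2) hV]] .
  have "ae (\<lambda>i w. w \<notin> Z i)" by (rule few_common_zeros[OF Z P(1,2) PV RA RV])
  then have "ae (\<lambda>i w. \<not> (f i \<noteq> 0 \<and> v w (f i) > 0))"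
    by (rule ae_mono[OF ae_conj[OF _ ae_finite[OF Wb(1)]]]) (auto simp: Z_def intro!: always_eventually)
  then have "dst p1 / p1 \<in> Sm" unfolding f(1) using int(1) nz(1) unfolding f(1) by (intro small_logderiv[OF f(2)])
  then have lL: "dst p1 / p1 \<in> L" using Sm_A A_L by blast
  have "del P1 - smult (dst p1 / p1) P1 = 0"
  proof (rule transcendental_L)
    show "poly_over L (del P1 - smult (dst p1 / p1) P1)" by (intro polyL del_L P1 lL)
    show "poly (del P1 - smult (dst p1 / p1) P1) X = 0" using nz(1) dp unfolding p1_def by simp
  qed
  then show ?thesis using del_eq_smult[OF P1 P1'(1) c0, of "dst p1 / p1"] by simp
qed

end

section \<open>Finitely generated torsion-free groups\<close>

definition mgen :: "nat set \<Rightarrow> (nat \<Rightarrow> 'a::field) \<Rightarrow> 'a set" where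
  "mgen I e = {\<Prod>i\<in>I. e i powi n i | n. True}"

lemma mgenI: "(\<Prod>i\<in>I. e i powi n i) \<in> mgen I e" unfolding mgen_def by blast

lemma mgenE: assumes "x \<in> mgen I e" obtains n where "x = (\<Prod>i\<in>I. e i powi n i)"
  using assms unfolding mgen_def by blast

lemma mgen_member: assumes "finite I" "i \<in> I" shows "e i \<in> mgen I e"
proof -
  have "(\<Prod>j\<in>I. e j powi (if j = i then 1 else 0)) = (\<Prod>j\<in>I. if j = i then e j else 1)" by (intro prod.cong) auto
  also have "\<dots> = e i" using assms by simp
  finally show ?thesis using mgenI[where n = "\<lambda>j. if j = i then 1 else 0"] by metis
qed

text \<open>An elementary operation: replacing \<open>e j\<close> by
  \<open>e j * e i powi \<epsilon>\<close> affects only the exponent at \<open>i\<close>.\<close>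

lemma prod_move_generator:
  fixes e :: "nat \<Rightarrow> 'a::field"
  assumes I: "finite I" "i \<in> I" "j \<in> I" "i \<noteq> j" and nz: "e i \<noteq> 0"
  shows "(\<Prod>k\<in>I. (e(j := e j * e i powi \<epsilon>)) k powi n k) = (\<Prod>k\<in>I. e k powi (n(i := n i + \<epsilon> * n j)) k)"
proof -
  have split: "(\<Prod>k\<in>I. f k) = f i * (f j * (\<Prod>k\<in>I - {i} - {j}. f k))" for f :: "nat \<Rightarrow> 'a"
    using I by (subst prod.remove[of I i], simp, simp, subst prod.remove[of "I - {i}" j]) auto
  have "(\<Prod>k\<in>I - {i} - {j}. (e(j := e j * e i powi \<epsilon>)) k powi n k) = (\<Prod>k\<in>I - {i} - {j}. e k powi (n(i := n i + \<epsilon> * n j)) k)"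
    by (intro prod.cong) auto
  then show ?thesis unfolding split using I(4) nz
    by (simp add: power_int_mult_distrib power_int_add power_int_mult mult_ac)
qed

lemma mgen_move_generator:
  fixes e :: "nat \<Rightarrow> 'a::field"
  assumes I: "finite I" "i \<in> I" "j \<in> I" "i \<noteq> j" and nz: "e i \<noteq> 0"
  shows "mgen I (e(j := e j * e i powi \<epsilon>)) = mgen I e"
proof
  show "mgen I (e(j := e j * e i powi \<epsilon>)) \<subseteq> mgen I e"
  proof
    fix x assume "x \<in> mgen I (e(j := e j * e i powi \<epsilon>))"
    then obtain n where "x = (\<Prod>k\<in>I. (e(j := e j * e i powi \<epsilon>)) k powi n k)" by (rule mgenE)
    from this prod_move_generator[where e = e, OF assms, of \<epsilon> n] have "x = (\<Prod>k\<in>I. e k powi (n(i := n i + \<epsilon> * n j)) k)" by (rule trans)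
    then show "x \<in> mgen I e" using mgenI[of e "n(i := n i + \<epsilon> * n j)" I] by (simp only:)
  qed
  show "mgen I e \<subseteq> mgen I (e(j := e j * e i powi \<epsilon>))"
  proof
    fix x assume "x \<in> mgen I e"
    then obtain n where x: "x = (\<Prod>k\<in>I. e k powi n k)" unfolding mgen_def by blast
    define m where "m = n(i := n i - \<epsilon> * n j)"
    have "m(i := m i + \<epsilon> * m j) = n" using I(4) by (auto simp: m_def)
    then have "x = (\<Prod>k\<in>I. (e(j := e j * e i powi \<epsilon>)) k powi m k)" using prod_move_generator[where e = e, OF assms, of \<epsilon> m] x by (simp only:)
    then show "x \<in> mgen I (e(j := e j * e i powi \<epsilon>))" using mgenI[of "e(j := e j * e i powi \<epsilon>)" m I] by (simp only:)
  qed
qed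

text \<open>Take the fewest generators and, among all relations, one minimising \<open>\<Sum>|n i|\<close>: a Euclidean step
  on two generators shortens it, so a minimal relation involves one generator only.\<close>
lemma independent_generators:
  fixes e0 :: "nat \<Rightarrow> 'a::field"
  assumes I0: "finite I0" "\<And>i. i \<in> I0 \<Longrightarrow> e0 i \<noteq> 0"
    and tf: "\<And>x n. x \<in> mgen I0 e0 \<Longrightarrow> x ^ n = 1 \<Longrightarrow> n > 0 \<Longrightarrow> x = 1"
  shows "\<exists>I e. finite I \<and> (\<forall>i\<in>I. e i \<noteq> 0) \<and> mgen I e = mgen I0 e0 \<and>
    (\<forall>n. (\<Prod>i\<in>I. e i powi n i) = 1 \<longrightarrow> (\<forall>i\<in>I. n i = 0))"
proof (rule ccontr)
  assume none: "\<not> ?thesis"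
  define gs where "gs I e \<longleftrightarrow> finite I \<and> (\<forall>i\<in>I. e i \<noteq> 0) \<and> mgen I e = mgen I0 e0" for I and e :: "nat \<Rightarrow> 'a"
  define r where "r = (LEAST r. \<exists>I e. gs I e \<and> card I = r)"
  have "\<exists>r I e. gs I e \<and> card I = r" using I0 unfolding gs_def by blast
  then have r: "\<exists>I e. gs I e \<and> card I = r" unfolding r_def by (rule LeastI_ex)
  have rmin: "r \<le> card I" if "gs I e" for I e unfolding r_def using that by (intro Least_le) blast
  define Q where "Q N \<longleftrightarrow> (\<exists>I e n. gs I e \<and> card I = r \<and> (\<Prod>i\<in>I. e i powi n i) = 1 \<and> (\<exists>i\<in>I. n i \<noteq> 0) \<and> (\<Sum>i\<in>I. nat \<bar>n i\<bar>) = N)" for N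
  have "\<exists>N. Q N"
  proof -
    obtain I e where Ie: "gs I e" "card I = r" using r by blast
    then obtain n where "(\<Prod>i\<in>I. e i powi n i) = 1" "\<exists>i\<in>I. n i \<noteq> 0" using none unfolding gs_def by blast
    then have "Q (\<Sum>i\<in>I. nat \<bar>n i\<bar>)" unfolding Q_def using Ie by (intro exI conjI) auto
    then show ?thesis by (rule exI)
  qed
  then have "Q (LEAST N. Q N)" by (rule LeastI_ex)
  then obtain I e n where g: "gs I e" "card I = r" and rel: "(\<Prod>i\<in>I. e i powi n i) = 1" "\<exists>i\<in>I. n i \<noteq> 0"
    and N: "(\<Sum>i\<in>I. nat \<bar>n i\<bar>) = (LEAST N. Q N)" unfolding Q_def by blast
  have I: "finite I" "\<And>i. i \<in> I \<Longrightarrow> e i \<noteq> 0" "mgen I e = mgen I0 e0" using g(1) unfolding gs_def by auto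
  have single: "\<not> (n i \<noteq> 0 \<and> n j \<noteq> 0 \<and> \<bar>n j\<bar> \<le> \<bar>n i\<bar>)" if ij: "i \<in> I" "j \<in> I" "i \<noteq> j" for i j
  proof
    assume a: "n i \<noteq> 0 \<and> n j \<noteq> 0 \<and> \<bar>n j\<bar> \<le> \<bar>n i\<bar>"
    \<comment> \<open>With this sign, \<open>n i - \<epsilon> * n j\<close> has absolute value
      \<open>\<bar>n i\<bar> - \<bar>n j\<bar>\<close>.\<close>
    define \<epsilon> where "\<epsilon> = sgn (n i) * sgn (n j)"
    define e' where "e' = e(j := e j * e i powi \<epsilon>)"
    define m where "m = n(i := n i - \<epsilon> * n j)"
    have mn: "m(i := m i + \<epsilon> * m j) = n" using ij(3) by (auto simp: m_def)
    have "(\<Prod>k\<in>I. e' k powi m k) = 1"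
      unfolding e'_def prod_move_generator[where e = e, OF I(1) ij I(2)[OF ij(1)]] mn by (rule rel(1))
    moreover have "gs I e'" unfolding gs_def e'_def using I mgen_move_generator[where e = e, OF I(1) ij I(2)[OF ij(1)]] ij by auto
    moreover have "\<exists>k\<in>I. m k \<noteq> 0" using ij a by (intro bexI[of _ j]) (auto simp: m_def)
    ultimately have "Q (\<Sum>k\<in>I. nat \<bar>m k\<bar>)" unfolding Q_def using g(2) by (intro exI conjI) (assumption | rule refl)+
    then have "(\<Sum>k\<in>I. nat \<bar>n k\<bar>) \<le> (\<Sum>k\<in>I. nat \<bar>m k\<bar>)" unfolding N by (rule Least_le)
    moreover have "(\<Sum>k\<in>I - {i}. nat \<bar>m k\<bar>) = (\<Sum>k\<in>I - {i}. nat \<bar>n k\<bar>)" by (intro sum.cong) (auto simp: m_def)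
    moreover have "nat \<bar>m i\<bar> < nat \<bar>n i\<bar>" using a unfolding m_def \<epsilon>_def by (auto simp: sgn_if split: if_splits)
    ultimately show False using I(1) ij(1) by (simp add: sum.remove[of I i])
  qed
  obtain i where i: "i \<in> I" "n i \<noteq> 0" using rel(2) by blast
  have zero: "n j = 0" if "j \<in> I" "j \<noteq> i" for j
    using single[OF i(1) that(1)] single[OF that(1) i(1)] that(2) i(2) by (metis linear)
  have "(\<Prod>j\<in>I - {i}. e j powi n j) = 1" using zero by (intro prod.neutral) auto
  then have "e i powi n i = 1" using rel(1) I(1) i(1) by (simp add: prod.remove[of I i])
  \<comment> \<open>A relation in one generator makes it a torsion element, hence 1; dropping it
    contradicts the minimal number of generators.\<close>
  then have "e i ^ nat \<bar>n i\<bar> = 1" by (auto simp: power_int_def inverse_eq_1_iff power_inverse split: if_splits)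
  moreover have "e i \<in> mgen I0 e0" using mgen_member[OF I(1) i(1)] I(3) by blast
  ultimately have "e i = 1" using tf[of "e i" "nat \<bar>n i\<bar>"] i(2) by simp
  have eq: "(\<Prod>j\<in>I. e j powi m j) = (\<Prod>j\<in>I - {i}. e j powi m j)" for m
    using I(1) i(1) \<open>e i = 1\<close> by (simp add: prod.remove[of I i])
  have "mgen (I - {i}) e = mgen I e" unfolding mgen_def eq ..
  then have "gs (I - {i}) e" unfolding gs_def using I by auto
  then have "r \<le> card (I - {i})" by (rule rmin)
  then show False using g(2) I(1) i(1) card_Diff1_less[of I i] by simp
qed

lemma power_int_sum: "(x::'a::field) \<noteq> 0 \<Longrightarrow> x powi (\<Sum>j\<in>A. f j) = (\<Prod>j\<in>A. x powi f j)"
  by (induction A rule: infinite_finite_induct) (auto simp: power_int_add)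

text \<open>Nagata's change of variables: the weights \<open>1, q, q\<^sup>2, \<dots>\<close> separate the points of \<open>S\<close> for almost every
  \<open>q\<close>, and the kernel of the weight has an explicit basis.\<close>
theorem separating_weight:
  fixes e0 :: "nat \<Rightarrow> 'a::field"
  assumes I0: "finite I0" "\<And>i. i \<in> I0 \<Longrightarrow> e0 i \<noteq> 0" and G: "G = mgen I0 e0"
    and tf: "\<And>x n. x \<in> G \<Longrightarrow> x ^ n = 1 \<Longrightarrow> n > 0 \<Longrightarrow> x = 1"
    and S: "finite S" "S \<subseteq> G" and nontriv: "x0 \<in> G" "x0 \<noteq> 1"
  obtains \<omega> :: "'a \<Rightarrow> int" and \<gamma> e and s :: nat where "\<And>x y. x \<in> G \<Longrightarrow> y \<in> G \<Longrightarrow> \<omega> (x * y) = \<omega> x + \<omega> y" "inj_on \<omega> S"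
    "\<gamma> \<in> G" "\<omega> \<gamma> = 1" "\<And>n. (\<Prod>j<s. e j powi n j) \<in> G" "\<And>n. \<omega> (\<Prod>j<s. e j powi n j) = 0"
    "\<And>x. x \<in> G \<Longrightarrow> \<omega> x = 0 \<Longrightarrow> \<exists>n. x = (\<Prod>j<s. e j powi n j)"
    "\<And>n j. (\<Prod>j<s. e j powi n j) = 1 \<Longrightarrow> j < s \<Longrightarrow> n j = 0" "\<And>j. j < s \<Longrightarrow> e j \<noteq> (0::'a)"
proof -
  have tf': "\<And>x n. x \<in> mgen I0 e0 \<Longrightarrow> x ^ n = 1 \<Longrightarrow> n > 0 \<Longrightarrow> x = 1" using tf unfolding G .
  have "\<exists>I h. finite I \<and> (\<forall>i\<in>I. h i \<noteq> 0) \<and> mgen I h = mgen I0 e0 \<and> (\<forall>n. (\<Prod>i\<in>I. h i powi n i) = 1 \<longrightarrow> (\<forall>i\<in>I. n i = 0))"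
    by (rule independent_generators[OF I0(1)]) (use I0(2) tf' in blast)+
  then obtain I h where Ih0: "finite I" "\<forall>i\<in>I. h i \<noteq> 0" "mgen I h = mgen I0 e0"
    "\<forall>n. (\<Prod>i\<in>I. h i powi n i) = 1 \<longrightarrow> (\<forall>i\<in>I. n i = 0)" by (elim exE conjE)
  note Ih = Ih0(1,2) Ih0(3)[folded G] Ih0(4)[rule_format]
  obtain b where b: "bij_betw b {..<card I} I" using ex_bij_betw_nat_finite[OF Ih(1)] unfolding atLeast0LessThan by blast
  define r where "r = card I"
  define f where "f = h \<circ> b"
  define pr where "pr n = (\<Prod>i<r. f i powi n i)" for n :: "nat \<Rightarrow> int"
  have re: "(\<Prod>i\<in>I. h i powi n i) = (\<Prod>i<r. f i powi n (b i))" for n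
    unfolding r_def f_def using prod.reindex_bij_betw[OF b, of "\<lambda>i. h i powi n i"] by simp
  have f0: "f i \<noteq> 0" if "i < r" for i using that b Ih(2) bij_betwE[OF b] unfolding f_def r_def by auto
  have ind: "n i = 0" if p1: "(\<Prod>i<r. f i powi n i) = 1" and i: "i < r" for n :: "nat \<Rightarrow> int" and i
  proof -
    define n' where "n' j = n (the_inv_into {..<card I} b j)" for j
    have n': "n' (b i) = n i" if "i < r" for i unfolding n'_def
      using the_inv_into_f_f[of b "{..<card I}" i] b that by (auto simp: bij_betw_def r_def)
    have "(\<Prod>i\<in>I. h i powi n' i) = 1" unfolding re using p1 n' by simp
    then have "n' (b i) = 0" using Ih(4) bij_betwE[OF b] i unfolding r_def by auto
    then show ?thesis using n'[OF i] by simp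
  qed
  have Gf: "G = range pr"
  proof
    show "G \<subseteq> range pr"
    proof
      fix x assume "x \<in> G"
      then have "x \<in> mgen I h" using Ih(3) by simp
      then obtain n where "x = (\<Prod>i\<in>I. h i powi n i)" by (rule mgenE)
      then have "x = pr (\<lambda>i. n (b i))" unfolding re pr_def .
      then show "x \<in> range pr" by blast
    qed
    show "range pr \<subseteq> G"
    proof
      fix x assume "x \<in> range pr"
      then obtain n where x: "x = pr n" by blast
      have "x = (\<Prod>i\<in>I. h i powi n (the_inv_into {..<card I} b i))"
        unfolding re x pr_def using the_inv_into_f_f[of b "{..<card I}"] b by (intro prod.cong) (auto simp: bij_betw_def r_def)
      then show "x \<in> G" unfolding Ih(3)[symmetric] using mgenI[of h "\<lambda>i. n (the_inv_into {..<card I} b i)" I] by (simp only:)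
    qed
  qed
  define co where "co x = (SOME n. x = pr n)" for x
  have co: "x = pr (co x)" if x: "x \<in> G" for x
  proof -
    obtain n where "x = pr n" using x unfolding Gf by blast
    then show ?thesis unfolding co_def by (rule someI[of "\<lambda>n. x = pr n"])
  qed
  have pm: "pr n * pr m = pr (\<lambda>i. n i + m i)" for n m
    unfolding pr_def prod.distrib[symmetric] using f0 by (intro prod.cong) (auto simp: power_int_add)
  have uniq: "n i = m i" if eq: "pr n = pr m" and i: "i < r" for n m i
  proof -
    have "pr (\<lambda>i. n i + - m i) = pr (\<lambda>i. m i + - m i)" unfolding pm[symmetric] eq ..
    then have "pr (\<lambda>i. n i + - m i) = 1" by (simp add: pr_def)
    from ind[OF this[unfolded pr_def] i] show ?thesis by simp
  qed
  have coP: "co (pr n) i = n i" if "i < r" for n i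
    using uniq[OF co[of "pr n", symmetric] that] Gf by simp
  have Gm: "x * y \<in> G" if xy: "x \<in> G" "y \<in> G" for x y
  proof -
    obtain n m where "x = pr n" "y = pr m" using xy unfolding Gf by blast
    then have "x * y = pr (\<lambda>i. n i + m i)" using pm by simp
    then show ?thesis unfolding Gf by blast
  qed
  have com: "co (x * y) i = co x i + co y i" if xy: "x \<in> G" "y \<in> G" and i: "i < r" for x y i
  proof -
    have "x * y = pr (\<lambda>i. co x i + co y i)" using co[OF xy(1)] co[OF xy(2)] pm[of "co x" "co y"] by (simp only:)
    then show ?thesis using coP[OF i, of "\<lambda>i. co x i + co y i"] by simp
  qed
  have "r > 0"
  proof (rule ccontr)
    assume "\<not> r > 0"
    then have "G = {1}" unfolding Gf by (auto simp: pr_def)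
    then show False using nontriv by auto
  qed
  then obtain s where s: "r = Suc s" by (cases r) auto
  define \<omega>p where "\<omega>p x y = (\<Sum>i<r. monom (co x i - co y i) i)" for x y
  have \<omega>p0: "\<omega>p x y \<noteq> 0" if xy: "x \<in> G" "y \<in> G" "x \<noteq> y" for x y
  proof
    assume z: "\<omega>p x y = 0"
    have "co x i = co y i" if "i < r" for i
    proof -
      have "coeff (\<omega>p x y) i = co x i - co y i" unfolding \<omega>p_def using that by (simp add: coeff_sum)
      then show ?thesis using z by simp
    qed
    then have "pr (co x) = pr (co y)" unfolding pr_def by (intro prod.cong) auto
    then have "x = y" using co[OF xy(1)] co[OF xy(2)] by simp
    then show False using xy(3) by blast
  qed
  \<comment> \<open>Differences of exponent vectors are coefficient lists of nonzero polynomials;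
    \<open>q\<close> only has to avoid their finitely many integer roots.\<close>
  define bad where "bad = (\<Union>x\<in>S. \<Union>y\<in>S - {x}. {q. poly (\<omega>p x y) q = 0})"
  have "finite bad" unfolding bad_def using S \<omega>p0 by (intro finite_UN_I) (auto intro!: poly_roots_finite)
  then obtain q where q: "q \<notin> bad" using ex_new_if_finite[OF infinite_UNIV_int] by blast
  define \<omega> where "\<omega> x = (\<Sum>i<r. co x i * q ^ i)" for x
  have \<omega>m: "\<omega> (x * y) = \<omega> x + \<omega> y" if "x \<in> G" "y \<in> G" for x y
    unfolding \<omega>_def sum.distrib[symmetric] using com that by (intro sum.cong) (auto simp: distrib_right)
  have inj: "inj_on \<omega> S"
  proof (rule inj_onI, rule ccontr)
    fix x y assume xy: "x \<in> S" "y \<in> S" "\<omega> x = \<omega> y" "x \<noteq> y"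
    have "poly (\<omega>p x y) q = \<omega> x - \<omega> y" unfolding \<omega>p_def \<omega>_def by (simp add: poly_sum poly_monom left_diff_distrib sum_subtractf)
    then show False using q xy unfolding bad_def by auto
  qed
  \<comment> \<open>\<open>f (Suc j)\<close> has weight \<open>q ^ Suc j\<close> and
    \<open>f 0\<close> has weight 1, so this product has weight 0. Together these elements form a
    basis of the kernel, and \<open>sh\<close> converts its exponents into those of
    \<open>f\<close>.\<close>
  define e where "e j = f (Suc j) * f 0 powi (- (q ^ Suc j))" for j
  define sh where "sh n i = (case i of 0 \<Rightarrow> - (\<Sum>j<s. q ^ Suc j * n j) | Suc j \<Rightarrow> n j)" for n :: "nat \<Rightarrow> int" and i
  have f00: "f 0 \<noteq> 0" using f0 s by auto
  have eprod: "(\<Prod>j<s. e j powi n j) = pr (sh n)" for n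
  proof -
    have "(\<Prod>j<s. e j powi n j) = (\<Prod>j<s. f (Suc j) powi n j * f 0 powi (- (q ^ Suc j) * n j))"
      unfolding e_def by (intro prod.cong) (simp_all only: power_int_mult_distrib power_int_mult)
    also have "\<dots> = (\<Prod>j<s. f (Suc j) powi n j) * f 0 powi (\<Sum>j<s. - (q ^ Suc j) * n j)"
      unfolding prod.distrib power_int_sum[OF f00] ..
    also have "\<dots> = pr (sh n)"
      unfolding pr_def s prod.lessThan_Suc_shift sh_def by (simp add: sum_negf mult.commute)
    finally show ?thesis .
  qed
  have eG: "(\<Prod>j<s. e j powi n j) \<in> G" for n unfolding eprod Gf by blast
  have \<omega>e: "\<omega> (\<Prod>j<s. e j powi n j) = 0" for n
  proof -
    have "\<omega> (\<Prod>j<s. e j powi n j) = (\<Sum>i<r. sh n i * q ^ i)" unfolding \<omega>_def eprod using coP by (intro sum.cong) auto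
    also have "\<dots> = 0" unfolding s sum.lessThan_Suc_shift sh_def by (simp add: mult.commute)
    finally show ?thesis .
  qed
  have \<gamma>: "f 0 \<in> G" "\<omega> (f 0) = 1"
  proof -
    have f0e: "f 0 = pr (\<lambda>i. if i = 0 then 1 else 0)" unfolding pr_def s prod.lessThan_Suc_shift by simp
    then show "f 0 \<in> G" unfolding Gf by blast
    have "co (f 0) i = (if i = 0 then 1 else 0)" if "i < r" for i by (subst f0e) (rule coP[OF that])
    then have "\<omega> (f 0) = (\<Sum>i<r. (if i = 0 then 1 else 0) * q ^ i)" unfolding \<omega>_def by (intro sum.cong) auto
    then show "\<omega> (f 0) = 1" unfolding s sum.lessThan_Suc_shift by simp
  qed
  show thesis
  proof (rule that[where \<omega> = \<omega> and \<gamma> = "f 0" and e = e and s = s])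
    show "\<omega> (x * y) = \<omega> x + \<omega> y" if "x \<in> G" "y \<in> G" for x y using \<omega>m that .
    show "inj_on \<omega> S" "f 0 \<in> G" "\<omega> (f 0) = 1" using inj \<gamma> by auto
    show "(\<Prod>j<s. e j powi n j) \<in> G" "\<omega> (\<Prod>j<s. e j powi n j) = 0" for n using eG \<omega>e by auto
  next
    fix x assume x: "x \<in> G" "\<omega> x = 0"
    have "co x 0 = - (\<Sum>j<s. q ^ Suc j * co x (Suc j))" using x(2) unfolding \<omega>_def s sum.lessThan_Suc_shift by (simp add: mult.commute)
    then have "sh (\<lambda>j. co x (Suc j)) i = co x i" for i unfolding sh_def by (cases i) auto
    then have "sh (\<lambda>j. co x (Suc j)) = co x" by (rule ext)
    then have "(\<Prod>j<s. e j powi co x (Suc j)) = x" unfolding eprod using co[OF x(1)] by simp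
    then show "\<exists>n. x = (\<Prod>j<s. e j powi n j)" by (intro exI[of _ "\<lambda>j. co x (Suc j)"]) simp
  next
    fix n j assume "(\<Prod>j<s. e j powi n j) = 1" "j < s"
    then have "sh n (Suc j) = 0" using ind[of "sh n" "Suc j"] unfolding eprod pr_def s by simp
    then show "n j = 0" unfolding sh_def by simp
  next
    fix j assume "j < s"
    then show "e j \<noteq> 0" unfolding e_def using f0 f00 s by auto
  qed
qed

section \<open>Polynomial coefficients\<close>

context valued_function_field begin

lemma of_nat_k: "of_nat n \<in> k" by (rule subfield_of_nat[OF ks])

lemma poly_nat_K: "poly_over K P \<Longrightarrow> poly P (of_nat n) \<in> K"
  using poly_over_poly[OF Ks] of_nat_k kK by blast

lemma vge_k_mult: "w \<in> W \<Longrightarrow> c \<in> k \<Longrightarrow> x \<in> K \<Longrightarrow> vge w m x \<Longrightarrow> vge w m (c * x)"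
  using vge_mult[of w c x 0 m] kK v_k[of w c] unfolding vge_def by auto

text \<open>Interpolation: dividing out a linear factor at \<open>n0\<close> lowers the degree, and
  differences of distinct integers are nonzero elements of \<open>k\<close>, hence units at every
  place.\<close>

lemma coeffs_vge_of_values:
  assumes w: "w \<in> W" and P: "poly_over K P" "degree P \<le> r" and N: "finite N" "card N > r"
    and val: "\<And>n. n \<in> N \<Longrightarrow> vge w m (poly P (of_nat n))"
  shows "vge w m (coeff P i)"
  using P N val
proof (induction r arbitrary: P N i)
  case 0
  then obtain n where n: "n \<in> N" by fastforce
  obtain c where c: "P = [:c:]" using 0 degree_eq_zeroE by (metis le_zero_eq)
  then have "vge w m c" using 0(5)[OF n] by simp
  then show ?case unfolding c by (cases i) (auto simp: vge_def)
next
  case (Suc r)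
  then obtain n0 where n0: "n0 \<in> N" by fastforce
  define a where "a = poly P (of_nat n0)"
  have aK: "a \<in> K" unfolding a_def using poly_nat_K Suc.prems by blast
  have va: "vge w m a" unfolding a_def using Suc.prems n0 by blast
  have "[:- of_nat n0, 1:] dvd P - [:a:]" unfolding poly_eq_0_iff_dvd[symmetric] by (simp add: a_def)
  then obtain Q where Q: "P - [:a:] = [:- of_nat n0, 1:] * Q" by blast
  have n0K: "(of_nat n :: 'a) \<in> K" for n using of_nat_k kK by blast
  have QK: "poly_over K Q"
  proof (rule poly_over_dvd_quotient[OF Ks])
    show "poly_over K [:- of_nat n0, 1:]" using n0K Kc by (simp add: poly_over_pCons_iff[OF Ks] poly_over_0[OF Ks])
    show "poly_over K ([:- of_nat n0, 1:] * Q)" unfolding Q[symmetric]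
      using Suc.prems aK by (intro poly_over_diff[OF Ks]) (simp_all add: poly_over_pCons_iff[OF Ks] poly_over_0[OF Ks])
  qed simp
  have "degree (P - [:a:]) \<le> Suc r" using Suc.prems(2) by (intro degree_diff_le) auto
  then have dQ: "degree Q \<le> r" unfolding Q by (cases "Q = 0") (auto simp: degree_mult_eq simp del: mult_pCons_left)
  have vQ: "vge w m (coeff Q i)" for i
  proof (rule Suc.IH[OF QK dQ, of "N - {n0}"])
    show "finite (N - {n0})" "r < card (N - {n0})" using Suc.prems n0 by auto
    fix n assume n: "n \<in> N - {n0}"
    have ne: "(of_nat n - of_nat n0 :: 'a) \<noteq> 0" using n by simp
    have "poly (P - [:a:]) (of_nat n) = poly ([:- of_nat n0, 1:] * Q) (of_nat n)" unfolding Q ..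
    then have "poly P (of_nat n) - a = (of_nat n - of_nat n0) * poly Q (of_nat n)" by (simp add: algebra_simps)
    then have e: "poly Q (of_nat n) = inverse (of_nat n - of_nat n0) * (poly P (of_nat n) + - a)" using ne by (simp add: field_simps)
    show "vge w m (poly Q (of_nat n))" unfolding e
      using n Suc.prems va aK poly_nat_K[OF Suc.prems(1)] of_nat_k
      by (intro vge_k_mult vge_add vge_uminus kc(4,6) Kc(3,7) w) auto
  qed
  have P: "P = [:a:] + [:- of_nat n0, 1:] * Q" unfolding Q[symmetric] by simp
  have cK: "coeff Q i \<in> K" for i using QK unfolding poly_over_def by blast
  have "coeff P i = coeff [:a:] i + (- of_nat n0 * coeff Q i + (if i = 0 then 0 else coeff Q (i - 1)))"
    unfolding P by (cases i) (auto simp: coeff_pCons)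
  also have "vge w m \<dots>"
  proof (intro vge_add vge_k_mult w)
    show "coeff [:a:] i \<in> K" "vge w m (coeff [:a:] i)" using aK va Kc(1) by (cases i; simp add: vge_def)+
    show "(if i = 0 then 0 else coeff Q (i - 1)) \<in> K" "vge w m (if i = 0 then 0 else coeff Q (i - 1))"
      using cK vQ Kc(1) by (auto simp: vge_def)
    then show "- of_nat n0 * coeff Q i + (if i = 0 then 0 else coeff Q (i - 1)) \<in> K"
      using cK n0K Kc(3,5,7) by (simp only: Kc)
  qed (use cK vQ of_nat_k kc(7) n0K Kc(5,7) in blast)+
  finally show ?case .
qed

text \<open>Zeros at more than \<open>degree P\<close> integers would force a positive order on the
  leading coefficient 1.\<close>

lemma monic_finitely_many_zeros:
  assumes w: "w \<in> W" and P: "poly_over K P" "lead_coeff P = 1"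
  shows "finite {n. vge w 1 (poly P (of_nat n))}"
proof (rule ccontr)
  assume "\<not> ?thesis"
  then obtain N where N: "N \<subseteq> {n. vge w 1 (poly P (of_nat n))}" "finite N" "card N = Suc (degree P)"
    using infinite_arbitrarily_large by blast
  have "vge w 1 (coeff P (degree P))" by (rule coeffs_vge_of_values[OF w P(1) order.refl N(2)]) (use N in auto)
  then show False using P(2) v_1[OF w] unfolding vge_def by simp
qed

lemma poly_integral_off_finite:
  assumes P: "poly_over K P" shows "\<exists>E. finite E \<and> (\<forall>w\<in>W - E. \<forall>n. vge w 0 (poly P (of_nat n)))"
proof (intro exI[of _ "\<Union>i\<le>degree P. {w\<in>W. coeff P i \<noteq> 0 \<and> v w (coeff P i) \<noteq> 0}"] conjI ballI allI)
  have cK: "coeff P i \<in> K" for i using P unfolding poly_over_def by blast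
  show "finite (\<Union>i\<le>degree P. {w\<in>W. coeff P i \<noteq> 0 \<and> v w (coeff P i) \<noteq> 0})"
  proof (intro finite_UN_I)
    fix i
    show "finite {w\<in>W. coeff P i \<noteq> 0 \<and> v w (coeff P i) \<noteq> 0}" using v_finite[OF cK[of i]] by (cases "coeff P i = 0") auto
  qed simp
  fix w n assume w: "w \<in> W - (\<Union>i\<le>degree P. {w\<in>W. coeff P i \<noteq> 0 \<and> v w (coeff P i) \<noteq> 0})"
  have "vge w 0 (of_nat n ^ i * coeff P i)" if "i \<le> degree P" for i
    using w that cK subfield_power[OF ks of_nat_k] by (intro vge_k_mult) (auto simp: vge_def)
  moreover have "of_nat n ^ i * coeff P i \<in> K" for i using cK subfield_power[OF ks of_nat_k] kK Kc(5) by blast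
  ultimately have "vge w 0 (\<Sum>i\<le>degree P. of_nat n ^ i * coeff P i)" using w by (intro vge_sum) auto
  then show "vge w 0 (poly P (of_nat n))" by (simp add: poly_altdef mult.commute)
qed

lemma D_sum: "(\<And>i. i \<in> A \<Longrightarrow> f i \<in> K) \<Longrightarrow> D (sum f A) = (\<Sum>i\<in>A. D (f i))"
  by (induction A rule: infinite_finite_induct) (auto simp: D_0 D_add subfield_sum[OF Ks])

text \<open>Only the coefficients are differentiated, because the argument will be an integer and
  thus a constant.\<close>

definition polyD where "polyD P = (\<Sum>i\<le>degree P. monom (D (coeff P i)) i)"

lemma coeff_polyD: "coeff (polyD P) i = D (coeff P i)"
  unfolding polyD_def by (simp add: coeff_sum coeff_eq_0 D_0)

lemma D_poly_nat: assumes P: "poly_over K P" shows "D (poly P (of_nat n)) = poly (polyD P) (of_nat n)"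
proof -
  have cK: "coeff P i \<in> K" "(of_nat n ^ i :: 'a) \<in> k" "(of_nat n ^ i :: 'a) \<in> K" for i
    using P subfield_power[OF ks of_nat_k] kK unfolding poly_over_def by auto
  have "D (poly P (of_nat n)) = (\<Sum>i\<le>degree P. D (coeff P i * of_nat n ^ i))"
    unfolding poly_altdef by (rule D_sum) (intro Kc(5) cK)
  also have "\<dots> = (\<Sum>i\<le>degree P. D (coeff P i) * of_nat n ^ i)"
    using D_mult[OF cK(1,3)] D_const[OF cK(2)] by simp
  also have "\<dots> = poly (polyD P) (of_nat n)" unfolding polyD_def by (simp add: poly_sum poly_monom)
  finally show ?thesis .
qed

end

section \<open>Ramification in the polynomial coefficient\<close>

context exp_ring begin

lemma nu_avoids: assumes "finite F" shows "eventually (\<lambda>i. \<nu> i \<notin> F) UF"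
proof -
  obtain c where "\<forall>n\<in>F. n < c" using assms finite_nat_set_iff_bounded by blast
  then show ?thesis by (intro eventually_mono[OF nu_large[of c]]) force
qed

lemma nu_poly_nz: fixes P :: "'a poly" assumes "P \<noteq> 0" shows "eventually (\<lambda>i. poly P (of_nat (\<nu> i)) \<noteq> 0) UF"
proof -
  have "finite ((of_nat :: nat \<Rightarrow> 'a) -` {x. poly P x = 0})"
    by (rule finite_vimageI[OF poly_roots_finite[OF assms]]) (simp add: inj_on_def)
  from nu_avoids[OF this] show ?thesis by simp
qed

text \<open>Bezout relations turn a common zero of two coefficients into a pole of \<open>1\<close>; this bounds the
  multiplicities in the values of the coefficient by one off a finite set of places.\<close>
theorem coefficient_is_power:
  assumes a0: "poly_over K a0" "a0 \<noteq> 0" and d: "d > 0"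
    and y: "y \<in> Kst" "z \<in> Kst" "z \<noteq> 0" "\<kappa> \<in> K" "\<kappa> \<noteq> 0" "g \<in> \<Gamma>"
      "y ^ d = star (\<lambda>i. poly a0 (of_nat (\<nu> i))) * star (\<lambda>_. \<kappa>) * chi g * z ^ d"
  shows "\<exists>R Q lc. poly_over k R \<and> poly_over K Q \<and> lc \<in> K \<and> a0 = smult lc (R * Q ^ d)"
proof -
  \<comment> \<open>A factor over \<open>k\<close> of largest degree is split off first; the
    remaining factor is the one that must be a \<open>d\<close>-th power.\<close>
  define good where "good R \<longleftrightarrow> poly_over k R \<and> lead_coeff R = 1 \<and> R dvd a0" for R
  have "good 1" unfolding good_def using poly_over_1[OF ks] by simp
  moreover have "\<forall>R. good R \<longrightarrow> degree R < Suc (degree a0)" unfolding good_def less_Suc_eq_le using dvd_imp_degree_le a0(2) by blast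
  ultimately have "\<exists>R. good R \<and> (\<forall>R'. good R' \<longrightarrow> degree R' \<le> degree R)"
    using ex_has_greatest_nat[of good 1 degree "Suc (degree a0)"] by (simp add: less_imp_le)
  then obtain R where R: "good R" "\<And>R'. good R' \<Longrightarrow> degree R' \<le> degree R" by blast
  then obtain c1 where c1: "a0 = R * c1" unfolding good_def by blast
  have Rk: "poly_over k R" "lead_coeff R = 1" "R \<noteq> 0" using R(1) unfolding good_def by auto
  have RK: "poly_over K R" using Rk(1) kK unfolding poly_over_def by blast
  have c1K: "poly_over K c1" using poly_over_dvd_quotient[OF Ks RK Rk(3)] a0(1) c1 by blast
  define lc where "lc = lead_coeff c1"
  have lc: "lc \<in> K" "lc \<noteq> 0" unfolding lc_def using c1K a0 c1 unfolding poly_over_def by auto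
  define c' where "c' = smult (inverse lc) c1"
  have c': "poly_over K c'" "lead_coeff c' = 1" "c1 = smult lc c'"
    unfolding c'_def using lc c1K by (auto intro!: poly_over_smult[OF Ks] Kc(6) simp: lc_def)
  show ?thesis
  proof (rule perfect_power_or_simple_factor[OF Ks c'(1,2) d])
    fix G assume "poly_over K G" "c' = G ^ d"
    then show ?thesis using Rk lc c1 c'(3) by (intro exI[of _ R] exI[of _ G] exI[of _ lc]) simp
  next
    fix P1 H G e
    assume P1: "poly_over K P1" "lead_coeff P1 = 1" and H: "poly_over K H" "lead_coeff H = 1" and G: "poly_over K G" "lead_coeff G = 1"
      and PF: "c' = P1 ^ e * H * G ^ d" and e: "0 < e" "e < d" and P1': "degree P1 > 0" "\<not> P1 dvd H"
      and bez: "\<And>q. poly_over K q \<Longrightarrow> \<not> P1 dvd q \<Longrightarrow> \<exists>u v. poly_over K u \<and> poly_over K v \<and> u * P1 + v * q = 1"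
    define P' where "P' = polyD P1"
    have P'K: "poly_over K P'" unfolding P'_def poly_over_def coeff_polyD using P1(1) D_K unfolding poly_over_def by blast
    \<comment> \<open>If \<open>P1\<close> had constant coefficients, \<open>R * P1\<close> would be
      a factor over \<open>k\<close> of larger degree than \<open>R\<close>.\<close>
    have P'0: "P' \<noteq> 0"
    proof
      assume "P' = 0"
      then have "D (coeff P1 i) = 0" for i unfolding P'_def coeff_polyD[symmetric] by simp
      then have "poly_over k P1" using P1(1) D_zero unfolding poly_over_def by blast
      moreover have "R * P1 dvd a0"
      proof -
        have "P1 dvd P1 ^ e" using e by (intro dvd_power) simp
        then have "P1 dvd c1" unfolding c'(3) PF by (intro dvd_smult dvd_mult2)
        then show ?thesis unfolding c1 by (intro mult_dvd_mono) auto
      qed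
      moreover have "lead_coeff (R * P1) = 1" unfolding lead_coeff_mult using Rk(2) P1(2) by simp
      ultimately have Rg: "good (R * P1)" unfolding good_def using poly_over_mult[OF ks Rk(1)] by blast
      have "P1 \<noteq> 0" using P1(2) by auto
      then have "degree (R * P1) = degree R + degree P1" using Rk(3) by (simp add: degree_mult_eq)
      then show False using R(2)[OF Rg] P1'(1) by simp
    qed
    \<comment> \<open>\<open>P1\<close> is monic and \<open>D\<close> kills 1, so the top
      coefficient disappears.\<close>
    have "degree P' < degree P1"
    proof (rule ccontr)
      assume "\<not> ?thesis"
      then have "degree P' \<ge> degree P1" by simp
      then have "coeff P' (degree P') = 0" unfolding P'_def coeff_polyD[of P1 "degree (polyD P1)"]
        using P1(2) D_const kc(2) D_0 by (cases "degree (polyD P1) = degree P1") (auto simp: coeff_eq_0)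
      then show False using P'0 by simp
    qed
    then have ndvd: "\<not> P1 dvd P'" using dvd_imp_degree_le[of P1 P'] P'0 by auto
    obtain u1 t1 where b1: "poly_over K u1" "poly_over K t1" "u1 * P1 + t1 * H = 1" using bez[OF H(1) P1'(2)] by blast
    obtain u2 t2 where b2: "poly_over K u2" "poly_over K t2" "u2 * P1 + t2 * P' = 1" using bez[OF P'K ndvd] by blast
    have "\<exists>E. finite E \<and> (\<forall>w\<in>W - E. \<forall>P\<in>{P1, H, G, u1, t1, u2, t2, P'}. \<forall>n. vge w 0 (poly P (of_nat n)))"
    proof -
      have "\<forall>P\<in>{P1, H, G, u1, t1, u2, t2, P'}. \<exists>E. finite E \<and> (\<forall>w\<in>W - E. \<forall>n. vge w 0 (poly P (of_nat n)))"
        using poly_integral_off_finite P1 H G b1 b2 P'K by blast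
      then obtain Ef where Ef: "\<forall>P\<in>{P1, H, G, u1, t1, u2, t2, P'}. finite (Ef P) \<and> (\<forall>w\<in>W - Ef P. \<forall>n. vge w 0 (poly P (of_nat n)))"
        by (rule bchoice[THEN exE])
      show ?thesis by (intro exI[of _ "\<Union>P\<in>{P1, H, G, u1, t1, u2, t2, P'}. Ef P"] conjI) (use Ef in blast)+
    qed
    then obtain E0 where E0: "finite E0" "\<And>w P n. w \<in> W - E0 \<Longrightarrow> P \<in> {P1, H, G, u1, t1, u2, t2, P'} \<Longrightarrow> vge w 0 (poly P (of_nat n))" by blast
    have gK: "g \<in> K" "g \<noteq> 0" using y(6) \<Gamma>K \<Gamma>0 by auto
    \<comment> \<open>Besides \<open>Wb\<close>, these are the places where integrality of the
      polynomials may fail or where one of the constants is not a unit. None of them is a zero of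
      the value of \<open>P1\<close> once \<open>n\<close> is large.\<close>
    define E where "E = E0 \<union> Wb \<union> {w\<in>W. v w \<kappa> \<noteq> 0} \<union> {w\<in>W. v w g \<noteq> 0} \<union> {w\<in>W. v w lc \<noteq> 0}"
    have fE: "finite E" unfolding E_def using E0(1) Wb(1) v_finite y(4,5) gK lc by simp
    obtain fy where fy: "y = star fy" "\<And>i. fy i \<in> K" by (rule KstE[OF y(1)]) (rule that)
    obtain fz where fz: "z = star fz" "\<And>i. fz i \<in> K" by (rule KstE[OF y(2)]) (rule that)
    have rel: "eventually (\<lambda>i. fy i ^ d = poly a0 (of_nat (\<nu> i)) * \<kappa> * g ^ \<nu> i * fz i ^ d) UF"
      using y(7) unfolding fy(1) fz(1) chi_def star_power star_arith star_eq_iff .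
    have zn: "eventually (\<lambda>i. fz i \<noteq> 0) UF" using y(3) unfolding fz(1) star_0_iff UF_not .
    have "eventually (\<lambda>i. \<nu> i \<notin> (\<Union>w\<in>E \<inter> W. {n. vge w 1 (poly P1 (of_nat n))})) UF"
      by (rule nu_avoids) (use fE monic_finitely_many_zeros P1 in blast)
    then have "eventually (\<lambda>i. False) UF"
      using rel zn nu_poly_nz[OF a0(2)] nu_poly_nz[OF P'0]
    proof eventually_elim
      case (elim i)
      define n where "n = \<nu> i"
      define V where "V P = poly P (of_nat n :: 'a)" for P
      have VK: "V P \<in> K" if "poly_over K P" for P unfolding V_def using poly_nat_K[OF that] .
      have Va0: "V a0 = V R * (lc * (V P1 ^ e * V H * V G ^ d))" unfolding V_def c1 c'(3) PF by (simp add: algebra_simps)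
      have nz: "V a0 \<noteq> 0" using elim(4) unfolding V_def n_def .
      then have nzs: "V R \<noteq> 0" "V P1 \<noteq> 0" "V H \<noteq> 0" "V G \<noteq> 0" using e d unfolding Va0 by auto
      have DV: "D (V P1) = V P'" unfolding V_def P'_def by (rule D_poly_nat[OF P1(1)])
      have one: "V u1 * V P1 + V t1 * V H = 1" "V u2 * V P1 + V t2 * V P' = 1"
        using b1(3) b2(3) unfolding V_def by (metis poly_1 poly_add poly_mult)+
      have "v w (V P1) \<le> 0" if w: "w \<in> W" for w
      proof (cases "w \<in> E")
        case True
        then have "\<not> vge w 1 (V P1)" using elim(1) w unfolding n_def V_def by blast
        then show ?thesis unfolding vge_def by auto
      next
        case False
        then have wW: "w \<in> W - Wb" and wE: "w \<in> W - E0" and v0: "v w \<kappa> = 0" "v w g = 0" "v w lc = 0" using w unfolding E_def by auto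
        have int: "vge w 0 (V P)" if "P \<in> {P1, H, G, u1, t1, u2, t2, P'}" for P unfolding V_def using E0(2)[OF wE that] .
        show ?thesis
        proof (rule ccontr)
          assume "\<not> ?thesis"
          then have pos: "v w (V P1) \<ge> 1" by simp
          have no1: "\<not> vge w 1 (1::'a)" using v_1[OF w] unfolding vge_def by simp
          have no: "\<not> vge w 1 x" if x: "x \<in> K" "u * V P1 + t * x = 1" "u \<in> K" "t \<in> K" "vge w 0 u" "vge w 0 t" for x u t
          proof
            assume vx: "vge w 1 x"
            have "vge w 1 (V P1)" using pos unfolding vge_def by simp
            then have "vge w (0 + 1) (u * V P1)" "vge w (0 + 1) (t * x)" using w x vx VK[OF P1(1)] by (intro vge_mult; simp)+
            then have "vge w 1 (u * V P1 + t * x)" using w x VK[OF P1(1)] Kc(5) by (intro vge_add) auto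
            then show False using no1 x(2) by simp
          qed
          \<comment> \<open>By the Bezout relations \<open>V H\<close> and the derivative
            \<open>V P'\<close> are units at a zero of \<open>V P1\<close>. So the zero is simple,
            and comparing orders in the power identity makes \<open>d\<close> divide
            \<open>e\<close>.\<close>
          have "\<not> vge w 1 (V H)" by (rule no[OF VK[OF H(1)] one(1) VK[OF b1(1)] VK[OF b1(2)] int int]) auto
          then have vH: "v w (V H) = 0" using int[of H] nzs unfolding vge_def by auto
          have "\<not> vge w 1 (V P')" by (rule no[OF VK[OF P'K] one(2) VK[OF b2(1)] VK[OF b2(2)] int int]) auto
          moreover have "v w (V P') = v w (V P1) - 1" "V P' \<noteq> 0" using v_D_simple[OF wW VK[OF P1(1)] nzs(2)] pos unfolding DV by auto
          ultimately have vP: "v w (V P1) = 1" using pos unfolding vge_def by auto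
          have VRk: "V R \<in> k" unfolding V_def using poly_over_poly[OF ks Rk(1) of_nat_k] .
          have eq: "fy i ^ d = V a0 * \<kappa> * g ^ n * fz i ^ d" using elim(2) unfolding V_def n_def .
          have fy0: "fy i \<noteq> 0"
          proof
            assume "fy i = 0"
            then have "fy i ^ d = 0" using d by simp
            then show False unfolding eq using nz y(5) gK elim(3) by simp
          qed
          have pw: "g ^ n \<in> K" "V P1 ^ e \<in> K" "V G ^ d \<in> K" "fz i ^ d \<in> K" "V R \<in> K" "V H \<in> K" "V P1 \<in> K" "V G \<in> K"
            using gK VK P1 G H fz(2) VRk kK by (auto intro: subfield_power[OF Ks])
          have "int d * v w (fy i) = v w (fy i ^ d)" using v_power[OF w fy(2) fy0] by simp
          also have "\<dots> = int e * v w (V P1) + v w (V H) + int d * v w (V G) + int d * v w (fz i)"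
            unfolding eq Va0 using nzs nz y(4,5) gK elim(3) w pw lc fz(2) Kc(5) v0 v_k[OF w VRk] by (simp add: v_mult v_power)
          finally have "int e = int d * (v w (fy i) - v w (V G) - v w (fz i))" using vH vP by (simp add: algebra_simps)
          then have "int d dvd int e" by (metis dvd_triv_left)
          then show False using e by (simp add: int_dvd_int_iff nat_dvd_not_less)
        qed
      qed
      \<comment> \<open>Without any zero, \<open>V P1\<close> has an integral inverse and is
        therefore constant; its derivative \<open>V P'\<close> then vanishes, which is excluded for
        large \<open>n\<close>.\<close>
      then have "v w (inverse (V P1)) \<ge> 0" if "w \<in> W" for w using that VK[OF P1(1)] nzs by (simp add: v_inverse)
      then have "inverse (V P1) \<in> k" using VK[OF P1(1)] nzs by (intro integral_const) (auto intro: Kc(6))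
      then have "inverse (inverse (V P1)) \<in> k" by (rule kc(6))
      then have "D (V P1) = 0" using D_const by simp
      then show False using elim(5) DV unfolding V_def n_def by simp
    qed
    then show ?thesis using UF_ex by blast
  qed
qed

section \<open>Specialisations of exponential polynomials\<close>

definition Ts :: "'a poly \<Rightarrow> 'a ultra" where "Ts p = star (\<lambda>i. poly p (of_nat (\<nu> i)))"

lemma Ts_hom: "Ts (p + q) = Ts p + Ts q" "Ts (p * q) = Ts p * Ts q" "Ts 0 = 0" "Ts 1 = 1" "Ts (p ^ n) = Ts p ^ n" "Ts (- p) = - Ts p"
  unfolding Ts_def star_arith star_power by simp_all

lemma Ts_Sm: "poly_over K p \<Longrightarrow> Ts p \<in> Sm" unfolding Ts_def by (intro SmI small_poly)

lemma Ts_0_iff: "Ts p = 0 \<longleftrightarrow> p = 0"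
proof
  assume "Ts p = 0"
  then have "\<not> eventually (\<lambda>i. poly p (of_nat (\<nu> i)) \<noteq> 0) UF" unfolding Ts_def star_0_iff by (simp add: UF_not)
  then show "p = 0" using nu_poly_nz by blast
qed (simp add: Ts_hom)

text \<open>\<open>tr \<chi> \<theta>\<close> is the graph of the ring homomorphism on \<open>K[T][\<Gamma>]\<close> extending \<open>\<chi>\<close> on \<open>K[T]\<close> and \<open>\<theta>\<close> on \<open>\<Gamma>\<close>,
  where \<open>K[T][\<Gamma>]\<close> is realised by its values in the ultrapower.\<close>
inductive tr :: "('a poly \<Rightarrow> 'r::comm_ring_1) \<Rightarrow> ('a \<Rightarrow> 'r) \<Rightarrow> 'a ultra \<Rightarrow> 'r \<Rightarrow> bool" for \<chi> \<theta> where
  tr_0: "tr \<chi> \<theta> 0 0"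
| tr_Cons: "poly_over K p \<Longrightarrow> g \<in> \<Gamma> \<Longrightarrow> tr \<chi> \<theta> z w \<Longrightarrow> tr \<chi> \<theta> (Ts p * chi g + z) (\<chi> p * \<theta> g + w)"

lemma tr_plus: "tr \<chi> \<theta> z w \<Longrightarrow> tr \<chi> \<theta> z' w' \<Longrightarrow> tr \<chi> \<theta> (z + z') (w + w')"
  by (induction rule: tr.induct) (auto simp: add.assoc intro: tr_Cons)

lemma tr_monom: "poly_over K p \<Longrightarrow> g \<in> \<Gamma> \<Longrightarrow> tr \<chi> \<theta> (Ts p * chi g) (\<chi> p * \<theta> g)"
  using tr_Cons[OF _ _ tr_0, of p g \<chi> \<theta>] by simp

lemma tr_sum: "(\<And>i. i \<in> A \<Longrightarrow> tr \<chi> \<theta> (f i) (h i)) \<Longrightarrow> tr \<chi> \<theta> (sum f A) (sum h A)"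
  by (induction A rule: infinite_finite_induct) (auto intro: tr_0 tr_plus)

text \<open>Collecting terms with equal bases needs additivity of \<open>\<chi>\<close>. The graph
  is defined for arbitrary \<open>\<chi>\<close>, so the part about \<open>w\<close> is conditional,
  while the representation of \<open>z\<close> is always available.\<close>

lemma tr_rep: "tr \<chi> \<theta> z w \<Longrightarrow> \<exists>S q. finite S \<and> S \<subseteq> \<Gamma> \<and> (\<forall>g. poly_over K (q g)) \<and> z = (\<Sum>g\<in>S. Ts (q g) * chi g) \<and>
    ((\<forall>p q. poly_over K p \<longrightarrow> poly_over K q \<longrightarrow> \<chi> (p + q) = \<chi> p + \<chi> q) \<longrightarrow> \<chi> 0 = 0 \<longrightarrow> w = (\<Sum>g\<in>S. \<chi> (q g) * \<theta> g))"
proof (induction rule: tr.induct)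
  case tr_0
  show ?case by (intro exI[of _ "{}"] exI[of _ "\<lambda>_. 0"]) (simp add: poly_over_0[OF Ks])
next
  case (tr_Cons p g z w)
  then obtain S q where q: "finite S" "S \<subseteq> \<Gamma>" "\<And>g. poly_over K (q g)" "z = (\<Sum>g\<in>S. Ts (q g) * chi g)"
    "(\<forall>p q. poly_over K p \<longrightarrow> poly_over K q \<longrightarrow> \<chi> (p + q) = \<chi> p + \<chi> q) \<longrightarrow> \<chi> 0 = 0 \<longrightarrow> w = (\<Sum>g\<in>S. \<chi> (q g) * \<theta> g)" by blast
  define q0 where "q0 h = (if h \<in> S then q h else 0)" for h
  define q' where "q' = q0(g := q0 g + p)"
  have q0K: "poly_over K (q0 h)" for h unfolding q0_def using q(3) poly_over_0[OF Ks] by auto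
  have q'K: "poly_over K (q' h)" for h unfolding q'_def using q0K tr_Cons(1) poly_over_add[OF Ks] by auto
  have gen: "(\<Sum>h\<in>insert g S. F (q' h) * G h) = F p * G g + (\<Sum>h\<in>S. F (q h) * G h)"
    if F: "F (q0 g + p) = F (q0 g) + F p" "F 0 = 0" for F :: "'a poly \<Rightarrow> 's::comm_ring_1" and G
  proof -
    have "(\<Sum>h\<in>insert g S. F (q' h) * G h) = F (q' g) * G g + (\<Sum>h\<in>S - {g}. F (q' h) * G h)" using q(1) by (simp add: sum.insert_remove)
    also have "(\<Sum>h\<in>S - {g}. F (q' h) * G h) = (\<Sum>h\<in>S - {g}. F (q h) * G h)" by (intro sum.cong) (auto simp: q'_def q0_def)
    also have "F (q' g) * G g = F p * G g + F (q0 g) * G g" unfolding q'_def using F(1) by (simp add: distrib_right)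
    also have "F p * G g + F (q0 g) * G g + (\<Sum>h\<in>S - {g}. F (q h) * G h) = F p * G g + (\<Sum>h\<in>S. F (q h) * G h)"
      using q(1) F(2) by (cases "g \<in> S") (auto simp: q0_def sum.remove)
    finally show ?thesis .
  qed
  show ?case
  proof (intro exI[of _ "insert g S"] exI[of _ q'] conjI impI allI q'K)
    show "finite (insert g S)" "insert g S \<subseteq> \<Gamma>" using q tr_Cons by auto
    show "Ts p * chi g + z = (\<Sum>g\<in>insert g S. Ts (q' g) * chi g)" unfolding q(4) by (rule gen[symmetric]) (simp_all add: Ts_hom)
    assume F: "\<forall>p q. poly_over K p \<longrightarrow> poly_over K q \<longrightarrow> \<chi> (p + q) = \<chi> p + \<chi> q" "\<chi> 0 = 0"
    then have "w = (\<Sum>g\<in>S. \<chi> (q g) * \<theta> g)" using q(5) by blast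
    then show "\<chi> p * \<theta> g + w = (\<Sum>g\<in>insert g S. \<chi> (q' g) * \<theta> g)"
      by (simp only:) (rule gen[symmetric], use F q0K tr_Cons(1) in auto)
  qed
qed

definition trhom :: "('a poly \<Rightarrow> 'r::comm_ring_1) \<Rightarrow> ('a \<Rightarrow> 'r) \<Rightarrow> bool" where
  "trhom \<chi> \<theta> \<longleftrightarrow> (\<forall>p q. \<chi> (p + q) = \<chi> p + \<chi> q \<and> \<chi> (p * q) = \<chi> p * \<chi> q) \<and> \<chi> 0 = 0 \<and> \<chi> 1 = 1 \<and>
    (\<forall>g\<in>\<Gamma>. \<forall>h\<in>\<Gamma>. \<theta> (g * h) = \<theta> g * \<theta> h) \<and> \<theta> 1 = 1"

context
  fixes \<chi> :: "'a poly \<Rightarrow> 'r::comm_ring_1" and \<theta> :: "'a \<Rightarrow> 'r"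
  assumes hom: "trhom \<chi> \<theta>"
begin

lemma \<chi>: "\<chi> (p + q) = \<chi> p + \<chi> q" "\<chi> (p * q) = \<chi> p * \<chi> q" "\<chi> 0 = 0" "\<chi> 1 = 1"
  and \<theta>: "g \<in> \<Gamma> \<Longrightarrow> h \<in> \<Gamma> \<Longrightarrow> \<theta> (g * h) = \<theta> g * \<theta> h" "\<theta> 1 = 1"
  using hom unfolding trhom_def by auto

lemma tr_scale: "tr \<chi> \<theta> z w \<Longrightarrow> poly_over K p \<Longrightarrow> g \<in> \<Gamma> \<Longrightarrow> tr \<chi> \<theta> (Ts p * chi g * z) (\<chi> p * \<theta> g * w)"
proof (induction rule: tr.induct)
  case (tr_Cons q h z w)
  then have "tr \<chi> \<theta> (Ts (p * q) * chi (g * h) + Ts p * chi g * z) (\<chi> (p * q) * \<theta> (g * h) + \<chi> p * \<theta> g * w)"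
    by (intro tr.tr_Cons poly_over_mult[OF Ks] \<Gamma>m) auto
  then show ?case using tr_Cons \<theta>(1)[of g h] by (simp add: Ts_hom chi_mult \<chi> algebra_simps)
qed (simp add: tr_0)

lemma tr_mult: "tr \<chi> \<theta> z w \<Longrightarrow> tr \<chi> \<theta> z' w' \<Longrightarrow> tr \<chi> \<theta> (z * z') (w * w')"
proof (induction rule: tr.induct)
  case (tr_Cons p g z w)
  then show ?case using tr_plus[OF tr_scale[OF tr_Cons(5) tr_Cons(1,2)] tr_Cons(4)[OF tr_Cons(5)]] by (simp add: distrib_right)
qed (simp add: tr_0)

lemma tr_Ts: "poly_over K p \<Longrightarrow> tr \<chi> \<theta> (Ts p) (\<chi> p)"
  using tr_monom[OF _ \<Gamma>1, of p \<chi> \<theta>] by (simp add: chi_1 \<theta>)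

lemma tr_chi: "g \<in> \<Gamma> \<Longrightarrow> tr \<chi> \<theta> (chi g) (\<theta> g)"
  using tr_monom[OF poly_over_1[OF Ks], of g \<chi> \<theta>] by (simp add: Ts_hom \<chi>)

lemma tr_power: "tr \<chi> \<theta> z w \<Longrightarrow> tr \<chi> \<theta> (z ^ n) (w ^ n)"
  using tr_Ts[OF poly_over_1[OF Ks]] by (induction n) (auto simp: Ts_hom \<chi> intro: tr_mult)

text \<open>By additivity only the value 0 matters, and any representation of 0 has vanishing
  coefficients because the exponentials are independent over the small field.\<close>

lemma tr_functional: assumes "tr \<chi> \<theta> z w" "tr \<chi> \<theta> z w'" shows "w = w'"
proof -
  have "poly_over K (- 1)" using poly_over_uminus[OF Ks poly_over_1[OF Ks]] .
  from tr_mult[OF tr_Ts[OF this] assms(2)] have "tr \<chi> \<theta> (Ts (- 1) * z) (\<chi> (- 1) * w')" .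
  from tr_plus[OF assms(1) this] have t: "tr \<chi> \<theta> 0 (w + \<chi> (- 1) * w')" by (simp add: Ts_hom)
  obtain S q where q: "finite S" "S \<subseteq> \<Gamma>" "\<And>g. poly_over K (q g)" "0 = (\<Sum>g\<in>S. Ts (q g) * chi g)" "w + \<chi> (- 1) * w' = (\<Sum>g\<in>S. \<chi> (q g) * \<theta> g)"
    using tr_rep[OF t] \<chi>(1,3) by blast
  have "Ts (q g) = 0" if "g \<in> S" for g
    using chi_independent[OF q(1,2), of "\<lambda>g. Ts (q g)" g] q Ts_Sm that by simp
  then have "\<chi> (q g) = 0" if "g \<in> S" for g using that Ts_0_iff \<chi>(3) by simp
  then have "w + \<chi> (- 1) * w' = 0" using q(5) by simp
  moreover have "\<chi> (- 1) = - 1" using \<chi>(1)[of 1 "- 1"] \<chi>(3,4) by (simp add: eq_neg_iff_add_eq_0 add.commute)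
  ultimately show ?thesis by simp
qed

end

end

section \<open>Boxes in a finitely generated group\<close>

locale fg_exp_ring = exp_ring k K W Wb v D c0 \<nu> \<Gamma>
  for k K :: "'a::{alg_closed_field, field_char_0} set" and W Wb :: "'w set" and v D c0 \<nu> \<Gamma> +
  fixes I0 :: "nat set" and e0 :: "nat \<Rightarrow> 'a"
  assumes I0: "finite I0" "\<And>i. i \<in> I0 \<Longrightarrow> e0 i \<noteq> 0" and \<Gamma>_gen: "\<Gamma> = mgen I0 e0"

context exp_ring begin

lemma \<Gamma>_nz: "x \<in> \<Gamma> \<Longrightarrow> x \<in> K" "x \<in> \<Gamma> \<Longrightarrow> x \<noteq> 0" using \<Gamma>K \<Gamma>0 by auto

text \<open>A root of unity has height 0, so it lies in \<open>k\<close>, which meets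
  \<open>\<Gamma>\<close> only in 1.\<close>

lemma torsion_free: assumes "x \<in> \<Gamma>" "x ^ n = 1" "n > 0" shows "x = 1"
proof -
  have "n * height x = height (1 :: 'a)" using height_power[OF \<Gamma>_nz[OF assms(1)], of n] assms(2) by simp
  then have "height x = 0" using height_k[OF kc(2)] assms(3) by simp
  then show ?thesis using height_0_k \<Gamma>_nz[OF assms(1)] \<Gamma>k assms(1) by blast
qed

lemma \<Gamma>_power: "x \<in> \<Gamma> \<Longrightarrow> x ^ n \<in> \<Gamma>" by (induction n) (auto simp: \<Gamma>1 \<Gamma>m)

lemma \<Gamma>_powi: "x \<in> \<Gamma> \<Longrightarrow> x powi n \<in> \<Gamma>" unfolding power_int_def by (auto intro: \<Gamma>_power \<Gamma>i)

end

context valued_function_field begin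

lemma pole_1: "w \<in> W \<Longrightarrow> pole 1 w = 0" unfolding pole_def by (simp add: v_1)

lemma pole_powi: assumes "w \<in> W" "x \<in> K" "x \<noteq> 0" shows "pole (x powi n) w \<le> nat \<bar>n\<bar> * (pole x w + pole (inverse x) w)"
  using pole_power[OF assms, of "nat n"] pole_power[OF assms(1) Kc(6)[OF assms(2)], of "nat (- n)"] assms(3)
  unfolding power_int_def by (auto simp: distrib_left)

lemma pole_prod: assumes "w \<in> W" "\<And>j. j \<in> A \<Longrightarrow> f j \<in> K" shows "pole (prod f A) w \<le> (\<Sum>j\<in>A. pole (f j) w)"
  using assms(2)
proof (induction A rule: infinite_finite_induct)
  case (insert a A)
  then have "pole (f a * prod f A) w \<le> pole (f a) w + pole (prod f A) w"
    using subfield_prod[OF Ks, of A f] by (intro pole_mult[OF assms(1)]) auto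
  then show ?case using insert by (auto intro: order.trans)
qed (auto simp: pole_1[OF assms(1)])

end

context fg_exp_ring begin

lemma box_ring_exists:
  assumes S: "finite S" "S \<subseteq> \<Gamma>" and x0: "x0 \<in> \<Gamma>" "x0 \<noteq> 1"
  shows "\<exists>(\<omega> :: 'a \<Rightarrow> int) \<gamma> box s Y. box_ring k K W Wb v D c0 \<nu> \<Gamma> \<gamma> {x\<in>\<Gamma>. \<omega> x = 0} box s Y \<and>
    (\<forall>x\<in>\<Gamma>. \<forall>y\<in>\<Gamma>. \<omega> (x * y) = \<omega> x + \<omega> y) \<and> inj_on \<omega> S \<and> \<omega> \<gamma> = 1"
proof (rule separating_weight[of I0 e0 \<Gamma> S x0])
  show "\<And>x n. x \<in> \<Gamma> \<Longrightarrow> x ^ n = 1 \<Longrightarrow> 0 < n \<Longrightarrow> x = 1" by (rule torsion_free)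
next
  fix \<omega> :: "'a \<Rightarrow> int" and \<gamma> and e :: "nat \<Rightarrow> 'a" and s
  assume \<omega>: "\<And>x y. x \<in> \<Gamma> \<Longrightarrow> y \<in> \<Gamma> \<Longrightarrow> \<omega> (x * y) = \<omega> x + \<omega> y" and inj: "inj_on \<omega> S" and \<gamma>: "\<gamma> \<in> \<Gamma>" "\<omega> \<gamma> = 1"
    and e\<Gamma>: "\<And>n. (\<Prod>j<s. e j powi n j) \<in> \<Gamma>" and \<omega>e: "\<And>n. \<omega> (\<Prod>j<s. e j powi n j) = 0"
    and ker: "\<And>x. x \<in> \<Gamma> \<Longrightarrow> \<omega> x = 0 \<Longrightarrow> \<exists>n. x = (\<Prod>j<s. e j powi n j)"
    and ind: "\<And>n j. (\<Prod>j<s. e j powi n j) = 1 \<Longrightarrow> j < s \<Longrightarrow> n j = 0" and e0: "\<And>j. j < s \<Longrightarrow> e j \<noteq> 0"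
  define pr where "pr n = (\<Prod>j<s. e j powi n j)" for n :: "nat \<Rightarrow> int"
  define B where "B M = PiE {..<s} (\<lambda>_. {- int M..int M})" for M
  define box where "box M = pr ` B M" for M
  \<comment> \<open>\<open>Y\<close> is a set, in which equal elements coincide, so the poles of the
    generators cannot simply be added up. With exponent \<open>2 * s\<close> every single member is
    bounded by the sum over \<open>Y\<close>, and averaging over the \<open>2 * s\<close> generators
    and inverses gives the estimate.\<close>
  define Y where "Y = insert \<gamma> ((\<lambda>j. e j ^ (2 * s)) ` {..<s} \<union> (\<lambda>j. inverse (e j) ^ (2 * s)) ` {..<s})"
  have pr_cong: "pr n = pr m" if "\<And>j. j < s \<Longrightarrow> n j = m j" for n m unfolding pr_def using that by (intro prod.cong) auto
  have pr_add: "pr n * pr m = pr (\<lambda>j. n j + m j)" for n m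
    unfolding pr_def prod.distrib[symmetric] using e0 by (intro prod.cong) (auto simp: power_int_add)
  have eG: "e j \<in> \<Gamma>" if "j < s" for j
  proof -
    have "e j \<in> mgen {..<s} e" using mgen_member[of "{..<s}" j e] that by simp
    then obtain n where "e j = (\<Prod>j<s. e j powi n j)" by (rule mgenE)
    then show ?thesis using e\<Gamma>[of n] by (simp only:)
  qed
  have fB: "finite (B M)" for M unfolding B_def by (intro finite_PiE) auto
  have restr: "pr n \<in> box M" if "\<And>j. j < s \<Longrightarrow> \<bar>n j\<bar> \<le> int M" for n M
  proof -
    have "pr n = pr (restrict n {..<s})" by (rule pr_cong) auto
    moreover have "restrict n {..<s} \<in> B M" unfolding B_def using that by (auto simp: abs_le_iff minus_le_iff)
    ultimately show ?thesis unfolding box_def by (simp only:) (rule imageI)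
  qed
  have boxE: "\<exists>n. x = pr n \<and> (\<forall>j<s. \<bar>n j\<bar> \<le> int M)" if "x \<in> box M" for x M
  proof -
    obtain n where n: "n \<in> B M" "x = pr n" using \<open>x \<in> box M\<close> unfolding box_def by blast
    have "\<bar>n j\<bar> \<le> int M" if "j < s" for j
    proof -
      have "n j \<in> {- int M..int M}"
        using PiE_mem[of n "{..<s}" "\<lambda>_. {- int M..int M}" j] n(1) that unfolding B_def by simp
      then show ?thesis by (auto simp: abs_le_iff)
    qed
    then show ?thesis using n(2) by blast
  qed
  have injB: "inj_on pr (B M)" for M
  proof (rule inj_onI)
    fix n m assume nm: "n \<in> B M" "m \<in> B M" "pr n = pr m"
    have "pr (\<lambda>j. n j + - m j) = pr (\<lambda>j. m j + - m j)" unfolding pr_add[symmetric] nm(3) ..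
    then have "pr (\<lambda>j. n j + - m j) = 1" by (simp add: pr_def)
    then have "n j = m j" if "j < s" for j using ind[of "\<lambda>j. n j + - m j" j] that unfolding pr_def by simp
    then show "n = m" using nm(1,2) unfolding B_def by (intro PiE_ext) auto
  qed
  have \<omega>1: "\<omega> 1 = 0" using \<omega>[OF \<Gamma>1 \<Gamma>1] by simp
  have \<omega>\<gamma>: "\<omega> (\<gamma> ^ m) = int m" for m by (induction m) (auto simp: \<omega>1 \<omega>[OF \<gamma>(1) \<Gamma>_power[OF \<gamma>(1)]] \<gamma>(2))
  have eK: "e j \<in> K" "e j \<noteq> 0" if "j < s" for j using \<Gamma>_nz[OF eG[OF that]] .
  have fY: "finite Y" "Y \<subseteq> K" unfolding Y_def using \<Gamma>_nz(1)[OF \<gamma>(1)] eK subfield_power[OF Ks] Kc(6) by auto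
  have "box_ring k K W Wb v D c0 \<nu> \<Gamma> \<gamma> {x\<in>\<Gamma>. \<omega> x = 0} box s Y"
  proof unfold_locales
    show "\<gamma> \<in> \<Gamma>" by (rule \<gamma>(1))
    show "{x\<in>\<Gamma>. \<omega> x = 0} \<subseteq> \<Gamma>" by blast
    show "x * y \<in> {x\<in>\<Gamma>. \<omega> x = 0}" if "x \<in> {x\<in>\<Gamma>. \<omega> x = 0}" "y \<in> {x\<in>\<Gamma>. \<omega> x = 0}" for x y using that \<omega> \<Gamma>m by auto
    show "finite (box M)" for M unfolding box_def using fB by blast
    show "box M \<subseteq> {x\<in>\<Gamma>. \<omega> x = 0}" for M unfolding box_def pr_def using e\<Gamma> \<omega>e by auto
    show "card (box M) = (2 * M + 1) ^ s" for M
    proof -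
      have "card (box M) = card (B M)" unfolding box_def by (rule card_image[OF injB])
      also have "\<dots> = (2 * M + 1) ^ s" unfolding B_def by (simp add: card_PiE nat_add_distrib nat_mult_distrib)
      finally show ?thesis .
    qed
    have "pr (\<lambda>_. 0) \<in> box 0" by (rule restr) simp
    then show "1 \<in> box 0" by (simp add: pr_def)
    show "box M \<subseteq> box N" if "M \<le> N" for M N
    proof
      fix x assume "x \<in> box M"
      then obtain n where "x = pr n" "\<forall>j<s. \<bar>n j\<bar> \<le> int M" using boxE by blast
      then show "x \<in> box N" using that by (auto intro!: restr intro: order.trans)
    qed
    show "x * y \<in> box (M + N)" if xy: "x \<in> box M" "y \<in> box N" for x y M N
    proof -
      obtain n where n: "x = pr n" "\<forall>j<s. \<bar>n j\<bar> \<le> int M" using boxE[OF xy(1)] by blast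
      obtain m where m: "y = pr m" "\<forall>j<s. \<bar>m j\<bar> \<le> int N" using boxE[OF xy(2)] by blast
      show ?thesis unfolding n(1) m(1) pr_add
      proof (rule restr)
        fix j assume "j < s"
        then show "\<bar>n j + m j\<bar> \<le> int (M + N)" using n(2) m(2) abs_triangle_ineq[of "n j" "m j"] by fastforce
      qed
    qed
    show "\<exists>\<rho>. S \<subseteq> box \<rho>" if "finite S" "S \<subseteq> {x\<in>\<Gamma>. \<omega> x = 0}" for S
      using that
    proof (induction S rule: finite_induct)
      case (insert x S)
      then obtain \<rho> where \<rho>: "S \<subseteq> box \<rho>" by auto
      obtain n where n: "x = pr n" using ker[of x] insert.prems unfolding pr_def by auto
      define M where "M = \<rho> + (\<Sum>j<s. nat \<bar>n j\<bar>)"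
      have "x \<in> box M" unfolding n
      proof (rule restr)
        fix j assume "j < s"
        then have "nat \<bar>n j\<bar> \<le> (\<Sum>j<s. nat \<bar>n j\<bar>)" by (intro member_le_sum) auto
        then show "\<bar>n j\<bar> \<le> int M" unfolding M_def by linarith
      qed
      moreover have "S \<subseteq> box M"
      proof
        fix y assume "y \<in> S"
        then obtain m where m: "y = pr m" "\<forall>j<s. \<bar>m j\<bar> \<le> int \<rho>" using boxE \<rho> by blast
        have "int \<rho> \<le> int M" unfolding M_def by simp
        then have "\<bar>m j\<bar> \<le> int M" if "j < s" for j using m(2) that by (blast intro: order.trans)
        then show "y \<in> box M" unfolding m(1) by (rule restr)
      qed
      ultimately show ?case by blast
    qed blast
    show "g = h \<and> m = n" if gh: "g \<in> {x\<in>\<Gamma>. \<omega> x = 0}" "h \<in> {x\<in>\<Gamma>. \<omega> x = 0}" "g * \<gamma> ^ m = h * \<gamma> ^ n" for g h m n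
    proof -
      have "\<omega> (g * \<gamma> ^ m) = int m" "\<omega> (h * \<gamma> ^ n) = int n" using gh(1,2) \<omega> \<Gamma>_power[OF \<gamma>(1)] \<omega>\<gamma> by auto
      then have "m = n" using gh(3) by simp
      then show ?thesis using gh(3) \<Gamma>_nz(2)[OF \<gamma>(1)] by simp
    qed
    show "finite Y" "Y \<subseteq> K" by (rule fY)+
    show "pole \<gamma> w \<le> (\<Sum>y\<in>Y. pole y w)" for w using fY by (intro member_le_sum) (auto simp: Y_def)
    show "pole g w \<le> M * (\<Sum>y\<in>Y. pole y w)" if g: "g \<in> box M" and w: "w \<in> W" for g M w
    proof -
      define PY where "PY = (\<Sum>y\<in>Y. pole y w)"
      obtain n where n: "g = pr n" "\<forall>j<s. \<bar>n j\<bar> \<le> int M" using boxE[OF g] by blast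
      have "pole g w \<le> (\<Sum>j<s. pole (e j powi n j) w)"
        unfolding n(1) pr_def using eK subfield_power_int[OF Ks] by (intro pole_prod[OF w]) auto
      also have "\<dots> \<le> (\<Sum>j<s. M * (pole (e j) w + pole (inverse (e j)) w))"
      proof (rule sum_mono)
        fix j assume j: "j \<in> {..<s}"
        have "pole (e j powi n j) w \<le> nat \<bar>n j\<bar> * (pole (e j) w + pole (inverse (e j)) w)" using pole_powi[OF w] eK j by auto
        also have "\<dots> \<le> M * (pole (e j) w + pole (inverse (e j)) w)" using n(2) j by (intro mult_right_mono) auto
        finally show "pole (e j powi n j) w \<le> M * (pole (e j) w + pole (inverse (e j)) w)" .
      qed
      also have "\<dots> = M * (\<Sum>j<s. pole (e j) w + pole (inverse (e j)) w)" by (simp add: sum_distrib_left)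
      also have "\<dots> \<le> M * PY"
      proof (rule mult_left_mono)
        have le: "pole y w \<le> PY" if "y \<in> Y" for y unfolding PY_def using fY(1) that by (intro member_le_sum) auto
        have "2 * s * (pole (e j) w + pole (inverse (e j)) w) \<le> 2 * PY" if j: "j < s" for j
        proof -
          have "e j ^ (2 * s) \<in> Y" "inverse (e j) ^ (2 * s) \<in> Y" unfolding Y_def using j by blast+
          from le[OF this(1)] le[OF this(2)] show ?thesis
            using pole_power[OF w eK[OF j], of "2 * s"] pole_power[OF w Kc(6)[OF eK(1)[OF j]], of "2 * s"] eK(2)[OF j]
            by (simp add: distrib_left)
        qed
        then have "(\<Sum>j<s. 2 * s * (pole (e j) w + pole (inverse (e j)) w)) \<le> (\<Sum>j<s. 2 * PY)" by (intro sum_mono) auto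
        then have "2 * s * (\<Sum>j<s. pole (e j) w + pole (inverse (e j)) w) \<le> 2 * s * PY" by (simp add: sum_distrib_left mult_ac)
        then show "(\<Sum>j<s. pole (e j) w + pole (inverse (e j)) w) \<le> PY" by (cases "s = 0") auto
      qed simp
      finally show ?thesis unfolding PY_def .
    qed
  qed
  then show ?thesis using \<omega> inj \<gamma>(2) by blast
qed (use I0 \<Gamma>_gen S x0 in auto)

section \<open>Contents and the descent from the ultrapower\<close>

lemma content:
  assumes S: "finite S" "g0 \<in> S" "f g0 \<noteq> 0" and f: "\<And>g. g \<in> S \<Longrightarrow> poly_over K (f g)"
  shows "\<exists>c f1. poly_over K c \<and> c \<noteq> 0 \<and> (\<forall>g\<in>S. poly_over K (f1 g) \<and> f g = c * f1 g) \<and> (\<forall>\<tau>. \<exists>g\<in>S. poly (f1 g) \<tau> \<noteq> 0)"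
proof -
  \<comment> \<open>The ideal of \<open>K[T]\<close> generated by the coefficients. Its generator is
    the content, and since 1 is a combination of the quotients, these have no common root.\<close>
  define I where "I = {\<Sum>g\<in>S. a g * f g | a. \<forall>g\<in>S. poly_over K (a g)}"
  have fI: "f g \<in> I" if g: "g \<in> S" for g
  proof -
    have "(\<Sum>h\<in>S. (if h = g then 1 else 0) * f h) = (\<Sum>h\<in>S. if h = g then f h else 0)" by (intro sum.cong) auto
    also have "\<dots> = f g" using S(1) g by simp
    finally have e: "f g = (\<Sum>h\<in>S. (if h = g then 1 else 0) * f h)" by simp
    show ?thesis unfolding I_def mem_Collect_eq
      by (intro exI[of _ "\<lambda>h. if h = g then 1 else 0"] conjI e) (simp add: poly_over_0[OF Ks] poly_over_1[OF Ks])
  qed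
  show ?thesis
  proof (rule poly_over_ideal_generator[OF Ks, of I])
    show "poly_over K p" if "p \<in> I" for p using that f unfolding I_def by (auto intro!: poly_over_sum[OF Ks] poly_over_mult[OF Ks])
    show "p - q \<in> I" if pq: "p \<in> I" "q \<in> I" for p q
    proof -
      obtain a where a: "p = (\<Sum>g\<in>S. a g * f g)" "\<forall>g\<in>S. poly_over K (a g)" using pq(1) unfolding I_def by blast
      obtain b where b: "q = (\<Sum>g\<in>S. b g * f g)" "\<forall>g\<in>S. poly_over K (b g)" using pq(2) unfolding I_def by blast
      have "p - q = (\<Sum>g\<in>S. (a g - b g) * f g)" unfolding a(1) b(1) by (simp add: sum_subtractf left_diff_distrib)
      then show ?thesis unfolding I_def using a(2) b(2) poly_over_diff[OF Ks] by (auto intro!: exI[of _ "\<lambda>g. a g - b g"])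
    qed
    show "p * q \<in> I" if pq: "p \<in> I" "poly_over K q" for p q
    proof -
      obtain a where a: "p = (\<Sum>g\<in>S. a g * f g)" "\<forall>g\<in>S. poly_over K (a g)" using pq(1) unfolding I_def by blast
      have "p * q = (\<Sum>g\<in>S. (q * a g) * f g)" unfolding a(1) by (simp add: sum_distrib_left sum_distrib_right mult_ac)
      then show ?thesis unfolding I_def using a(2) pq(2) poly_over_mult[OF Ks] by (auto intro!: exI[of _ "\<lambda>g. q * a g"])
    qed
    show "\<exists>p\<in>I. p \<noteq> 0" using fI S by blast
  next
    fix c assume c: "c \<in> I" "lead_coeff c = 1" and dv: "\<And>p. p \<in> I \<Longrightarrow> \<exists>q. poly_over K q \<and> p = c * q"
    have c0: "c \<noteq> 0" using c(2) by auto
    obtain a where a: "c = (\<Sum>g\<in>S. a g * f g)" "\<forall>g\<in>S. poly_over K (a g)" using c(1) unfolding I_def by blast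
    have "\<forall>g\<in>S. \<exists>q. poly_over K q \<and> f g = c * q" using dv fI by blast
    then obtain f1 where f1: "\<forall>g\<in>S. poly_over K (f1 g) \<and> f g = c * f1 g" by (rule bchoice[THEN exE])
    have "c * 1 = c * (\<Sum>g\<in>S. a g * f1 g)" unfolding sum_distrib_left using a(1) f1 by (simp add: mult_ac)
    then have one: "(\<Sum>g\<in>S. a g * f1 g) = 1" using c0 by simp
    have "\<exists>g\<in>S. poly (f1 g) \<tau> \<noteq> 0" for \<tau>
    proof (rule ccontr)
      assume "\<not> ?thesis"
      then have "poly (\<Sum>g\<in>S. a g * f1 g) \<tau> = 0" by (simp add: poly_sum)
      then show False unfolding one by simp
    qed
    moreover have "poly_over K c" using a f by (auto intro!: poly_over_sum[OF Ks] poly_over_mult[OF Ks])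
    ultimately show ?thesis using c0 f1 by blast
  qed
qed

text \<open>The ring of values of \<open>K[T][\<Gamma>]\<close> in the ultrapower; the
  specialisation \<open>T = 0\<close>, \<open>g = 1\<close> is a device to inherit the closure
  properties of \<open>tr\<close>.\<close>

definition polynomial_span :: "'a ultra set" where
  "polynomial_span = {z. \<exists>w::'a. tr (\<lambda>p. poly p 0) (\<lambda>_. 1) z w}"

lemma trhom_0: "trhom (\<lambda>p. poly p 0) (\<lambda>_. 1 :: 'a)" unfolding trhom_def by auto

lemma polynomial_span_closed:
  "x \<in> polynomial_span \<Longrightarrow> y \<in> polynomial_span \<Longrightarrow> x + y \<in> polynomial_span"
  "x \<in> polynomial_span \<Longrightarrow> y \<in> polynomial_span \<Longrightarrow> x * y \<in> polynomial_span"
  "poly_over K p \<Longrightarrow> Ts p \<in> polynomial_span" "g \<in> \<Gamma> \<Longrightarrow> chi g \<in> polynomial_span" "0 \<in> polynomial_span"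
  unfolding polynomial_span_def using tr_plus tr_mult[OF trhom_0] tr_Ts[OF trhom_0] tr_chi[OF trhom_0] tr_0 by blast+

lemma polynomial_span_sum: "(\<And>i. i \<in> A \<Longrightarrow> f i \<in> polynomial_span) \<Longrightarrow> sum f A \<in> polynomial_span"
  by (induction A rule: infinite_finite_induct) (auto intro: polynomial_span_closed)

lemma polynomial_span_power: "x \<in> polynomial_span \<Longrightarrow> x ^ n \<in> polynomial_span"
  using polynomial_span_closed(3)[OF poly_over_1[OF Ks]] by (induction n) (auto simp: Ts_hom intro: polynomial_span_closed)

lemma polynomial_span_rep:
  assumes "z \<in> polynomial_span"
  shows "\<exists>S q. finite S \<and> S \<subseteq> \<Gamma> \<and> (\<forall>g. poly_over K (q g)) \<and> z = (\<Sum>g\<in>S. Ts (q g) * chi g)"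
proof -
  obtain w :: 'a where "tr (\<lambda>p. poly p 0) (\<lambda>_. 1) z w" using assms unfolding polynomial_span_def by blast
  from tr_rep[OF this] show ?thesis by blast
qed

text \<open>An identity between values whose coefficients have no common zero forces the polynomial factors to
  be constant: otherwise specialise \<open>T\<close> to a root and \<open>\<Gamma>\<close> to powers of a Laurent variable.\<close>
lemma primitive_identity:
  fixes f h :: "'a poly"
  assumes f: "poly_over K f" "f \<noteq> 0" and h: "poly_over K h" "h \<noteq> 0" and u: "u \<in> \<Gamma>" and d: "d > 0"
    and S: "finite S" "S \<subseteq> \<Gamma>" "\<And>g. g \<in> S \<Longrightarrow> poly_over K (p g)" "\<And>\<tau>. \<exists>g\<in>S. poly (p g) \<tau> \<noteq> 0"
    and H: "finite H" "H \<subseteq> \<Gamma>" "\<And>g. g \<in> H \<Longrightarrow> poly_over K (q g)" "\<And>\<tau>. \<exists>g\<in>H. poly (q g) \<tau> \<noteq> 0"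
    and x0: "x0 \<in> \<Gamma>" "x0 \<noteq> 1"
    and eq: "Ts f * (\<Sum>g\<in>S. Ts (p g) * chi g) = Ts h * chi u * (\<Sum>g\<in>H. Ts (q g) * chi g) ^ d"
  shows "\<exists>\<kappa>\<in>K. \<kappa> \<noteq> 0 \<and> (\<forall>m. (\<Sum>g\<in>S. poly (p g) (of_nat m) * g ^ m) = \<kappa> * u ^ m * (\<Sum>g\<in>H. poly (q g) (of_nat m) * g ^ m) ^ d)"
proof -
  \<comment> \<open>After division by the greatest common divisor, \<open>f'\<close> and
    \<open>h'\<close> have no common root, so a root of either can be excluded separately.\<close>
  obtain g r t f' h' where bz: "poly_over K g" "poly_over K r" "poly_over K t" "poly_over K f'" "poly_over K h'"
    "g = r * f + t * h" "f = g * f'" "h = g * h'" "lead_coeff g = 1"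
    by (rule poly_over_bezout[OF Ks f(1) h(1)]) (use f(2) in blast)+
  have g0: "g \<noteq> 0" using bz(9) by auto
  have "g * (r * f' + t * h') = g * 1" using bz(6-8) by (simp add: algebra_simps)
  then have one: "r * f' + t * h' = 1" using g0 by simp
  have fh0: "f' \<noteq> 0" "h' \<noteq> 0" using f(2) h(2) bz(7,8) by auto
  have "Ts g * (Ts f' * (\<Sum>g\<in>S. Ts (p g) * chi g)) = Ts g * (Ts h' * chi u * (\<Sum>g\<in>H. Ts (q g) * chi g) ^ d)"
    using eq unfolding bz(7,8) Ts_hom by (simp add: mult.assoc)
  then have eq': "Ts f' * (\<Sum>g\<in>S. Ts (p g) * chi g) = Ts h' * chi u * (\<Sum>g\<in>H. Ts (q g) * chi g) ^ d"
    using g0 Ts_0_iff by simp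
  have key: "\<chi> f' * (\<Sum>g\<in>S. \<chi> (p g) * \<theta> g) = \<chi> h' * \<theta> u * (\<Sum>g\<in>H. \<chi> (q g) * \<theta> g) ^ d"
    if hom: "trhom \<chi> \<theta>" for \<chi> :: "'a poly \<Rightarrow> 'r::comm_ring_1" and \<theta>
  proof (rule tr_functional[OF hom])
    show "tr \<chi> \<theta> (Ts f' * (\<Sum>g\<in>S. Ts (p g) * chi g)) (\<chi> f' * (\<Sum>g\<in>S. \<chi> (p g) * \<theta> g))"
      using S by (intro tr_mult[OF hom] tr_Ts[OF hom] tr_sum tr_monom bz) auto
    show "tr \<chi> \<theta> (Ts f' * (\<Sum>g\<in>S. Ts (p g) * chi g)) (\<chi> h' * \<theta> u * (\<Sum>g\<in>H. \<chi> (q g) * \<theta> g) ^ d)"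
      unfolding eq' using H u by (intro tr_mult[OF hom] tr_Ts[OF hom] tr_chi[OF hom] tr_power[OF hom] tr_sum tr_monom bz) auto
  qed
  have "finite (S \<union> H)" "S \<union> H \<subseteq> \<Gamma>" using S H by auto
  from box_ring_exists[OF this x0] obtain \<omega> :: "'a \<Rightarrow> int"
    where \<omega>: "\<forall>x\<in>\<Gamma>. \<forall>y\<in>\<Gamma>. \<omega> (x * y) = \<omega> x + \<omega> y" and inj: "inj_on \<omega> (S \<union> H)" by blast
  \<comment> \<open>\<open>g\<close> goes to the Laurent monomial \<open>X^(\<omega> g)\<close>; as
    \<open>\<omega>\<close> is injective on \<open>S \<union> H\<close>, terms with different bases
    do not collide.\<close>
  define \<theta> where "\<theta> g = fls_shift (- \<omega> g) (1 :: 'a fls)" for g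
  have "\<omega> 1 = 0" using \<omega> \<Gamma>1 by (metis add_cancel_right_right mult_1)
  then have hom: "trhom (\<lambda>p. fls_const (poly p \<tau>)) \<theta>" for \<tau>
    unfolding trhom_def \<theta>_def using \<omega> by (auto simp: fls_plus_const fls_const_mult_const fls_shifted_times_simps)
  have zero: "\<forall>g\<in>A. a g = 0" if A: "finite A" "A \<subseteq> S \<union> H" "(\<Sum>g\<in>A. fls_const (a g) * \<theta> g) = 0" for A and a :: "'a \<Rightarrow> 'a"
  proof
    fix g assume g: "g \<in> A"
    have "0 = fls_nth (\<Sum>h\<in>A. fls_const (a h) * \<theta> h) (\<omega> g)" unfolding A(3) by simp
    also have "\<dots> = (\<Sum>h\<in>A. if h = g then a h else 0)"
    proof -
      have "fls_nth (fls_const (a h) * \<theta> h) (\<omega> g) = (if h = g then a h else 0)" if "h \<in> A" for h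
        using inj g that A(2) unfolding \<theta>_def inj_on_def by auto
      then show ?thesis unfolding fls_nth_sum by (intro sum.cong) auto
    qed
    also have "\<dots> = a g" using A(1) g by simp
    finally show "a g = 0" by simp
  qed
  have at: "poly r \<tau> * poly f' \<tau> + poly t \<tau> * poly h' \<tau> = 1" for \<tau> using one by (metis poly_1 poly_add poly_mult)
  have "poly f' \<tau> \<noteq> 0" for \<tau>
  proof
    assume z: "poly f' \<tau> = 0"
    then have "poly h' \<tau> \<noteq> 0" using at[of \<tau>] by auto
    moreover have "\<theta> u \<noteq> 0" unfolding \<theta>_def by simp
    ultimately have "(\<Sum>g\<in>H. fls_const (poly (q g) \<tau>) * \<theta> g) = 0"
      using key[OF hom[of \<tau>]] z d by simp
    then have "\<forall>g\<in>H. poly (q g) \<tau> = 0" by (intro zero H(1)) blast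
    then show False using H(4)[of \<tau>] by blast
  qed
  moreover have "poly h' \<tau> \<noteq> 0" for \<tau>
  proof
    assume z: "poly h' \<tau> = 0"
    then have "poly f' \<tau> \<noteq> 0" using at[of \<tau>] by auto
    then have "(\<Sum>g\<in>S. fls_const (poly (p g) \<tau>) * \<theta> g) = 0" using key[OF hom[of \<tau>]] z by simp
    then have "\<forall>g\<in>S. poly (p g) \<tau> = 0" by (intro zero S(1)) blast
    then show False using S(4)[of \<tau>] by blast
  qed
  ultimately have "degree f' = 0" "degree h' = 0" using alg_closed_imp_poly_has_root by (metis gr0I)+
  then obtain a b where ab: "f' = [:a:]" "h' = [:b:]" using degree_eq_zeroE by metis
  have abK: "a \<in> K" "b \<in> K" "a \<noteq> 0" "b \<noteq> 0" using bz(4,5) fh0 unfolding ab poly_over_pCons_iff[OF Ks] by auto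
  show ?thesis
  proof (intro bexI[of _ "b / a"] conjI allI)
    fix m :: nat
    \<comment> \<open>The identity, known only along the ultrafilter, reaches every \<open>m\<close>
      through the specialisation of \<open>T\<close> to \<open>m\<close> and of \<open>g\<close> to
      \<open>g^m\<close>.\<close>
    have "trhom (\<lambda>p. poly p (of_nat m)) (\<lambda>g. g ^ m :: 'a)" unfolding trhom_def by (auto simp: power_mult_distrib)
    from key[OF this] show "(\<Sum>g\<in>S. poly (p g) (of_nat m) * g ^ m) = b / a * u ^ m * (\<Sum>g\<in>H. poly (q g) (of_nat m) * g ^ m) ^ d"
      unfolding ab using abK by (simp add: field_simps)
  qed (use abK Kc(8) in auto)
qed

text \<open>Up to its leading coefficient \<open>cT\<close> and a unit \<open>chi u\<close>, the
  primitive part is a monic polynomial \<open>P\<close> in \<open>X\<close>, and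
  \<open>perfect_power_of_values\<close> writes it as \<open>G ^ d\<close> over a field of
  fractions. The coefficients of \<open>P\<close> have only powers of \<open>cT\<close> as
  denominators, hence so do those of \<open>G\<close>. Clearing them gives an identity between
  exponential polynomials along the sequence, which \<open>primitive_identity\<close> extends to all
  \<open>m\<close>.\<close>

theorem value_structure:
  assumes S: "finite S" "S \<subseteq> \<Gamma>" "S \<noteq> {}" and p: "\<And>g. g \<in> S \<Longrightarrow> poly_over K (p g) \<and> p g \<noteq> 0" and d: "d > 0"
    and y: "y \<in> Kst" "y ^ d = (\<Sum>g\<in>S. Ts (p g) * chi g)"
  shows "\<exists>a0 \<kappa> u H q. poly_over K a0 \<and> a0 \<noteq> 0 \<and> \<kappa> \<in> K \<and> \<kappa> \<noteq> 0 \<and> u \<in> \<Gamma> \<and> finite H \<and> H \<subseteq> \<Gamma> \<and> (\<forall>h\<in>H. poly_over K (q h)) \<and>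
    (\<forall>m. (\<Sum>g\<in>S. poly (p g) (of_nat m) * g ^ m) = poly a0 (of_nat m) * (\<kappa> * u ^ m * (\<Sum>h\<in>H. poly (q h) (of_nat m) * h ^ m) ^ d))"
proof (cases "\<exists>g. S = {g}")
  case True
  then obtain g where g: "S = {g}" by blast
  show ?thesis
    by (intro exI[of _ "p g"] exI[of _ 1] exI[of _ g] exI[of _ "{1}"] exI[of _ "\<lambda>_. 1"] conjI)
      (use g p[of g] S Kc(2) \<Gamma>1 poly_over_1[OF Ks] in auto)
next
  case False
  \<comment> \<open>With two different bases one is not 1, so \<open>\<Gamma>\<close> has positive
    rank and offers a variable \<open>X\<close>.\<close>
  then obtain x0 where x0: "x0 \<in> S" "x0 \<noteq> 1" using S(3) by blast
  have x0\<Gamma>: "x0 \<in> \<Gamma>" using x0 S by blast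
  have "p x0 \<noteq> 0" using p x0 by blast
  have "\<exists>c p1. poly_over K c \<and> c \<noteq> 0 \<and> (\<forall>g\<in>S. poly_over K (p1 g) \<and> p g = c * p1 g) \<and> (\<forall>\<tau>. \<exists>g\<in>S. poly (p1 g) \<tau> \<noteq> 0)"
    by (rule content[of S x0 p]) (use S(1) x0(1) \<open>p x0 \<noteq> 0\<close> p in blast)+
  then obtain c p1 where c: "poly_over K c" "c \<noteq> 0" and p1: "\<forall>g\<in>S. poly_over K (p1 g) \<and> p g = c * p1 g"
    "\<forall>\<tau>. \<exists>g\<in>S. poly (p1 g) \<tau> \<noteq> 0" by blast
  have p1K: "poly_over K (p1 g)" "p1 g \<noteq> 0" "p g = c * p1 g" if "g \<in> S" for g using p1(1) p that by auto
  obtain \<omega> :: "'a \<Rightarrow> int" and \<gamma> box s Y where br: "box_ring k K W Wb v D c0 \<nu> \<Gamma> \<gamma> {x\<in>\<Gamma>. \<omega> x = 0} box s Y"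
    and \<omega>: "\<And>x y. x \<in> \<Gamma> \<Longrightarrow> y \<in> \<Gamma> \<Longrightarrow> \<omega> (x * y) = \<omega> x + \<omega> y" and inj: "inj_on \<omega> S" and \<omega>\<gamma>1: "\<omega> \<gamma> = 1"
    using box_ring_exists[OF S(1,2) x0\<Gamma> x0(2)] by blast
  interpret B: box_ring k K W Wb v D c0 \<nu> \<Gamma> \<gamma> "{x\<in>\<Gamma>. \<omega> x = 0}" box s Y by (rule br)
  have \<gamma>: "\<gamma> \<in> \<Gamma>" "\<gamma> \<noteq> 0" using B.\<gamma> B.\<gamma>K by auto
  have \<omega>1: "\<omega> 1 = 0" using \<omega>[OF \<Gamma>1 \<Gamma>1] by simp
  have \<omega>n: "\<omega> (\<gamma> ^ m) = int m" for m by (induction m) (auto simp: \<omega>1 \<omega>[OF \<gamma>(1) \<Gamma>_power[OF \<gamma>(1)]] \<omega>\<gamma>1)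
  have \<omega>i: "\<omega> (inverse x) = - \<omega> x" if "x \<in> \<Gamma>" for x
    using \<omega>[OF that \<Gamma>i[OF that]] \<omega>1 \<Gamma>_nz(2)[OF that] by simp
  have \<omega>z: "\<omega> (\<gamma> powi m) = m" for m
    using \<omega>n[of "nat m"] \<omega>n[of "nat (- m)"] \<omega>i[OF \<Gamma>_power[OF \<gamma>(1)], of "nat (- m)"]
    unfolding power_int_def by (auto simp: power_inverse)
  define \<omega>0 where "\<omega>0 = Min (\<omega> ` S)"
  have \<omega>0: "\<omega>0 \<le> \<omega> g" if "g \<in> S" for g unfolding \<omega>0_def using S(1) that by simp
  have "Min (\<omega> ` S) \<in> \<omega> ` S" "Max (\<omega> ` S) \<in> \<omega> ` S" using S(1,3) by (auto intro!: Min_in Max_in)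
  then obtain gm gJ where gm: "gm \<in> S" "\<omega> gm = \<omega>0" and gJ: "gJ \<in> S" "\<omega> gJ = Max (\<omega> ` S)" unfolding \<omega>0_def by fastforce
  have gJmax: "\<omega> g \<le> \<omega> gJ" if "g \<in> S" for g unfolding gJ(2) using S(1) that by simp
  define j where "j g = nat (\<omega> g - \<omega>0)" for g
  have injj: "g = h" if "g \<in> S" "h \<in> S" "j g = j h" for g h
    using that \<omega>0[OF that(1)] \<omega>0[OF that(2)] inj unfolding j_def inj_on_def by (auto simp: eq_nat_nat_iff)
  define g' where "g' g = g * \<gamma> powi (- \<omega> g)" for g
  have g'\<Gamma>: "g' g \<in> \<Gamma>" "\<omega> (g' g) = 0" "g' g \<noteq> 0" if "g \<in> S" for g
  proof -
    have "g \<in> \<Gamma>" using that S(2) by blast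
    then show "g' g \<in> \<Gamma>" "\<omega> (g' g) = 0" "g' g \<noteq> 0"
      unfolding g'_def using \<Gamma>m \<Gamma>_powi[OF \<gamma>(1)] \<omega> \<omega>z \<Gamma>_nz(2) \<gamma>(2) by auto
  qed
  \<comment> \<open>\<open>u\<close> takes out the lowest power of \<open>\<gamma>\<close> and the
    weight-0 part of the top base. After division by \<open>cT\<close>, the polynomial
    \<open>P\<close> is then monic with nonzero constant coefficient.\<close>
  define u where "u = g' gJ * \<gamma> powi \<omega>0"
  have u\<Gamma>: "u \<in> \<Gamma>" unfolding u_def using g'\<Gamma>[OF gJ(1)] \<Gamma>m \<Gamma>_powi[OF \<gamma>(1)] by blast
  have split: "u * (g' g * inverse (g' gJ)) * \<gamma> ^ j g = g" if "g \<in> S" for g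
  proof -
    have "\<gamma> powi (- \<omega> g) * \<gamma> powi \<omega>0 * \<gamma> ^ j g = \<gamma> powi (- \<omega> g + \<omega>0 + int (j g))"
      by (simp only: power_int_add[OF disjI1[OF \<gamma>(2)]] power_int_of_nat)
    also have "- \<omega> g + \<omega>0 + int (j g) = 0" unfolding j_def using \<omega>0[OF that] by simp
    finally have "\<gamma> powi (- \<omega> g) * \<gamma> powi \<omega>0 * \<gamma> ^ j g = 1" by simp
    then have "g * (\<gamma> powi (- \<omega> g) * \<gamma> powi \<omega>0 * \<gamma> ^ j g) = g" by simp
    moreover have "u * (g' g * inverse (g' gJ)) * \<gamma> ^ j g = g * (\<gamma> powi (- \<omega> g) * \<gamma> powi \<omega>0 * \<gamma> ^ j g)"
      unfolding u_def using g'\<Gamma>(3)[OF gJ(1)] by (simp add: g'_def[of g] mult_ac)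
    ultimately show ?thesis by (simp only:)
  qed
  define cT where "cT = Ts (p1 gJ)"
  have cT: "cT \<noteq> 0" "cT \<in> Sm" unfolding cT_def using Ts_0_iff Ts_Sm p1K[OF gJ(1)] by auto
  define cf where "cf g = (Ts (p1 g) / cT) * chi (g' g * inverse (g' gJ))" for g
  have quot: "g' g * inverse (g' gJ) \<in> {x\<in>\<Gamma>. \<omega> x = 0}" if "g \<in> S" for g
    using g'\<Gamma>[OF that] g'\<Gamma>[OF gJ(1)] \<Gamma>m \<Gamma>i \<omega> \<omega>i by auto
  define P where "P = (\<Sum>g\<in>S. monom (cf g) (j g))"
  have cP: "coeff P i = (\<Sum>g\<in>S. if j g = i then cf g else 0)" for i unfolding P_def by (simp add: coeff_sum)
  have cPj: "coeff P (j g) = cf g" if "g \<in> S" for g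
  proof -
    have "coeff P (j g) = (\<Sum>h\<in>S. if h = g then cf h else 0)" unfolding cP using injj that by (intro sum.cong) auto
    then show ?thesis using S(1) that by simp
  qed
  have cfA: "cf g \<in> B.A" if "g \<in> S" for g unfolding cf_def B.A_def
    using Ts_Sm[OF p1K(1)[OF that]] cT(2) quot[OF that] by (intro spn_monom Sc(8)) auto
  have PA: "poly_over B.A P" unfolding poly_over_def cP using cfA B.A_closed(1) by (auto intro!: B.A_sum)
  have cfJ: "cf gJ = 1" unfolding cf_def cT_def[symmetric] using cT(1) g'\<Gamma>(3)[OF gJ(1)] by (simp add: chi_1)
  have "degree P = j gJ"
  proof (rule antisym)
    have "j g \<le> j gJ" if "g \<in> S" for g unfolding j_def using gJmax[OF that] by (intro nat_mono) simp
    then show "degree P \<le> j gJ" by (intro degree_le allI impI) (force simp: cP intro!: sum.neutral)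
    show "j gJ \<le> degree P" by (rule le_degree) (simp add: cPj[OF gJ(1)] cfJ)
  qed
  then have lP: "lead_coeff P = 1" using cPj[OF gJ(1)] cfJ by simp
  have "j gm = 0" unfolding j_def gm(2) by simp
  then have "coeff P 0 = cf gm" using cPj[OF gm(1)] by simp
  moreover have "cf gm \<noteq> 0" unfolding cf_def using cT(1) p1K(2)[OF gm(1)] Ts_0_iff quot[OF gm(1)] \<Gamma>_nz(2) chi_nz by auto
  ultimately have P0: "coeff P 0 \<noteq> 0" by simp
  have PX: "cT * chi u * poly P B.X = (\<Sum>g\<in>S. Ts (p1 g) * chi g)"
  proof -
    have "cT * chi u * (cf g * B.X ^ j g) = Ts (p1 g) * chi g" if "g \<in> S" for g
    proof -
      have "cT * chi u * (cf g * B.X ^ j g) = Ts (p1 g) * chi (u * (g' g * inverse (g' gJ)) * \<gamma> ^ j g)"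
        unfolding cf_def B.X_power chi_mult using cT(1) by (simp add: field_simps)
      then show ?thesis unfolding split[OF that] .
    qed
    then show ?thesis unfolding P_def poly_sum poly_monom sum_distrib_left by (intro sum.cong) auto
  qed
  define s0 where "s0 = Ts c * cT"
  have s0: "s0 \<in> Sm" "s0 \<noteq> 0" unfolding s0_def using Ts_Sm[OF c(1)] cT c(2) Ts_0_iff Sc(5) by auto
  have yc: "y ^ d = Ts c * (\<Sum>g\<in>S. Ts (p1 g) * chi g)"
    unfolding y(2) sum_distrib_left using p1K(3) by (intro sum.cong) (auto simp: Ts_hom mult.assoc)
  have "y ^ d = s0 * chi u * poly P B.X" unfolding s0_def yc PX[symmetric] by (simp add: mult.assoc)
  then obtain G where G: "poly_over B.L G" "lead_coeff G = 1" "P = G ^ d"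
    using B.perfect_power_of_values[OF PA lP P0 d y(1) s0 u\<Gamma>] by blast
  \<comment> \<open>A localisation at \<open>cT\<close>: it contains the coefficients of
    \<open>P = G ^ d\<close> and is closed under division by \<open>d\<close>, so the coefficients
    of the monic root \<open>G\<close> lie in it.\<close>
  define Bs where "Bs = {z. \<exists>M. cT ^ M * z \<in> polynomial_span}"
  have cTs: "cT ^ n \<in> polynomial_span" for n unfolding cT_def by (intro polynomial_span_power polynomial_span_closed p1K gJ)
  have "coeff G i \<in> Bs" for i
  proof (rule root_coeffs_in_ring[where B = Bs and G = G and d = d])
    show "1 \<in> Bs" unfolding Bs_def using cTs[of 0] by (auto intro!: exI[of _ 0])
    show "x + y \<in> Bs" "x * y \<in> Bs" if xy: "x \<in> Bs" "y \<in> Bs" for x y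
    proof -
      obtain M M' where M: "cT ^ M * x \<in> polynomial_span" "cT ^ M' * y \<in> polynomial_span" using xy unfolding Bs_def by blast
      have e: "cT ^ (M + M') * (x + y) = cT ^ M' * (cT ^ M * x) + cT ^ M * (cT ^ M' * y)"
        "cT ^ (M + M') * (x * y) = (cT ^ M * x) * (cT ^ M' * y)" by (simp_all add: power_add algebra_simps)
      show "x + y \<in> Bs" "x * y \<in> Bs" unfolding Bs_def mem_Collect_eq
        by (rule exI[of _ "M + M'"], unfold e, intro polynomial_span_closed M cTs)+
    qed
    have scal: "Ts [:a:] * x \<in> Bs" if xa: "x \<in> Bs" "a \<in> K" for x a
    proof -
      obtain M where M: "cT ^ M * x \<in> polynomial_span" using xa(1) unfolding Bs_def by blast
      have "Ts [:a:] * (cT ^ M * x) \<in> polynomial_span"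
        using xa(2) by (intro polynomial_span_closed M) (simp add: poly_over_pCons_iff[OF Ks] poly_over_0[OF Ks])
      then show ?thesis unfolding Bs_def by (auto simp: mult_ac intro!: exI[of _ M])
    qed
    show "x / of_nat d \<in> Bs" if "x \<in> Bs" for x
    proof -
      have "Ts [:inverse (of_nat d):] * of_nat d = 1" unfolding Ts_def star_of_nat star_arith using d by simp
      then have "x / of_nat d = Ts [:inverse (of_nat d):] * x" using d by (simp add: field_simps)
      then show ?thesis using scal[OF that, of "inverse (of_nat d)"] of_nat_k kK Kc(6) by auto
    qed
    show "- x \<in> Bs" if "x \<in> Bs" for x
    proof -
      have "Ts [:- 1:] = - 1" unfolding Ts_def star_arith by simp
      then show ?thesis using scal[OF that, of "- 1"] Kc(2,7) by simp
    qed
    show "coeff (G ^ d) i \<in> Bs" for i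
    proof -
      have "cT * cf g = Ts (p1 g) * chi (g' g * inverse (g' gJ))" for g unfolding cf_def using cT(1) by simp
      then have "cT * cf g \<in> polynomial_span" if "g \<in> S" for g
        using p1K(1)[OF that] quot[OF that] by (auto intro!: polynomial_span_closed)
      then have "(\<Sum>g\<in>S. if j g = i then cT * cf g else 0) \<in> polynomial_span"
        by (intro polynomial_span_sum) (auto intro: polynomial_span_closed)
      also have "(\<Sum>g\<in>S. if j g = i then cT * cf g else 0) = cT ^ 1 * coeff P i"
        unfolding cP by (simp add: sum_distrib_left if_distrib cong: if_cong)
      finally show ?thesis unfolding Bs_def G(3)[symmetric] by blast
    qed
  qed (use d G in auto)
  then have "\<forall>i. \<exists>M. cT ^ M * coeff G i \<in> polynomial_span" unfolding Bs_def by blast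
  then obtain Mi where Mi: "\<And>i. cT ^ Mi i * coeff G i \<in> polynomial_span" by metis
  define M where "M = (\<Sum>i\<le>degree G. Mi i)"
  have "cT ^ M * poly G B.X \<in> polynomial_span"
    unfolding poly_altdef sum_distrib_left
  proof (rule polynomial_span_sum)
    fix i assume "i \<in> {..degree G}"
    then have "Mi i \<le> M" unfolding M_def by (intro member_le_sum) auto
    then have "cT ^ M = cT ^ (M - Mi i) * cT ^ Mi i" by (simp flip: power_add)
    then have "cT ^ M * (coeff G i * B.X ^ i) = cT ^ (M - Mi i) * (cT ^ Mi i * coeff G i) * chi (\<gamma> ^ i)" unfolding B.X_power by simp
    also have "\<dots> \<in> polynomial_span" by (intro polynomial_span_closed cTs Mi \<Gamma>_power \<gamma>)
    finally show "cT ^ M * (coeff G i * B.X ^ i) \<in> polynomial_span" .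
  qed
  from polynomial_span_rep[OF this] obtain H q where H: "finite H" "H \<subseteq> \<Gamma>" "\<And>g. poly_over K (q g)"
    "cT ^ M * poly G B.X = (\<Sum>g\<in>H. Ts (q g) * chi g)" by blast
  have "G \<noteq> 0" using G(2) by auto
  then have "poly G B.X \<noteq> 0" using B.transcendental_L[OF G(1)] by blast
  then have "(\<Sum>g\<in>H. Ts (q g) * chi g) \<noteq> 0" using cT(1) unfolding H(4)[symmetric] by simp
  then have "\<exists>h\<in>H. q h \<noteq> 0" by (metis (no_types, lifting) Ts_hom(3) mult_zero_left sum.neutral)
  then obtain h0 where h0: "h0 \<in> H" "q h0 \<noteq> 0" by blast
  have "\<exists>\<kappa>0 q1. poly_over K \<kappa>0 \<and> \<kappa>0 \<noteq> 0 \<and> (\<forall>g\<in>H. poly_over K (q1 g) \<and> q g = \<kappa>0 * q1 g) \<and> (\<forall>\<tau>. \<exists>g\<in>H. poly (q1 g) \<tau> \<noteq> 0)"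
    by (rule content[of H h0 q]) (use H(1,3) h0 in blast)+
  then obtain \<kappa>0 q1 where \<kappa>0: "poly_over K \<kappa>0" "\<kappa>0 \<noteq> 0"
    and q1: "\<forall>g\<in>H. poly_over K (q1 g) \<and> q g = \<kappa>0 * q1 g" "\<forall>\<tau>. \<exists>g\<in>H. poly (q1 g) \<tau> \<noteq> 0" by blast
  have Hq: "(\<Sum>g\<in>H. Ts (q g) * chi g) = Ts \<kappa>0 * (\<Sum>g\<in>H. Ts (q1 g) * chi g)"
    unfolding sum_distrib_left using q1(1) by (intro sum.cong) (auto simp: Ts_hom mult.assoc)
  \<comment> \<open>The exponent \<open>M * d\<close> comes from clearing the denominators of
    \<open>G\<close> inside the \<open>d\<close>-th power; on the right, \<open>p1 gJ\<close> is the
    leading coefficient of the sum and \<open>\<kappa>0\<close> the content of the cleared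
    root.\<close>
  have eq: "Ts (p1 gJ ^ (M * d)) * (\<Sum>g\<in>S. Ts (p1 g) * chi g) = Ts (p1 gJ * \<kappa>0 ^ d) * chi u * (\<Sum>g\<in>H. Ts (q1 g) * chi g) ^ d"
  proof -
    have "Ts (p1 gJ ^ (M * d)) * (\<Sum>g\<in>S. Ts (p1 g) * chi g) = cT * chi u * (cT ^ M * poly G B.X) ^ d"
      unfolding PX[symmetric] Ts_hom cT_def[symmetric] G(3) poly_power by (simp add: power_mult power_mult_distrib mult_ac)
    then show ?thesis unfolding H(4) Hq Ts_hom cT_def[symmetric] by (simp add: power_mult_distrib mult_ac)
  qed
  have "\<exists>\<kappa>\<in>K. \<kappa> \<noteq> 0 \<and> (\<forall>m. (\<Sum>g\<in>S. poly (p1 g) (of_nat m) * g ^ m) = \<kappa> * u ^ m * (\<Sum>g\<in>H. poly (q1 g) (of_nat m) * g ^ m) ^ d)"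
  proof (rule primitive_identity[OF _ _ _ _ u\<Gamma> d S(1,2) _ _ H(1,2) _ _ x0\<Gamma> x0(2) eq])
    show "poly_over K (p1 gJ ^ (M * d))" "p1 gJ ^ (M * d) \<noteq> 0" using p1K[OF gJ(1)] poly_over_power[OF Ks] by auto
    show "poly_over K (p1 gJ * \<kappa>0 ^ d)" "p1 gJ * \<kappa>0 ^ d \<noteq> 0"
      using p1K[OF gJ(1)] \<kappa>0 poly_over_mult[OF Ks] poly_over_power[OF Ks] by auto
  qed (use p1 q1 in blast)+
  then obtain \<kappa> where \<kappa>: "\<kappa> \<in> K" "\<kappa> \<noteq> 0"
    "\<And>m. (\<Sum>g\<in>S. poly (p1 g) (of_nat m) * g ^ m) = \<kappa> * u ^ m * (\<Sum>g\<in>H. poly (q1 g) (of_nat m) * g ^ m) ^ d" by blast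
  have "(\<Sum>g\<in>S. poly (p g) (of_nat m) * g ^ m) = poly c (of_nat m) * (\<Sum>g\<in>S. poly (p1 g) (of_nat m) * g ^ m)" for m
    unfolding sum_distrib_left using p1K(3) by (intro sum.cong) (auto simp: mult.assoc)
  then show ?thesis using c \<kappa> u\<Gamma> H(1,2) q1(1)
    by (intro exI[of _ c] exI[of _ \<kappa>] exI[of _ u] exI[of _ H] exI[of _ q1]) auto
qed

end

section \<open>Roots in the algebraic closure and the theorem\<close>

lemma mem_alg_closure_of_power:
  assumes "is_subfield K" "z ^ d \<in> K" "d > 0" shows "z \<in> alg_closure_in K"
proof -
  define P where "P = monom 1 d - [:z ^ d:]"
  have "coeff P d = 1" unfolding P_def using assms(3) by (cases d) auto
  then have "P \<noteq> 0" by auto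
  moreover have "poly_over K P" unfolding P_def using subfieldD(2)[OF assms(1)] assms(2)
    by (intro poly_over_diff[OF assms(1)] poly_over_monom[OF assms(1)]) (simp_all add: poly_over_pCons_iff[OF assms(1)] poly_over_0[OF assms(1)])
  moreover have "poly P z = 0" unfolding P_def by (simp add: poly_monom)
  ultimately show ?thesis unfolding alg_closure_in_def algebraic_over_def by blast
qed

lemma alg_closed_root_exists:
  fixes c :: "'a::alg_closed_field" assumes "d > 0" shows "\<exists>z. z ^ d = c"
proof -
  have "coeff (monom 1 d - [:c:]) d = 1" using assms by (cases d) auto
  then have "degree (monom 1 d - [:c:]) \<ge> d" by (intro le_degree) simp
  then obtain z where "poly (monom 1 d - [:c:]) z = 0" using alg_closed_imp_poly_has_root[of "monom 1 d - [:c:]"] assms by auto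
  then show ?thesis by (auto simp: poly_monom)
qed

theorem theorem1p2:
  fixes k K :: "'a::{alg_closed_field, field_char_0} set"
    and d l :: nat and B :: "nat \<Rightarrow> 'a poly" and \<beta> :: "nat \<Rightarrow> 'a" and b :: "nat \<Rightarrow> 'a"
  assumes "alg_closed_subfield k"
    and "curve_function_field k K"
    and "d \<ge> 2"
    and "\<forall>i\<in>{1..l}. poly_over K (B i) \<and> \<beta> i \<in> K \<and> \<beta> i \<noteq> 0"
    and "\<forall>n. b n = (\<Sum>i\<in>{1..l}. poly (B i) (of_nat n) * \<beta> i ^ n)"
    and "gen_mult_subgroup l \<beta> \<inter> (k - {0}) = {1}"
    and "infinite {n. \<exists>y\<in>K. b n = y ^ d}"
  shows "\<exists>a R. exp_poly_over (alg_closure_in K) a \<and> poly_over k R \<and>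
           (\<forall>m. b m = poly R (of_nat m) * a m ^ d)"
proof -
  have d: "d > 0" using assms(3) by simp
  obtain W :: "('a option \<times> nat \<times> nat) set" and Wb v D c0 where vf: "valued_function_field k K W Wb v D c0"
    using valued_function_field_of_curve[OF assms(1,2)] by blast
  interpret valued_function_field k K W Wb v D c0 by (rule vf)
  obtain \<nu> :: "nat \<Rightarrow> nat" where \<nu>: "strict_mono \<nu>" "\<And>i. \<nu> i \<in> {n. \<exists>y\<in>K. b n = y ^ d}"
    using infinite_enumerate[OF assms(7)] by blast
  define \<Gamma> where "\<Gamma> = gen_mult_subgroup l \<beta>"
  have \<beta>: "\<beta> i \<in> K" "\<beta> i \<noteq> 0" "poly_over K (B i)" if "i \<in> {1..l}" for i using assms(4) that by auto
  have \<Gamma>E: "\<exists>e. x = (\<Prod>i\<in>{1..l}. \<beta> i powi e i)" if "x \<in> \<Gamma>" for x using that unfolding \<Gamma>_def gen_mult_subgroup_def by blast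
  have \<Gamma>I: "(\<Prod>i\<in>{1..l}. \<beta> i powi e i) \<in> \<Gamma>" for e unfolding \<Gamma>_def gen_mult_subgroup_def by blast
  have \<Gamma>_mgen: "\<Gamma> = mgen {1..l} \<beta>" unfolding \<Gamma>_def gen_mult_subgroup_def mgen_def ..
  have \<Gamma>0: "0 \<notin> \<Gamma>"
  proof
    assume "0 \<in> \<Gamma>"
    then obtain e where "0 = (\<Prod>i\<in>{1..l}. \<beta> i powi e i)" using \<Gamma>E by blast
    then have "(\<Prod>i\<in>{1..l}. \<beta> i powi e i) = 0" by simp
    then show False using \<beta>(2) by (auto simp: prod_zero_iff)
  qed
  interpret fg_exp_ring k K W Wb v D c0 \<nu> \<Gamma> "{1..l}" \<beta>
  proof unfold_locales
    show "strict_mono \<nu>" by (rule \<nu>(1))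
    show "\<Gamma> \<subseteq> K"
    proof
      fix x assume "x \<in> \<Gamma>"
      then obtain e where e: "x = (\<Prod>i\<in>{1..l}. \<beta> i powi e i)" using \<Gamma>E by blast
      show "x \<in> K" unfolding e by (intro subfield_prod[OF Ks] subfield_power_int[OF Ks] \<beta>(1))
    qed
    show "0 \<notin> \<Gamma>" by (rule \<Gamma>0)
    show "1 \<in> \<Gamma>" using \<Gamma>I[of "\<lambda>_. 0"] by simp
    show "x * y \<in> \<Gamma>" if xy: "x \<in> \<Gamma>" "y \<in> \<Gamma>" for x y
    proof -
      obtain e f where ef: "x = (\<Prod>i\<in>{1..l}. \<beta> i powi e i)" "y = (\<Prod>i\<in>{1..l}. \<beta> i powi f i)" using \<Gamma>E xy by metis
      have "x * y = (\<Prod>i\<in>{1..l}. \<beta> i powi (e i + f i))"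
        unfolding ef prod.distrib[symmetric] using \<beta>(2) by (intro prod.cong) (auto simp: power_int_add)
      then show ?thesis using \<Gamma>I[of "\<lambda>i. e i + f i"] by (simp only:)
    qed
    show "inverse x \<in> \<Gamma>" if x: "x \<in> \<Gamma>" for x
    proof -
      obtain e where e: "x = (\<Prod>i\<in>{1..l}. \<beta> i powi e i)" using \<Gamma>E x by blast
      have "inverse x = (\<Prod>i\<in>{1..l}. \<beta> i powi (- e i))" unfolding e prod_inversef[symmetric] by (simp add: power_int_minus)
      then show ?thesis using \<Gamma>I[of "\<lambda>i. - e i"] by (simp only:)
    qed
    show "\<Gamma> \<inter> k \<subseteq> {1}" using assms(6) \<Gamma>0 unfolding \<Gamma>_def[symmetric] by blast
    show "finite {1..l}" by simp
    show "\<beta> i \<noteq> 0" if "i \<in> {1..l}" for i using \<beta>(2) that .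
    show "\<Gamma> = mgen {1..l} \<beta>" by (rule \<Gamma>_mgen)
  qed
  \<comment> \<open>Equal bases are merged and zero coefficients dropped: independence of the
    exponentials speaks of distinct bases.\<close>
  define p where "p g = (\<Sum>i\<in>{i\<in>{1..l}. \<beta> i = g}. B i)" for g
  define S where "S = {g\<in>\<beta> ` {1..l}. p g \<noteq> 0}"
  have fS: "finite S" unfolding S_def by simp
  have S\<Gamma>: "S \<subseteq> \<Gamma>" unfolding S_def \<Gamma>_mgen using mgen_member[of "{1..l}" _ \<beta>] by auto
  have pK: "poly_over K (p g)" for g unfolding p_def using \<beta>(3) by (intro poly_over_sum[OF Ks]) auto
  have bS: "b n = (\<Sum>g\<in>S. poly (p g) (of_nat n) * g ^ n)" for n
  proof -
    have "b n = (\<Sum>g\<in>\<beta> ` {1..l}. \<Sum>i\<in>{i\<in>{1..l}. \<beta> i = g}. poly (B i) (of_nat n) * \<beta> i ^ n)"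
      unfolding assms(5)[rule_format] by (rule sum.image_gen) simp
    also have "\<dots> = (\<Sum>g\<in>\<beta> ` {1..l}. poly (p g) (of_nat n) * g ^ n)"
      unfolding p_def poly_sum sum_distrib_right by (intro sum.cong) auto
    also have "\<dots> = (\<Sum>g\<in>S. poly (p g) (of_nat n) * g ^ n)" unfolding S_def by (intro sum.mono_neutral_right) auto
    finally show ?thesis .
  qed
  show ?thesis
  proof (cases "S = {}")
    case True
    have "exp_poly_over (alg_closure_in K) (\<lambda>_. 0)" unfolding exp_poly_over_def by (intro exI[of _ 0]) auto
    moreover have "b m = poly 0 (of_nat m) * 0 ^ d" for m using bS True by simp
    ultimately show ?thesis using poly_over_0[OF ks] by blast
  next
    case False
    have "\<forall>i. \<exists>y. y \<in> K \<and> b (\<nu> i) = y ^ d" using \<nu>(2) by blast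
    then obtain yf where yf: "\<And>i. yf i \<in> K" "\<And>i. b (\<nu> i) = yf i ^ d" by metis
    define y where "y = star yf"
    have yK: "y \<in> Kst" unfolding y_def using yf(1) by (rule KstI)
    have yb: "y ^ d = star (\<lambda>i. b (\<nu> i))" unfolding y_def star_power using yf(2) by simp
    have yd: "y ^ d = (\<Sum>g\<in>S. Ts (p g) * chi g)"
      unfolding yb Ts_def chi_def star_arith star_sum bS ..
    have pS: "\<And>g. g \<in> S \<Longrightarrow> poly_over K (p g) \<and> p g \<noteq> 0" using pK unfolding S_def by blast
    obtain a0 \<kappa> u H q where a0: "poly_over K a0" "a0 \<noteq> 0" and \<kappa>: "\<kappa> \<in> K" "\<kappa> \<noteq> 0" and u: "u \<in> \<Gamma>"
      and H: "finite H" "H \<subseteq> \<Gamma>" "\<forall>h\<in>H. poly_over K (q h)"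
      and id: "\<forall>m. (\<Sum>g\<in>S. poly (p g) (of_nat m) * g ^ m) = poly a0 (of_nat m) * (\<kappa> * u ^ m * (\<Sum>h\<in>H. poly (q h) (of_nat m) * h ^ m) ^ d)"
      using value_structure[OF fS S\<Gamma> False pS d yK yd] by blast
    define s where "s m = (\<Sum>h\<in>H. poly (q h) (of_nat m) * h ^ m)" for m
    have ba: "b m = poly a0 (of_nat m) * (\<kappa> * u ^ m * s m ^ d)" for m unfolding bS s_def using id by blast
    define z where "z = star (\<lambda>i. s (\<nu> i))"
    have zK: "z \<in> Kst" unfolding z_def s_def
      using H poly_nat_K \<Gamma>_nz(1) by (intro KstI subfield_sum[OF Ks] Kc(5) subfield_power[OF Ks]) auto
    have yz: "y ^ d = star (\<lambda>i. poly a0 (of_nat (\<nu> i))) * star (\<lambda>_. \<kappa>) * chi u * z ^ d"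
      unfolding yb z_def chi_def star_arith star_power ba by (simp add: mult.assoc)
    \<comment> \<open>Otherwise \<open>b\<close> would vanish along the sequence in the ultrapower,
      although its merged coefficients are nonzero.\<close>
    have "z \<noteq> 0"
    proof
      assume "z = 0"
      then have 0: "(\<Sum>g\<in>S. Ts (p g) * chi g) = 0" using yz yd d by simp
      obtain g where g: "g \<in> S" using False by blast
      have "Ts (p g) = 0" by (rule chi_independent[OF fS S\<Gamma> _ 0 g]) (rule Ts_Sm[OF pK])
      then show False using pS[OF g] Ts_0_iff by blast
    qed
    then obtain R Q lc where R: "poly_over k R" and Q: "poly_over K Q" and lc: "lc \<in> K" and a0R: "a0 = smult lc (R * Q ^ d)"
      using coefficient_is_power[OF a0 d yK zK _ \<kappa> u yz] by blast
    \<comment> \<open>Only two \<open>d\<close>-th roots have to be adjoined, of a constant and of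
      the base \<open>u\<close>; every number built from them below has its \<open>d\<close>-th
      power in \<open>K\<close> and is therefore algebraic over \<open>K\<close>.\<close>
    obtain \<rho> where \<rho>: "\<rho> ^ d = lc * \<kappa>" using alg_closed_root_exists[OF d] by blast
    obtain \<eta> where \<eta>: "\<eta> ^ d = u" using alg_closed_root_exists[OF d] by blast
    have uK: "u \<in> K" "u \<noteq> 0" using \<Gamma>_nz[OF u] .
    obtain h where h: "bij_betw h {..<card H} H" using ex_bij_betw_nat_finite[OF H(1)] unfolding atLeast0LessThan by blast
    have hH: "h i \<in> H" if "i < card H" for i using bij_betwE[OF h] that by auto
    define a where "a m = \<rho> * poly Q (of_nat m) * \<eta> ^ m * s m" for m
    have "exp_poly_over (alg_closure_in K) a"
      unfolding exp_poly_over_def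
    proof (intro exI[of _ "card H"] exI[of _ "\<lambda>i. smult \<rho> (Q * q (h i))"] exI[of _ "\<lambda>i. \<eta> * h i"] conjI allI impI)
      fix i assume "i < card H"
      note hi = hH[OF this]
      have hK: "h i \<in> K" "h i \<noteq> 0" using \<Gamma>_nz H(2) hi by auto
      show "poly_over (alg_closure_in K) (smult \<rho> (Q * q (h i)))"
        unfolding poly_over_def
      proof
        fix n
        have "coeff (Q * q (h i)) n \<in> K" using poly_over_mult[OF Ks Q] H(3) hi unfolding poly_over_def by blast
        then have "(coeff (smult \<rho> (Q * q (h i))) n) ^ d \<in> K"
          using lc \<kappa>(1) by (simp add: power_mult_distrib \<rho> Kc(5) subfield_power[OF Ks])
        then show "coeff (smult \<rho> (Q * q (h i))) n \<in> alg_closure_in K" using mem_alg_closure_of_power[OF Ks _ d] by blast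
      qed
      have "(\<eta> * h i) ^ d \<in> K" using uK hK by (simp add: power_mult_distrib \<eta> Kc(5) subfield_power[OF Ks])
      then show "\<eta> * h i \<in> alg_closure_in K" by (rule mem_alg_closure_of_power[OF Ks _ d])
      show "\<eta> * h i \<noteq> 0" using hK uK \<eta> d by auto
    next
      fix m
      have "s m = (\<Sum>i<card H. poly (q (h i)) (of_nat m) * h i ^ m)"
        unfolding s_def using sum.reindex_bij_betw[OF h, of "\<lambda>h. poly (q h) (of_nat m) * h ^ m"] by simp
      then show "a m = (\<Sum>i<card H. poly (smult \<rho> (Q * q (h i))) (of_nat m) * (\<eta> * h i) ^ m)"
        unfolding a_def by (simp add: sum_distrib_left power_mult_distrib mult_ac)
    qed
    moreover have "b m = poly R (of_nat m) * a m ^ d" for m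
    proof -
      have "a m ^ d = (lc * \<kappa>) * poly Q (of_nat m) ^ d * u ^ m * s m ^ d"
        unfolding a_def power_mult_distrib \<rho> using \<eta> by (simp add: power_mult[symmetric] mult.commute[of m d] power_mult)
      then show ?thesis unfolding ba a0R by (simp add: mult_ac)
    qed
    ultimately show ?thesis using R by blast
  qed
qed

end
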